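(* Let $\mathfrak m$ be a finite-dimensional Lie algebra over a field $k$ of characteristic zero. Then the enveloping algebra $U(\mathfrak m)$ admits a connected bicovariant differential graded algebra whose space $\Lambda^1$ of left-invariant 1-forms has classical dimension (namely $\dim\Lambda^1=\dim\mathfrak m$) if and only if $\mathfrak m$ admits a pre-Lie structure.
   Context: $U(\mathfrak m)$ is a Hopf algebra with elements of $\mathfrak m$ primitive. A differential graded algebra over an algebra $A$ is a graded algebra $\Omega=\oplus_{n\ge0}\Omega^n$ with $\Omega^0=A$ and a degree-one super-derivation $d$ with $d^2=0$, generated by $A$ and $dA$ (so in particular $\Omega^1=\mathrm{span}\{a\,db\}$). If $A$ is a Hopf algebra it is left-covariant (resp. right-covariant) if the coproduct of $A$ extends to a left (resp. right) $A$-coaction on $\Omega$ which is an algebra map and commutes with $d$ (with $d$ acting on the $\Omega$ factor), and bicovariant if both hold. $\Lambda^1\subseteq\Omega^1$ is the space of left-invariant 1-forms, i.e. those $\eta$ with $\Delta_L\eta=1\otimes\eta$; then $\Omega^1\cong A\otimes\Lambda^1$. The calculus is connected if $\ker(d:A\to\Omega^1)=k\{1\}$. A (left) pre-Lie structure on a Lie algebra $\mathfrak m$ is a bilinear product $\circ$ on $\mathfrak m$ with $(x\circ y)\circ z-(y\circ x)\circ z=x\circ(y\circ z)-y\circ(x\circ z)$ and $x\circ y-y\circ x=[x,y]$ for all $x,y,z\in\mathfrak m$. *)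

theory Defs
  imports
    "Jordan_Normal_Form.Missing_VectorSpace"
    "HOL-Algebra.QuotRing"
    "HOL-Algebra.Generated_Rings"
begin

hide_const (open) Modules.module_hom Multiset.mult

section \<open>Algebras over a field\<close>

definition char_zero :: "('k, 'f) ring_scheme \<Rightarrow> bool" where
  "char_zero K \<longleftrightarrow> (\<forall>n::nat. 0 < n \<longrightarrow> [n] \<cdot>\<^bsub>K\<^esub> \<one>\<^bsub>K\<^esub> \<noteq> \<zero>\<^bsub>K\<^esub>)"

definition bilinear_map ::
  "('k, 'f) ring_scheme \<Rightarrow> ('k, 'u, 'e1) module_scheme \<Rightarrow> ('k, 'v, 'e2) module_scheme \<Rightarrow>
   ('k, 'w, 'e3) module_scheme \<Rightarrow> ('u \<Rightarrow> 'v \<Rightarrow> 'w) \<Rightarrow> bool" where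
  "bilinear_map K U V W f \<longleftrightarrow>
     (\<forall>u\<in>carrier U. f u \<in> module_hom K V W) \<and>
     (\<forall>v\<in>carrier V. (\<lambda>u. f u v) \<in> module_hom K U W)"

text \<open>Unlike \<^locale>\<open>algebra\<close>, the multiplication is not required to be commutative.\<close>

definition assoc_algebra :: "('k, 'f) ring_scheme \<Rightarrow> ('k, 'a, 'e) module_scheme \<Rightarrow> bool" where
  "assoc_algebra K A \<longleftrightarrow> vectorspace K A \<and> ring A \<and> bilinear_map K A A A (mult A)"

definition algebra_hom ::
  "('k, 'f) ring_scheme \<Rightarrow> ('k, 'a, 'e1) module_scheme \<Rightarrow> ('k, 'b, 'e2) module_scheme \<Rightarrow>
   ('a \<Rightarrow> 'b) set" where
  "algebra_hom K A B = module_hom K A B \<inter> ring_hom A B"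

definition ground_algebra :: "('k, 'f) ring_scheme \<Rightarrow> ('k, 'k) module" where
  "ground_algebra K = \<lparr>carrier = carrier K, mult = mult K, one = one K, zero = zero K,
     add = add K, smult = mult K\<rparr>"

definition quotient_algebra :: "('k, 'a, 'e) module_scheme \<Rightarrow> 'a set \<Rightarrow> ('k, 'a set) module" where
  "quotient_algebra A I = \<lparr>carrier = a_rcosets\<^bsub>A\<^esub> I, mult = rcoset_mult A I,
     one = I +>\<^bsub>A\<^esub> \<one>\<^bsub>A\<^esub>, zero = I, add = set_add A,
     smult = (\<lambda>c X. \<Union>x\<in>X. I +>\<^bsub>A\<^esub> (c \<odot>\<^bsub>A\<^esub> x))\<rparr>"


section \<open>Monoid algebras and linear extension\<close>

definition supp :: "('k, 'f) ring_scheme \<Rightarrow> ('x \<Rightarrow> 'k) \<Rightarrow> 'x set" where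
  "supp K \<phi> = {x. \<phi> x \<noteq> \<zero>\<^bsub>K\<^esub>}"

definition single :: "('k, 'f) ring_scheme \<Rightarrow> 'x \<Rightarrow> 'x \<Rightarrow> 'k" where
  "single K x = (\<lambda>y. if y = x then \<one>\<^bsub>K\<^esub> else \<zero>\<^bsub>K\<^esub>)"

definition monoid_algebra ::
  "('k, 'f) ring_scheme \<Rightarrow> ('x, 'e) monoid_scheme \<Rightarrow> ('k, 'x \<Rightarrow> 'k) module" where
  "monoid_algebra K G = \<lparr>
     carrier = {\<phi>. finite (supp K \<phi>) \<and> supp K \<phi> \<subseteq> carrier G \<and> range \<phi> \<subseteq> carrier K},
     mult = (\<lambda>\<phi> \<psi> z. \<Oplus>\<^bsub>K\<^esub>p\<in>{(x, y). x \<in> supp K \<phi> \<and> y \<in> supp K \<psi> \<and> x \<otimes>\<^bsub>G\<^esub> y = z}.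
                        \<phi> (fst p) \<otimes>\<^bsub>K\<^esub> \<psi> (snd p)),
     one = single K \<one>\<^bsub>G\<^esub>,
     zero = (\<lambda>_. \<zero>\<^bsub>K\<^esub>),
     add = (\<lambda>\<phi> \<psi> z. \<phi> z \<oplus>\<^bsub>K\<^esub> \<psi> z),
     smult = (\<lambda>c \<phi> z. c \<otimes>\<^bsub>K\<^esub> \<phi> z)\<rparr>"

definition linear_extension ::
  "('k, 'f) ring_scheme \<Rightarrow> ('k, 'z, 'e) module_scheme \<Rightarrow> ('x \<Rightarrow> 'z) \<Rightarrow> ('x \<Rightarrow> 'k) \<Rightarrow> 'z" where
  "linear_extension K Z g \<phi> = (\<Oplus>\<^bsub>Z\<^esub>x\<in>supp K \<phi>. \<phi> x \<odot>\<^bsub>Z\<^esub> g x)"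

text \<open>The map induced on a quotient of a monoid algebra by a map \<open>g\<close> on basis elements. It is
  meaningful when the linear extension of \<open>g\<close> vanishes on the subspace factored out, so that it
  is constant on each coset \<open>X\<close>.\<close>

definition induced_map ::
  "('k, 'f) ring_scheme \<Rightarrow> ('k, 'z, 'e) module_scheme \<Rightarrow> ('x \<Rightarrow> 'z) \<Rightarrow> ('x \<Rightarrow> 'k) set \<Rightarrow> 'z" where
  "induced_map K Z g X = the_elem (linear_extension K Z g ` X)"


section \<open>Tensor products\<close>

text \<open>\<open>V \<otimes> W\<close> is the vector space with basis the set \<open>V \<times> W\<close> modulo the span of the bilinearity
  relations. As that basis is taken inside the monoid algebra of the product of the multiplicative
  monoids, the quotient carries the product \<open>(v \<otimes> w) (v' \<otimes> w') = v v' \<otimes> w w'\<close> when \<open>V\<close> and \<open>W\<close>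
  are algebras.\<close>

definition tensor_relations ::
  "('k, 'f) ring_scheme \<Rightarrow> ('k, 'v, 'e1) module_scheme \<Rightarrow> ('k, 'w, 'e2) module_scheme \<Rightarrow>
   ('v \<times> 'w \<Rightarrow> 'k) set" where
  "tensor_relations K V W = (let F = monoid_algebra K (V \<times>\<times> W) in
     {single K (v \<oplus>\<^bsub>V\<^esub> v', w) \<ominus>\<^bsub>F\<^esub> single K (v, w) \<ominus>\<^bsub>F\<^esub> single K (v', w) | v v' w.
        v \<in> carrier V \<and> v' \<in> carrier V \<and> w \<in> carrier W} \<union>
     {single K (v, w \<oplus>\<^bsub>W\<^esub> w') \<ominus>\<^bsub>F\<^esub> single K (v, w) \<ominus>\<^bsub>F\<^esub> single K (v, w') | v w w'.
        v \<in> carrier V \<and> w \<in> carrier W \<and> w' \<in> carrier W} \<union>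
     {single K (c \<odot>\<^bsub>V\<^esub> v, w) \<ominus>\<^bsub>F\<^esub> c \<odot>\<^bsub>F\<^esub> single K (v, w) | c v w.
        c \<in> carrier K \<and> v \<in> carrier V \<and> w \<in> carrier W} \<union>
     {single K (v, c \<odot>\<^bsub>W\<^esub> w) \<ominus>\<^bsub>F\<^esub> c \<odot>\<^bsub>F\<^esub> single K (v, w) | c v w.
        c \<in> carrier K \<and> v \<in> carrier V \<and> w \<in> carrier W})"

definition tensor_null ::
  "('k, 'f) ring_scheme \<Rightarrow> ('k, 'v, 'e1) module_scheme \<Rightarrow> ('k, 'w, 'e2) module_scheme \<Rightarrow>
   ('v \<times> 'w \<Rightarrow> 'k) set" where
  "tensor_null K V W =
     LinearCombinations.module.span K (monoid_algebra K (V \<times>\<times> W)) (tensor_relations K V W)"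

definition tensor ::
  "('k, 'f) ring_scheme \<Rightarrow> ('k, 'v, 'e1) module_scheme \<Rightarrow> ('k, 'w, 'e2) module_scheme \<Rightarrow>
   ('k, ('v \<times> 'w \<Rightarrow> 'k) set) module" where
  "tensor K V W = quotient_algebra (monoid_algebra K (V \<times>\<times> W)) (tensor_null K V W)"

definition tens ::
  "('k, 'f) ring_scheme \<Rightarrow> ('k, 'v, 'e1) module_scheme \<Rightarrow> ('k, 'w, 'e2) module_scheme \<Rightarrow>
   'v \<Rightarrow> 'w \<Rightarrow> ('v \<times> 'w \<Rightarrow> 'k) set" where
  "tens K V W v w = tensor_null K V W +>\<^bsub>monoid_algebra K (V \<times>\<times> W)\<^esub> single K (v, w)"

text \<open>\<open>f \<otimes> g : V \<otimes> W \<rightarrow> V' \<otimes> W'\<close>; only the codomain has to be passed.\<close>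

definition tensor_map ::
  "('k, 'f) ring_scheme \<Rightarrow> ('k, 'v2, 'e1) module_scheme \<Rightarrow> ('k, 'w2, 'e2) module_scheme \<Rightarrow>
   ('v1 \<Rightarrow> 'v2) \<Rightarrow> ('w1 \<Rightarrow> 'w2) \<Rightarrow> ('v1 \<times> 'w1 \<Rightarrow> 'k) set \<Rightarrow> ('v2 \<times> 'w2 \<Rightarrow> 'k) set" where
  "tensor_map K V' W' f g =
     induced_map K (tensor K V' W') (\<lambda>(v, w). tens K V' W' (f v) (g w))"

text \<open>The canonical map \<open>(V \<otimes> W) \<otimes> X \<rightarrow> V \<otimes> (W \<otimes> X)\<close>.\<close>

definition tensor_assoc ::
  "('k, 'f) ring_scheme \<Rightarrow> ('k, 'v, 'e1) module_scheme \<Rightarrow> ('k, 'w, 'e2) module_scheme \<Rightarrow>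
   ('k, 'x, 'e3) module_scheme \<Rightarrow>
   (('v \<times> 'w \<Rightarrow> 'k) set \<times> 'x \<Rightarrow> 'k) set \<Rightarrow> ('v \<times> ('w \<times> 'x \<Rightarrow> 'k) set \<Rightarrow> 'k) set" where
  "tensor_assoc K V W X = (let T = tensor K V (tensor K W X) in
     induced_map K T (\<lambda>(t, x).
       induced_map K T (\<lambda>(v, w). tens K V (tensor K W X) v (tens K W X w x)) t))"


section \<open>Lie algebras, pre-Lie structures and enveloping algebras\<close>

text \<open>Vector spaces are \<^typ>\<open>('k, 'm) module\<close> records; the fields \<open>mult\<close> and \<open>one\<close> of the
  record \<open>M\<close> play no role here.\<close>

locale lie_algebra = vectorspace K M for K and M (structure) +
  fixes br :: "'c \<Rightarrow> 'c \<Rightarrow> 'c"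
  assumes br_bilinear: "bilinear_map K M M M br"
    and br_alternating: "x \<in> carrier M \<Longrightarrow> br x x = \<zero>\<^bsub>M\<^esub>"
    and br_jacobi: "\<lbrakk>x \<in> carrier M; y \<in> carrier M; z \<in> carrier M\<rbrakk> \<Longrightarrow>
      br x (br y z) \<oplus>\<^bsub>M\<^esub> br y (br z x) \<oplus>\<^bsub>M\<^esub> br z (br x y) = \<zero>\<^bsub>M\<^esub>"

definition pre_lie_structure ::
  "('k, 'f) ring_scheme \<Rightarrow> ('k, 'm, 'e) module_scheme \<Rightarrow> ('m \<Rightarrow> 'm \<Rightarrow> 'm) \<Rightarrow>
   ('m \<Rightarrow> 'm \<Rightarrow> 'm) \<Rightarrow> bool" where
  "pre_lie_structure K M br pl \<longleftrightarrow>
     bilinear_map K M M M pl \<and>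
     (\<forall>x\<in>carrier M. \<forall>y\<in>carrier M. \<forall>z\<in>carrier M.
        pl (pl x y) z \<ominus>\<^bsub>M\<^esub> pl (pl y x) z = pl x (pl y z) \<ominus>\<^bsub>M\<^esub> pl y (pl x z)) \<and>
     (\<forall>x\<in>carrier M. \<forall>y\<in>carrier M. pl x y \<ominus>\<^bsub>M\<^esub> pl y x = br x y)"

definition free_algebra ::
  "('k, 'f) ring_scheme \<Rightarrow> 'm set \<Rightarrow> ('k, 'm list \<Rightarrow> 'k) module" where
  "free_algebra K S =
     monoid_algebra K \<lparr>carrier = lists S, monoid.mult = (@), one = []\<rparr>"

text \<open>The first two families of relations cut the free algebra on the set \<open>\<mm>\<close> down to the tensor
  algebra \<open>T(\<mm>)\<close>; the third imposes \<open>x y - y x = [x, y]\<close>.\<close>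

definition enveloping_relations ::
  "('k, 'f) ring_scheme \<Rightarrow> ('k, 'm, 'e) module_scheme \<Rightarrow> ('m \<Rightarrow> 'm \<Rightarrow> 'm) \<Rightarrow>
   ('m list \<Rightarrow> 'k) set" where
  "enveloping_relations K M br = (let F = free_algebra K (carrier M) in
     {single K [x \<oplus>\<^bsub>M\<^esub> y] \<ominus>\<^bsub>F\<^esub> single K [x] \<ominus>\<^bsub>F\<^esub> single K [y] | x y.
        x \<in> carrier M \<and> y \<in> carrier M} \<union>
     {single K [c \<odot>\<^bsub>M\<^esub> x] \<ominus>\<^bsub>F\<^esub> c \<odot>\<^bsub>F\<^esub> single K [x] | c x.
        c \<in> carrier K \<and> x \<in> carrier M} \<union>
     {single K [x] \<otimes>\<^bsub>F\<^esub> single K [y] \<ominus>\<^bsub>F\<^esub> single K [y] \<otimes>\<^bsub>F\<^esub> single K [x]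
        \<ominus>\<^bsub>F\<^esub> single K [br x y] | x y.
        x \<in> carrier M \<and> y \<in> carrier M})"

definition enveloping_ideal ::
  "('k, 'f) ring_scheme \<Rightarrow> ('k, 'm, 'e) module_scheme \<Rightarrow> ('m \<Rightarrow> 'm \<Rightarrow> 'm) \<Rightarrow>
   ('m list \<Rightarrow> 'k) set" where
  "enveloping_ideal K M br =
     Idl\<^bsub>free_algebra K (carrier M)\<^esub> (enveloping_relations K M br)"

type_synonym ('k, 'm) env = "('m list \<Rightarrow> 'k) set"

definition enveloping_algebra ::
  "('k, 'f) ring_scheme \<Rightarrow> ('k, 'm, 'e) module_scheme \<Rightarrow> ('m \<Rightarrow> 'm \<Rightarrow> 'm) \<Rightarrow>
   ('k, ('k, 'm) env) module" where
  "enveloping_algebra K M br =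
     quotient_algebra (free_algebra K (carrier M)) (enveloping_ideal K M br)"

definition env_inj ::
  "('k, 'f) ring_scheme \<Rightarrow> ('k, 'm, 'e) module_scheme \<Rightarrow> ('m \<Rightarrow> 'm \<Rightarrow> 'm) \<Rightarrow>
   'm \<Rightarrow> ('k, 'm) env" where
  "env_inj K M br x =
     enveloping_ideal K M br +>\<^bsub>free_algebra K (carrier M)\<^esub> single K [x]"

text \<open>The algebra map \<open>U(\<mm>) \<rightarrow> B\<close> extending a Lie algebra map \<open>f : \<mm> \<rightarrow> B\<close>.\<close>

definition env_extend ::
  "('k, 'f) ring_scheme \<Rightarrow> ('k, 'b, 'e) module_scheme \<Rightarrow> ('m \<Rightarrow> 'b) \<Rightarrow> ('k, 'm) env \<Rightarrow> 'b" where
  "env_extend K B f = induced_map K B (\<lambda>w. foldr (mult B) (map f w) \<one>\<^bsub>B\<^esub>)"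

text \<open>The bialgebra structure of the Hopf algebra \<open>U(\<mm>)\<close>, in which elements of \<open>\<mm>\<close> are
  primitive. Covariance of a calculus does not involve the antipode.\<close>

definition env_coproduct ::
  "('k, 'f) ring_scheme \<Rightarrow> ('k, 'm, 'e) module_scheme \<Rightarrow> ('m \<Rightarrow> 'm \<Rightarrow> 'm) \<Rightarrow>
   ('k, 'm) env \<Rightarrow> (('k, 'm) env \<times> ('k, 'm) env \<Rightarrow> 'k) set" where
  "env_coproduct K M br = (let U = enveloping_algebra K M br in
     env_extend K (tensor K U U)
       (\<lambda>x. tens K U U (env_inj K M br x) \<one>\<^bsub>U\<^esub> \<oplus>\<^bsub>tensor K U U\<^esub> tens K U U \<one>\<^bsub>U\<^esub> (env_inj K M br x)))"

definition env_counit :: "('k, 'f) ring_scheme \<Rightarrow> ('k, 'm) env \<Rightarrow> 'k" where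
  "env_counit K = env_extend K (ground_algebra K) (\<lambda>_. \<zero>\<^bsub>K\<^esub>)"


section \<open>Differential graded algebras over an algebra\<close>

locale graded_algebra =
  fixes K :: "('k, 'f) ring_scheme" and \<Omega> :: "('k, 'w, 'e) module_scheme"
    and gr :: "nat \<Rightarrow> 'w set"
  assumes assoc_algebra: "assoc_algebra K \<Omega>"
    and gr_subspace: "VectorSpace.subspace K (gr n) \<Omega>"
    and gr_direct_sum: "x \<in> carrier \<Omega> \<Longrightarrow>
      \<exists>!c. (\<forall>n. c n \<in> gr n) \<and> finite {n. c n \<noteq> \<zero>\<^bsub>\<Omega>\<^esub>} \<and>
           x = (\<Oplus>\<^bsub>\<Omega>\<^esub>n\<in>{n. c n \<noteq> \<zero>\<^bsub>\<Omega>\<^esub>}. c n)"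
    and gr_one: "\<one>\<^bsub>\<Omega>\<^esub> \<in> gr 0"
    and gr_mult: "\<lbrakk>x \<in> gr m; y \<in> gr n\<rbrakk> \<Longrightarrow> x \<otimes>\<^bsub>\<Omega>\<^esub> y \<in> gr (m + n)"

text \<open>The identification \<open>\<Omega>\<^sup>0 = A\<close> is the algebra isomorphism \<open>j\<close> of \<open>A\<close> onto the degree-zero
  part. Since \<open>j\<close> is linear, the subring generated by \<open>A\<close> and \<open>dA\<close> is a subalgebra.\<close>

locale dga_over = graded_algebra K \<Omega> gr
  for K :: "('k, 'f) ring_scheme" and \<Omega> :: "('k, 'w, 'e) module_scheme" and gr +
  fixes A :: "('k, 'a, 'e2) module_scheme" and j :: "'a \<Rightarrow> 'w" and d :: "'w \<Rightarrow> 'w"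
  assumes j_hom: "j \<in> algebra_hom K A \<Omega>"
    and j_inj: "inj_on j (carrier A)"
    and j_image: "j ` carrier A = gr 0"
    and d_linear: "d \<in> module_hom K \<Omega> \<Omega>"
    and d_degree: "x \<in> gr n \<Longrightarrow> d x \<in> gr (Suc n)"
    and d_leibniz: "\<lbrakk>x \<in> gr n; y \<in> carrier \<Omega>\<rbrakk> \<Longrightarrow>
      d (x \<otimes>\<^bsub>\<Omega>\<^esub> y) = d x \<otimes>\<^bsub>\<Omega>\<^esub> y \<oplus>\<^bsub>\<Omega>\<^esub> (\<ominus>\<^bsub>\<Omega>\<^esub> \<one>\<^bsub>\<Omega>\<^esub>) [^]\<^bsub>\<Omega>\<^esub> n \<otimes>\<^bsub>\<Omega>\<^esub> (x \<otimes>\<^bsub>\<Omega>\<^esub> d y)"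
    and d_square: "x \<in> carrier \<Omega> \<Longrightarrow> d (d x) = \<zero>\<^bsub>\<Omega>\<^esub>"
    and generated: "generate_ring \<Omega> (j ` carrier A \<union> d ` j ` carrier A) = carrier \<Omega>"

definition connected_calculus ::
  "('k, 'f) ring_scheme \<Rightarrow> ('k, 'a, 'e1) module_scheme \<Rightarrow> ('k, 'w, 'e2) module_scheme \<Rightarrow>
   ('a \<Rightarrow> 'w) \<Rightarrow> ('w \<Rightarrow> 'w) \<Rightarrow> bool" where
  "connected_calculus K A \<Omega> j d \<longleftrightarrow>
     {a \<in> carrier A. d (j a) = \<zero>\<^bsub>\<Omega>\<^esub>} = {c \<odot>\<^bsub>A\<^esub> \<one>\<^bsub>A\<^esub> | c. c \<in> carrier K}"


section \<open>Covariance\<close>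

text \<open>\<open>(A, \<Delta>, \<epsilon>)\<close> is a bialgebra; the coactions are \<open>\<Delta>L : \<Omega> \<rightarrow> A \<otimes> \<Omega>\<close> and
  \<open>\<Delta>R : \<Omega> \<rightarrow> \<Omega> \<otimes> A\<close>.\<close>

locale left_covariance =
  fixes K :: "('k, 'f) ring_scheme" and A :: "('k, 'a, 'e1) module_scheme"
    and \<Delta> :: "'a \<Rightarrow> ('a \<times> 'a \<Rightarrow> 'k) set" and \<epsilon> :: "'a \<Rightarrow> 'k"
    and \<Omega> :: "('k, 'w, 'e2) module_scheme" and j :: "'a \<Rightarrow> 'w" and d :: "'w \<Rightarrow> 'w"
    and \<Delta>L :: "'w \<Rightarrow> ('a \<times> 'w \<Rightarrow> 'k) set"
  assumes L_hom: "\<Delta>L \<in> algebra_hom K \<Omega> (tensor K A \<Omega>)"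
    and L_coassoc: "\<omega> \<in> carrier \<Omega> \<Longrightarrow>
      tensor_assoc K A A \<Omega> (tensor_map K (tensor K A A) \<Omega> \<Delta> id (\<Delta>L \<omega>)) =
      tensor_map K A (tensor K A \<Omega>) id \<Delta>L (\<Delta>L \<omega>)"
    and L_counit: "\<omega> \<in> carrier \<Omega> \<Longrightarrow> induced_map K \<Omega> (\<lambda>(a, \<eta>). \<epsilon> a \<odot>\<^bsub>\<Omega>\<^esub> \<eta>) (\<Delta>L \<omega>) = \<omega>"
    and L_extends: "a \<in> carrier A \<Longrightarrow> \<Delta>L (j a) = tensor_map K A \<Omega> id j (\<Delta> a)"
    and L_d: "\<omega> \<in> carrier \<Omega> \<Longrightarrow> \<Delta>L (d \<omega>) = tensor_map K A \<Omega> id d (\<Delta>L \<omega>)"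

locale right_covariance =
  fixes K :: "('k, 'f) ring_scheme" and A :: "('k, 'a, 'e1) module_scheme"
    and \<Delta> :: "'a \<Rightarrow> ('a \<times> 'a \<Rightarrow> 'k) set" and \<epsilon> :: "'a \<Rightarrow> 'k"
    and \<Omega> :: "('k, 'w, 'e2) module_scheme" and j :: "'a \<Rightarrow> 'w" and d :: "'w \<Rightarrow> 'w"
    and \<Delta>R :: "'w \<Rightarrow> ('w \<times> 'a \<Rightarrow> 'k) set"
  assumes R_hom: "\<Delta>R \<in> algebra_hom K \<Omega> (tensor K \<Omega> A)"
    and R_coassoc: "\<omega> \<in> carrier \<Omega> \<Longrightarrow>
      tensor_assoc K \<Omega> A A (tensor_map K (tensor K \<Omega> A) A \<Delta>R id (\<Delta>R \<omega>)) =
      tensor_map K \<Omega> (tensor K A A) id \<Delta> (\<Delta>R \<omega>)"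
    and R_counit: "\<omega> \<in> carrier \<Omega> \<Longrightarrow> induced_map K \<Omega> (\<lambda>(\<eta>, a). \<epsilon> a \<odot>\<^bsub>\<Omega>\<^esub> \<eta>) (\<Delta>R \<omega>) = \<omega>"
    and R_extends: "a \<in> carrier A \<Longrightarrow> \<Delta>R (j a) = tensor_map K \<Omega> A j id (\<Delta> a)"
    and R_d: "\<omega> \<in> carrier \<Omega> \<Longrightarrow> \<Delta>R (d \<omega>) = tensor_map K \<Omega> A d id (\<Delta>R \<omega>)"

definition left_invariant_1forms ::
  "('k, 'f) ring_scheme \<Rightarrow> ('k, 'a, 'e1) module_scheme \<Rightarrow> ('k, 'w, 'e2) module_scheme \<Rightarrow>
   (nat \<Rightarrow> 'w set) \<Rightarrow> ('w \<Rightarrow> ('a \<times> 'w \<Rightarrow> 'k) set) \<Rightarrow> 'w set" where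
  "left_invariant_1forms K A \<Omega> gr \<Delta>L = {\<eta> \<in> gr 1. \<Delta>L \<eta> = tens K A \<Omega> \<one>\<^bsub>A\<^esub> \<eta>}"

text \<open>\<open>\<Lambda>\<^sup>1\<close> is required to be finite-dimensional because \<^const>\<open>vectorspace.dim\<close> is unspecified
  otherwise. HOL cannot quantify over types inside a formula, so the type \<open>'w\<close> in which the
  carrier of \<open>\<Omega>\<close> lives is a parameter.\<close>

definition admits_classical_calculus ::
  "'w itself \<Rightarrow> ('k, 'f) ring_scheme \<Rightarrow> ('k, 'm, 'e) module_scheme \<Rightarrow> ('m \<Rightarrow> 'm \<Rightarrow> 'm) \<Rightarrow> bool" where
  "admits_classical_calculus (_ :: 'w itself) K M br \<longleftrightarrow>
     (\<exists>(\<Omega> :: ('k, 'w) module) gr j d \<Delta>L \<Delta>R.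
        let U = enveloping_algebra K M br; \<Delta> = env_coproduct K M br; \<epsilon> = env_counit K;
            \<Lambda> = \<Omega>\<lparr>carrier := left_invariant_1forms K U \<Omega> gr \<Delta>L\<rparr> in
        dga_over K \<Omega> gr U j d \<and>
        left_covariance K U \<Delta> \<epsilon> \<Omega> j d \<Delta>L \<and>
        right_covariance K U \<Delta> \<epsilon> \<Omega> j d \<Delta>R \<and>
        connected_calculus K U \<Omega> j d \<and>
        vectorspace.fin_dim K \<Lambda> \<and>
        vectorspace.dim K \<Lambda> = vectorspace.dim K M)"

text \<open>A carrier type large enough for every calculus: an element of \<open>\<Omega>\<close> is a finite sum of terms
  \<open>a\<^sub>0 da\<^sub>1 \<dots> da\<^sub>n\<close> with \<open>a\<^sub>i\<close> in \<open>U(\<mm>)\<close>, hence is named by a finite list of finite lists of elements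
  of \<open>U(\<mm>)\<close>. So every calculus is isomorphic to one carried by a set of such lists.\<close>

type_synonym ('k, 'm) form = "('k, 'm) env list list"

end

theory Submission
  imports Defs
begin

text \<open>
  Given a calculus, \<open>x \<mapsto> dx\<close> maps \<open>\<mm>\<close> into \<open>\<Lambda>\<^sup>1\<close>. As \<open>\<mm>\<close> embeds into \<open>U(\<mm>)\<close> and meets the scalars
  trivially, connectedness makes this map injective, so it is bijective by dimension. The commutator
  \<open>[x, dy]\<close> is again left-invariant, and \<open>[x, dy] = d(x \<circ> y)\<close> defines a pre-Lie structure: the Leibniz
  rule gives \<open>x \<circ> y - y \<circ> x = [x, y]\<close>, and the Jacobi identity for commutators gives the other axiom.

  Conversely, let \<open>\<Omega> = U \<oplus> U \<otimes> \<mm>\<close> with vanishing products of 1-forms. The relations \<open>dy x = x dy - d(x \<circ> y)\<close>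
  and the Leibniz rule are packaged into one algebra map \<open>\<Phi>\<close> from \<open>U(\<mm>)\<close> to the matrices of size
  \<open>n + 1\<close> over \<open>U(\<mm>)\<close>, whose row \<open>0\<close> is \<open>d\<close> and whose other rows are the right action on the basic forms.
  Replacing each \<open>dx\<close> by \<open>x\<close> in \<open>du\<close> multiplies a word of length \<open>r\<close> by \<open>r\<close>, up to shorter words; in
  characteristic zero this yields connectedness.
\<close>

text \<open>Injectivity of \<open>\<iota>\<close> comes from rewriting words in a basis of the Lie
  algebra while keeping track only of the linear part of the normal form. The rewriting therefore
  takes its values in the Lie algebra itself, and Jacobi is exactly the confluence condition.

  In the converse the obstacle is consistency: the rules for \<open>dy x\<close> must respect every
  relation of \<open>U\<close>. They do because \<open>1 \<mapsto> x\<close>,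
  \<open>y \<mapsto> - x \<circ> y\<close> defines a right module over the Lie algebra. At
  \<open>1\<close> the module law says that \<open>\<circ>\<close> induces the bracket, elsewhere it
  is the pre-Lie identity. Adding these scalar matrices to \<open>x\<close> times the identity
  matrix gives an algebra map on \<open>U\<close>, so well-definedness, the Leibniz rule and
  associativity all follow from its multiplicativity.

  Stopping at degree one is legitimate, since the algebra only has to be generated by
  \<open>U\<close> and \<open>dU\<close>. Left covariance amounts to the matrix entries commuting
  with the coproduct; the right coaction is the flip of the left one, because \<open>U\<close> is
  cocommutative. Connectedness uses the filtration of \<open>U\<close> by word length.\<close>

lemma hom_closed: "f \<in> module_hom K V W \<Longrightarrow> x \<in> carrier V \<Longrightarrow> f x \<in> carrier W"
  by (auto simp: LinearCombinations.module_hom_def)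

lemma hom_add: "f \<in> module_hom K V W \<Longrightarrow> x \<in> carrier V \<Longrightarrow> y \<in> carrier V \<Longrightarrow> f (x \<oplus>\<^bsub>V\<^esub> y) = f x \<oplus>\<^bsub>W\<^esub> f y"
  by (auto simp: LinearCombinations.module_hom_def)

lemma hom_smult: "f \<in> module_hom K V W \<Longrightarrow> c \<in> carrier K \<Longrightarrow> x \<in> carrier V \<Longrightarrow> f (c \<odot>\<^bsub>V\<^esub> x) = c \<odot>\<^bsub>W\<^esub> f x"
  by (auto simp: LinearCombinations.module_hom_def)

lemma module_homI:
  assumes "\<And>x. x \<in> carrier V \<Longrightarrow> f x \<in> carrier W"
    and "\<And>x y. x \<in> carrier V \<Longrightarrow> y \<in> carrier V \<Longrightarrow> f (x \<oplus>\<^bsub>V\<^esub> y) = f x \<oplus>\<^bsub>W\<^esub> f y"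
    and "\<And>c x. c \<in> carrier K \<Longrightarrow> x \<in> carrier V \<Longrightarrow> f (c \<odot>\<^bsub>V\<^esub> x) = c \<odot>\<^bsub>W\<^esub> f x"
  shows "f \<in> module_hom K V W"
  using assms by (auto simp: LinearCombinations.module_hom_def)

lemma hom_comp:
  "f \<in> module_hom K V W \<Longrightarrow> g \<in> module_hom K W X \<Longrightarrow> (\<lambda>x. g (f x)) \<in> module_hom K V X"
  by (auto simp: LinearCombinations.module_hom_def Pi_def)

lemma hom_id: "(\<lambda>x. x) \<in> module_hom K V V" "id \<in> module_hom K V V"
  by (auto simp: LinearCombinations.module_hom_def)

text \<open>Membership in \<open>module_hom\<close> constrains a map only on the carrier;
  \<open>vectorspace K V\<close> ensures that sums and multiples stay inside it.\<close>

lemma hom_cong: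
  assumes "f \<in> module_hom K V W" "vectorspace K V" "\<And>x. x \<in> carrier V \<Longrightarrow> f x = g x"
  shows "g \<in> module_hom K V W"
proof -
  interpret vectorspace K V by fact
  show ?thesis using assms(1,3) by (auto simp: LinearCombinations.module_hom_def Pi_def)
qed

lemma vectorspace_linear_map:
  "vectorspace K V \<Longrightarrow> vectorspace K W \<Longrightarrow> f \<in> module_hom K V W \<Longrightarrow> linear_map K V W f"
  by (simp add: linear_map_def mod_hom_def mod_hom_axioms_def vectorspace_def)

lemma hom_zero:
  "f \<in> module_hom K V W \<Longrightarrow> vectorspace K V \<Longrightarrow> vectorspace K W \<Longrightarrow> f \<zero>\<^bsub>V\<^esub> = \<zero>\<^bsub>W\<^esub>"
  by (rule linear_map.T0_is_0[OF vectorspace_linear_map])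

lemma hom_minus:
  "f \<in> module_hom K V W \<Longrightarrow> vectorspace K V \<Longrightarrow> vectorspace K W \<Longrightarrow> x \<in> carrier V \<Longrightarrow> y \<in> carrier V
    \<Longrightarrow> f (x \<ominus>\<^bsub>V\<^esub> y) = f x \<ominus>\<^bsub>W\<^esub> f y"
  by (rule linear_map.T_minus[OF vectorspace_linear_map])

lemma hom_finsum:
  assumes "f \<in> module_hom K V W" "vectorspace K V" "vectorspace K W" "finite A" "\<And>a. a \<in> A \<Longrightarrow> g a \<in> carrier V"
  shows "f (\<Oplus>\<^bsub>V\<^esub>a\<in>A. g a) = (\<Oplus>\<^bsub>W\<^esub>a\<in>A. f (g a))"
proof -
  interpret V: vectorspace K V by fact
  interpret W: vectorspace K W by fact
  show ?thesis using assms(4,5)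
  proof (induct A rule: finite_induct)
    case empty then show ?case using hom_zero[OF assms(1-3)] by simp
  next
    case (insert a A)
    have g: "g \<in> A \<rightarrow> carrier V" "g a \<in> carrier V" using insert.prems by auto
    have fg: "(\<lambda>a. f (g a)) \<in> A \<rightarrow> carrier W" "f (g a) \<in> carrier W"
      using insert.prems hom_closed[OF assms(1)] by auto
    have "f (\<Oplus>\<^bsub>V\<^esub>a\<in>A. g a) = (\<Oplus>\<^bsub>W\<^esub>a\<in>A. f (g a))" using insert by simp
    then show ?case using insert.hyps(1,2) g fg by (simp add: V.M.finsum_insert W.M.finsum_insert hom_add[OF assms(1)] hom_closed[OF assms(1)])
  qed
qed

lemma minus_eq_zero_iff:
  assumes "vectorspace K V" "x \<in> carrier V" "y \<in> carrier V"
  shows "x \<ominus>\<^bsub>V\<^esub> y = \<zero>\<^bsub>V\<^esub> \<longleftrightarrow> x = y"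
proof -
  interpret V: vectorspace K V by fact
  show ?thesis
    using V.M.add.inv_equality[of x "\<ominus>\<^bsub>V\<^esub> y"] assms(2,3) by (auto simp: a_minus_def V.M.r_neg)
qed

lemma finsum_superset:
  assumes "vectorspace K Z"  "finite S" "A \<subseteq> S" "\<And>x. x \<in> S - A \<Longrightarrow> h x = \<zero>\<^bsub>Z\<^esub>"  "h \<in> S \<rightarrow> carrier Z"
  shows "(\<Oplus>\<^bsub>Z\<^esub>x\<in>A. h x) = (\<Oplus>\<^bsub>Z\<^esub>x\<in>S. h x)"
proof -
  interpret Z: vectorspace K Z by fact
  show ?thesis
    by (rule Z.M.add.finprod_mono_neutral_cong_left[OF assms(2,3) assms(4) refl assms(5)])
qed

section \<open>Pointwise operations on linear maps, and linear maps that agree on a span\<close>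

lemma hom_add_maps:
  assumes "vectorspace K W" "f \<in> module_hom K V W" "g \<in> module_hom K V W"
  shows "(\<lambda>x. f x \<oplus>\<^bsub>W\<^esub> g x) \<in> module_hom K V W"
proof -
  interpret W: vectorspace K W by fact
  show ?thesis
    by (rule module_homI)
      (use assms in \<open>auto simp: hom_closed hom_add hom_smult W.M.add.m_ac W.smult_r_distr\<close>)
qed

lemma hom_minus_maps:
  assumes "vectorspace K W" "f \<in> module_hom K V W" "g \<in> module_hom K V W"
  shows "(\<lambda>x. f x \<ominus>\<^bsub>W\<^esub> g x) \<in> module_hom K V W"
proof -
  interpret W: vectorspace K W by fact
  show ?thesis
    by (rule module_homI)
      (use assms in \<open>auto simp: hom_closed hom_add hom_smult W.M.add.m_ac W.smult_r_distr
          a_minus_def W.M.minus_add W.smult_r_minus\<close>)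
qed

lemma hom_smult_map:
  assumes "vectorspace K W" "f \<in> module_hom K V W" "c \<in> carrier K"
  shows "(\<lambda>x. c \<odot>\<^bsub>W\<^esub> f x) \<in> module_hom K V W"
proof -
  interpret W: vectorspace K W by fact
  show ?thesis
    by (rule module_homI)
      (use assms in \<open>auto simp: hom_closed hom_add hom_smult W.smult_r_distr
          W.smult_assoc1[symmetric] W.R.m_comm\<close>)
qed

lemma hom_zero_map:
  assumes "vectorspace K W" shows "(\<lambda>x. \<zero>\<^bsub>W\<^esub>) \<in> module_hom K V W"
proof -
  interpret W: vectorspace K W by fact
  show ?thesis by (rule module_homI) auto
qed

lemma hom_finsum_maps:
  assumes "vectorspace K W" "finite A" "\<And>a. a \<in> A \<Longrightarrow> f a \<in> module_hom K V W"
  shows "(\<lambda>x. \<Oplus>\<^bsub>W\<^esub>a\<in>A. f a x) \<in> module_hom K V W"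
proof -
  interpret W: vectorspace K W by fact
  have cl: "\<And>B x. B \<subseteq> A \<Longrightarrow> x \<in> carrier V \<Longrightarrow> (\<lambda>a. f a x) \<in> B \<rightarrow> carrier W"
    using assms(3) by (auto intro: hom_closed)
  show ?thesis
  proof (rule module_homI)
    fix x y assume xy: "x \<in> carrier V" "y \<in> carrier V"
    have "(\<Oplus>\<^bsub>W\<^esub>a\<in>A. f a (x \<oplus>\<^bsub>V\<^esub> y)) = (\<Oplus>\<^bsub>W\<^esub>a\<in>A. f a x \<oplus>\<^bsub>W\<^esub> f a y)"
      by (rule W.M.finsum_cong') (use assms(3) xy in \<open>auto intro: hom_closed hom_add\<close>)
    then show "(\<Oplus>\<^bsub>W\<^esub>a\<in>A. f a (x \<oplus>\<^bsub>V\<^esub> y)) = (\<Oplus>\<^bsub>W\<^esub>a\<in>A. f a x) \<oplus>\<^bsub>W\<^esub> (\<Oplus>\<^bsub>W\<^esub>a\<in>A. f a y)"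
      using cl xy W.M.finsum_addf by simp
  next
    fix c x assume cx: "c \<in> carrier K" "x \<in> carrier V"
    have "(\<Oplus>\<^bsub>W\<^esub>a\<in>A. f a (c \<odot>\<^bsub>V\<^esub> x)) = (\<Oplus>\<^bsub>W\<^esub>a\<in>A. c \<odot>\<^bsub>W\<^esub> f a x)"
      by (rule W.M.finsum_cong') (use assms(3) cx in \<open>auto intro: hom_closed hom_smult\<close>)
    then show "(\<Oplus>\<^bsub>W\<^esub>a\<in>A. f a (c \<odot>\<^bsub>V\<^esub> x)) = c \<odot>\<^bsub>W\<^esub> (\<Oplus>\<^bsub>W\<^esub>a\<in>A. f a x)"
      using cl cx W.finsum_smult[of c "\<lambda>a. f a x" A] by simp
  qed (use cl in \<open>auto intro: W.M.finsum_closed\<close>)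
qed

lemma equalizer_submodule:
  assumes "vectorspace K V" "vectorspace K W" "f \<in> module_hom K V W" "g \<in> module_hom K V W"
  shows "LinearCombinations.submodule K {x \<in> carrier V. f x = g x} V"
proof -
  interpret V: vectorspace K V by fact
  show ?thesis
    by (rule LinearCombinations.submodule.intro)
      (use assms in \<open>auto simp: hom_add hom_smult hom_zero V.module_axioms\<close>)
qed

text \<open>The equalizer of two linear maps is a subspace. With the zero map for \<open>g\<close>
  this shows that a map killing a set of relations kills their span.\<close>

lemma span_hom_eq:
  assumes "vectorspace K V" "vectorspace K W" "f \<in> module_hom K V W" "g \<in> module_hom K V W"
    "S \<subseteq> carrier V" "\<And>x. x \<in> S \<Longrightarrow> f x = g x" "x \<in> LinearCombinations.module.span K V S"
  shows "f x = g x"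
proof -
  interpret V: vectorspace K V by fact
  have "V.span S \<subseteq> {x \<in> carrier V. f x = g x}"
    by (rule V.span_is_subset) (use assms equalizer_submodule in auto)
  then show ?thesis using assms(7) by auto
qed

lemma field_vectorspace:
  assumes "field K" shows "vectorspace K (ground_algebra K)"
proof -
  interpret field K by fact
  show ?thesis
    unfolding ground_algebra_def
    by (rule vs_criteria) (auto simp: assms a_ac m_ac l_distr r_distr intro: l_neg)
qed

section \<open>Monoid algebras\<close>

text \<open>Only the carrier of \<open>G\<close> enters the linear structure; monoid laws are added
  in \<open>monoid_alg\<close>. This lets \<open>V \<times>\<times> W\<close> serve as a mere index
  set for vector spaces whose \<open>mult\<close> field is meaningless.\<close>

locale free_vectorspace = field K for K (structure) + fixes G :: "('x, 'g) monoid_scheme"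
begin

abbreviation F where "F \<equiv> monoid_algebra K G"

lemma mem_F: "\<phi> \<in> carrier F \<longleftrightarrow>
    finite (supp K \<phi>) \<and> supp K \<phi> \<subseteq> carrier G \<and> (\<forall>x. \<phi> x \<in> carrier K)"
  by (auto simp: monoid_algebra_def)

lemma F_simps: "\<zero>\<^bsub>F\<^esub> = (\<lambda>_. \<zero>)" "\<phi> \<oplus>\<^bsub>F\<^esub> \<psi> = (\<lambda>z. \<phi> z \<oplus> \<psi> z)" "c \<odot>\<^bsub>F\<^esub> \<phi> = (\<lambda>z. c \<otimes> \<phi> z)"
  "\<one>\<^bsub>F\<^esub> = single K \<one>\<^bsub>G\<^esub>"
  by (auto simp: monoid_algebra_def)

lemma supp_single: "supp K (single K x) = {x}"
  by (auto simp: supp_def single_def)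

lemma single_closed: "x \<in> carrier G \<Longrightarrow> single K x \<in> carrier F"
  unfolding mem_F supp_single by (auto simp: single_def)

lemma supp_add: "supp K (\<phi> \<oplus>\<^bsub>F\<^esub> \<psi>) \<subseteq> supp K \<phi> \<union> supp K \<psi>"
  by (auto simp: supp_def F_simps)

lemma supp_smult: "c \<in> carrier K \<Longrightarrow> supp K (c \<odot>\<^bsub>F\<^esub> \<phi>) \<subseteq> supp K \<phi>"
  by (auto simp: supp_def F_simps)

lemma F_vectorspace: "vectorspace K F"
proof (rule vs_criteria)
  show "\<zero>\<^bsub>F\<^esub> \<in> carrier F" by (auto simp: mem_F F_simps supp_def)
  show "\<forall>v w. v \<in> carrier F \<and> w \<in> carrier F \<longrightarrow> v \<oplus>\<^bsub>F\<^esub> w \<in> carrier F"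
  proof (intro allI impI)
    fix v w assume "v \<in> carrier F \<and> w \<in> carrier F"
    then show "v \<oplus>\<^bsub>F\<^esub> w \<in> carrier F"
      using supp_add[of v w] finite_subset[OF supp_add[of v w]] unfolding mem_F by (auto simp: F_simps)
  qed
  show "\<forall>c v. c \<in> carrier K \<and> v \<in> carrier F \<longrightarrow> c \<odot>\<^bsub>F\<^esub> v \<in> carrier F"
  proof (intro allI impI)
    fix c v assume "c \<in> carrier K \<and> v \<in> carrier F"
    then show "c \<odot>\<^bsub>F\<^esub> v \<in> carrier F"
      using supp_smult[of c v] finite_subset[OF supp_smult[of c v]] unfolding mem_F by (auto simp: F_simps)
  qed
  show "\<forall>v\<in>carrier F. \<exists>neg_v\<in>carrier F. v \<oplus>\<^bsub>F\<^esub> neg_v = \<zero>\<^bsub>F\<^esub>"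
  proof
    fix v assume v: "v \<in> carrier F"
    have "supp K (\<lambda>z. \<ominus> v z) = supp K v" using v
      unfolding mem_F supp_def by (metis add.inv_eq_1_iff)
    then show "\<exists>neg_v\<in>carrier F. v \<oplus>\<^bsub>F\<^esub> neg_v = \<zero>\<^bsub>F\<^esub>"
      using v by (intro bexI[of _ "\<lambda>z. \<ominus> v z"]) (auto simp: mem_F F_simps r_neg)
  qed
qed (auto simp: field_axioms mem_F F_simps a_ac m_ac l_distr r_distr)

sublocale F: vectorspace K F by (rule F_vectorspace)

text \<open>Induction on the size of the support: overwriting one support point by zero splits off a
  multiple of a basis element.\<close>

lemma F_induct [consumes 1, case_names zero add]:
  assumes "\<phi> \<in> carrier F" "P \<zero>\<^bsub>F\<^esub>"
    "\<And>c x \<phi>. c \<in> carrier K \<Longrightarrow> x \<in> carrier G \<Longrightarrow> \<phi> \<in> carrier F \<Longrightarrow> P \<phi> \<Longrightarrow> P (\<phi> \<oplus>\<^bsub>F\<^esub> c \<odot>\<^bsub>F\<^esub> single K x)"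
  shows "P \<phi>"
  using assms(1)
proof (induct "card (supp K \<phi>)" arbitrary: \<phi>)
  case 0
  then have "supp K \<phi> = {}" by (auto simp: mem_F)
  then have "\<phi> = \<zero>\<^bsub>F\<^esub>" by (auto simp: F_simps supp_def)
  then show ?case using assms(2) by simp
next
  case (Suc n)
  then obtain x where x: "x \<in> supp K \<phi>" by (metis card.empty equals0I nat.distinct(1))
  define \<psi> where "\<psi> = \<phi>(x := \<zero>)"
  have s: "supp K \<psi> = supp K \<phi> - {x}" by (auto simp: \<psi>_def supp_def)
  have \<psi>: "\<psi> \<in> carrier F" using Suc.prems unfolding mem_F s by (auto simp: \<psi>_def)
  have "card (supp K \<psi>) = n" using s Suc x by (auto simp: mem_F)
  then have P: "P \<psi>" using Suc \<psi> by auto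
  have "\<phi> = \<psi> \<oplus>\<^bsub>F\<^esub> \<phi> x \<odot>\<^bsub>F\<^esub> single K x"
    using Suc.prems by (auto simp: F_simps \<psi>_def single_def mem_F)
  then show ?case using assms(3)[OF _ _ \<psi> P, of "\<phi> x" x] Suc.prems x by (auto simp: mem_F)
qed

text \<open>The basic extensionality principle: identities that are linear in each argument are
  reduced by it, or by its analogues for \<open>tensor\<close>, \<open>U\<close> and
  \<open>Om\<close>, to basis elements.\<close>

lemma F_hom_eq:
  assumes "vectorspace K Z" "f \<in> module_hom K F Z" "g \<in> module_hom K F Z"
    "\<And>x. x \<in> carrier G \<Longrightarrow> f (single K x) = g (single K x)" "\<phi> \<in> carrier F"
  shows "f \<phi> = g \<phi>"
  using assms(5)
proof (induct rule: F_induct)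
  case zero then show ?case using assms F_vectorspace by (simp add: hom_zero)
next
  case (add c x \<phi>)
  then show ?case using assms by (simp add: hom_add hom_smult single_closed)
qed

text \<open>\<open>linear_extension\<close> sums over the support, which changes with the argument.
  Summing over a fixed larger set makes additivity in \<phi> a matter of adding two sums
  termwise.\<close>

lemma LE_superset:
  assumes "vectorspace K Z" "\<And>x. x \<in> carrier G \<Longrightarrow> g x \<in> carrier Z" "\<phi> \<in> carrier F"
    "finite S" "supp K \<phi> \<subseteq> S" "S \<subseteq> carrier G"
  shows "linear_extension K Z g \<phi> = (\<Oplus>\<^bsub>Z\<^esub>x\<in>S. \<phi> x \<odot>\<^bsub>Z\<^esub> g x)"
proof -
  interpret Z: vectorspace K Z by fact
  have "\<phi> x \<odot>\<^bsub>Z\<^esub> g x = \<zero>\<^bsub>Z\<^esub>" if "x \<in> S - supp K \<phi>" for x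
  proof -
    have "\<phi> x = \<zero>" "g x \<in> carrier Z" using that assms(2,6) by (auto simp: supp_def)
    then show ?thesis by simp
  qed
  moreover have "(\<lambda>x. \<phi> x \<odot>\<^bsub>Z\<^esub> g x) \<in> S \<rightarrow> carrier Z" using assms(2,3,6) by (auto simp: mem_F)
  ultimately show ?thesis unfolding linear_extension_def
    by (rule finsum_superset[OF assms(1,4,5)])
qed

lemma LE_hom:
  assumes "vectorspace K Z" "\<And>x. x \<in> carrier G \<Longrightarrow> g x \<in> carrier Z"
  shows "linear_extension K Z g \<in> module_hom K F Z"
proof -
  interpret Z: vectorspace K Z by fact
  have cl: "linear_extension K Z g \<phi> \<in> carrier Z" if \<phi>: "\<phi> \<in> carrier F" for \<phi>
  proof -
    have "supp K \<phi> \<subseteq> carrier G" "finite (supp K \<phi>)" "\<And>x. \<phi> x \<in> carrier K" using \<phi> by (auto simp: mem_F)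
    then show ?thesis
      unfolding linear_extension_def
      by (intro Z.M.finsum_closed) (use assms in auto)
  qed
  have sm: "linear_extension K Z g (c \<odot>\<^bsub>F\<^esub> \<phi>) = c \<odot>\<^bsub>Z\<^esub> linear_extension K Z g \<phi>"
    if c: "c \<in> carrier K" and \<phi>: "\<phi> \<in> carrier F" for c \<phi>
  proof -
    have sub: "supp K \<phi> \<subseteq> carrier G" "finite (supp K \<phi>)" and \<phi>c: "\<And>x. \<phi> x \<in> carrier K" using \<phi> by (auto simp: mem_F)
    have "linear_extension K Z g (c \<odot>\<^bsub>F\<^esub> \<phi>) = (\<Oplus>\<^bsub>Z\<^esub>x\<in>supp K \<phi>. (c \<odot>\<^bsub>F\<^esub> \<phi>) x \<odot>\<^bsub>Z\<^esub> g x)"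
      by (rule LE_superset[OF assms F.smult_closed[OF c \<phi>] sub(2) supp_smult[OF c] sub(1)])
    also have "\<dots> = (\<Oplus>\<^bsub>Z\<^esub>x\<in>supp K \<phi>. c \<odot>\<^bsub>Z\<^esub> (\<phi> x \<odot>\<^bsub>Z\<^esub> g x))"
      by (rule Z.M.finsum_cong') (use c \<phi>c assms sub in \<open>auto simp: F_simps Z.smult_assoc1\<close>)
    also have "\<dots> = c \<odot>\<^bsub>Z\<^esub> linear_extension K Z g \<phi>"
      unfolding linear_extension_def
      by (rule Z.finsum_smult[symmetric]) (use c \<phi>c assms sub in auto)
    finally show ?thesis .
  qed
  have ad: "linear_extension K Z g (\<phi> \<oplus>\<^bsub>F\<^esub> \<psi>) = linear_extension K Z g \<phi> \<oplus>\<^bsub>Z\<^esub> linear_extension K Z g \<psi>"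
    if \<phi>: "\<phi> \<in> carrier F" and \<psi>: "\<psi> \<in> carrier F" for \<phi> \<psi>
  proof -
  let ?S = "supp K \<phi> \<union> supp K \<psi>"
  have S: "?S \<subseteq> carrier G" "finite ?S" and \<phi>c: "\<And>x. \<phi> x \<in> carrier K" and \<psi>c: "\<And>x. \<psi> x \<in> carrier K"
    using \<phi> \<psi> by (auto simp: mem_F)
  have "linear_extension K Z g (\<phi> \<oplus>\<^bsub>F\<^esub> \<psi>) = (\<Oplus>\<^bsub>Z\<^esub>x\<in>?S. (\<phi> \<oplus>\<^bsub>F\<^esub> \<psi>) x \<odot>\<^bsub>Z\<^esub> g x)"
    by (rule LE_superset[OF assms F.M.add.m_closed[OF \<phi> \<psi>] S(2) supp_add S(1)])
  also have "\<dots> = (\<Oplus>\<^bsub>Z\<^esub>x\<in>?S. \<phi> x \<odot>\<^bsub>Z\<^esub> g x \<oplus>\<^bsub>Z\<^esub> \<psi> x \<odot>\<^bsub>Z\<^esub> g x)"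
    by (rule Z.M.finsum_cong') (use \<phi>c \<psi>c assms S in \<open>auto simp: F_simps Z.smult_l_distr\<close>)
  also have "\<dots> = (\<Oplus>\<^bsub>Z\<^esub>x\<in>?S. \<phi> x \<odot>\<^bsub>Z\<^esub> g x) \<oplus>\<^bsub>Z\<^esub> (\<Oplus>\<^bsub>Z\<^esub>x\<in>?S. \<psi> x \<odot>\<^bsub>Z\<^esub> g x)"
    by (rule Z.M.finsum_addf) (use \<phi>c \<psi>c assms S in auto)
  also have "\<dots> = linear_extension K Z g \<phi> \<oplus>\<^bsub>Z\<^esub> linear_extension K Z g \<psi>"
    by (intro arg_cong2[of _ _ _ _ "add Z"] LE_superset[symmetric, OF assms _ S(2) _ S(1)]) (use \<phi> \<psi> in auto)
  finally show ?thesis .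
  qed
  show ?thesis by (rule module_homI; (rule cl ad sm)?; assumption)
qed

lemma LE_single:
  assumes "vectorspace K Z" "g x \<in> carrier Z"
  shows "linear_extension K Z g (single K x) = g x"
proof -
  interpret Z: vectorspace K Z by fact
  have "(\<Oplus>\<^bsub>Z\<^esub>y\<in>{x}. single K x y \<odot>\<^bsub>Z\<^esub> g y) = single K x x \<odot>\<^bsub>Z\<^esub> g x \<oplus>\<^bsub>Z\<^esub> (\<Oplus>\<^bsub>Z\<^esub>y\<in>{}. single K x y \<odot>\<^bsub>Z\<^esub> g y)"
    by (rule Z.M.finsum_insert) (use assms(2) in \<open>auto simp: single_def\<close>)
  then have "linear_extension K Z g (single K x) = single K x x \<odot>\<^bsub>Z\<^esub> g x \<oplus>\<^bsub>Z\<^esub> \<zero>\<^bsub>Z\<^esub>"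
    unfolding linear_extension_def supp_single Z.M.finsum_empty .
  then show ?thesis using assms(2) by (simp add: single_def)
qed

text \<open>Evaluation at a point, linear into the field seen as a space over itself, carries finite
  sums of functions to finite sums of scalars.\<close>

lemma eval_hom: "(\<lambda>\<phi>. \<phi> z) \<in> module_hom K F (ground_algebra K)"
  by (rule module_homI) (auto simp: ground_algebra_def F_simps mem_F)

end

section \<open>Associative algebras\<close>

locale assoc_alg = vectorspace K A + A: ring A for K and A +
  assumes mult_bilinear: "bilinear_map K A A A (mult A)"
begin

lemma mult_hom_right: "x \<in> carrier A \<Longrightarrow> (\<lambda>y. x \<otimes>\<^bsub>A\<^esub> y) \<in> module_hom K A A"
  and mult_hom_left: "y \<in> carrier A \<Longrightarrow> (\<lambda>x. x \<otimes>\<^bsub>A\<^esub> y) \<in> module_hom K A A"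
  using mult_bilinear by (auto simp: bilinear_map_def)

lemma smult_mult_left: "c \<in> carrier K \<Longrightarrow> x \<in> carrier A \<Longrightarrow> y \<in> carrier A \<Longrightarrow>
    (c \<odot>\<^bsub>A\<^esub> x) \<otimes>\<^bsub>A\<^esub> y = c \<odot>\<^bsub>A\<^esub> (x \<otimes>\<^bsub>A\<^esub> y)"
  using hom_smult[OF mult_hom_left] by blast

lemma smult_mult_right: "c \<in> carrier K \<Longrightarrow> x \<in> carrier A \<Longrightarrow> y \<in> carrier A \<Longrightarrow>
    x \<otimes>\<^bsub>A\<^esub> (c \<odot>\<^bsub>A\<^esub> y) = c \<odot>\<^bsub>A\<^esub> (x \<otimes>\<^bsub>A\<^esub> y)"
  using hom_smult[OF mult_hom_right] by blast

lemma ideal_submodule: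
  assumes "ideal I A" shows "LinearCombinations.submodule K I A"
proof -
  interpret ideal I A by fact
  have "c \<odot>\<^bsub>A\<^esub> x \<in> I" if "c \<in> carrier K" "x \<in> I" for c x
  proof -
    have "(c \<odot>\<^bsub>A\<^esub> \<one>\<^bsub>A\<^esub>) \<otimes>\<^bsub>A\<^esub> x \<in> I" using that I_l_closed Icarr by simp
    then show ?thesis using that Icarr by (simp add: smult_mult_left)
  qed
  then show ?thesis
    by (intro LinearCombinations.submodule.intro) (auto simp: module_axioms Icarr)
qed

end

lemma assoc_algebra_iff: "assoc_algebra K A \<longleftrightarrow> assoc_alg K A"
  by (auto simp: assoc_algebra_def assoc_alg_def assoc_alg_axioms_def)

lemma assoc_algI:
  assumes "vectorspace K A"
    and "\<And>x. x \<in> carrier A \<Longrightarrow> (\<lambda>y. x \<otimes>\<^bsub>A\<^esub> y) \<in> module_hom K A A"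
    and "\<And>y. y \<in> carrier A \<Longrightarrow> (\<lambda>x. x \<otimes>\<^bsub>A\<^esub> y) \<in> module_hom K A A"
    and "\<one>\<^bsub>A\<^esub> \<in> carrier A"
    and "\<And>x. x \<in> carrier A \<Longrightarrow> \<one>\<^bsub>A\<^esub> \<otimes>\<^bsub>A\<^esub> x = x"
    and "\<And>x. x \<in> carrier A \<Longrightarrow> x \<otimes>\<^bsub>A\<^esub> \<one>\<^bsub>A\<^esub> = x"
    and "\<And>x y z. x \<in> carrier A \<Longrightarrow> y \<in> carrier A \<Longrightarrow> z \<in> carrier A \<Longrightarrow>
      (x \<otimes>\<^bsub>A\<^esub> y) \<otimes>\<^bsub>A\<^esub> z = x \<otimes>\<^bsub>A\<^esub> (y \<otimes>\<^bsub>A\<^esub> z)"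
  shows "assoc_alg K A"
proof -
  interpret vectorspace K A by fact
  have "ring A"
    by (intro ringI M.abelian_group_axioms monoidI)
      (use assms hom_closed[OF assms(2)] hom_add[OF assms(2)] hom_add[OF assms(3)] in auto)
  moreover have "bilinear_map K A A A (mult A)" using assms(2,3) by (auto simp: bilinear_map_def)
  ultimately show ?thesis
    by (intro assoc_alg.intro assoc_alg_axioms.intro assms(1))
qed

lemma algebra_homD:
  assumes "f \<in> algebra_hom K A B"
  shows "f \<in> module_hom K A B" "x \<in> carrier A \<Longrightarrow> f x \<in> carrier B"
    "x \<in> carrier A \<Longrightarrow> y \<in> carrier A \<Longrightarrow> f (x \<otimes>\<^bsub>A\<^esub> y) = f x \<otimes>\<^bsub>B\<^esub> f y" "f \<one>\<^bsub>A\<^esub> = \<one>\<^bsub>B\<^esub>"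
    "x \<in> carrier A \<Longrightarrow> y \<in> carrier A \<Longrightarrow> f (x \<oplus>\<^bsub>A\<^esub> y) = f x \<oplus>\<^bsub>B\<^esub> f y"
    "c \<in> carrier K \<Longrightarrow> x \<in> carrier A \<Longrightarrow> f (c \<odot>\<^bsub>A\<^esub> x) = c \<odot>\<^bsub>B\<^esub> f x"
  using assms by (auto simp: algebra_hom_def ring_hom_def LinearCombinations.module_hom_def)

lemma algebra_homI:
  assumes "f \<in> module_hom K A B" "f \<one>\<^bsub>A\<^esub> = \<one>\<^bsub>B\<^esub>"
    "\<And>x y. x \<in> carrier A \<Longrightarrow> y \<in> carrier A \<Longrightarrow> f (x \<otimes>\<^bsub>A\<^esub> y) = f x \<otimes>\<^bsub>B\<^esub> f y"
  shows "f \<in> algebra_hom K A B"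
  using assms by (auto simp: algebra_hom_def ring_hom_def LinearCombinations.module_hom_def)

lemma ground_assoc_alg:
  assumes "field K" shows "assoc_alg K (ground_algebra K)"
proof -
  interpret field K by fact
  show ?thesis
    by (rule assoc_algI[OF field_vectorspace[OF assms]])
      (auto simp: ground_algebra_def m_ac l_distr r_distr intro!: module_homI)
qed

lemma finsum_ground: "finsum (ground_algebra K) = finsum K"
  by (simp add: finsum_def finprod_def ground_algebra_def fun_eq_iff)

section \<open>The product of a monoid algebra\<close>

locale monoid_alg = free_vectorspace K G + G: monoid G for K (structure) and G
begin

text \<open>The product of the monoid algebra as an iterated linear extension of the monoid product.
  In this form bilinearity comes for free, whereas the record defines \<open>mult\<close> by a sum
  over pairs with prescribed product.\<close>

definition conv where
  "conv \<phi> \<psi> = linear_extension K F (\<lambda>x. linear_extension K F (\<lambda>y. single K (x \<otimes>\<^bsub>G\<^esub> y)) \<psi>) \<phi>"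

lemma conv_inner_hom: "x \<in> carrier G \<Longrightarrow> linear_extension K F (\<lambda>y. single K (x \<otimes>\<^bsub>G\<^esub> y)) \<in> module_hom K F F"
  by (rule LE_hom[OF F_vectorspace]) (auto intro: single_closed)

lemma conv_hom_left: "\<psi> \<in> carrier F \<Longrightarrow> (\<lambda>\<phi>. conv \<phi> \<psi>) \<in> module_hom K F F"
  unfolding conv_def by (rule LE_hom[OF F_vectorspace]) (rule hom_closed[OF conv_inner_hom])

lemma conv_hom_right: "\<phi> \<in> carrier F \<Longrightarrow> (\<lambda>\<psi>. conv \<phi> \<psi>) \<in> module_hom K F F"
  \<comment> \<open>Only the outer extension is unfolded: for fixed \<phi> it is a fixed finite
    combination of maps that are linear in \<psi>.\<close>
  unfolding conv_def linear_extension_def[of K F "\<lambda>x. linear_extension K F (\<lambda>y. single K (x \<otimes>\<^bsub>G\<^esub> y)) _" \<phi>]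
  by (intro hom_finsum_maps[OF F_vectorspace] hom_smult_map[OF F_vectorspace] conv_inner_hom)
    (auto simp: mem_F)

lemma conv_single: "x \<in> carrier G \<Longrightarrow> y \<in> carrier G \<Longrightarrow> conv (single K x) (single K y) = single K (x \<otimes>\<^bsub>G\<^esub> y)"
  unfolding conv_def using F_vectorspace by (simp add: LE_single single_closed)

text \<open>At each \<open>z\<close>, both sides become sums over pairs of support points. The
  indicator of \<open>x \<otimes> y = z\<close> turns the sum over all pairs into the sum over the
  pairs with product \<open>z\<close>.\<close>

lemma mult_eq_conv:
  assumes "\<phi> \<in> carrier F" "\<psi> \<in> carrier F"
  shows "\<phi> \<otimes>\<^bsub>F\<^esub> \<psi> = conv \<phi> \<psi>"
proof
  fix z
  let ?S = "supp K \<phi>" and ?T = "supp K \<psi>"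
  let ?P = "{(x, y). x \<in> ?S \<and> y \<in> ?T \<and> x \<otimes>\<^bsub>G\<^esub> y = z}"
  let ?h = "\<lambda>x y. if x \<otimes>\<^bsub>G\<^esub> y = z then \<phi> x \<otimes> \<psi> y else \<zero>"
  have S: "finite ?S" "?S \<subseteq> carrier G" "\<And>x. \<phi> x \<in> carrier K" and T: "finite ?T" "?T \<subseteq> carrier G" "\<And>x. \<psi> x \<in> carrier K"
    using assms by (auto simp: mem_F)
  have GK: "vectorspace K (ground_algebra K)" by (rule field_vectorspace) (rule field_axioms)
  have ev: "linear_extension K F g \<chi> z = (\<Oplus>x\<in>supp K \<chi>. \<chi> x \<otimes> g x z)"
    if "\<And>x. x \<in> carrier G \<Longrightarrow> g x \<in> carrier F" "\<chi> \<in> carrier F" for g \<chi>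
  proof -
    have "finite (supp K \<chi>)" "\<And>x. x \<in> supp K \<chi> \<Longrightarrow> \<chi> x \<odot>\<^bsub>F\<^esub> g x \<in> carrier F"
      using that(2) by (auto simp: mem_F[of \<chi>] intro!: F.smult_closed that(1))
    from hom_finsum[OF eval_hom F_vectorspace GK this] show ?thesis
      unfolding linear_extension_def finsum_ground by (simp add: F_simps)
  qed
  have sc: "single K x z \<in> carrier K" for x by (simp add: single_def)
  have inner: "(\<Oplus>y\<in>?T. \<psi> y \<otimes> single K (x \<otimes>\<^bsub>G\<^esub> y) z) \<in> carrier K" for x
    by (rule finsum_closed) (use T(3) sc in simp)
  have hcl: "?h x y \<in> carrier K" for x y using S(3) T(3) by simp
  have "conv \<phi> \<psi> z = (\<Oplus>x\<in>?S. \<phi> x \<otimes> linear_extension K F (\<lambda>y. single K (x \<otimes>\<^bsub>G\<^esub> y)) \<psi> z)"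
    unfolding conv_def by (rule ev[OF hom_closed[OF conv_inner_hom assms(2)] assms(1)])
  also have "\<dots> = (\<Oplus>x\<in>?S. \<phi> x \<otimes> (\<Oplus>y\<in>?T. \<psi> y \<otimes> single K (x \<otimes>\<^bsub>G\<^esub> y) z))"
  proof (rule finsum_cong'[OF refl])
    fix x assume "x \<in> ?S"
    then have "x \<in> carrier G" using S(2) by blast
    then have "single K (x \<otimes>\<^bsub>G\<^esub> y) \<in> carrier F" if "y \<in> carrier G" for y using that by (simp add: single_closed)
    from ev[OF this assms(2)]
    show "\<phi> x \<otimes> linear_extension K F (\<lambda>y. single K (x \<otimes>\<^bsub>G\<^esub> y)) \<psi> z = \<phi> x \<otimes> (\<Oplus>y\<in>?T. \<psi> y \<otimes> single K (x \<otimes>\<^bsub>G\<^esub> y) z)"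
      by simp
  qed (use S(3) inner in simp)
  also have "\<dots> = (\<Oplus>x\<in>?S. \<Oplus>y\<in>?T. ?h x y)"
  proof (rule finsum_cong'[OF refl])
    fix x assume "x \<in> ?S"
    have "\<phi> x \<otimes> (\<Oplus>y\<in>?T. \<psi> y \<otimes> single K (x \<otimes>\<^bsub>G\<^esub> y) z) = (\<Oplus>y\<in>?T. \<phi> x \<otimes> (\<psi> y \<otimes> single K (x \<otimes>\<^bsub>G\<^esub> y) z))"
      by (rule finsum_rdistr[OF T(1) S(3)]) (use T(3) sc in simp)
    also have "\<dots> = (\<Oplus>y\<in>?T. ?h x y)"
      by (rule finsum_cong'[OF refl]) (use S(3) T(3) in \<open>simp_all add: single_def\<close>)
    finally show "\<phi> x \<otimes> (\<Oplus>y\<in>?T. \<psi> y \<otimes> single K (x \<otimes>\<^bsub>G\<^esub> y) z) = (\<Oplus>y\<in>?T. ?h x y)" .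
  qed (use hcl in \<open>blast intro: finsum_closed\<close>)
  also have "\<dots> = (\<Oplus>p\<in>?S \<times> ?T. case p of (x, y) \<Rightarrow> ?h x y)"
    by (rule add.finprod_finprod[OF S(1) T(1) hcl])
  \<comment> \<open>Pairs outside \<open>?P\<close> contribute the value zero of
    \<open>?h\<close>.\<close>
  also have "\<dots> = (\<Oplus>p\<in>?P. case p of (x, y) \<Rightarrow> ?h x y)"
    by (rule finsum_superset[OF GK, unfolded finsum_ground, symmetric])
      (use S(1,3) T(1,3) in \<open>auto simp: ground_algebra_def split: if_splits\<close>)
  also have "\<dots> = (\<Oplus>p\<in>?P. \<phi> (fst p) \<otimes> \<psi> (snd p))"
    by (rule finsum_cong'[OF refl]) (use S(3) T(3) in auto)
  finally show "(\<phi> \<otimes>\<^bsub>F\<^esub> \<psi>) z = conv \<phi> \<psi> z"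
    by (simp add: monoid_algebra_def)
qed

lemma single_mult: "x \<in> carrier G \<Longrightarrow> y \<in> carrier G \<Longrightarrow> single K x \<otimes>\<^bsub>F\<^esub> single K y = single K (x \<otimes>\<^bsub>G\<^esub> y)"
  by (simp add: mult_eq_conv single_closed conv_single)

lemma F_mult_hom_right: "\<phi> \<in> carrier F \<Longrightarrow> (\<lambda>\<psi>. \<phi> \<otimes>\<^bsub>F\<^esub> \<psi>) \<in> module_hom K F F"
  by (rule hom_cong[OF conv_hom_right F_vectorspace]) (simp_all add: mult_eq_conv)

lemma F_mult_hom_left: "\<psi> \<in> carrier F \<Longrightarrow> (\<lambda>\<phi>. \<phi> \<otimes>\<^bsub>F\<^esub> \<psi>) \<in> module_hom K F F"
  by (rule hom_cong[OF conv_hom_left F_vectorspace]) (simp_all add: mult_eq_conv)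

lemma F_assoc_alg: "assoc_alg K F"
proof (rule assoc_algI[OF F_vectorspace F_mult_hom_right F_mult_hom_left])
  have one: "\<one>\<^bsub>F\<^esub> = single K \<one>\<^bsub>G\<^esub>" by (simp add: F_simps)
  show one_cl: "\<one>\<^bsub>F\<^esub> \<in> carrier F" unfolding one by (rule single_closed) simp
  note eq = F_hom_eq[OF F_vectorspace]
  show "\<one>\<^bsub>F\<^esub> \<otimes>\<^bsub>F\<^esub> \<phi> = \<phi>" if "\<phi> \<in> carrier F" for \<phi>
    by (rule eq[OF F_mult_hom_right[OF one_cl] hom_id(1) _ that]) (simp add: one single_mult)
  show "\<phi> \<otimes>\<^bsub>F\<^esub> \<one>\<^bsub>F\<^esub> = \<phi>" if "\<phi> \<in> carrier F" for \<phi>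
    by (rule eq[OF F_mult_hom_left[OF one_cl] hom_id(1) _ that]) (simp add: one single_mult)
  note cl = hom_closed[OF F_mult_hom_right]
  fix \<phi> \<psi> \<chi> assume m: "\<phi> \<in> carrier F" "\<psi> \<in> carrier F" "\<chi> \<in> carrier F"
  \<comment> \<open>Associativity spreads from basis elements to all elements one factor at a time,
    the third factor first.\<close>
  have 1: "single K x \<otimes>\<^bsub>F\<^esub> single K y \<otimes>\<^bsub>F\<^esub> \<chi> = single K x \<otimes>\<^bsub>F\<^esub> (single K y \<otimes>\<^bsub>F\<^esub> \<chi>)"
    if "x \<in> carrier G" "y \<in> carrier G" for x y
    by (rule eq[OF F_mult_hom_right hom_comp[OF F_mult_hom_right F_mult_hom_right] _ m(3)])
      (use that in \<open>simp_all add: cl single_closed single_mult G.m_assoc\<close>)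
  have 2: "single K x \<otimes>\<^bsub>F\<^esub> \<psi> \<otimes>\<^bsub>F\<^esub> \<chi> = single K x \<otimes>\<^bsub>F\<^esub> (\<psi> \<otimes>\<^bsub>F\<^esub> \<chi>)" if "x \<in> carrier G" for x
    by (rule eq[OF hom_comp[OF F_mult_hom_right F_mult_hom_left] hom_comp[OF F_mult_hom_left F_mult_hom_right] _ m(2)])
      (use that m in \<open>simp_all add: cl single_closed 1\<close>)
  show "\<phi> \<otimes>\<^bsub>F\<^esub> \<psi> \<otimes>\<^bsub>F\<^esub> \<chi> = \<phi> \<otimes>\<^bsub>F\<^esub> (\<psi> \<otimes>\<^bsub>F\<^esub> \<chi>)"
    by (rule eq[OF hom_comp[OF F_mult_hom_left F_mult_hom_left] F_mult_hom_left _ m(1)])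
      (use m in \<open>simp_all add: cl single_closed 2\<close>)
qed

end

section \<open>Quotients\<close>

locale quotient_vs = vectorspace K A for K and A +
  fixes I assumes subm: "LinearCombinations.submodule K I A"
begin

abbreviation Q where "Q \<equiv> quotient_algebra A I"
abbreviation pr where "pr x \<equiv> I +>\<^bsub>A\<^esub> x"

lemma I_closed: "x \<in> I \<Longrightarrow> x \<in> carrier A" "x \<in> I \<Longrightarrow> y \<in> I \<Longrightarrow> x \<oplus>\<^bsub>A\<^esub> y \<in> I" "\<zero>\<^bsub>A\<^esub> \<in> I"
    "c \<in> carrier K \<Longrightarrow> x \<in> I \<Longrightarrow> c \<odot>\<^bsub>A\<^esub> x \<in> I" "x \<in> I \<Longrightarrow> \<ominus>\<^bsub>A\<^esub> x \<in> I"
proof -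
  interpret S: LinearCombinations.submodule K I A by (rule subm)
  show *: "x \<in> I \<Longrightarrow> x \<in> carrier A" for x using S.subset by auto
  show "x \<in> I \<Longrightarrow> y \<in> I \<Longrightarrow> x \<oplus>\<^bsub>A\<^esub> y \<in> I" "\<zero>\<^bsub>A\<^esub> \<in> I" "c \<in> carrier K \<Longrightarrow> x \<in> I \<Longrightarrow> c \<odot>\<^bsub>A\<^esub> x \<in> I"
    by auto
  assume x: "x \<in> I"
  have "(\<ominus>\<^bsub>K\<^esub> \<one>\<^bsub>K\<^esub>) \<odot>\<^bsub>A\<^esub> x \<in> I" using x by auto
  then show "\<ominus>\<^bsub>A\<^esub> x \<in> I" using *[OF x] by (simp add: smult_minus_1)
qed

sublocale I: abelian_subgroup I A
proof (rule abelian_subgroupI3)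
  show "additive_subgroup I A"
    by (intro additive_subgroupI subgroup.intro)
      (auto simp: I_closed a_inv_def[symmetric])
qed (rule M.abelian_group_axioms)

lemma carrier_Q: "carrier Q = pr ` carrier A"
  by (auto simp: quotient_algebra_def A_RCOSETS_def' image_def)

lemma pr_closed: "x \<in> carrier A \<Longrightarrow> pr x \<in> carrier Q"
  by (simp add: carrier_Q)

lemma pr_eq_iff: "x \<in> carrier A \<Longrightarrow> y \<in> carrier A \<Longrightarrow> pr x = pr y \<longleftrightarrow> x \<ominus>\<^bsub>A\<^esub> y \<in> I"
  using I.a_rcos_module[of y x] I.a_repr_independence'[of x y] I.a_rcos_self[of x] by (auto simp: a_minus_def)

lemma mem_pr: "x \<in> carrier A \<Longrightarrow> y \<in> pr x \<Longrightarrow> y \<in> carrier A \<and> pr y = pr x"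
  by (metis I.a_elemrcos_carrier I.a_repr_independence')

lemma pr_add: "x \<in> carrier A \<Longrightarrow> y \<in> carrier A \<Longrightarrow> pr x \<oplus>\<^bsub>Q\<^esub> pr y = pr (x \<oplus>\<^bsub>A\<^esub> y)"
  by (simp add: quotient_algebra_def I.a_rcos_sum)

lemma pr_zero: "\<zero>\<^bsub>Q\<^esub> = pr \<zero>\<^bsub>A\<^esub>"
  by (simp add: quotient_algebra_def I.a_subset)

text \<open>The record defines a scalar multiple of a coset as a union of cosets, one for each
  representative; these must be shown to coincide.\<close>

lemma pr_smult:
  assumes "c \<in> carrier K" "x \<in> carrier A" shows "c \<odot>\<^bsub>Q\<^esub> pr x = pr (c \<odot>\<^bsub>A\<^esub> x)"
proof -
  have "pr (c \<odot>\<^bsub>A\<^esub> y) = pr (c \<odot>\<^bsub>A\<^esub> x)" if "y \<in> pr x" for y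
  proof -
    have y: "y \<in> carrier A" "y \<ominus>\<^bsub>A\<^esub> x \<in> I" using mem_pr[OF assms(2) that] assms(2) pr_eq_iff by auto
    have "c \<odot>\<^bsub>A\<^esub> y \<ominus>\<^bsub>A\<^esub> c \<odot>\<^bsub>A\<^esub> x = c \<odot>\<^bsub>A\<^esub> (y \<ominus>\<^bsub>A\<^esub> x)"
      using assms y by (simp add: a_minus_def smult_r_distr smult_r_minus)
    then show ?thesis using assms y by (simp add: pr_eq_iff I_closed)
  qed
  moreover have "x \<in> pr x" using assms by (simp add: I.a_rcos_self)
  moreover have "c \<odot>\<^bsub>Q\<^esub> pr x = (\<Union>y\<in>pr x. pr (c \<odot>\<^bsub>A\<^esub> y))"
    unfolding quotient_algebra_def by (simp only: module.simps)
  ultimately show ?thesis by blast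
qed

lemma Q_vectorspace: "vectorspace K Q"
proof (rule vs_criteria)
  show "\<forall>v\<in>carrier Q. \<exists>neg_v\<in>carrier Q. v \<oplus>\<^bsub>Q\<^esub> neg_v = \<zero>\<^bsub>Q\<^esub>"
  proof
    fix v assume "v \<in> carrier Q"
    then obtain x where x: "x \<in> carrier A" "v = pr x" by (auto simp: carrier_Q)
    then show "\<exists>neg_v\<in>carrier Q. v \<oplus>\<^bsub>Q\<^esub> neg_v = \<zero>\<^bsub>Q\<^esub>"
      by (intro bexI[of _ "pr (\<ominus>\<^bsub>A\<^esub> x)"]) (auto simp: pr_add pr_zero pr_closed M.r_neg)
  qed
qed (auto simp: carrier_Q pr_add pr_zero pr_smult field_axioms M.add.m_ac smult_assoc1 smult_l_distr smult_r_distr)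

lemma pr_hom: "(\<lambda>x. pr x) \<in> module_hom K A Q"
  by (rule module_homI) (auto simp: pr_closed pr_add pr_smult)

text \<open>A linear map that kills \<open>I\<close> is constant on cosets, so the image of a coset
  is a singleton. This gives \<open>induced_map\<close> its meaning.\<close>

lemma the_elem_pr:
  assumes "f \<in> module_hom K A Z" "vectorspace K Z" "\<And>x. x \<in> I \<Longrightarrow> f x = \<zero>\<^bsub>Z\<^esub>" "x \<in> carrier A"
  shows "the_elem (f ` pr x) = f x"
proof -
  interpret Z: vectorspace K Z by fact
  have "f y = f x" if "y \<in> pr x" for y
  proof -
    have y: "y \<in> carrier A" "y \<ominus>\<^bsub>A\<^esub> x \<in> I" using mem_pr[OF assms(4) that] pr_eq_iff[OF _ assms(4), of y] by blast+
    have "f y \<ominus>\<^bsub>Z\<^esub> f x = \<zero>\<^bsub>Z\<^esub>"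
      by (rule trans[OF hom_minus[OF assms(1) vectorspace_axioms assms(2) y(1) assms(4), symmetric] assms(3)[OF y(2)]])
    then show ?thesis using minus_eq_zero_iff[OF assms(2) hom_closed[OF assms(1) y(1)] hom_closed[OF assms(1,4)]] by blast
  qed
  moreover have "x \<in> pr x" using assms(4) by (simp add: I.a_rcos_self)
  ultimately have "f ` pr x = {f x}" by blast
  then show ?thesis by simp
qed

lemma the_elem_hom:
  assumes "f \<in> module_hom K A Z" "vectorspace K Z" "\<And>x. x \<in> I \<Longrightarrow> f x = \<zero>\<^bsub>Z\<^esub>"
  shows "(\<lambda>X. the_elem (f ` X)) \<in> module_hom K Q Z"
  by (rule module_homI)
    (auto simp only: carrier_Q pr_add pr_smult the_elem_pr[OF assms] hom_closed[OF assms(1)] hom_add[OF assms(1)]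
      hom_smult[OF assms(1)] M.add.m_closed smult_closed)

lemma Q_hom_eq:
  assumes "\<And>x. x \<in> carrier A \<Longrightarrow> f (pr x) = g (pr x)" "X \<in> carrier Q"
  shows "f X = g X"
  using assms by (auto simp: carrier_Q)

end

locale quotient_alg = assoc_alg K A for K and A +
  fixes I assumes ideal: "ideal I A"
begin

sublocale quotient_vs K A I
  by (intro quotient_vs.intro quotient_vs_axioms.intro vectorspace_axioms ideal_submodule[OF ideal])

lemma pr_mult: "x \<in> carrier A \<Longrightarrow> y \<in> carrier A \<Longrightarrow> pr x \<otimes>\<^bsub>Q\<^esub> pr y = pr (x \<otimes>\<^bsub>A\<^esub> y)"
  by (simp add: quotient_algebra_def ideal.rcoset_mult_add[OF ideal])

lemma pr_one: "\<one>\<^bsub>Q\<^esub> = pr \<one>\<^bsub>A\<^esub>"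
  by (simp add: quotient_algebra_def)

lemma Q_assoc_alg: "assoc_alg K Q"
  by (rule assoc_algI[OF Q_vectorspace])
    (auto simp: carrier_Q pr_add pr_smult pr_mult pr_one A.l_distr A.r_distr A.m_assoc smult_mult_left smult_mult_right intro!: module_homI)

lemma pr_algebra_hom: "(\<lambda>x. pr x) \<in> algebra_hom K A Q"
proof (rule algebra_homI)
  show "(\<lambda>x. pr x) \<in> module_hom K A Q" by (rule pr_hom)
  show "pr \<one>\<^bsub>A\<^esub> = \<one>\<^bsub>Q\<^esub>" by (rule pr_one[symmetric])
  fix x y assume "x \<in> carrier A" "y \<in> carrier A"
  then show "pr (x \<otimes>\<^bsub>A\<^esub> y) = pr x \<otimes>\<^bsub>Q\<^esub> pr y" by (rule pr_mult[symmetric])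
qed

end

section \<open>Tensor products\<close>

lemma bilinearD:
  assumes "bilinear_map K V W Z \<beta>"
  shows "v \<in> carrier V \<Longrightarrow> (\<lambda>w. \<beta> v w) \<in> module_hom K W Z"
    "w \<in> carrier W \<Longrightarrow> (\<lambda>v. \<beta> v w) \<in> module_hom K V Z"
    "v \<in> carrier V \<Longrightarrow> w \<in> carrier W \<Longrightarrow> \<beta> v w \<in> carrier Z"
    "v \<in> carrier V \<Longrightarrow> v' \<in> carrier V \<Longrightarrow> w \<in> carrier W \<Longrightarrow> \<beta> (v \<oplus>\<^bsub>V\<^esub> v') w = \<beta> v w \<oplus>\<^bsub>Z\<^esub> \<beta> v' w"
    "v \<in> carrier V \<Longrightarrow> w \<in> carrier W \<Longrightarrow> w' \<in> carrier W \<Longrightarrow> \<beta> v (w \<oplus>\<^bsub>W\<^esub> w') = \<beta> v w \<oplus>\<^bsub>Z\<^esub> \<beta> v w'"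
    "c \<in> carrier K \<Longrightarrow> v \<in> carrier V \<Longrightarrow> w \<in> carrier W \<Longrightarrow> \<beta> (c \<odot>\<^bsub>V\<^esub> v) w = c \<odot>\<^bsub>Z\<^esub> \<beta> v w"
    "c \<in> carrier K \<Longrightarrow> v \<in> carrier V \<Longrightarrow> w \<in> carrier W \<Longrightarrow> \<beta> v (c \<odot>\<^bsub>W\<^esub> w) = c \<odot>\<^bsub>Z\<^esub> \<beta> v w"
  using assms by (auto simp: bilinear_map_def LinearCombinations.module_hom_def)

lemma bilinearI:
  assumes "\<And>v w. v \<in> carrier V \<Longrightarrow> w \<in> carrier W \<Longrightarrow> \<beta> v w \<in> carrier Z"
    "\<And>v v' w. v \<in> carrier V \<Longrightarrow> v' \<in> carrier V \<Longrightarrow> w \<in> carrier W \<Longrightarrow> \<beta> (v \<oplus>\<^bsub>V\<^esub> v') w = \<beta> v w \<oplus>\<^bsub>Z\<^esub> \<beta> v' w"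
    "\<And>v w w'. v \<in> carrier V \<Longrightarrow> w \<in> carrier W \<Longrightarrow> w' \<in> carrier W \<Longrightarrow> \<beta> v (w \<oplus>\<^bsub>W\<^esub> w') = \<beta> v w \<oplus>\<^bsub>Z\<^esub> \<beta> v w'"
    "\<And>c v w. c \<in> carrier K \<Longrightarrow> v \<in> carrier V \<Longrightarrow> w \<in> carrier W \<Longrightarrow> \<beta> (c \<odot>\<^bsub>V\<^esub> v) w = c \<odot>\<^bsub>Z\<^esub> \<beta> v w"
    "\<And>c v w. c \<in> carrier K \<Longrightarrow> v \<in> carrier V \<Longrightarrow> w \<in> carrier W \<Longrightarrow> \<beta> v (c \<odot>\<^bsub>W\<^esub> w) = c \<odot>\<^bsub>Z\<^esub> \<beta> v w"
  shows "bilinear_map K V W Z \<beta>"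
  unfolding bilinear_map_def using assms by (auto intro!: module_homI)

lemma bilinear_comp:
  assumes "bilinear_map K V' W' Z \<beta>" "f \<in> module_hom K V V'" "g \<in> module_hom K W W'"
  shows "bilinear_map K V W Z (\<lambda>v w. \<beta> (f v) (g w))"
  unfolding bilinear_map_def
  using hom_comp[OF assms(2) bilinearD(2)[OF assms(1) hom_closed[OF assms(3)]]]
    hom_comp[OF assms(3) bilinearD(1)[OF assms(1) hom_closed[OF assms(2)]]] by blast

locale tensor_vs = V: vectorspace K V + W: vectorspace K W for K V W
begin

sublocale FV: free_vectorspace K "V \<times>\<times> W"
  by (intro free_vectorspace.intro V.field_axioms)

abbreviation "R \<equiv> tensor_relations K V W"
abbreviation "N \<equiv> tensor_null K V W"
abbreviation "T \<equiv> tensor K V W"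

lemma single_VW: "v \<in> carrier V \<Longrightarrow> w \<in> carrier W \<Longrightarrow> single K (v, w) \<in> carrier FV.F"
  by (rule FV.single_closed) (simp add: DirProd_def)

lemma R_closed: "R \<subseteq> carrier FV.F"
  by (auto simp: tensor_relations_def Let_def single_VW)

sublocale TQ: quotient_vs K FV.F N
  by (intro quotient_vs.intro quotient_vs_axioms.intro FV.F_vectorspace)
    (simp add: tensor_null_def FV.F.span_is_submodule[OF R_closed])

lemma T_def': "T = TQ.Q" by (simp add: tensor_def)

lemma T_vectorspace: "vectorspace K T"
  unfolding T_def' by (rule TQ.Q_vectorspace)

lemma tens_pr: "tens K V W v w = TQ.pr (single K (v, w))"
  by (simp add: tens_def)

text \<open>Bilinearity of \<beta> kills each defining relation, hence their span. The map
  \<open>h\<close> is arbitrary rather than a linear extension because \<open>null_ideal\<close>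
  applies this to multiplication by a basis element followed by the projection.\<close>

lemma null_vanish:
  assumes "vectorspace K Z" "h \<in> module_hom K FV.F Z" "bilinear_map K V W Z \<beta>"
    "\<And>v w. v \<in> carrier V \<Longrightarrow> w \<in> carrier W \<Longrightarrow> h (single K (v, w)) = \<beta> v w" "x \<in> N"
  shows "h x = \<zero>\<^bsub>Z\<^esub>"
proof -
  interpret Z: vectorspace K Z by fact
  have m: "h (\<phi> \<ominus>\<^bsub>FV.F\<^esub> \<psi>) = h \<phi> \<ominus>\<^bsub>Z\<^esub> h \<psi>" if "\<phi> \<in> carrier FV.F" "\<psi> \<in> carrier FV.F" for \<phi> \<psi>
    by (rule hom_minus[OF assms(2) FV.F_vectorspace assms(1) that])
  have s: "h (c \<odot>\<^bsub>FV.F\<^esub> \<phi>) = c \<odot>\<^bsub>Z\<^esub> h \<phi>" if "c \<in> carrier K" "\<phi> \<in> carrier FV.F" for c \<phi>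
    by (rule hom_smult[OF assms(2) that])
  have mm: "(a \<oplus>\<^bsub>Z\<^esub> b) \<ominus>\<^bsub>Z\<^esub> a \<ominus>\<^bsub>Z\<^esub> b = \<zero>\<^bsub>Z\<^esub>" if "a \<in> carrier Z" "b \<in> carrier Z" for a b
  proof -
    have "(a \<oplus>\<^bsub>Z\<^esub> b) \<ominus>\<^bsub>Z\<^esub> a \<ominus>\<^bsub>Z\<^esub> b = (a \<oplus>\<^bsub>Z\<^esub> b) \<oplus>\<^bsub>Z\<^esub> \<ominus>\<^bsub>Z\<^esub> (a \<oplus>\<^bsub>Z\<^esub> b)"
      using that by (simp add: a_minus_def Z.M.add.m_assoc Z.M.minus_add)
    then show ?thesis using that by (simp add: Z.M.r_neg)
  qed
  have mz: "a \<ominus>\<^bsub>Z\<^esub> a = \<zero>\<^bsub>Z\<^esub>" if "a \<in> carrier Z" for a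
    using that by (simp add: a_minus_def Z.M.r_neg)
  note \<beta> = bilinearD[OF assms(3)]
  have "h x = \<zero>\<^bsub>Z\<^esub>" if "x \<in> R" for x
    using that unfolding tensor_relations_def Let_def
    by (elim UnE CollectE exE conjE; hypsubst)
      (simp_all add: m s single_VW FV.F.M.minus_closed assms(4) \<beta>(3-7) mm mz)
  from span_hom_eq[OF FV.F_vectorspace assms(1,2) hom_zero_map[OF assms(1)] R_closed this]
  show ?thesis using assms(5) unfolding tensor_null_def by blast
qed

lemma tens_closed: "v \<in> carrier V \<Longrightarrow> w \<in> carrier W \<Longrightarrow> tens K V W v w \<in> carrier T"
  unfolding tens_pr T_def' by (simp add: TQ.pr_closed single_VW)

lemma rel_null: "r \<in> R \<Longrightarrow> r \<in> N"
  unfolding tensor_null_def using FV.F.in_own_span[OF R_closed] by blast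

lemma minus3: "a \<in> carrier FV.F \<Longrightarrow> b \<in> carrier FV.F \<Longrightarrow> c \<in> carrier FV.F \<Longrightarrow> a \<ominus>\<^bsub>FV.F\<^esub> b \<ominus>\<^bsub>FV.F\<^esub> c = a \<ominus>\<^bsub>FV.F\<^esub> (b \<oplus>\<^bsub>FV.F\<^esub> c)"
  by (simp add: a_minus_def FV.F.M.add.m_assoc FV.F.M.minus_add)

text \<open>Each bilinearity law is, up to rearrangement, membership of one defining relation in the
  null space.\<close>

lemma tens_bilinear: "bilinear_map K V W T (tens K V W)"
proof (rule bilinearI)
  fix v v' w assume c: "v \<in> carrier V" "v' \<in> carrier V" "w \<in> carrier W"
  let ?r = "single K (v \<oplus>\<^bsub>V\<^esub> v', w) \<ominus>\<^bsub>FV.F\<^esub> single K (v, w) \<ominus>\<^bsub>FV.F\<^esub> single K (v', w)"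
  have "?r \<in> R" unfolding tensor_relations_def Let_def using c by blast
  then have "?r \<in> N" by (rule rel_null)
  then show "tens K V W (v \<oplus>\<^bsub>V\<^esub> v') w = tens K V W v w \<oplus>\<^bsub>T\<^esub> tens K V W v' w"
    unfolding tens_pr T_def' using c by (simp add: TQ.pr_add single_VW TQ.pr_eq_iff minus3)
next
  fix v w w' assume c: "v \<in> carrier V" "w \<in> carrier W" "w' \<in> carrier W"
  let ?r = "single K (v, w \<oplus>\<^bsub>W\<^esub> w') \<ominus>\<^bsub>FV.F\<^esub> single K (v, w) \<ominus>\<^bsub>FV.F\<^esub> single K (v, w')"
  have "?r \<in> R" unfolding tensor_relations_def Let_def using c by blast
  then have "?r \<in> N" by (rule rel_null)
  then show "tens K V W v (w \<oplus>\<^bsub>W\<^esub> w') = tens K V W v w \<oplus>\<^bsub>T\<^esub> tens K V W v w'"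
    unfolding tens_pr T_def' using c by (simp add: TQ.pr_add single_VW TQ.pr_eq_iff minus3)
next
  fix c v w assume c: "c \<in> carrier K" "v \<in> carrier V" "w \<in> carrier W"
  have "single K (c \<odot>\<^bsub>V\<^esub> v, w) \<ominus>\<^bsub>FV.F\<^esub> c \<odot>\<^bsub>FV.F\<^esub> single K (v, w) \<in> R"
    unfolding tensor_relations_def Let_def using c by blast
  then show "tens K V W (c \<odot>\<^bsub>V\<^esub> v) w = c \<odot>\<^bsub>T\<^esub> tens K V W v w"
    unfolding tens_pr T_def' using c by (simp add: TQ.pr_smult single_VW TQ.pr_eq_iff rel_null)
  have "single K (v, c \<odot>\<^bsub>W\<^esub> w) \<ominus>\<^bsub>FV.F\<^esub> c \<odot>\<^bsub>FV.F\<^esub> single K (v, w) \<in> R"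
    unfolding tensor_relations_def Let_def using c by blast
  then show "tens K V W v (c \<odot>\<^bsub>W\<^esub> w) = c \<odot>\<^bsub>T\<^esub> tens K V W v w"
    unfolding tens_pr T_def' using c by (simp add: TQ.pr_smult single_VW TQ.pr_eq_iff rel_null)
qed (rule tens_closed)

lemma T_hom_eq:
  assumes "vectorspace K Z" "f \<in> module_hom K T Z" "g \<in> module_hom K T Z"
    "\<And>v w. v \<in> carrier V \<Longrightarrow> w \<in> carrier W \<Longrightarrow> f (tens K V W v w) = g (tens K V W v w)" "X \<in> carrier T"
  shows "f X = g X"
proof (rule TQ.Q_hom_eq[OF _ assms(5)[unfolded T_def']])
  note fg = hom_comp[OF TQ.pr_hom[folded T_def'] assms(2)] hom_comp[OF TQ.pr_hom[folded T_def'] assms(3)]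
  fix \<phi> assume "\<phi> \<in> carrier FV.F"
  then show "f (TQ.pr \<phi>) = g (TQ.pr \<phi>)"
    by (rule FV.F_hom_eq[OF assms(1) fg, rotated]) (auto simp: assms(4) tens_pr[symmetric])
qed

text \<open>The universal property of the tensor product, in the concrete form of
  \<open>induced_map\<close>.\<close>

lemma induced_tens:
  assumes "vectorspace K Z" "bilinear_map K V W Z \<beta>"
  shows "induced_map K Z (\<lambda>(v, w). \<beta> v w) \<in> module_hom K T Z" (is ?A)
    and "v \<in> carrier V \<Longrightarrow> w \<in> carrier W \<Longrightarrow> induced_map K Z (\<lambda>(v, w). \<beta> v w) (tens K V W v w) = \<beta> v w"
proof -
  let ?g = "\<lambda>(v, w). \<beta> v w"
  let ?h = "linear_extension K Z ?g"
  have g: "\<And>x. x \<in> carrier (V \<times>\<times> W) \<Longrightarrow> ?g x \<in> carrier Z"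
    using bilinearD(3)[OF assms(2)] by (auto simp: DirProd_def)
  note h = FV.LE_hom[OF assms(1) g]
  have hs: "?h (single K (v, w)) = \<beta> v w" if "v \<in> carrier V" "w \<in> carrier W" for v w
    using FV.LE_single[OF assms(1), of ?g "(v, w)"] bilinearD(3)[OF assms(2) that] by simp
  have van: "?h x = \<zero>\<^bsub>Z\<^esub>" if "x \<in> N" for x
    by (rule null_vanish[OF assms(1) h assms(2) hs that])
  show ?A using TQ.the_elem_hom[OF h assms(1) van] unfolding T_def' induced_map_def .
  show "induced_map K Z ?g (tens K V W v w) = \<beta> v w" if "v \<in> carrier V" "w \<in> carrier W"
    unfolding induced_map_def tens_pr
    by (rule trans[OF TQ.the_elem_pr[OF h assms(1) van single_VW[OF that]] hs[OF that]])
qed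

end

lemma tensor_vsI: "vectorspace K V \<Longrightarrow> vectorspace K W \<Longrightarrow> tensor_vs K V W"
  by (rule tensor_vs.intro)

lemmas tensor_vectorspace = tensor_vs.T_vectorspace[OF tensor_vsI]
lemmas tens_bilinear = tensor_vs.tens_bilinear[OF tensor_vsI]
lemmas tensor_hom_eq = tensor_vs.T_hom_eq[OF tensor_vsI]
lemmas induced_map_hom = tensor_vs.induced_tens(1)[OF tensor_vsI]
lemmas induced_map_tens = tensor_vs.induced_tens(2)[OF tensor_vsI]

lemma tensor_map_hom:
  assumes "vectorspace K V" "vectorspace K W" "vectorspace K V'" "vectorspace K W'"
    "f \<in> module_hom K V V'" "g \<in> module_hom K W W'"
  shows "tensor_map K V' W' f g \<in> module_hom K (tensor K V W) (tensor K V' W')"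
  unfolding tensor_map_def
  by (rule induced_map_hom[OF assms(1,2) tensor_vectorspace[OF assms(3,4)]
        bilinear_comp[OF tens_bilinear[OF assms(3,4)] assms(5,6)]])

lemma tensor_map_tens:
  assumes "vectorspace K V" "vectorspace K W" "vectorspace K V'" "vectorspace K W'"
    "f \<in> module_hom K V V'" "g \<in> module_hom K W W'" "v \<in> carrier V" "w \<in> carrier W"
  shows "tensor_map K V' W' f g (tens K V W v w) = tens K V' W' (f v) (g w)"
  unfolding tensor_map_def
  by (rule induced_map_tens[OF assms(1,2) tensor_vectorspace[OF assms(3,4)]
        bilinear_comp[OF tens_bilinear[OF assms(3,4)] assms(5,6)] assms(7,8)])

context
  fixes K V W X assumes vs: "vectorspace K V" "vectorspace K W" "vectorspace K X"
begin

lemma tensor_assoc_aux: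
  assumes x: "x \<in> carrier X"
  shows "induced_map K (tensor K V (tensor K W X)) (\<lambda>(v, w). tens K V (tensor K W X) v (tens K W X w x))
      \<in> module_hom K (tensor K V W) (tensor K V (tensor K W X))" (is "?I x \<in> _")
    and "v \<in> carrier V \<Longrightarrow> w \<in> carrier W \<Longrightarrow>
      induced_map K (tensor K V (tensor K W X)) (\<lambda>(v, w). tens K V (tensor K W X) v (tens K W X w x)) (tens K V W v w)
      = tens K V (tensor K W X) v (tens K W X w x)"
proof -
  note WX = tensor_vectorspace[OF vs(2,3)]
  note b = bilinear_comp[OF tens_bilinear[OF vs(1) WX] hom_id(1) bilinearD(2)[OF tens_bilinear[OF vs(2,3)] x]]
  note i = induced_map_hom[OF vs(1,2) tensor_vectorspace[OF vs(1) WX] b] induced_map_tens[OF vs(1,2) tensor_vectorspace[OF vs(1) WX] b]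
  show "?I x \<in> module_hom K (tensor K V W) (tensor K V (tensor K W X))" by (rule i)
  show "v \<in> carrier V \<Longrightarrow> w \<in> carrier W \<Longrightarrow>
      ?I x (tens K V W v w) = tens K V (tensor K W X) v (tens K W X w x)" by (rule i)
qed

text \<open>Linearity in the first argument is that of an induced map. Linearity in
  \<open>x\<close>, which occurs inside the function being extended, has to be checked on elementary
  tensors.\<close>

lemma tensor_assoc_bilinear:
  "bilinear_map K (tensor K V W) X (tensor K V (tensor K W X))
    (\<lambda>t x. induced_map K (tensor K V (tensor K W X)) (\<lambda>(v, w). tens K V (tensor K W X) v (tens K W X w x)) t)"
    (is "bilinear_map K ?VW X ?T ?I")
proof -
  note WX = tensor_vectorspace[OF vs(2,3)]
  note T = tensor_vectorspace[OF vs(1) WX]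
  interpret T: vectorspace K ?T by (rule T)
  interpret X: vectorspace K X by (rule vs)
  note I = tensor_assoc_aux
  note t = bilinearD[OF tens_bilinear[OF vs(2,3)]]
  note t' = bilinearD[OF tens_bilinear[OF vs(1) WX]]
  show ?thesis
  proof (rule bilinearI)
    fix s x x' assume s: "s \<in> carrier ?VW" and x: "x \<in> carrier X" "x' \<in> carrier X"
    show "?I s (x \<oplus>\<^bsub>X\<^esub> x') = ?I s x \<oplus>\<^bsub>?T\<^esub> ?I s x'"
      by (rule tensor_hom_eq[OF vs(1,2) T I(1) hom_add_maps[OF T I(1) I(1)] _ s])
        (simp_all add: x I(2) t(3,5) t'(5))
  next
    fix c s x assume c: "c \<in> carrier K" and s: "s \<in> carrier ?VW" and x: "x \<in> carrier X"
    show "?I s (c \<odot>\<^bsub>X\<^esub> x) = c \<odot>\<^bsub>?T\<^esub> ?I s x"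
      by (rule tensor_hom_eq[OF vs(1,2) T I(1) hom_smult_map[OF T I(1) c] _ s])
        (simp_all add: x c I(2) t(3,7) t'(7))
  qed (rule hom_closed[OF I(1)] hom_add[OF I(1)] hom_smult[OF I(1)]; assumption)+
qed

lemma tensor_assoc_hom:
  "tensor_assoc K V W X \<in> module_hom K (tensor K (tensor K V W) X) (tensor K V (tensor K W X))"
  unfolding tensor_assoc_def Let_def
  by (rule induced_map_hom[OF tensor_vectorspace[OF vs(1,2)] vs(3) tensor_vectorspace[OF vs(1) tensor_vectorspace[OF vs(2,3)]]
        tensor_assoc_bilinear])

lemma tensor_assoc_tens:
  assumes "v \<in> carrier V" "w \<in> carrier W" "x \<in> carrier X"
  shows "tensor_assoc K V W X (tens K (tensor K V W) X (tens K V W v w) x) = tens K V (tensor K W X) v (tens K W X w x)"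
  unfolding tensor_assoc_def Let_def
  using induced_map_tens[OF tensor_vectorspace[OF vs(1,2)] vs(3) tensor_vectorspace[OF vs(1) tensor_vectorspace[OF vs(2,3)]]
        tensor_assoc_bilinear bilinearD(3)[OF tens_bilinear[OF vs(1,2)] assms(1,2)] assms(3)]
    tensor_assoc_aux(2)[OF assms(3,1,2)] by simp

end

section \<open>Tensor products of algebras\<close>

locale tensor_alg = V: assoc_alg K V + W: assoc_alg K W for K V W
begin

sublocale tensor_vs K V W ..

sublocale FA: monoid_alg K "V \<times>\<times> W"
  by (intro monoid_alg.intro FV.free_vectorspace_axioms DirProd_monoid V.A.monoid_axioms W.A.monoid_axioms)

lemma single_mult_VW:
  "v \<in> carrier V \<Longrightarrow> w \<in> carrier W \<Longrightarrow> v' \<in> carrier V \<Longrightarrow> w' \<in> carrier W \<Longrightarrow>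
    single K (v, w) \<otimes>\<^bsub>FV.F\<^esub> single K (v', w') = single K (v \<otimes>\<^bsub>V\<^esub> v', w \<otimes>\<^bsub>W\<^esub> w')"
  using FA.single_mult[of "(v, w)" "(v', w')"] by (simp add: DirProd_def)

text \<open>Without this the product of cosets would be ill defined. Multiplication by a basis
  element \<open>(a, b)\<close> sends \<open>(v, w)\<close> to \<open>(a v, b w)\<close>, whose
  class is bilinear in \<open>v\<close> and \<open>w\<close>, so \<open>null_vanish\<close> applies;
  general multipliers follow by linearity.\<close>

lemma null_ideal: "ideal N FV.F"
proof -
  interpret FA: assoc_alg K FV.F by (rule FA.F_assoc_alg)
  note zero = hom_zero_map[OF TQ.Q_vectorspace]
  have zN: "x \<in> N" if "TQ.pr x = \<zero>\<^bsub>TQ.Q\<^esub>" "x \<in> carrier FV.F" for x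
    using that TQ.pr_eq_iff[of x "\<zero>\<^bsub>FV.F\<^esub>"] by (simp add: TQ.pr_zero a_minus_def)
  have l: "TQ.pr (\<phi> \<otimes>\<^bsub>FV.F\<^esub> n) = \<zero>\<^bsub>TQ.Q\<^esub>" if n: "n \<in> N" and "\<phi> \<in> carrier FV.F" for \<phi> n
  proof (rule FV.F_hom_eq[OF TQ.Q_vectorspace hom_comp[OF FA.mult_hom_left[OF TQ.I_closed(1)[OF n]] TQ.pr_hom] zero _ that(2)])
    fix x assume "x \<in> carrier (V \<times>\<times> W)"
    then obtain a b where x: "x = (a, b)" "a \<in> carrier V" "b \<in> carrier W" by (auto simp: DirProd_def)
    show "TQ.pr (single K x \<otimes>\<^bsub>FV.F\<^esub> n) = \<zero>\<^bsub>TQ.Q\<^esub>"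
    proof (rule null_vanish[OF TQ.Q_vectorspace hom_comp[OF FA.mult_hom_right TQ.pr_hom] _ _ n])
      show "single K x \<in> carrier FV.F" using x by (simp add: single_VW)
      show "bilinear_map K V W TQ.Q (\<lambda>v w. tens K V W (a \<otimes>\<^bsub>V\<^esub> v) (b \<otimes>\<^bsub>W\<^esub> w))"
        by (rule bilinear_comp[OF tens_bilinear[unfolded T_def'] V.mult_hom_right[OF x(2)] W.mult_hom_right[OF x(3)]])
    qed (use x in \<open>simp add: single_mult_VW tens_pr\<close>)
  qed
  have r: "TQ.pr (n \<otimes>\<^bsub>FV.F\<^esub> \<phi>) = \<zero>\<^bsub>TQ.Q\<^esub>" if n: "n \<in> N" and "\<phi> \<in> carrier FV.F" for \<phi> n
  proof (rule FV.F_hom_eq[OF TQ.Q_vectorspace hom_comp[OF FA.mult_hom_right[OF TQ.I_closed(1)[OF n]] TQ.pr_hom] zero _ that(2)])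
    fix x assume "x \<in> carrier (V \<times>\<times> W)"
    then obtain a b where x: "x = (a, b)" "a \<in> carrier V" "b \<in> carrier W" by (auto simp: DirProd_def)
    show "TQ.pr (n \<otimes>\<^bsub>FV.F\<^esub> single K x) = \<zero>\<^bsub>TQ.Q\<^esub>"
    proof (rule null_vanish[OF TQ.Q_vectorspace hom_comp[OF FA.mult_hom_left TQ.pr_hom] _ _ n])
      show "single K x \<in> carrier FV.F" using x by (simp add: single_VW)
      show "bilinear_map K V W TQ.Q (\<lambda>v w. tens K V W (v \<otimes>\<^bsub>V\<^esub> a) (w \<otimes>\<^bsub>W\<^esub> b))"
        by (rule bilinear_comp[OF tens_bilinear[unfolded T_def'] V.mult_hom_left[OF x(2)] W.mult_hom_left[OF x(3)]])
    qed (use x in \<open>simp add: single_mult_VW tens_pr\<close>)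
  qed
  show ?thesis
  proof (rule idealI[OF FA.A.ring_axioms TQ.I.a_subgroup])
    fix a x assume "a \<in> N" "x \<in> carrier FV.F"
    then show "x \<otimes>\<^bsub>FV.F\<^esub> a \<in> N" "a \<otimes>\<^bsub>FV.F\<^esub> x \<in> N"
      using l r TQ.I_closed(1) by (auto intro!: zN)
  qed
qed

sublocale QA: quotient_alg K FV.F N
  by (intro quotient_alg.intro quotient_alg_axioms.intro FA.F_assoc_alg null_ideal)

lemma T_assoc_alg: "assoc_alg K T"
  unfolding T_def' by (rule QA.Q_assoc_alg)

lemma tens_mult:
  "v \<in> carrier V \<Longrightarrow> w \<in> carrier W \<Longrightarrow> v' \<in> carrier V \<Longrightarrow> w' \<in> carrier W \<Longrightarrow>
    tens K V W v w \<otimes>\<^bsub>T\<^esub> tens K V W v' w' = tens K V W (v \<otimes>\<^bsub>V\<^esub> v') (w \<otimes>\<^bsub>W\<^esub> w')"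
  unfolding tens_pr T_def' by (simp add: QA.pr_mult single_VW single_mult_VW)

lemma tens_one: "\<one>\<^bsub>T\<^esub> = tens K V W \<one>\<^bsub>V\<^esub> \<one>\<^bsub>W\<^esub>"
  unfolding tens_pr T_def' QA.pr_one FV.F_simps by simp

text \<open>Multiplicativity spreads from elementary tensors to all tensors, first in the second
  factor and then in the first.\<close>

lemma T_mult_hom:
  assumes "assoc_alg K B" "f \<in> module_hom K T B"
    "\<And>v w v' w'. v \<in> carrier V \<Longrightarrow> w \<in> carrier W \<Longrightarrow> v' \<in> carrier V \<Longrightarrow> w' \<in> carrier W \<Longrightarrow>
      f (tens K V W (v \<otimes>\<^bsub>V\<^esub> v') (w \<otimes>\<^bsub>W\<^esub> w')) = f (tens K V W v w) \<otimes>\<^bsub>B\<^esub> f (tens K V W v' w')"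
    "X \<in> carrier T" "Y \<in> carrier T"
  shows "f (X \<otimes>\<^bsub>T\<^esub> Y) = f X \<otimes>\<^bsub>B\<^esub> f Y"
proof -
  interpret B: assoc_alg K B by fact
  interpret TT: assoc_alg K T by (rule T_assoc_alg)
  note fc = hom_closed[OF assms(2)]
  have "f (tens K V W v w \<otimes>\<^bsub>T\<^esub> Y) = f (tens K V W v w) \<otimes>\<^bsub>B\<^esub> f Y" if "v \<in> carrier V" "w \<in> carrier W" for v w
    by (rule T_hom_eq[OF B.vectorspace_axioms hom_comp[OF TT.mult_hom_right assms(2)] hom_comp[OF assms(2) B.mult_hom_right] _ assms(5)])
      (simp_all add: that tens_closed fc tens_mult assms(3))
  then show ?thesis
    by (intro T_hom_eq[OF B.vectorspace_axioms hom_comp[OF TT.mult_hom_left assms(2)] hom_comp[OF assms(2) B.mult_hom_left] _ assms(4)])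
      (simp_all add: fc assms(5))
qed

end

lemmas tensor_assoc_alg = tensor_alg.T_assoc_alg[OF tensor_alg.intro]
lemmas tens_mult = tensor_alg.tens_mult[OF tensor_alg.intro]
lemmas tens_one = tensor_alg.tens_one[OF tensor_alg.intro]
lemmas tensor_mult_hom = tensor_alg.T_mult_hom[OF tensor_alg.intro]

section \<open>The enveloping algebra\<close>

lemma lists_monoid: "monoid \<lparr>carrier = lists S, monoid.mult = (@), one = []\<rparr>"
  by unfold_locales auto

lemma word_product_closed:
  assumes "assoc_alg K B" "\<And>x. x \<in> S \<Longrightarrow> f x \<in> carrier B"
  shows "w \<in> lists S \<Longrightarrow> foldr (mult B) (map f w) \<one>\<^bsub>B\<^esub> \<in> carrier B"
proof (induct w)
  case (Cons x w)
  interpret B: assoc_alg K B by fact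
  show ?case using Cons assms(2) by auto
next
  case Nil
  interpret B: assoc_alg K B by fact
  show ?case by simp
qed

lemma word_product_append:
  assumes "assoc_alg K B" "\<And>x. x \<in> S \<Longrightarrow> f x \<in> carrier B" "v \<in> lists S" "w \<in> lists S"
  shows "foldr (mult B) (map f (v @ w)) \<one>\<^bsub>B\<^esub>
    = foldr (mult B) (map f v) \<one>\<^bsub>B\<^esub> \<otimes>\<^bsub>B\<^esub> foldr (mult B) (map f w) \<one>\<^bsub>B\<^esub>"
  using assms(3)
proof (induct v)
  case (Cons x v)
  interpret B: assoc_alg K B by fact
  note c = word_product_closed[OF assms(1,2)]
  have "x \<in> S" "v \<in> lists S" using Cons(1,2) by auto
  then show ?case using Cons(3) c[OF _ \<open>v \<in> lists S\<close>] c[OF _ assms(4)] assms(2)[of x] by (simp add: B.A.m_assoc)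
next
  case Nil
  interpret B: assoc_alg K B by fact
  show ?case using word_product_closed[OF assms(1,2,4)] by simp
qed

context lie_algebra begin

abbreviation "G \<equiv> \<lparr>carrier = lists (carrier M), monoid.mult = (@), one = []\<rparr>"

sublocale FM: monoid_alg K G
  by (intro monoid_alg.intro free_vectorspace.intro field_axioms lists_monoid)

sublocale FA: assoc_alg K FM.F by (rule FM.F_assoc_alg)

abbreviation "Rels \<equiv> enveloping_relations K M br"
abbreviation "J \<equiv> enveloping_ideal K M br"
abbreviation "U \<equiv> enveloping_algebra K M br"
abbreviation "\<iota> \<equiv> env_inj K M br"

lemma single1: "x \<in> carrier M \<Longrightarrow> single K [x] \<in> carrier FM.F"
  by (rule FM.single_closed) simp

lemma br_closed: "x \<in> carrier M \<Longrightarrow> y \<in> carrier M \<Longrightarrow> br x y \<in> carrier M"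
  by (rule bilinearD(3)[OF br_bilinear])

lemma Rels_closed: "Rels \<subseteq> carrier FM.F"
  unfolding enveloping_relations_def Let_def free_algebra_def
  by (auto intro!: FM.F.M.minus_closed FM.F.smult_closed FA.A.m_closed single1 br_closed)

lemma J_ideal: "ideal J FM.F"
  unfolding enveloping_ideal_def free_algebra_def by (rule FA.A.genideal_ideal[OF Rels_closed])

sublocale UQ: quotient_alg K FM.F J
  by (intro quotient_alg.intro quotient_alg_axioms.intro FM.F_assoc_alg J_ideal)

lemma U_def': "U = UQ.Q" by (simp add: enveloping_algebra_def free_algebra_def)

lemma U_assoc_alg: "assoc_alg K U" unfolding U_def' by (rule UQ.Q_assoc_alg)

sublocale U: assoc_alg K U by (rule U_assoc_alg)

lemma \<iota>_pr: "\<iota> x = UQ.pr (single K [x])" by (simp add: env_inj_def free_algebra_def)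

lemma Rels_J: "Rels \<subseteq> J"
  unfolding enveloping_ideal_def free_algebra_def by (rule FA.A.genideal_self[OF Rels_closed])

lemma \<iota>_closed: "x \<in> carrier M \<Longrightarrow> \<iota> x \<in> carrier U"
  unfolding \<iota>_pr U_def' by (simp add: UQ.pr_closed single1)

lemma F_minus3: "a \<in> carrier FM.F \<Longrightarrow> b \<in> carrier FM.F \<Longrightarrow> c \<in> carrier FM.F \<Longrightarrow> a \<ominus>\<^bsub>FM.F\<^esub> b \<ominus>\<^bsub>FM.F\<^esub> c = a \<ominus>\<^bsub>FM.F\<^esub> (b \<oplus>\<^bsub>FM.F\<^esub> c)"
  by (simp add: a_minus_def FM.F.M.add.m_assoc FM.F.M.minus_add)

lemma \<iota>_hom: "\<iota> \<in> module_hom K M U"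
proof (rule module_homI)
  fix x y assume c: "x \<in> carrier M" "y \<in> carrier M"
  have "single K [x \<oplus>\<^bsub>M\<^esub> y] \<ominus>\<^bsub>FM.F\<^esub> single K [x] \<ominus>\<^bsub>FM.F\<^esub> single K [y] \<in> Rels"
    unfolding enveloping_relations_def Let_def free_algebra_def using c by blast
  with Rels_J have "single K [x \<oplus>\<^bsub>M\<^esub> y] \<ominus>\<^bsub>FM.F\<^esub> single K [x] \<ominus>\<^bsub>FM.F\<^esub> single K [y] \<in> J" by (rule subsetD)
  then have "single K [x \<oplus>\<^bsub>M\<^esub> y] \<ominus>\<^bsub>FM.F\<^esub> (single K [x] \<oplus>\<^bsub>FM.F\<^esub> single K [y]) \<in> J"
    using c by (simp add: F_minus3 single1)
  then show "\<iota> (x \<oplus>\<^bsub>M\<^esub> y) = \<iota> x \<oplus>\<^bsub>U\<^esub> \<iota> y"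
    unfolding \<iota>_pr U_def' using c by (simp add: UQ.pr_add single1 UQ.pr_eq_iff)
next
  fix c x assume c: "c \<in> carrier K" "x \<in> carrier M"
  have "single K [c \<odot>\<^bsub>M\<^esub> x] \<ominus>\<^bsub>FM.F\<^esub> c \<odot>\<^bsub>FM.F\<^esub> single K [x] \<in> Rels"
    unfolding enveloping_relations_def Let_def free_algebra_def using c by blast
  with Rels_J have "single K [c \<odot>\<^bsub>M\<^esub> x] \<ominus>\<^bsub>FM.F\<^esub> c \<odot>\<^bsub>FM.F\<^esub> single K [x] \<in> J" by (rule subsetD)
  then show "\<iota> (c \<odot>\<^bsub>M\<^esub> x) = c \<odot>\<^bsub>U\<^esub> \<iota> x"
    unfolding \<iota>_pr U_def' using c by (simp add: UQ.pr_smult single1 UQ.pr_eq_iff)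
qed (rule \<iota>_closed)

lemma \<iota>_bracket:
  assumes c: "x \<in> carrier M" "y \<in> carrier M"
  shows "\<iota> x \<otimes>\<^bsub>U\<^esub> \<iota> y \<ominus>\<^bsub>U\<^esub> \<iota> y \<otimes>\<^bsub>U\<^esub> \<iota> x = \<iota> (br x y)"
proof -
  have "single K [x] \<otimes>\<^bsub>FM.F\<^esub> single K [y] \<ominus>\<^bsub>FM.F\<^esub> single K [y] \<otimes>\<^bsub>FM.F\<^esub> single K [x] \<ominus>\<^bsub>FM.F\<^esub> single K [br x y] \<in> Rels"
    unfolding enveloping_relations_def Let_def free_algebra_def using c by blast
  with Rels_J have "single K [x] \<otimes>\<^bsub>FM.F\<^esub> single K [y] \<ominus>\<^bsub>FM.F\<^esub> single K [y] \<otimes>\<^bsub>FM.F\<^esub> single K [x] \<ominus>\<^bsub>FM.F\<^esub> single K [br x y] \<in> J" by (rule subsetD)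
  then have "UQ.pr (single K [x] \<otimes>\<^bsub>FM.F\<^esub> single K [y] \<ominus>\<^bsub>FM.F\<^esub> single K [y] \<otimes>\<^bsub>FM.F\<^esub> single K [x]) = \<iota> (br x y)"
    unfolding \<iota>_pr using c by (simp add: UQ.pr_eq_iff single1 br_closed)
  then show ?thesis
    using hom_minus[OF UQ.pr_hom FM.F_vectorspace UQ.Q_vectorspace, of "single K [x] \<otimes>\<^bsub>FM.F\<^esub> single K [y]" "single K [y] \<otimes>\<^bsub>FM.F\<^esub> single K [x]"] c
    by (simp add: \<iota>_pr U_def' UQ.pr_mult single1)
qed

lemma pr_hom_U: "(\<lambda>x. UQ.pr x) \<in> algebra_hom K FM.F U"
  unfolding U_def' by (rule UQ.pr_algebra_hom)

lemma pr_snoc: "x \<in> carrier M \<Longrightarrow> w \<in> lists (carrier M) \<Longrightarrow> UQ.pr (single K (w @ [x])) = UQ.pr (single K w) \<otimes>\<^bsub>U\<^esub> \<iota> x"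
  using FM.single_mult[of w "[x]"] algebra_homD(3)[OF pr_hom_U FM.single_closed single1, of w x] by (simp add: \<iota>_pr)

lemma pr_Nil: "UQ.pr (single K []) = \<one>\<^bsub>U\<^esub>"
  using algebra_homD(4)[OF pr_hom_U] by (simp add: FM.F_simps)

lemma word_closed: "w \<in> lists (carrier M) \<Longrightarrow> UQ.pr (single K w) \<in> carrier U"
  by (rule algebra_homD(2)[OF pr_hom_U FM.single_closed]) simp

lemma U_word_induct [consumes 1, case_names word add smult]:
  assumes "u \<in> carrier U" "\<And>w. w \<in> lists (carrier M) \<Longrightarrow> P (UQ.pr (single K w))"
    "\<And>u v. u \<in> carrier U \<Longrightarrow> v \<in> carrier U \<Longrightarrow> P u \<Longrightarrow> P v \<Longrightarrow> P (u \<oplus>\<^bsub>U\<^esub> v)"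
    "\<And>c u. c \<in> carrier K \<Longrightarrow> u \<in> carrier U \<Longrightarrow> P u \<Longrightarrow> P (c \<odot>\<^bsub>U\<^esub> u)"
  shows "P u"
proof -
  have "P (UQ.pr \<phi>)" if "\<phi> \<in> carrier FM.F" for \<phi>
    using that
  proof (induct rule: FM.F_induct)
    \<comment> \<open>Zero is produced as a multiple of the unit, which is the class of the empty
      word.\<close>
    case zero
    have "P (\<zero>\<^bsub>K\<^esub> \<odot>\<^bsub>U\<^esub> \<one>\<^bsub>U\<^esub>)" using assms(2)[of "[]"] assms(4)[of "\<zero>\<^bsub>K\<^esub>" "\<one>\<^bsub>U\<^esub>"] by (simp add: pr_Nil)
    moreover have "\<zero>\<^bsub>K\<^esub> \<odot>\<^bsub>U\<^esub> \<one>\<^bsub>U\<^esub> = UQ.pr \<zero>\<^bsub>FM.F\<^esub>"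
      using U.lmult_0[OF U.A.one_closed] UQ.pr_zero unfolding U_def' by (rule trans)
    ultimately show ?case by simp
  next
    case (add c x \<phi>)
    have x: "x \<in> lists (carrier M)" using add by simp
    have "P (c \<odot>\<^bsub>U\<^esub> UQ.pr (single K x))" using assms(2,4) x add(1) word_closed by blast
    then have "P (UQ.pr \<phi> \<oplus>\<^bsub>U\<^esub> c \<odot>\<^bsub>U\<^esub> UQ.pr (single K x))"
      using assms(3) add algebra_homD(2)[OF pr_hom_U add(3)] word_closed[OF x] by blast
    then show ?case
      using algebra_homD(5)[OF pr_hom_U add(3) FM.F.smult_closed[OF add(1) FM.single_closed[OF add(2)]]]
        algebra_homD(6)[OF pr_hom_U add(1) FM.single_closed[OF add(2)]] by simp
  qed
  then show ?thesis using assms(1) unfolding U_def' UQ.carrier_Q by auto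
qed

text \<open>Words grow at the right end, matching the later recursions for the matrix map and the
  differential, which describe what happens under right multiplication by a generator.\<close>

lemma U_induct_right [consumes 1, case_names one mult add smult]:
  assumes "u \<in> carrier U" "P \<one>\<^bsub>U\<^esub>"
    "\<And>u x. u \<in> carrier U \<Longrightarrow> x \<in> carrier M \<Longrightarrow> P u \<Longrightarrow> P (u \<otimes>\<^bsub>U\<^esub> \<iota> x)"
    "\<And>u v. u \<in> carrier U \<Longrightarrow> v \<in> carrier U \<Longrightarrow> P u \<Longrightarrow> P v \<Longrightarrow> P (u \<oplus>\<^bsub>U\<^esub> v)"
    "\<And>c u. c \<in> carrier K \<Longrightarrow> u \<in> carrier U \<Longrightarrow> P u \<Longrightarrow> P (c \<odot>\<^bsub>U\<^esub> u)"
  shows "P u"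
  using assms(1)
proof (induct rule: U_word_induct)
  case (word w)
  then show ?case
    by (induct w rule: rev_induct) (auto simp: pr_Nil pr_snoc word_closed assms(2,3))
qed (use assms(4,5) in auto)

lemma U_algebra_hom_eq:
  assumes "assoc_alg K B" "f \<in> algebra_hom K U B" "g \<in> algebra_hom K U B"
    "\<And>x. x \<in> carrier M \<Longrightarrow> f (\<iota> x) = g (\<iota> x)" "u \<in> carrier U"
  shows "f u = g u"
  using assms(5)
proof (induct rule: U_induct_right)
  case one then show ?case by (simp add: algebra_homD(4)[OF assms(2)] algebra_homD(4)[OF assms(3)])
qed (simp_all add: algebra_homD(3,5,6)[OF assms(2)] algebra_homD(3,5,6)[OF assms(3)] assms(4) \<iota>_closed)

text \<open>The universal property of \<open>U\<close>: the multiplicative extension to the free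
  algebra kills all three families of relations, the first two by linearity of \<open>f\<close> and
  the third by \<open>brf\<close>.\<close>

lemma env_extend:
  assumes B: "assoc_alg K B" and f: "f \<in> module_hom K M B"
    and brf: "\<And>x y. x \<in> carrier M \<Longrightarrow> y \<in> carrier M \<Longrightarrow> f x \<otimes>\<^bsub>B\<^esub> f y \<ominus>\<^bsub>B\<^esub> f y \<otimes>\<^bsub>B\<^esub> f x = f (br x y)"
  shows "env_extend K B f \<in> algebra_hom K U B" (is ?A)
    and "x \<in> carrier M \<Longrightarrow> env_extend K B f (\<iota> x) = f x"
proof -
  interpret B: assoc_alg K B by fact
  let ?E = "\<lambda>w. foldr (mult B) (map f w) \<one>\<^bsub>B\<^esub>"
  let ?h = "linear_extension K B ?E"
  note fc = hom_closed[OF f]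
  have Ec: "\<And>w. w \<in> carrier G \<Longrightarrow> ?E w \<in> carrier B" using word_product_closed[OF B fc] by simp
  have h: "?h \<in> module_hom K FM.F B" by (rule FM.LE_hom[OF B.vectorspace_axioms Ec])
  have hs: "?h (single K w) = ?E w" if "w \<in> lists (carrier M)" for w
    by (rule FM.LE_single[OF B.vectorspace_axioms]) (use Ec that in simp)
  have hs1: "?h (single K [x]) = f x" if "x \<in> carrier M" for x
    using hs[of "[x]"] that fc by simp
  have hm1: "?h (single K v \<otimes>\<^bsub>FM.F\<^esub> \<psi>) = ?h (single K v) \<otimes>\<^bsub>B\<^esub> ?h \<psi>" if v: "v \<in> lists (carrier M)" and \<psi>: "\<psi> \<in> carrier FM.F" for v \<psi>
  proof (rule FM.F_hom_eq[OF B.vectorspace_axioms hom_comp[OF FA.mult_hom_right h] hom_comp[OF h B.mult_hom_right] _ \<psi>])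
    show "single K v \<in> carrier FM.F" "?h (single K v) \<in> carrier B" using v Ec by (simp_all add: FM.single_closed hs)
    fix w assume "w \<in> carrier G"
    then show "?h (single K v \<otimes>\<^bsub>FM.F\<^esub> single K w) = ?h (single K v) \<otimes>\<^bsub>B\<^esub> ?h (single K w)"
      using FM.single_mult[of v w] v word_product_append[OF B, where f=f and S="carrier M" and v=v and w=w] fc by (simp add: hs)
  qed
  have hm: "?h (\<phi> \<otimes>\<^bsub>FM.F\<^esub> \<psi>) = ?h \<phi> \<otimes>\<^bsub>B\<^esub> ?h \<psi>" if \<phi>: "\<phi> \<in> carrier FM.F" and \<psi>: "\<psi> \<in> carrier FM.F" for \<phi> \<psi>
    by (rule FM.F_hom_eq[OF B.vectorspace_axioms hom_comp[OF FA.mult_hom_left[OF \<psi>] h] hom_comp[OF h B.mult_hom_left[OF hom_closed[OF h \<psi>]]] _ \<phi>])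
      (rule hm1[OF _ \<psi>], simp)
  have h1: "?h \<one>\<^bsub>FM.F\<^esub> = \<one>\<^bsub>B\<^esub>" using hs[of "[]"] by (simp add: FM.F_simps)
  \<comment> \<open>The kernel of the extension. It is a two-sided ideal containing the relations,
    hence contains the ideal \<open>J\<close> generated by them.\<close>
  define N where "N = {\<phi> \<in> carrier FM.F. ?h \<phi> = \<zero>\<^bsub>B\<^esub>}"
  note mi = hom_minus[OF h FM.F_vectorspace B.vectorspace_axioms]
  have mm: "(a \<oplus>\<^bsub>B\<^esub> b) \<ominus>\<^bsub>B\<^esub> a \<ominus>\<^bsub>B\<^esub> b = \<zero>\<^bsub>B\<^esub>" if "a \<in> carrier B" "b \<in> carrier B" for a b
  proof -
    have "(a \<oplus>\<^bsub>B\<^esub> b) \<ominus>\<^bsub>B\<^esub> a \<ominus>\<^bsub>B\<^esub> b = (a \<oplus>\<^bsub>B\<^esub> b) \<oplus>\<^bsub>B\<^esub> \<ominus>\<^bsub>B\<^esub> (a \<oplus>\<^bsub>B\<^esub> b)"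
      using that by (simp add: a_minus_def B.M.add.m_assoc B.M.minus_add)
    then show ?thesis using that by (simp add: B.M.r_neg)
  qed
  have mz: "a \<ominus>\<^bsub>B\<^esub> a = \<zero>\<^bsub>B\<^esub>" if "a \<in> carrier B" for a
    using that by (simp add: a_minus_def B.M.r_neg)
  have "Rels \<subseteq> N"
  proof
    fix r assume r: "r \<in> Rels"
    then have "?h r = \<zero>\<^bsub>B\<^esub>"
      unfolding enveloping_relations_def Let_def free_algebra_def
      by (elim UnE CollectE exE conjE; hypsubst)
        (simp_all add: mi hs1 single1 FM.F.M.minus_closed hm br_closed hom_smult[OF h] hom_add[OF f] hom_smult[OF f] fc mm mz brf)
    then show "r \<in> N" using r Rels_closed by (auto simp: N_def)
  qed
  moreover have "ideal N FM.F"
  proof (rule idealI[OF FA.A.ring_axioms])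
    show "subgroup N (add_monoid FM.F)"
    proof (rule subgroup.intro)
      fix x assume x: "x \<in> N"
      then have "?h (\<ominus>\<^bsub>FM.F\<^esub> x) = ?h (\<zero>\<^bsub>FM.F\<^esub> \<ominus>\<^bsub>FM.F\<^esub> x)" by (simp add: N_def a_minus_def)
      also have "\<dots> = \<zero>\<^bsub>B\<^esub>" using x by (simp add: mi N_def hom_zero[OF h FM.F_vectorspace B.vectorspace_axioms] mz)
      finally show "inv\<^bsub>add_monoid FM.F\<^esub> x \<in> N" using x by (simp add: N_def a_inv_def[symmetric])
    qed (auto simp: N_def hom_add[OF h] hom_zero[OF h FM.F_vectorspace B.vectorspace_axioms])
  qed (auto simp: N_def hm hom_closed[OF h])
  ultimately have "J \<subseteq> N" unfolding enveloping_ideal_def free_algebra_def by (rule FA.A.genideal_minimal[rotated])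
  then have van: "?h x = \<zero>\<^bsub>B\<^esub>" if "x \<in> J" for x using that by (auto simp: N_def)
  have e: "env_extend K B f = (\<lambda>X. the_elem (?h ` X))" by (simp add: env_extend_def induced_map_def fun_eq_iff)
  have ep: "env_extend K B f (UQ.pr \<phi>) = ?h \<phi>" if "\<phi> \<in> carrier FM.F" for \<phi>
    unfolding e by (rule UQ.the_elem_pr[OF h B.vectorspace_axioms van that])
  show ?A
  proof (rule algebra_homI)
    show "env_extend K B f \<in> module_hom K U B" unfolding e U_def' by (rule UQ.the_elem_hom[OF h B.vectorspace_axioms van])
    show "env_extend K B f \<one>\<^bsub>U\<^esub> = \<one>\<^bsub>B\<^esub>" unfolding U_def' UQ.pr_one ep[OF FA.A.one_closed] by (rule h1)
    fix x y assume "x \<in> carrier U" "y \<in> carrier U"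
    then obtain \<phi> \<psi> where *: "\<phi> \<in> carrier FM.F" "\<psi> \<in> carrier FM.F" "x = UQ.pr \<phi>" "y = UQ.pr \<psi>"
      unfolding U_def' UQ.carrier_Q by blast
    then show "env_extend K B f (x \<otimes>\<^bsub>U\<^esub> y) = env_extend K B f x \<otimes>\<^bsub>B\<^esub> env_extend K B f y"
      using ep[OF FA.A.m_closed[OF *(1,2)]] UQ.pr_mult[OF *(1,2)] by (simp add: U_def' ep hm)
  qed
  show "env_extend K B f (\<iota> x) = f x" if "x \<in> carrier M"
    unfolding \<iota>_pr ep[OF single1[OF that]] by (rule hs1[OF that])
qed

lemma counit: "env_counit K \<in> algebra_hom K U (ground_algebra K)"
  "x \<in> carrier M \<Longrightarrow> env_counit K (\<iota> x) = \<zero>\<^bsub>K\<^esub>"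
proof -
  have z: "(\<lambda>_. \<zero>\<^bsub>K\<^esub>) \<in> module_hom K M (ground_algebra K)"
    by (rule module_homI) (auto simp: ground_algebra_def)
  have b: "\<zero>\<^bsub>K\<^esub> \<otimes>\<^bsub>ground_algebra K\<^esub> \<zero>\<^bsub>K\<^esub> \<ominus>\<^bsub>ground_algebra K\<^esub> \<zero>\<^bsub>K\<^esub> \<otimes>\<^bsub>ground_algebra K\<^esub> \<zero>\<^bsub>K\<^esub> = \<zero>\<^bsub>K\<^esub>"
  proof -
    interpret g: assoc_alg K "ground_algebra K" by (rule ground_assoc_alg) (rule field_axioms)
    have "\<zero>\<^bsub>ground_algebra K\<^esub> = \<zero>\<^bsub>K\<^esub>" by (simp add: ground_algebra_def)
    then show ?thesis using g.M.zero_closed by (metis g.A.l_null g.M.r_neg a_minus_def)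
  qed
  note e = env_extend[OF ground_assoc_alg[OF field_axioms] z b]
  show "env_counit K \<in> algebra_hom K U (ground_algebra K)" "x \<in> carrier M \<Longrightarrow> env_counit K (\<iota> x) = \<zero>\<^bsub>K\<^esub>"
    unfolding env_counit_def by (rule e)+
qed

end

lemma hom_neg:
  "f \<in> module_hom K V W \<Longrightarrow> vectorspace K V \<Longrightarrow> vectorspace K W \<Longrightarrow> x \<in> carrier V \<Longrightarrow> f (\<ominus>\<^bsub>V\<^esub> x) = \<ominus>\<^bsub>W\<^esub> f x"
  by (rule linear_map.T_neg[OF vectorspace_linear_map])

section \<open>Coordinates\<close>

text \<open>A basis with its dual functionals. Closure is assumed for all natural indices, which
  avoids side conditions and allows words over all natural numbers later; values beyond
  \<open>n\<close> are otherwise unconstrained.\<close>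

locale coords = vectorspace K V for K and V +
  fixes n :: nat and e :: "nat \<Rightarrow> 'c" and co :: "nat \<Rightarrow> 'c \<Rightarrow> 'a"
  assumes e_closed: "e i \<in> carrier V"
    and co_hom: "co i \<in> module_hom K V (ground_algebra K)"
    and expand: "v \<in> carrier V \<Longrightarrow> (\<Oplus>\<^bsub>V\<^esub>l\<in>{..<n}. co l v \<odot>\<^bsub>V\<^esub> e l) = v"
    and dual: "i < n \<Longrightarrow> j < n \<Longrightarrow> co i (e j) = (if i = j then \<one>\<^bsub>K\<^esub> else \<zero>\<^bsub>K\<^esub>)"
begin

lemma co_closed: "v \<in> carrier V \<Longrightarrow> co i v \<in> carrier K"
  using hom_closed[OF co_hom] by (simp add: ground_algebra_def)

lemma co_add: "v \<in> carrier V \<Longrightarrow> w \<in> carrier V \<Longrightarrow> co i (v \<oplus>\<^bsub>V\<^esub> w) = co i v \<oplus>\<^bsub>K\<^esub> co i w"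
  using hom_add[OF co_hom] by (simp add: ground_algebra_def)

lemma co_smult: "c \<in> carrier K \<Longrightarrow> v \<in> carrier V \<Longrightarrow> co i (c \<odot>\<^bsub>V\<^esub> v) = c \<otimes>\<^bsub>K\<^esub> co i v"
  using hom_smult[OF co_hom] by (simp add: ground_algebra_def)

lemma coords_hom:
  assumes "vectorspace K Z" "\<And>l. z l \<in> carrier Z"
  shows "(\<lambda>v. \<Oplus>\<^bsub>Z\<^esub>l\<in>{..<n}. co l v \<odot>\<^bsub>Z\<^esub> z l) \<in> module_hom K V Z"
proof (rule hom_finsum_maps[OF assms(1)])
  interpret Z: vectorspace K Z by fact
  show "(\<lambda>v. co l v \<odot>\<^bsub>Z\<^esub> z l) \<in> module_hom K V Z" for l
    by (rule module_homI) (use assms(2) in \<open>simp_all add: co_closed co_add co_smult Z.smult_l_distr Z.smult_assoc1\<close>)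
qed simp

lemma hom_expand:
  assumes "vectorspace K Z" "f \<in> module_hom K V Z" "v \<in> carrier V"
  shows "f v = (\<Oplus>\<^bsub>Z\<^esub>l\<in>{..<n}. co l v \<odot>\<^bsub>Z\<^esub> f (e l))"
proof -
  interpret Z: vectorspace K Z by fact
  have "f v = f (\<Oplus>\<^bsub>V\<^esub>l\<in>{..<n}. co l v \<odot>\<^bsub>V\<^esub> e l)" by (simp only: expand[OF assms(3)])
  also have "\<dots> = (\<Oplus>\<^bsub>Z\<^esub>l\<in>{..<n}. f (co l v \<odot>\<^bsub>V\<^esub> e l))"
    by (rule hom_finsum[OF assms(2) vectorspace_axioms assms(1)]) (simp_all add: co_closed assms(3) e_closed)
  also have "\<dots> = (\<Oplus>\<^bsub>Z\<^esub>l\<in>{..<n}. co l v \<odot>\<^bsub>Z\<^esub> f (e l))"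
    using hom_closed[OF assms(2) e_closed] co_closed[OF assms(3)]
    by (intro Z.M.finsum_cong') (simp_all add: hom_smult[OF assms(2)] e_closed)
  finally show ?thesis .
qed

lemma hom_eq_coords:
  assumes "vectorspace K Z" "f \<in> module_hom K V Z" "g \<in> module_hom K V Z"
    "\<And>l. l < n \<Longrightarrow> f (e l) = g (e l)" "v \<in> carrier V"
  shows "f v = g v"
proof -
  interpret Z: vectorspace K Z by fact
  show ?thesis unfolding hom_expand[OF assms(1,2,5)] hom_expand[OF assms(1,3,5)]
    using hom_closed[OF assms(3) e_closed] co_closed[OF assms(5)]
    by (intro Z.M.finsum_cong') (simp_all add: assms(4))
qed

text \<open>Duality collapses the coordinate sum at a basis vector. It evaluates any map defined by
  coordinates, such as \<open>lsum\<close> and \<open>rep\<close>.\<close>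

lemma finsum_delta:
  assumes "vectorspace K Z" "\<And>l. z l \<in> carrier Z" "i < n"
  shows "(\<Oplus>\<^bsub>Z\<^esub>l\<in>{..<n}. co l (e i) \<odot>\<^bsub>Z\<^esub> z l) = z i"
proof -
  interpret Z: vectorspace K Z by fact
  have "(\<Oplus>\<^bsub>Z\<^esub>l\<in>{..<n}. co l (e i) \<odot>\<^bsub>Z\<^esub> z l) = (\<Oplus>\<^bsub>Z\<^esub>l\<in>{..<n}. if i = l then z l else \<zero>\<^bsub>Z\<^esub>)"
    by (rule Z.M.finsum_cong') (use assms(2,3) in \<open>simp_all add: dual\<close>)
  also have "\<dots> = z i"
    by (rule Z.M.finsum_singleton) (use assms(2,3) in simp_all)
  finally show ?thesis .
qed

end

lemma coords_exist:
  assumes "vectorspace K V" "vectorspace.fin_dim K V"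
  shows "\<exists>e co. coords K V (vectorspace.dim K V) e co"
proof -
  interpret V: vectorspace K V by fact
  obtain \<beta> where \<beta>: "finite \<beta>" "V.basis \<beta>" using V.finite_basis_exists[OF assms(2)] by blast
  then have \<beta>c: "\<beta> \<subseteq> carrier V" by (simp add: V.basis_def)
  let ?n = "V.dim"
  have "?n = card \<beta>" by (rule V.dim_basis[OF \<beta>])
  then obtain h where h: "bij_betw h {..<?n} \<beta>"
    using ex_bij_betw_nat_finite[OF \<beta>(1)] by (auto simp: lessThan_atLeast0)
  have uniq: "\<And>v. v \<in> carrier V \<Longrightarrow> \<exists>!a. a \<in> \<beta> \<rightarrow>\<^sub>E carrier K \<and> V.lincomb a \<beta> = v"
    using V.basis_criterion[OF \<beta>(1) \<beta>c] \<beta>(2) by blast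
  define cf where "cf v = (THE a. a \<in> \<beta> \<rightarrow>\<^sub>E carrier K \<and> V.lincomb a \<beta> = v)" for v
  have cf: "cf v \<in> \<beta> \<rightarrow>\<^sub>E carrier K" "V.lincomb (cf v) \<beta> = v" if "v \<in> carrier V" for v
    using theI'[OF uniq[OF that]] by (simp_all add: cf_def)
  \<comment> \<open>Any coefficients that represent \<open>v\<close> agree with \<open>cf v\<close>.
    Linearity of the coordinates follows by exhibiting the sum or multiple of coefficients as a
    representation.\<close>
  have cfE: "cf v x = a x" if "x \<in> \<beta>" "v \<in> carrier V" "a \<in> \<beta> \<rightarrow> carrier K" "V.lincomb a \<beta> = v" for v a x
  proof -
    have "V.lincomb (restrict a \<beta>) \<beta> = V.lincomb a \<beta>"
      by (rule V.lincomb_cong[OF refl \<beta>c _ that(3)]) simp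
    then have "restrict a \<beta> \<in> \<beta> \<rightarrow>\<^sub>E carrier K \<and> V.lincomb (restrict a \<beta>) \<beta> = v" using that by auto
    then have "cf v = restrict a \<beta>" using uniq[OF that(2)] cf[OF that(2)] by blast
    then show ?thesis using that(1) by simp
  qed
  have cfc: "cf v x \<in> carrier K" if "v \<in> carrier V" "x \<in> \<beta>" for v x using cf(1)[OF that(1)] that(2) by auto
  have cfP: "cf v \<in> \<beta> \<rightarrow> carrier K" if "v \<in> carrier V" for v using cf(1)[OF that] by auto
  \<comment> \<open>Padding by zero beyond the dimension makes the closure conditions hold for every
    index.\<close>
  define e where "e i = (if i < ?n then h i else \<zero>\<^bsub>V\<^esub>)" for i
  define co where "co i v = (if i < ?n then cf v (h i) else \<zero>\<^bsub>K\<^esub>)" for i v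
  have h\<beta>: "h i \<in> \<beta>" if "i < ?n" for i using h that by (auto simp: bij_betw_def)
  have "coords K V ?n e co"
  proof
    show "e i \<in> carrier V" for i using h\<beta> \<beta>c by (auto simp: e_def)
    show "co i \<in> module_hom K V (ground_algebra K)" for i
    proof (rule module_homI)
      show "co i v \<in> carrier (ground_algebra K)" if "v \<in> carrier V" for v
        using cfc[OF that h\<beta>] by (simp add: co_def ground_algebra_def)
      fix v w assume vw: "v \<in> carrier V" "w \<in> carrier V"
      have "cf (v \<oplus>\<^bsub>V\<^esub> w) x = cf v x \<oplus>\<^bsub>K\<^esub> cf w x" if "x \<in> \<beta>" for x
        by (rule cfE[OF that])
          (use vw cfc cf(2) V.lincomb_sum[OF \<beta>(1) \<beta>c cfP cfP] in auto)
      then show "co i (v \<oplus>\<^bsub>V\<^esub> w) = co i v \<oplus>\<^bsub>ground_algebra K\<^esub> co i w"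
        using h\<beta> by (simp add: co_def ground_algebra_def)
    next
      fix c v assume cv: "c \<in> carrier K" "v \<in> carrier V"
      have "cf (c \<odot>\<^bsub>V\<^esub> v) x = c \<otimes>\<^bsub>K\<^esub> cf v x" if "x \<in> \<beta>" for x
        by (rule cfE[OF that])
          (use cv cfc cf(2) V.lincomb_smult[OF \<beta>c cfP, of v c] in auto)
      then show "co i (c \<odot>\<^bsub>V\<^esub> v) = c \<odot>\<^bsub>ground_algebra K\<^esub> co i v"
        using h\<beta> cv by (simp add: co_def ground_algebra_def)
    qed
    fix v assume v: "v \<in> carrier V"
    have "v = (\<Oplus>\<^bsub>V\<^esub>x\<in>h ` {..<?n}. cf v x \<odot>\<^bsub>V\<^esub> x)"
      using cf(2)[OF v] h by (simp add: V.lincomb_def bij_betw_def)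
    also have "\<dots> = (\<Oplus>\<^bsub>V\<^esub>i\<in>{..<?n}. cf v (h i) \<odot>\<^bsub>V\<^esub> h i)"
      by (rule V.M.finsum_reindex)
        (use h cfc[OF v] \<beta>c in \<open>auto simp: bij_betw_def intro!: V.smult_closed\<close>)
    also have "\<dots> = (\<Oplus>\<^bsub>V\<^esub>i\<in>{..<?n}. co i v \<odot>\<^bsub>V\<^esub> e i)"
    proof (rule V.M.finsum_cong'[OF refl])
      show "(\<lambda>i. co i v \<odot>\<^bsub>V\<^esub> e i) \<in> {..<?n} \<rightarrow> carrier V"
        using cfc[OF v h\<beta>] h\<beta> \<beta>c by (auto simp: co_def e_def intro!: V.smult_closed)
    qed (simp add: co_def e_def)
    finally show "(\<Oplus>\<^bsub>V\<^esub>i\<in>{..<?n}. co i v \<odot>\<^bsub>V\<^esub> e i) = v" by simp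
  next
    fix i j assume ij: "i < ?n" "j < ?n"
    let ?a = "\<lambda>x. if x = h j then \<one>\<^bsub>K\<^esub> else \<zero>\<^bsub>K\<^esub>"
    have hj: "h j \<in> \<beta>" "h j \<in> carrier V" using h\<beta> ij \<beta>c by auto
    have "V.lincomb ?a \<beta> = (\<Oplus>\<^bsub>V\<^esub>x\<in>\<beta>. if h j = x then x else \<zero>\<^bsub>V\<^esub>)"
      unfolding V.lincomb_def
    proof (rule V.M.finsum_cong'[OF refl])
      fix x assume "x \<in> \<beta>"
      then have "x \<in> carrier V" using \<beta>c by blast
      then show "?a x \<odot>\<^bsub>V\<^esub> x = (if h j = x then x else \<zero>\<^bsub>V\<^esub>)" by simp
    qed (use \<beta>c in auto)
    also have "\<dots> = h j" by (rule V.M.finsum_singleton[OF hj(1) \<beta>(1)]) (use \<beta>c in auto)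
    finally have "V.lincomb ?a \<beta> = h j" .
    then have "cf (h j) (h i) = ?a (h i)" by (intro cfE h\<beta> hj ij) auto
    moreover have "h i = h j \<longleftrightarrow> i = j" using h ij by (auto simp: bij_betw_def inj_on_def)
    ultimately show "co i (e j) = (if i = j then \<one>\<^bsub>K\<^esub> else \<zero>\<^bsub>K\<^esub>)" using ij by (simp add: co_def e_def)
  qed
  then show ?thesis by blast
qed

section \<open>Antisymmetry and the Jacobi identity for rewriting\<close>

context lie_algebra begin

lemma br_anti:
  assumes "x \<in> carrier M" "y \<in> carrier M"
  shows "br y x = \<ominus>\<^bsub>M\<^esub> br x y"
proof -
  have "br (x \<oplus>\<^bsub>M\<^esub> y) (x \<oplus>\<^bsub>M\<^esub> y) = (br x x \<oplus>\<^bsub>M\<^esub> br y x) \<oplus>\<^bsub>M\<^esub> (br x y \<oplus>\<^bsub>M\<^esub> br y y)"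
    using assms bilinearD(4,5)[OF br_bilinear] by simp
  then have "br y x \<oplus>\<^bsub>M\<^esub> br x y = \<zero>\<^bsub>M\<^esub>" using assms by (simp add: br_alternating br_closed)
  then show ?thesis using assms M.add.inv_equality[of "br y x" "br x y"] by (simp add: br_closed)
qed

lemma br_neg_right: "x \<in> carrier M \<Longrightarrow> y \<in> carrier M \<Longrightarrow> br x (\<ominus>\<^bsub>M\<^esub> y) = \<ominus>\<^bsub>M\<^esub> br x y"
  by (rule hom_neg[OF bilinearD(1)[OF br_bilinear] vectorspace_axioms vectorspace_axioms])

text \<open>The form of the Jacobi identity in which the overlap ambiguity resolves.\<close>

lemma jacobi_overlap:
  assumes "x \<in> carrier M" "y \<in> carrier M" "z \<in> carrier M"
  shows "br (br z y) x \<oplus>\<^bsub>M\<^esub> br (br y x) z = br (br z x) y"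
proof -
  let ?a = "br x (br y z)" and ?b = "br y (br z x)" and ?c = "br z (br x y)"
  have c: "?a \<in> carrier M" "?b \<in> carrier M" "?c \<in> carrier M" using assms by (simp_all add: br_closed)
  have "?a \<oplus>\<^bsub>M\<^esub> ?b \<oplus>\<^bsub>M\<^esub> ?c = \<zero>\<^bsub>M\<^esub>" by (rule br_jacobi[OF assms])
  then have "(?a \<oplus>\<^bsub>M\<^esub> ?c) \<oplus>\<^bsub>M\<^esub> ?b = \<zero>\<^bsub>M\<^esub>" using c by (simp add: M.add.m_ac)
  then have "\<ominus>\<^bsub>M\<^esub> ?b = ?a \<oplus>\<^bsub>M\<^esub> ?c" using c by (intro M.add.inv_equality) auto
  moreover have "br (br z y) x = ?a"
    using br_anti[of x "br z y"] br_anti[of y z] br_neg_right[of x "br y z"] assms by (simp add: br_closed)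
  moreover have "br (br y x) z = ?c"
    using br_anti[of z "br y x"] br_anti[of x y] br_neg_right[of z "br x y"] assms by (simp add: br_closed)
  moreover have "br (br z x) y = \<ominus>\<^bsub>M\<^esub> ?b"
    using br_anti[of y "br z x"] assms by (simp add: br_closed)
  ultimately show ?thesis by simp
qed

end

section \<open>A Poincare-Birkhoff-Witt theorem in degree one\<close>

locale pbw = lie_algebra K M br + coords K M n e co for K M br n e co
begin

text \<open>The value of \<open>f\<close> at a word with a vector \<open>v\<close> in one position,
  obtained by expanding \<open>v\<close> in the basis. Bracket terms need this because a bracket of
  basis vectors is in general no single letter.\<close>

definition lsum :: "(nat list \<Rightarrow> 'c) \<Rightarrow> nat list \<Rightarrow> 'c \<Rightarrow> nat list \<Rightarrow> 'c" where
  "lsum f a v b = (\<Oplus>\<^bsub>M\<^esub>l\<in>{..<n}. co l v \<odot>\<^bsub>M\<^esub> f (a @ l # b))"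

definition descents :: "nat list \<Rightarrow> (nat list \<times> nat \<times> nat \<times> nat list) set" where
  "descents w = {(a, j, i, b). w = a @ j # i # b \<and> i < j}"

definition rewrite :: "(nat list \<Rightarrow> 'c) \<Rightarrow> nat list \<Rightarrow> nat \<Rightarrow> nat \<Rightarrow> nat list \<Rightarrow> 'c" where
  "rewrite f a j i b = f (a @ i # j # b) \<oplus>\<^bsub>M\<^esub> lsum f a (br (e j) (e i)) b"

text \<open>One unfolding of the recursion at an arbitrarily chosen descent. A word without descents
  is its own normal form, and its linear part is nonzero at most if the word is a single
  letter.\<close>

definition step :: "(nat list \<Rightarrow> 'c) \<Rightarrow> nat list \<Rightarrow> 'c" where
  "step f w = (if descents w = {} then if length w = 1 then e (hd w) else \<zero>\<^bsub>M\<^esub>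
     else case SOME x. x \<in> descents w of (a, j, i, b) \<Rightarrow> rewrite f a j i b)"

text \<open>The linear part of the normal form of a word in the basis letters, where a descent \<open>j i\<close> with
  \<open>i < j\<close> is rewritten as \<open>i j + [e\<^sub>j, e\<^sub>i]\<close>.\<close>

definition normal :: "nat list \<Rightarrow> 'c" where
  "normal = wfrec (lenlex less_than) step"

lemma lex_at: "x < y \<Longrightarrow> length c = length d \<Longrightarrow> (a @ x # c, a @ y # d) \<in> lex less_than"
  by (rule lex_append_leftI) simp

text \<open>Termination: \<open>lenlex\<close> compares lengths first, so removing a letter
  decreases the word, and exchanging a descent decreases it lexicographically.\<close>

lemma smaller:
  "i < j \<Longrightarrow> (a @ i # j # b, a @ j # i # b) \<in> lenlex less_than"
  "(a @ l # b, a @ j # i # b) \<in> lenlex less_than"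
  by (auto simp: lenlex_conv lex_at)

text \<open>\<open>step\<close> consults its argument only at smaller words, which is what the
  recursion equation of \<open>wfrec\<close> requires.\<close>

lemma step_cong:
  assumes "\<And>v. (v, w) \<in> lenlex less_than \<Longrightarrow> f v = g v" shows "step f w = step g w"
proof (cases "descents w = {}")
  case False
  obtain a j i b where s: "(SOME x. x \<in> descents w) = (a, j, i, b)" by (metis prod_cases4)
  then have "(a, j, i, b) \<in> descents w" using False by (metis some_in_eq)
  then have w: "w = a @ j # i # b" "i < j" by (auto simp: descents_def)
  have "f (a @ l # b) = g (a @ l # b)" for l using assms smaller(2) w by blast
  moreover have "f (a @ i # j # b) = g (a @ i # j # b)" using assms smaller(1) w by blast
  ultimately show ?thesis using False by (simp add: step_def s rewrite_def lsum_def)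
qed (simp add: step_def)

lemma normal_step: "normal w = step normal w"
proof -
  have "normal w = step (Wfrec.cut normal (lenlex less_than) w) w"
    by (rule def_wfrec[OF normal_def[THEN eq_reflection]]) (simp add: wf_lenlex)
  also have "\<dots> = step normal w" by (rule step_cong) (simp add: Wfrec.cut_def)
  finally show ?thesis .
qed

lemma wf_words: "wf (lenlex (less_than :: (nat \<times> nat) set))" by (simp add: wf_lenlex)

lemma e_br_closed: "br (e j) (e i) \<in> carrier M" by (simp add: br_closed e_closed)

lemma normal_cases:
  obtains "descents w = {}" "normal w = (if length w = 1 then e (hd w) else \<zero>\<^bsub>M\<^esub>)"
  | a j i b where "(a, j, i, b) \<in> descents w" "normal w = rewrite normal a j i b"
proof (cases "descents w = {}")
  case True then show ?thesis using that(1) normal_step[of w] by (simp add: step_def)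
next
  case False
  obtain a j i b where s: "(SOME x. x \<in> descents w) = (a, j, i, b)" by (metis prod_cases4)
  then have "(a, j, i, b) \<in> descents w" using False by (metis some_in_eq)
  moreover have "normal w = rewrite normal a j i b" using normal_step[of w] False by (simp add: step_def s)
  ultimately show ?thesis by (rule that(2))
qed

lemma normal_closed: "normal w \<in> carrier M"
proof (induct w rule: wf_induct_rule[OF wf_words])
  case (1 w)
  show ?case
  proof (cases rule: normal_cases[of w])
    case 1 then show ?thesis by (simp add: e_closed)
  next
    case (2 a j i b)
    then have w: "w = a @ j # i # b" "i < j" by (auto simp: descents_def)
    have "normal (a @ l # b) \<in> carrier M" for l using 1 smaller(2) w by blast
    moreover have "normal (a @ i # j # b) \<in> carrier M" using 1 smaller(1) w by blast
    ultimately show ?thesis using 2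
      by (auto simp: rewrite_def lsum_def co_closed e_br_closed intro!: M.add.m_closed M.finsum_closed)
  qed
qed

section \<open>Words with a vector in place of a letter\<close>

abbreviation "S \<equiv> lsum normal"

lemma S_hom: "(\<lambda>v. S a v b) \<in> module_hom K M M"
  unfolding lsum_def by (rule coords_hom[OF vectorspace_axioms normal_closed])

lemma S_closed: "v \<in> carrier M \<Longrightarrow> S a v b \<in> carrier M"
  by (rule hom_closed[OF S_hom])

lemma S_e: "l < n \<Longrightarrow> S a (e l) b = normal (a @ l # b)"
  unfolding lsum_def by (rule finsum_delta[OF vectorspace_axioms normal_closed])

lemma S_br_hom: "(\<lambda>u. S a (br u (e k)) b) \<in> module_hom K M M"
  by (rule hom_comp[OF bilinearD(2)[OF br_bilinear e_closed] S_hom])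

text \<open>The rule \<open>u k = k u + [u, k]\<close> for a vector \<open>u\<close>, by linearity
  from its instances at basis letters.\<close>

lemma S_swap_next:
  assumes R: "\<And>l. normal (a @ l # k # b) = rewrite normal a l k b" and u: "u \<in> carrier M"
  shows "S a u (k # b) = S (a @ [k]) u b \<oplus>\<^bsub>M\<^esub> S a (br u (e k)) b"
  by (rule hom_eq_coords[OF vectorspace_axioms S_hom hom_add_maps[OF vectorspace_axioms S_hom S_br_hom] _ u])
    (simp add: S_e R rewrite_def)

text \<open>A word with vectors \<open>u\<close> and \<open>v\<close> in two positions separated by
  \<open>c\<close> may be expanded in either vector first. This matches the bracket terms of two
  disjoint descents.\<close>

lemma S_S_commute:
  assumes u: "u \<in> carrier M" and v: "v \<in> carrier M"
  shows "(\<Oplus>\<^bsub>M\<^esub>s\<in>{..<n}. co s u \<odot>\<^bsub>M\<^esub> S (a @ s # c) v b) = (\<Oplus>\<^bsub>M\<^esub>t\<in>{..<n}. co t v \<odot>\<^bsub>M\<^esub> S a u (c @ t # b))"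
proof (rule hom_eq_coords[OF vectorspace_axioms coords_hom[OF vectorspace_axioms S_closed[OF v]] _ _ u])
  show "(\<lambda>u. \<Oplus>\<^bsub>M\<^esub>t\<in>{..<n}. co t v \<odot>\<^bsub>M\<^esub> S a u (c @ t # b)) \<in> module_hom K M M"
    by (intro hom_finsum_maps hom_smult_map vectorspace_axioms S_hom co_closed v) simp
  fix l assume l: "l < n"
  show "(\<Oplus>\<^bsub>M\<^esub>s\<in>{..<n}. co s (e l) \<odot>\<^bsub>M\<^esub> S (a @ s # c) v b) = (\<Oplus>\<^bsub>M\<^esub>t\<in>{..<n}. co t v \<odot>\<^bsub>M\<^esub> S a (e l) (c @ t # b))"
    using l finsum_delta[OF vectorspace_axioms S_closed[OF v] l] by (simp add: S_e) (simp add: lsum_def)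
qed

text \<open>Exchanging two letters to the right of a vector produces a term with vectors in two
  positions. \<open>S_rewrite_left\<close> is the mirror image, with the other order of
  expansion.\<close>

lemma S_rewrite_right:
  assumes R: "\<And>s. normal (a @ s # c @ l # m # b) = rewrite normal (a @ s # c) l m b" and u: "u \<in> carrier M"
  shows "S a u (c @ l # m # b) = S a u (c @ m # l # b) \<oplus>\<^bsub>M\<^esub> (\<Oplus>\<^bsub>M\<^esub>s\<in>{..<n}. co s u \<odot>\<^bsub>M\<^esub> S (a @ s # c) (br (e l) (e m)) b)"
  by (rule hom_eq_coords[OF vectorspace_axioms S_hom hom_add_maps[OF vectorspace_axioms S_hom
        coords_hom[OF vectorspace_axioms S_closed[OF e_br_closed]]] _ u])
    (simp add: S_e R rewrite_def finsum_delta[OF vectorspace_axioms S_closed[OF e_br_closed]])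

lemma S_rewrite_left:
  assumes R: "\<And>t. normal (a @ j # i # c @ t # b) = rewrite normal a j i (c @ t # b)" and v: "v \<in> carrier M"
  shows "S (a @ j # i # c) v b = S (a @ i # j # c) v b \<oplus>\<^bsub>M\<^esub> (\<Oplus>\<^bsub>M\<^esub>t\<in>{..<n}. co t v \<odot>\<^bsub>M\<^esub> S a (br (e j) (e i)) (c @ t # b))"
  by (rule hom_eq_coords[OF vectorspace_axioms S_hom hom_add_maps[OF vectorspace_axioms S_hom
        coords_hom[OF vectorspace_axioms S_closed[OF e_br_closed]]] _ v])
    (simp add: S_e R rewrite_def finsum_delta[OF vectorspace_axioms S_closed[OF e_br_closed]])

text \<open>The rule for descents gives the exchange equation for any two letters: for equal letters
  the bracket vanishes, and an ascent uses the reversed descent together with antisymmetry.\<close>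

lemma rewrite_symmetric:
  assumes "i < j \<Longrightarrow> normal (a @ j # i # b) = rewrite normal a j i b"
    and "j < i \<Longrightarrow> normal (a @ i # j # b) = rewrite normal a i j b"
  shows "normal (a @ j # i # b) = rewrite normal a j i b"
proof (cases i j rule: linorder_cases)
  case equal
  have "S a (br (e j) (e j)) b = \<zero>\<^bsub>M\<^esub>"
    using hom_zero[OF S_hom vectorspace_axioms vectorspace_axioms] by (simp add: br_alternating e_closed)
  then show ?thesis using equal by (simp add: rewrite_def normal_closed)
next
  case greater
  have "S a (br (e j) (e i)) b = \<ominus>\<^bsub>M\<^esub> S a (br (e i) (e j)) b"
    using hom_neg[OF S_hom vectorspace_axioms vectorspace_axioms e_br_closed] br_anti[OF e_closed e_closed, of i j]
    by (simp add: S_closed e_br_closed)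
  then show ?thesis using assms(2)[OF greater]
    by (simp add: rewrite_def normal_closed S_closed e_br_closed M.add.m_assoc M.r_neg)
qed (use assms(1) in simp)

text \<open>Bergman's diamond lemma: the overlapping case \<open>k l i'\<close> is the Jacobi identity, disjoint descents commute.\<close>

lemma ambiguity:
  assumes IH: "\<And>v a j i b. (v, w) \<in> lenlex less_than \<Longrightarrow> (a, j, i, b) \<in> descents v \<Longrightarrow> normal v = rewrite normal a j i b"
    and p: "(a, j, i, b) \<in> descents w" and q: "(a', j', i', b') \<in> descents w" and le: "length a \<le> length a'"
  shows "rewrite normal a j i b = rewrite normal a' j' i' b'"
proof -
  have w: "w = a @ j # i # b" "i < j" and w': "w = a' @ j' # i' # b'" "i' < j'"
    using p q by (auto simp: descents_def)
  \<comment> \<open>In words shorter than \<open>w\<close> any two adjacent letters may be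
    exchanged, whatever their order.\<close>
  have R: "normal (a @ j # i # b) = rewrite normal a j i b" if "Suc (Suc (length a + length b)) < length w" for a j i b
    by (rule rewrite_symmetric; rule IH) (use that in \<open>auto simp: lenlex_conv descents_def\<close>)
  \<comment> \<open>This also covers words of the same length as \<open>w\<close>, but only for
    descents and only below \<open>w\<close> in the order.\<close>
  have R': "normal (a @ j # i # b) = rewrite normal a j i b" if "i < j" "(a @ j # i # b, w) \<in> lenlex less_than" for a j i b
    by (rule IH[OF that(2)]) (use that(1) in \<open>simp add: descents_def\<close>)
  obtain c where c: "a' = a @ c" "j # i # b = c @ j' # i' # b'"
    using w(1) w'(1) le by (auto simp: append_eq_append_conv2)
  note cl = normal_closed S_closed e_br_closed e_closed br_closed
  \<comment> \<open>The second descent starts \<open>length c\<close> letters after the first: at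
    the same place, one letter later (overlap), or clear of it.\<close>
  consider "c = []" | "c = [j]" "i = j'" "b = i' # b'" | c' where "c = j # i # c'" "b = c' @ j' # i' # b'"
    using c(2) by (cases c; cases "tl c") auto
  then show ?thesis
  proof cases
    case 1 then show ?thesis using c by simp
  next
    case 2
    define k where "k = j"
    define l where "l = i"
    have k: "j = k" "i = l" "j' = l" "a' = a @ [k]" using 2 c by (simp_all add: k_def l_def)
    have lt: "i' < l" "l < k" using w(2) w'(2) k by auto
    have wk: "w = a @ k # l # i' # b'" using w'(1) k by simp
    \<comment> \<open>Both reductions of \<open>k l i'\<close> end in \<open>i' l k\<close>:
      \<open>d1\<close> and \<open>d2\<close> pass through \<open>l k i'\<close> and
      \<open>l i' k\<close>, while \<open>d3\<close> and \<open>d4\<close> pass through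
      \<open>k i' l\<close> and \<open>i' k l\<close>.\<close>
    have d1: "normal (a @ l # k # i' # b') = normal (a @ l # i' # k # b') \<oplus>\<^bsub>M\<^esub> S (a @ [l]) (br (e k) (e i')) b'"
      using R'[of i' k "a @ [l]" b'] lt unfolding rewrite_def wk by (auto simp: lenlex_conv lex_at)
    have d2: "normal (a @ l # i' # k # b') = normal (a @ i' # l # k # b') \<oplus>\<^bsub>M\<^esub> S a (br (e l) (e i')) (k # b')"
      using R'[of i' l a "k # b'"] lt unfolding rewrite_def wk by (auto simp: lenlex_conv lex_at)
    have d3: "normal (a @ k # i' # l # b') = normal (a @ i' # k # l # b') \<oplus>\<^bsub>M\<^esub> S a (br (e k) (e i')) (l # b')"
      using R'[of i' k a "l # b'"] lt lex_at[of i' l "l # b'" "i' # b'" "a @ [k]"]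
      unfolding rewrite_def wk by (auto simp: lenlex_conv)
    have d4: "normal (a @ i' # k # l # b') = normal (a @ i' # l # k # b') \<oplus>\<^bsub>M\<^esub> S (a @ [i']) (br (e k) (e l)) b'"
      using R'[of l k "a @ [i']" b'] lt unfolding rewrite_def wk by (auto simp: lenlex_conv lex_at)
    \<comment> \<open>A bracket has replaced two of the three letters, so the words here are shorter
      than \<open>w\<close> and \<open>R\<close> applies. Moving the bracket past the remaining
      letter creates a double bracket.\<close>
    have s: "S a (br (e x) (e y)) (z # b') = S (a @ [z]) (br (e x) (e y)) b' \<oplus>\<^bsub>M\<^esub> S a (br (br (e x) (e y)) (e z)) b'" for x y z
      by (rule S_swap_next[OF R e_br_closed]) (simp add: wk)
    \<comment> \<open>One reduction leaves the single double bracket on the left, the other the two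
      on the right.\<close>
    have J: "S a (br (br (e k) (e i')) (e l)) b' = S a (br (br (e k) (e l)) (e i')) b' \<oplus>\<^bsub>M\<^esub> S a (br (br (e l) (e i')) (e k)) b'"
      using hom_add[OF S_hom, of "br (br (e k) (e l)) (e i')" "br (br (e l) (e i')) (e k)"] jacobi_overlap[of "e i'" "e l" "e k"]
      by (simp add: cl)
    have "rewrite normal a j i b = normal (a @ i' # l # k # b')
        \<oplus>\<^bsub>M\<^esub> (S (a @ [k]) (br (e l) (e i')) b' \<oplus>\<^bsub>M\<^esub> S a (br (br (e l) (e i')) (e k)) b')
        \<oplus>\<^bsub>M\<^esub> S (a @ [l]) (br (e k) (e i')) b'
        \<oplus>\<^bsub>M\<^esub> (S (a @ [i']) (br (e k) (e l)) b' \<oplus>\<^bsub>M\<^esub> S a (br (br (e k) (e l)) (e i')) b')"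
      unfolding rewrite_def 2(3) k d1 d2 s ..
    also have "\<dots> = normal (a @ i' # l # k # b') \<oplus>\<^bsub>M\<^esub> S (a @ [i']) (br (e k) (e l)) b'
        \<oplus>\<^bsub>M\<^esub> (S (a @ [l]) (br (e k) (e i')) b' \<oplus>\<^bsub>M\<^esub> S a (br (br (e k) (e i')) (e l)) b')
        \<oplus>\<^bsub>M\<^esub> S (a @ [k]) (br (e l) (e i')) b'"
      unfolding J by (simp add: cl M.add.m_ac)
    also have "\<dots> = rewrite normal a' j' i' b'"
      using d3 d4 s[of k i' l] unfolding rewrite_def k by simp
    finally show ?thesis .
  next
    case (3 c')
    have wk: "w = a @ j # i # c' @ j' # i' # b'" using w 3 by simp
    have a': "a' = a @ j # i # c'" using c 3 by simp
    note lt = w(2) w'(2)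
    let ?u = "br (e j) (e i)" and ?v = "br (e j') (e i')"
    have d1: "normal (a @ i # j # c' @ j' # i' # b') = normal (a @ i # j # c' @ i' # j' # b') \<oplus>\<^bsub>M\<^esub> S (a @ i # j # c') ?v b'"
      using R'[of i' j' "a @ i # j # c'" b'] lt unfolding rewrite_def wk by (auto simp: lenlex_conv lex_at)
    have d2: "normal (a @ j # i # c' @ i' # j' # b') = normal (a @ i # j # c' @ i' # j' # b') \<oplus>\<^bsub>M\<^esub> S a ?u (c' @ i' # j' # b')"
      using R'[of i j a "c' @ i' # j' # b'"] lt lex_at[of i' j' "j' # b'" "i' # b'" "a @ j # i # c'"]
      unfolding rewrite_def wk by (auto simp: lenlex_conv)
    \<comment> \<open>The term in which both descents have become brackets; it occurs in both
      reductions.\<close>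
    let ?D = "\<Oplus>\<^bsub>M\<^esub>s\<in>{..<n}. co s ?u \<odot>\<^bsub>M\<^esub> S (a @ s # c') ?v b'"
    have D: "?D \<in> carrier M" by (intro M.finsum_closed) (simp add: co_closed cl)
    have s1: "S a ?u (c' @ j' # i' # b') = S a ?u (c' @ i' # j' # b') \<oplus>\<^bsub>M\<^esub> ?D"
      by (rule S_rewrite_right[OF _ e_br_closed]) (use R[of "a @ _ # c'" b'] in \<open>simp add: wk\<close>)
    have s2: "S (a @ j # i # c') ?v b' = S (a @ i # j # c') ?v b' \<oplus>\<^bsub>M\<^esub> ?D"
      unfolding S_S_commute[OF e_br_closed e_br_closed]
      by (rule S_rewrite_left[OF R e_br_closed]) (simp add: wk)
    have "rewrite normal a j i b = (normal (a @ i # j # c' @ i' # j' # b') \<oplus>\<^bsub>M\<^esub> S (a @ i # j # c') ?v b')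
        \<oplus>\<^bsub>M\<^esub> (S a ?u (c' @ i' # j' # b') \<oplus>\<^bsub>M\<^esub> ?D)"
      unfolding rewrite_def 3(2) d1 s1 ..
    also have "\<dots> = (normal (a @ i # j # c' @ i' # j' # b') \<oplus>\<^bsub>M\<^esub> S a ?u (c' @ i' # j' # b'))
        \<oplus>\<^bsub>M\<^esub> (S (a @ i # j # c') ?v b' \<oplus>\<^bsub>M\<^esub> ?D)"
      using D by (simp add: cl M.add.m_ac)
    also have "\<dots> = rewrite normal a' j' i' b'"
      unfolding rewrite_def a' using d2 s2 by simp
    finally show ?thesis .
  qed
qed

text \<open>\<open>normal\<close> is defined through a chosen descent. By \<open>ambiguity\<close>,
  applied in the order in which the two descents occur in the word, every other descent gives the
  same value.\<close>

lemma normal_descent: "(a, j, i, b) \<in> descents w \<Longrightarrow> normal w = rewrite normal a j i b"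
proof (induct w arbitrary: a j i b rule: wf_induct_rule[OF wf_words])
  case (1 w)
  show ?case
  proof (cases rule: normal_cases[of w])
    case 1 then show ?thesis using \<open>(a, j, i, b) \<in> descents w\<close> by simp
  next
    case (2 a' j' i' b')
    then show ?thesis
      using ambiguity[OF 1(1) 1(2) 2(1)] ambiguity[OF 1(1) 2(1) 1(2)] by (metis nat_le_linear)
  qed
qed

lemma normal_rewrite: "normal (a @ j # i # b) = rewrite normal a j i b"
  by (rule rewrite_symmetric; rule normal_descent) (auto simp: descents_def)

lemma normal_letter: "normal [i] = e i"
  by (cases rule: normal_cases[of "[i]"]) (auto simp: descents_def)

section \<open>An algebra containing the Lie algebra\<close>

sublocale FN: monoid_alg K "\<lparr>carrier = UNIV :: nat list set, monoid.mult = (@), one = []\<rparr>"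
  by (intro monoid_alg.intro free_vectorspace.intro field_axioms) (unfold_locales, auto)

sublocale FNA: assoc_alg K FN.F by (rule FN.F_assoc_alg)

lemma single_FN: "single K w \<in> carrier FN.F"
  by (rule FN.single_closed) simp

lemma single_FN_mult: "single K v \<otimes>\<^bsub>FN.F\<^esub> single K w = single K (v @ w)"
  using FN.single_mult[of v w] by simp

text \<open>The functionals \<open>context_value a b\<close> jointly cut out a two-sided ideal; the quotient by it is
  an algebra containing \<open>\<mm>\<close> as a Lie subalgebra.\<close>

definition context_value :: "nat list \<Rightarrow> nat list \<Rightarrow> (nat list \<Rightarrow> 'a) \<Rightarrow> 'c" where
  "context_value a b \<psi> = linear_extension K M normal (single K a \<otimes>\<^bsub>FN.F\<^esub> \<psi> \<otimes>\<^bsub>FN.F\<^esub> single K b)"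

definition kernel_ideal :: "(nat list \<Rightarrow> 'a) set" where
  "kernel_ideal = {\<psi> \<in> carrier FN.F. \<forall>a b. context_value a b \<psi> = \<zero>\<^bsub>M\<^esub>}"

lemma LN_hom: "linear_extension K M normal \<in> module_hom K FN.F M"
  by (rule FN.LE_hom[OF vectorspace_axioms normal_closed])

lemma LN_single: "linear_extension K M normal (single K w) = normal w"
  by (rule FN.LE_single[OF vectorspace_axioms]) (rule normal_closed)

lemma context_hom: "context_value a b \<in> module_hom K FN.F M"
  unfolding context_value_def
  by (rule hom_comp[OF hom_comp[OF FNA.mult_hom_right[OF single_FN] FNA.mult_hom_left[OF single_FN]] LN_hom])

lemma context_single: "context_value a b (single K w) = normal (a @ w @ b)"
  by (simp add: context_value_def single_FN_mult LN_single)

lemma context_value_Nil: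
  assumes "\<psi> \<in> carrier FN.F" shows "context_value [] [] \<psi> = linear_extension K M normal \<psi>"
proof -
  have "single K [] = \<one>\<^bsub>FN.F\<^esub>" by (simp add: FN.F_simps)
  then show ?thesis using assms by (simp add: context_value_def)
qed

text \<open>A word multiplied from the left is absorbed into the left context, and all contexts
  vanish on \<open>kernel_ideal\<close>; general multipliers follow by linearity.\<close>

lemma context_mult_left:
  assumes "\<psi> \<in> kernel_ideal" "\<phi> \<in> carrier FN.F"
  shows "context_value a b (\<phi> \<otimes>\<^bsub>FN.F\<^esub> \<psi>) = \<zero>\<^bsub>M\<^esub>"
proof (rule FN.F_hom_eq[OF vectorspace_axioms hom_comp[OF FNA.mult_hom_left context_hom] hom_zero_map[OF vectorspace_axioms] _ assms(2)])
  show \<psi>: "\<psi> \<in> carrier FN.F" using assms(1) by (simp add: kernel_ideal_def)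
  fix c
  have "single K a \<otimes>\<^bsub>FN.F\<^esub> (single K c \<otimes>\<^bsub>FN.F\<^esub> \<psi>) = single K (a @ c) \<otimes>\<^bsub>FN.F\<^esub> \<psi>"
    using \<psi> single_FN by (simp add: FNA.A.m_assoc[symmetric] single_FN_mult)
  then have "context_value a b (single K c \<otimes>\<^bsub>FN.F\<^esub> \<psi>) = context_value (a @ c) b \<psi>"
    by (simp add: context_value_def)
  then show "context_value a b (single K c \<otimes>\<^bsub>FN.F\<^esub> \<psi>) = \<zero>\<^bsub>M\<^esub>" using assms(1) by (simp add: kernel_ideal_def)
qed

lemma context_mult_right:
  assumes "\<psi> \<in> kernel_ideal" "\<phi> \<in> carrier FN.F"
  shows "context_value a b (\<psi> \<otimes>\<^bsub>FN.F\<^esub> \<phi>) = \<zero>\<^bsub>M\<^esub>"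
proof (rule FN.F_hom_eq[OF vectorspace_axioms hom_comp[OF FNA.mult_hom_right context_hom] hom_zero_map[OF vectorspace_axioms] _ assms(2)])
  show \<psi>: "\<psi> \<in> carrier FN.F" using assms(1) by (simp add: kernel_ideal_def)
  fix c
  have "single K a \<otimes>\<^bsub>FN.F\<^esub> (\<psi> \<otimes>\<^bsub>FN.F\<^esub> single K c) \<otimes>\<^bsub>FN.F\<^esub> single K b = single K a \<otimes>\<^bsub>FN.F\<^esub> \<psi> \<otimes>\<^bsub>FN.F\<^esub> single K (c @ b)"
    using \<psi> single_FN by (simp add: FNA.A.m_assoc single_FN_mult)
  then have "context_value a b (\<psi> \<otimes>\<^bsub>FN.F\<^esub> single K c) = context_value a (c @ b) \<psi>"
    by (simp add: context_value_def)
  then show "context_value a b (\<psi> \<otimes>\<^bsub>FN.F\<^esub> single K c) = \<zero>\<^bsub>M\<^esub>" using assms(1) by (simp add: kernel_ideal_def)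
qed

lemma kernel_ideal_ideal: "ideal kernel_ideal FN.F"
proof (rule idealI[OF FNA.A.ring_axioms])
  note vs = FN.F_vectorspace vectorspace_axioms
  show "subgroup kernel_ideal (add_monoid FN.F)"
    by (rule subgroup.intro)
      (auto simp: kernel_ideal_def hom_add[OF context_hom] hom_zero[OF context_hom vs] hom_neg[OF context_hom vs] a_inv_def[symmetric])
  fix a x assume ax: "a \<in> kernel_ideal" "x \<in> carrier FN.F"
  have a: "a \<in> carrier FN.F" using ax by (simp add: kernel_ideal_def)
  show "x \<otimes>\<^bsub>FN.F\<^esub> a \<in> kernel_ideal"
    using context_mult_left[OF ax] a ax(2) by (simp add: kernel_ideal_def)
  show "a \<otimes>\<^bsub>FN.F\<^esub> x \<in> kernel_ideal"
    using context_mult_right[OF ax] a ax(2) by (simp add: kernel_ideal_def)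
qed

sublocale NQ: quotient_alg K FN.F kernel_ideal
  by (intro quotient_alg.intro quotient_alg_axioms.intro FN.F_assoc_alg kernel_ideal_ideal)

lemma NQ_eqI:
  assumes "\<phi> \<in> carrier FN.F" "\<psi> \<in> carrier FN.F" "\<And>a b. context_value a b \<phi> = context_value a b \<psi>"
  shows "NQ.pr \<phi> = NQ.pr \<psi>"
proof -
  have "context_value a b (\<phi> \<ominus>\<^bsub>FN.F\<^esub> \<psi>) = \<zero>\<^bsub>M\<^esub>" for a b
  proof -
    have "context_value a b \<phi> \<ominus>\<^bsub>M\<^esub> context_value a b \<psi> = \<zero>\<^bsub>M\<^esub>"
      by (rule minus_eq_zero_iff[THEN iffD2, OF vectorspace_axioms hom_closed[OF context_hom assms(1)]
          hom_closed[OF context_hom assms(2)] assms(3)])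
    then show ?thesis by (simp only: hom_minus[OF context_hom FN.F_vectorspace vectorspace_axioms assms(1,2)])
  qed
  then have "\<phi> \<ominus>\<^bsub>FN.F\<^esub> \<psi> \<in> kernel_ideal"
    unfolding kernel_ideal_def using FN.F.M.minus_closed[OF assms(1,2)] by blast
  then show ?thesis by (rule NQ.pr_eq_iff[THEN iffD2, OF assms(1,2)])
qed

sublocale NQA: assoc_alg K NQ.Q by (rule NQ.Q_assoc_alg)

text \<open>The linear embedding that sends \<open>e l\<close> to the class of the letter
  \<open>l\<close> for \<open>l < n\<close>.\<close>

definition rep :: "'c \<Rightarrow> (nat list \<Rightarrow> 'a) set" where
  "rep v = (\<Oplus>\<^bsub>NQ.Q\<^esub>l\<in>{..<n}. co l v \<odot>\<^bsub>NQ.Q\<^esub> NQ.pr (single K [l]))"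

lemma pr_letter: "NQ.pr (single K w) \<in> carrier NQ.Q" by (rule NQ.pr_closed[OF single_FN])

lemma rep_hom: "rep \<in> module_hom K M NQ.Q"
  unfolding rep_def by (rule coords_hom[OF NQ.Q_vectorspace pr_letter])

lemma rep_e: "l < n \<Longrightarrow> rep (e l) = NQ.pr (single K [l])"
  unfolding rep_def by (rule finsum_delta[OF NQ.Q_vectorspace pr_letter])

text \<open>Elements of the quotient are equal once all contexts agree on representatives, and in
  the context \<open>a\<close>, \<open>b\<close> this equation is
  \<open>normal_rewrite\<close>.\<close>

lemma rep_letters:
  "NQ.pr (single K [l]) \<otimes>\<^bsub>NQ.Q\<^esub> NQ.pr (single K [m]) \<ominus>\<^bsub>NQ.Q\<^esub> NQ.pr (single K [m]) \<otimes>\<^bsub>NQ.Q\<^esub> NQ.pr (single K [l])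
    = rep (br (e l) (e m))"
proof -
  let ?w = "br (e l) (e m)"
  let ?x = "single K [l, m] \<ominus>\<^bsub>FN.F\<^esub> single K [m, l]"
  let ?y = "\<Oplus>\<^bsub>FN.F\<^esub>s\<in>{..<n}. co s ?w \<odot>\<^bsub>FN.F\<^esub> single K [s]"
  have sc: "co s ?w \<odot>\<^bsub>FN.F\<^esub> single K [s] \<in> carrier FN.F" for s
    by (rule FN.F.smult_closed[OF co_closed[OF e_br_closed] single_FN])
  have x: "?x \<in> carrier FN.F" by (rule FN.F.M.minus_closed[OF single_FN single_FN])
  have y: "?y \<in> carrier FN.F" using sc by (intro FN.F.M.finsum_closed) simp
  have "NQ.pr ?x = NQ.pr ?y"
  proof (rule NQ_eqI[OF x y])
    fix a b
    have "context_value a b ?x = normal (a @ l # m # b) \<ominus>\<^bsub>M\<^esub> normal (a @ m # l # b)"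
      using hom_minus[OF context_hom FN.F_vectorspace vectorspace_axioms single_FN single_FN] by (simp add: context_single)
    also have "\<dots> = S a ?w b"
    proof -
      have "normal (a @ l # m # b) = S a ?w b \<oplus>\<^bsub>M\<^esub> normal (a @ m # l # b)"
        unfolding normal_rewrite[of a l m b] rewrite_def
        by (rule M.add.m_comm[OF normal_closed S_closed[OF e_br_closed]])
      then show ?thesis
        using normal_closed S_closed[OF e_br_closed] by (simp add: a_minus_def M.add.m_assoc M.r_neg)
    qed
    also have "\<dots> = (\<Oplus>\<^bsub>M\<^esub>s\<in>{..<n}. context_value a b (co s ?w \<odot>\<^bsub>FN.F\<^esub> single K [s]))"
      unfolding lsum_def by (simp only: hom_smult[OF context_hom co_closed[OF e_br_closed] single_FN] context_single append.simps)
    also have "\<dots> = context_value a b ?y"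
      using sc by (intro hom_finsum[OF context_hom FN.F_vectorspace vectorspace_axioms, symmetric]) simp_all
    finally show "context_value a b ?x = context_value a b ?y" .
  qed
  moreover have "NQ.pr ?y = rep ?w"
  proof -
    have "NQ.pr ?y = (\<Oplus>\<^bsub>NQ.Q\<^esub>s\<in>{..<n}. NQ.pr (co s ?w \<odot>\<^bsub>FN.F\<^esub> single K [s]))"
      using sc by (intro hom_finsum[OF NQ.pr_hom FN.F_vectorspace NQ.Q_vectorspace]) simp_all
    then show ?thesis
      by (simp only: rep_def NQ.pr_smult[OF co_closed[OF e_br_closed] single_FN])
  qed
  moreover have "NQ.pr ?x = NQ.pr (single K [l, m]) \<ominus>\<^bsub>NQ.Q\<^esub> NQ.pr (single K [m, l])"
    by (rule hom_minus[OF NQ.pr_hom FN.F_vectorspace NQ.Q_vectorspace single_FN single_FN])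
  moreover have "NQ.pr (single K [x, y]) = NQ.pr (single K [x]) \<otimes>\<^bsub>NQ.Q\<^esub> NQ.pr (single K [y])" for x y
    by (simp only: NQ.pr_mult[OF single_FN single_FN] single_FN_mult append.simps)
  ultimately show ?thesis by (simp only:)
qed

lemma rep_bracket:
  assumes u: "u \<in> carrier M" and v: "v \<in> carrier M"
  shows "rep u \<otimes>\<^bsub>NQ.Q\<^esub> rep v \<ominus>\<^bsub>NQ.Q\<^esub> rep v \<otimes>\<^bsub>NQ.Q\<^esub> rep u = rep (br u v)"
proof -
  note Q = NQ.Q_vectorspace
  note rc = hom_closed[OF rep_hom]
  have h: "(\<lambda>u. rep u \<otimes>\<^bsub>NQ.Q\<^esub> q \<ominus>\<^bsub>NQ.Q\<^esub> q \<otimes>\<^bsub>NQ.Q\<^esub> rep u) \<in> module_hom K M NQ.Q"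
    "(\<lambda>v. q \<otimes>\<^bsub>NQ.Q\<^esub> rep v \<ominus>\<^bsub>NQ.Q\<^esub> rep v \<otimes>\<^bsub>NQ.Q\<^esub> q) \<in> module_hom K M NQ.Q" if "q \<in> carrier NQ.Q" for q
    by (intro hom_minus_maps[OF Q] hom_comp[OF rep_hom NQA.mult_hom_left[OF that]] hom_comp[OF rep_hom NQA.mult_hom_right[OF that]])+
  have 1: "rep (e l) \<otimes>\<^bsub>NQ.Q\<^esub> rep v \<ominus>\<^bsub>NQ.Q\<^esub> rep v \<otimes>\<^bsub>NQ.Q\<^esub> rep (e l) = rep (br (e l) v)" if l: "l < n" for l
    by (rule hom_eq_coords[OF Q h(2)[OF rc[OF e_closed]] hom_comp[OF bilinearD(1)[OF br_bilinear e_closed] rep_hom] _ v])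
      (simp only: rep_e l rep_letters)
  show ?thesis
    by (rule hom_eq_coords[OF Q h(1)[OF rc[OF v]] hom_comp[OF bilinearD(2)[OF br_bilinear v] rep_hom] _ u])
      (rule 1)
qed

text \<open>The empty context descends to the quotient and is a left inverse of \<open>rep\<close>,
  since a single letter is already in normal form.\<close>

lemma LN_rep:
  assumes v: "v \<in> carrier M" shows "the_elem (linear_extension K M normal ` rep v) = v"
proof -
  have van: "linear_extension K M normal \<psi> = \<zero>\<^bsub>M\<^esub>" if "\<psi> \<in> kernel_ideal" for \<psi>
  proof -
    have "\<psi> \<in> carrier FN.F" "context_value [] [] \<psi> = \<zero>\<^bsub>M\<^esub>" using that unfolding kernel_ideal_def by blast+
    then show ?thesis using context_value_Nil by metis
  qed
  have h: "(\<lambda>X. the_elem (linear_extension K M normal ` X)) \<in> module_hom K NQ.Q M"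
    by (rule NQ.the_elem_hom[OF LN_hom vectorspace_axioms van])
  have hs: "the_elem (linear_extension K M normal ` NQ.pr (single K w)) = normal w" for w
    by (rule trans[OF NQ.the_elem_pr[OF LN_hom vectorspace_axioms van single_FN] LN_single])
  show ?thesis
    by (rule hom_eq_coords[OF vectorspace_axioms hom_comp[OF rep_hom h] hom_id(1) _ v])
      (simp only: rep_e hs normal_letter)
qed

text \<open>\<open>rep\<close> respects brackets, so it extends to \<open>U\<close> and factors
  through \<open>\<iota>\<close>. Since \<open>rep\<close> has a left inverse, so does
  \<open>\<iota>\<close>.\<close>

theorem \<iota>_inj: "inj_on \<iota> (carrier M)"
proof (rule inj_onI)
  have E: "env_extend K NQ.Q rep (\<iota> x) = rep x" if "x \<in> carrier M" for x
    by (rule env_extend(2)[OF NQ.Q_assoc_alg rep_hom _ that]) (rule rep_bracket)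
  fix x y assume xy: "x \<in> carrier M" "y \<in> carrier M" "\<iota> x = \<iota> y"
  have "rep x = rep y" using E[OF xy(1)] unfolding xy(3) E[OF xy(2)] by (rule sym)
  then show "x = y" using LN_rep[OF xy(1)] unfolding LN_rep[OF xy(2)] by (metis LN_rep[OF xy(2)])
qed

end

section \<open>The coproduct\<close>

text \<open>In terms of \<open>ad x = [x, _]\<close>, this is
  \<open>[ad x, ad y] = ad [x, y]\<close> evaluated at \<open>h\<close>.\<close>

lemma (in ring) commutator_commutator:
  assumes "x \<in> carrier R" "y \<in> carrier R" "h \<in> carrier R"
  shows "(x \<otimes> (y \<otimes> h \<ominus> h \<otimes> y) \<ominus> (y \<otimes> h \<ominus> h \<otimes> y) \<otimes> x) \<ominus> (y \<otimes> (x \<otimes> h \<ominus> h \<otimes> x) \<ominus> (x \<otimes> h \<ominus> h \<otimes> x) \<otimes> y)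
    = (x \<otimes> y \<ominus> y \<otimes> x) \<otimes> h \<ominus> h \<otimes> (x \<otimes> y \<ominus> y \<otimes> x)"
  using assms by algebra

text \<open>The cancellation common to brackets of primitive elements and of the matrices
  \<open>gen\<close>: the mixed terms \<open>b\<close> and \<open>c\<close> occur in both products,
  in opposite places.\<close>

lemma (in ring) minus_four:
  assumes "a \<in> carrier R" "b \<in> carrier R" "c \<in> carrier R" "d \<in> carrier R" "a' \<in> carrier R" "d' \<in> carrier R"
  shows "((a \<oplus> b) \<oplus> (c \<oplus> d)) \<ominus> ((a' \<oplus> c) \<oplus> (b \<oplus> d')) = (a \<ominus> a') \<oplus> (d \<ominus> d')"
  using assms by algebra

lemma (in ring) commutator_leibniz:
  assumes "x \<in> carrier R" "y \<in> carrier R" "p \<in> carrier R" "q \<in> carrier R"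
  shows "(p \<otimes> y \<oplus> x \<otimes> q) \<ominus> (q \<otimes> x \<oplus> y \<otimes> p) = (x \<otimes> q \<ominus> q \<otimes> x) \<ominus> (y \<otimes> p \<ominus> p \<otimes> y)"
  using assms by algebra

lemma (in ring) minus_cancel_left:
  assumes "a \<in> carrier R" "b \<in> carrier R" "b' \<in> carrier R"
  shows "(a \<oplus> b) \<ominus> (a \<oplus> b') = b \<ominus> b'"
  using assms by algebra

context lie_algebra begin

abbreviation "UU \<equiv> tensor K U U"
abbreviation "\<Delta> \<equiv> env_coproduct K M br"

definition primitive :: "'c \<Rightarrow> (('a, 'c) env \<times> ('a, 'c) env \<Rightarrow> 'a) set" where
  "primitive x = tens K U U (\<iota> x) \<one>\<^bsub>U\<^esub> \<oplus>\<^bsub>UU\<^esub> tens K U U \<one>\<^bsub>U\<^esub> (\<iota> x)"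

lemma UU_assoc_alg: "assoc_alg K UU"
  by (rule tensor_assoc_alg[OF U_assoc_alg U_assoc_alg])

sublocale UU: assoc_alg K UU by (rule UU_assoc_alg)

lemmas UU_bilinear = tens_bilinear[OF U.vectorspace_axioms U.vectorspace_axioms]
lemmas UU_closed = bilinearD(3)[OF UU_bilinear]
lemmas UU_mult = tens_mult[OF U_assoc_alg U_assoc_alg]

lemma primitive_hom: "primitive \<in> module_hom K M UU"
  unfolding primitive_def
  by (intro hom_add_maps[OF UU.vectorspace_axioms] hom_comp[OF \<iota>_hom bilinearD(2)[OF UU_bilinear]]
      hom_comp[OF \<iota>_hom bilinearD(1)[OF UU_bilinear]]) simp_all

text \<open>The mixed terms \<open>x \<otimes> y\<close> and \<open>y \<otimes> x\<close> appear in
  both products and cancel, leaving the bracket in each tensor factor separately.\<close>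

lemma primitive_bracket:
  assumes x: "x \<in> carrier M" and y: "y \<in> carrier M"
  shows "primitive x \<otimes>\<^bsub>UU\<^esub> primitive y \<ominus>\<^bsub>UU\<^esub> primitive y \<otimes>\<^bsub>UU\<^esub> primitive x = primitive (br x y)"
proof -
  let ?t = "tens K U U" and ?x = "\<iota> x" and ?y = "\<iota> y"
  have c: "?x \<in> carrier U" "?y \<in> carrier U" "\<one>\<^bsub>U\<^esub> \<in> carrier U" using x y by (simp_all add: \<iota>_closed)
  have p: "primitive x \<otimes>\<^bsub>UU\<^esub> primitive y = (?t (\<iota> x \<otimes>\<^bsub>U\<^esub> \<iota> y) \<one>\<^bsub>U\<^esub> \<oplus>\<^bsub>UU\<^esub> ?t (\<iota> y) (\<iota> x)) \<oplus>\<^bsub>UU\<^esub> (?t (\<iota> x) (\<iota> y) \<oplus>\<^bsub>UU\<^esub> ?t \<one>\<^bsub>U\<^esub> (\<iota> x \<otimes>\<^bsub>U\<^esub> \<iota> y))"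
    if "x \<in> carrier M" "y \<in> carrier M" for x y
    using that by (simp add: primitive_def UU.A.l_distr UU.A.r_distr UU_closed UU_mult \<iota>_closed)
  have m: "?t \<one>\<^bsub>U\<^esub> (a \<ominus>\<^bsub>U\<^esub> b) = ?t \<one>\<^bsub>U\<^esub> a \<ominus>\<^bsub>UU\<^esub> ?t \<one>\<^bsub>U\<^esub> b" "?t (a \<ominus>\<^bsub>U\<^esub> b) \<one>\<^bsub>U\<^esub> = ?t a \<one>\<^bsub>U\<^esub> \<ominus>\<^bsub>UU\<^esub> ?t b \<one>\<^bsub>U\<^esub>"
    if "a \<in> carrier U" "b \<in> carrier U" for a b
    using hom_minus[OF bilinearD(1)[OF UU_bilinear c(3)] U.vectorspace_axioms UU.vectorspace_axioms that]
      hom_minus[OF bilinearD(2)[OF UU_bilinear c(3)] U.vectorspace_axioms UU.vectorspace_axioms that] by blast+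
  have "primitive (br x y) = ?t (?x \<otimes>\<^bsub>U\<^esub> ?y) \<one>\<^bsub>U\<^esub> \<ominus>\<^bsub>UU\<^esub> ?t (?y \<otimes>\<^bsub>U\<^esub> ?x) \<one>\<^bsub>U\<^esub> \<oplus>\<^bsub>UU\<^esub> (?t \<one>\<^bsub>U\<^esub> (?x \<otimes>\<^bsub>U\<^esub> ?y) \<ominus>\<^bsub>UU\<^esub> ?t \<one>\<^bsub>U\<^esub> (?y \<otimes>\<^bsub>U\<^esub> ?x))"
    unfolding primitive_def \<iota>_bracket[OF x y, symmetric] using c by (simp only: m U.A.m_closed)
  then show ?thesis
    unfolding p[OF x y] p[OF y x] using c by (simp only: UU.A.minus_four UU_closed U.A.m_closed)
qed

lemma coproduct_eq: "\<Delta> = env_extend K UU primitive"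
  by (simp add: env_coproduct_def Let_def primitive_def[abs_def])

lemma coproduct_hom: "\<Delta> \<in> algebra_hom K U UU"
  unfolding coproduct_eq by (rule env_extend(1)[OF UU_assoc_alg primitive_hom]) (rule primitive_bracket)

lemma coproduct_\<iota>: "x \<in> carrier M \<Longrightarrow> \<Delta> (\<iota> x) = primitive x"
  unfolding coproduct_eq by (rule env_extend(2)[OF UU_assoc_alg primitive_hom]) (rule primitive_bracket)

end

section \<open>From a calculus to a pre-Lie structure\<close>

text \<open>The image of a basis is independent and has as many elements as the dimension of the
  target, hence is a basis of it.\<close>

lemma inj_hom_surj:
  assumes "vectorspace K V" "vectorspace K W" "T \<in> module_hom K V W" "inj_on T (carrier V)"
    "vectorspace.fin_dim K V" "vectorspace.fin_dim K W" "vectorspace.dim K W = vectorspace.dim K V"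
  shows "T ` carrier V = carrier W"
proof -
  interpret V: vectorspace K V by fact
  interpret W: vectorspace K W by fact
  interpret L: linear_map K V W T by (rule vectorspace_linear_map[OF assms(1-3)])
  obtain B where B: "finite B" "V.basis B" using V.finite_basis_exists[OF assms(5)] by blast
  then have Bc: "B \<subseteq> carrier V" and li: "V.lin_indpt B" by (simp_all add: V.basis_def)
  have TB: "finite (T ` B)" "T ` B \<subseteq> carrier W" using B(1) Bc hom_closed[OF assms(3)] by auto
  have "W.lin_indpt (T ` B)"
  proof (rule W.finite_lin_indpt2[OF TB])
    fix a assume a: "a \<in> T ` B \<rightarrow> carrier K" "W.lincomb a (T ` B) = \<zero>\<^bsub>W\<^esub>"
    have aT: "a \<circ> T \<in> B \<rightarrow> carrier K" using a(1) by auto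
    have "T (V.lincomb (a \<circ> T) B) = T \<zero>\<^bsub>V\<^esub>"
      using L.lincomb_linear_image[OF assms(4) Bc a(1) B(1)] a(2) hom_zero[OF assms(3,1,2)] by (simp only:)
    then have "V.lincomb (a \<circ> T) B = \<zero>\<^bsub>V\<^esub>"
      by (rule inj_onD[OF assms(4)]) (use V.lincomb_closed[OF Bc aT] in simp_all)
    then have "(a \<circ> T) v = \<zero>\<^bsub>K\<^esub>" if "v \<in> B" for v
      using V.lin_dep_crit[OF B(1) order_refl aT that] li by blast
    then show "\<forall>v\<in>T ` B. a v = \<zero>\<^bsub>K\<^esub>" by auto
  qed
  moreover have "card (T ` B) = V.dim"
    using card_image[OF inj_on_subset[OF assms(4) Bc]] V.dim_basis[OF B] by simp
  ultimately have "W.basis (T ` B)"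
    by (intro W.dim_li_is_basis[OF assms(6) TB]) (simp_all add: assms(7))
  then have "carrier W = W.span (T ` B)" by (simp add: W.basis_def)
  also have "\<dots> \<subseteq> L.im"
    by (rule W.span_is_subset) (use Bc L.im_is_submodule in \<open>auto simp: L.im_def\<close>)
  finally show ?thesis using hom_closed[OF assms(3)] by (auto simp: L.im_def)
qed

locale left_covariant_calculus =
  lie_algebra K M br + dga_over K \<Omega> gr "enveloping_algebra K M br" j d +
  left_covariance K "enveloping_algebra K M br" "env_coproduct K M br" "env_counit K" \<Omega> j d \<Delta>L
  for K M br \<Omega> gr j d \<Delta>L
begin

sublocale \<Omega>: assoc_alg K \<Omega> using assoc_algebra by (simp add: assoc_algebra_iff)

sublocale U\<Omega>: assoc_alg K "tensor K U \<Omega>" by (rule tensor_assoc_alg[OF U_assoc_alg \<Omega>.assoc_alg_axioms])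

lemmas vsO = \<Omega>.vectorspace_axioms

lemma gr_closed: "x \<in> gr k \<Longrightarrow> x \<in> carrier \<Omega>"
  using gr_subspace[of k] by (auto simp: VectorSpace.subspace_def LinearCombinations.submodule_def)

lemma gr_sub: "LinearCombinations.submodule K (gr k) \<Omega>"
  using gr_subspace[of k] by (simp add: VectorSpace.subspace_def)

lemma gr_minus: "x \<in> gr k \<Longrightarrow> y \<in> gr k \<Longrightarrow> x \<ominus>\<^bsub>\<Omega>\<^esub> y \<in> gr k"
proof -
  interpret q: quotient_vs K \<Omega> "gr k" by (intro quotient_vs.intro quotient_vs_axioms.intro vsO gr_sub)
  show "x \<in> gr k \<Longrightarrow> y \<in> gr k \<Longrightarrow> x \<ominus>\<^bsub>\<Omega>\<^esub> y \<in> gr k" unfolding a_minus_def by (intro q.I_closed)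
qed

lemma j_gr: "u \<in> carrier U \<Longrightarrow> j u \<in> gr 0" using j_image by blast

lemma d_closed: "w \<in> carrier \<Omega> \<Longrightarrow> d w \<in> carrier \<Omega>" by (rule hom_closed[OF d_linear])

lemma d_j_mult:
  assumes "u \<in> carrier U" "v \<in> carrier U"
  shows "d (j (u \<otimes>\<^bsub>U\<^esub> v)) = d (j u) \<otimes>\<^bsub>\<Omega>\<^esub> j v \<oplus>\<^bsub>\<Omega>\<^esub> j u \<otimes>\<^bsub>\<Omega>\<^esub> d (j v)"
  using d_leibniz[OF j_gr[OF assms(1)] gr_closed[OF j_gr[OF assms(2)]]] assms algebra_homD(2,3)[OF j_hom]
  by (simp add: d_closed)

text \<open>The Leibniz rule at \<open>1 = 1 1\<close> gives \<open>d 1 = d 1 + d 1\<close>.\<close>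

lemma d_one: "d \<one>\<^bsub>\<Omega>\<^esub> = \<zero>\<^bsub>\<Omega>\<^esub>"
  using d_j_mult[of "\<one>\<^bsub>U\<^esub>" "\<one>\<^bsub>U\<^esub>"] d_closed[OF \<Omega>.A.one_closed] algebra_homD(4)[OF j_hom]
  by (simp add: \<Omega>.M.add.l_cancel_one)

abbreviation "jx x \<equiv> j (\<iota> x)"
abbreviation "D x \<equiv> d (j (\<iota> x))"
abbreviation "\<Lambda> \<equiv> left_invariant_1forms K U \<Omega> gr \<Delta>L"

lemma jx_closed: "x \<in> carrier M \<Longrightarrow> jx x \<in> carrier \<Omega>"
  by (rule algebra_homD(2)[OF j_hom \<iota>_closed])

lemma D_hom: "(\<lambda>x. D x) \<in> module_hom K M \<Omega>"
  by (rule hom_comp[OF hom_comp[OF \<iota>_hom algebra_homD(1)[OF j_hom]] d_linear])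

lemma D_closed: "x \<in> carrier M \<Longrightarrow> D x \<in> carrier \<Omega>"
  by (rule hom_closed[OF D_hom])

lemma D_gr: "x \<in> carrier M \<Longrightarrow> D x \<in> gr 1"
  using d_degree[OF j_gr[OF \<iota>_closed]] by simp

lemmas U\<Omega>_bilinear = tens_bilinear[OF U.vectorspace_axioms vsO]
lemmas U\<Omega>_closed = bilinearD(3)[OF U\<Omega>_bilinear]
lemmas U\<Omega>_mult = tens_mult[OF U_assoc_alg \<Omega>.assoc_alg_axioms]

lemma tensor_map_tens_U:
  assumes "vectorspace K V" "f \<in> module_hom K V \<Omega>" "u \<in> carrier U" "v \<in> carrier V"
  shows "tensor_map K U \<Omega> id f (tens K U V u v) = tens K U \<Omega> u (f v)"
  using tensor_map_tens[OF U.vectorspace_axioms assms(1) U.vectorspace_axioms vsO hom_id(2) assms(2-4)] by simp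

lemma L_jx:
  assumes x: "x \<in> carrier M"
  shows "\<Delta>L (jx x) = tens K U \<Omega> (\<iota> x) \<one>\<^bsub>\<Omega>\<^esub> \<oplus>\<^bsub>tensor K U \<Omega>\<^esub> tens K U \<Omega> \<one>\<^bsub>U\<^esub> (jx x)"
proof -
  note jm = algebra_homD(1)[OF j_hom]
  note h = tensor_map_hom[OF U.vectorspace_axioms U.vectorspace_axioms U.vectorspace_axioms vsO hom_id(2) jm]
  show ?thesis
    using L_extends[OF \<iota>_closed[OF x]] coproduct_\<iota>[OF x] x
    by (simp add: primitive_def hom_add[OF h] UU_closed \<iota>_closed tensor_map_tens_U[OF U.vectorspace_axioms jm] algebra_homD(4)[OF j_hom])
qed

text \<open>Applying \<open>id \<otimes> d\<close> to \<open>x \<otimes> 1 + 1 \<otimes> x\<close>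
  kills the first term because \<open>d 1 = 0\<close>. This is why differentials of primitive
  elements are left-invariant.\<close>

lemma L_D:
  assumes x: "x \<in> carrier M"
  shows "\<Delta>L (D x) = tens K U \<Omega> \<one>\<^bsub>U\<^esub> (D x)"
proof -
  note h = tensor_map_hom[OF U.vectorspace_axioms vsO U.vectorspace_axioms vsO hom_id(2) d_linear]
  have "tens K U \<Omega> (\<iota> x) \<zero>\<^bsub>\<Omega>\<^esub> = \<zero>\<^bsub>tensor K U \<Omega>\<^esub>"
    by (rule hom_zero[OF bilinearD(1)[OF U\<Omega>_bilinear \<iota>_closed[OF x]] vsO U\<Omega>.vectorspace_axioms])
  then show ?thesis
    using L_d[OF jx_closed[OF x]] x
    by (simp add: L_jx hom_add[OF h] U\<Omega>_closed \<iota>_closed jx_closed D_closed tensor_map_tens_U[OF vsO d_linear] d_one)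
qed

lemma D_invariant: "x \<in> carrier M \<Longrightarrow> D x \<in> \<Lambda>"
  by (simp add: left_invariant_1forms_def D_gr[simplified] L_D)

lemma \<Lambda>_submodule: "LinearCombinations.submodule K \<Lambda> \<Omega>"
proof (rule LinearCombinations.submodule.intro[OF \<Omega>.module_axioms])
  note L = algebra_homD(1)[OF L_hom]
  note t = bilinearD(1)[OF U\<Omega>_bilinear U.A.one_closed]
  interpret g: LinearCombinations.submodule K "gr 1" \<Omega> by (rule gr_sub)
  show "\<Lambda> \<subseteq> carrier \<Omega>" using gr_closed by (auto simp: left_invariant_1forms_def)
  show "v \<oplus>\<^bsub>\<Omega>\<^esub> w \<in> \<Lambda>" if "v \<in> \<Lambda>" "w \<in> \<Lambda>" for v w
    using that g.m_closed gr_closed[of v 1] gr_closed[of w 1]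
    by (simp add: left_invariant_1forms_def hom_add[OF L] hom_add[OF t])
  show "\<zero>\<^bsub>\<Omega>\<^esub> \<in> \<Lambda>"
    using g.zero_closed hom_zero[OF L vsO U\<Omega>.vectorspace_axioms] hom_zero[OF t vsO U\<Omega>.vectorspace_axioms]
    by (simp add: left_invariant_1forms_def)
  show "c \<odot>\<^bsub>\<Omega>\<^esub> v \<in> \<Lambda>" if "c \<in> carrier K" "v \<in> \<Lambda>" for c v
    using that g.smult_closed gr_closed[of v 1]
    by (simp add: left_invariant_1forms_def hom_smult[OF L] hom_smult[OF t])
qed

abbreviation "\<Lambda>V \<equiv> \<Omega>\<lparr>carrier := \<Lambda>\<rparr>"

lemma \<Lambda>_vectorspace: "vectorspace K \<Lambda>V"
  by (rule \<Omega>.subspace_is_vs) (simp add: VectorSpace.subspace_def vsO \<Lambda>_submodule)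

lemma D_hom_\<Lambda>: "(\<lambda>x. D x) \<in> module_hom K M \<Lambda>V"
  by (rule module_homI) (simp_all add: D_invariant hom_add[OF D_hom] hom_smult[OF D_hom])

section \<open>The adjoint action of the Lie algebra on invariant forms\<close>

definition commutator :: "'c \<Rightarrow> 'e \<Rightarrow> 'e" where
  "commutator x \<eta> = jx x \<otimes>\<^bsub>\<Omega>\<^esub> \<eta> \<ominus>\<^bsub>\<Omega>\<^esub> \<eta> \<otimes>\<^bsub>\<Omega>\<^esub> jx x"

text \<open>Under the coaction the term \<open>x \<otimes> \<eta>\<close> arises from both products
  and cancels, so only \<open>1 \<otimes> [x, \<eta>]\<close> survives.\<close>

lemma commutator_invariant:
  assumes x: "x \<in> carrier M" and \<eta>: "\<eta> \<in> \<Lambda>"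
  shows "commutator x \<eta> \<in> \<Lambda>"
proof -
  have g: "\<eta> \<in> gr 1" and L\<eta>: "\<Delta>L \<eta> = tens K U \<Omega> \<one>\<^bsub>U\<^esub> \<eta>" using \<eta> by (simp_all add: left_invariant_1forms_def)
  note c = gr_closed[OF g] jx_closed[OF x] \<iota>_closed[OF x]
  have "commutator x \<eta> \<in> gr 1"
    unfolding commutator_def using gr_mult[OF j_gr[OF \<iota>_closed[OF x]] g] gr_mult[OF g j_gr[OF \<iota>_closed[OF x]]]
    by (simp add: gr_minus)
  moreover have "\<Delta>L (commutator x \<eta>) = tens K U \<Omega> \<one>\<^bsub>U\<^esub> (commutator x \<eta>)"
  proof -
    let ?t = "tens K U \<Omega>" and ?T = "tensor K U \<Omega>"
    have "\<Delta>L (commutator x \<eta>) = \<Delta>L (jx x \<otimes>\<^bsub>\<Omega>\<^esub> \<eta>) \<ominus>\<^bsub>?T\<^esub> \<Delta>L (\<eta> \<otimes>\<^bsub>\<Omega>\<^esub> jx x)"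
      unfolding commutator_def using c
      by (intro hom_minus[OF algebra_homD(1)[OF L_hom] vsO U\<Omega>.vectorspace_axioms]) simp_all
    also have "\<dots> = (?t (\<iota> x) \<eta> \<oplus>\<^bsub>?T\<^esub> ?t \<one>\<^bsub>U\<^esub> (jx x \<otimes>\<^bsub>\<Omega>\<^esub> \<eta>)) \<ominus>\<^bsub>?T\<^esub> (?t (\<iota> x) \<eta> \<oplus>\<^bsub>?T\<^esub> ?t \<one>\<^bsub>U\<^esub> (\<eta> \<otimes>\<^bsub>\<Omega>\<^esub> jx x))"
      using c by (simp add: algebra_homD(3)[OF L_hom] L_jx[OF x] L\<eta> U\<Omega>.A.l_distr U\<Omega>.A.r_distr U\<Omega>_closed U\<Omega>_mult)
    also have "\<dots> = ?t \<one>\<^bsub>U\<^esub> (jx x \<otimes>\<^bsub>\<Omega>\<^esub> \<eta>) \<ominus>\<^bsub>?T\<^esub> ?t \<one>\<^bsub>U\<^esub> (\<eta> \<otimes>\<^bsub>\<Omega>\<^esub> jx x)"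
      using c by (intro U\<Omega>.A.minus_cancel_left U\<Omega>_closed) simp_all
    also have "\<dots> = ?t \<one>\<^bsub>U\<^esub> (commutator x \<eta>)"
      unfolding commutator_def using c
      by (intro hom_minus[OF bilinearD(1)[OF U\<Omega>_bilinear U.A.one_closed] vsO U\<Omega>.vectorspace_axioms, symmetric]) simp_all
    finally show ?thesis .
  qed
  ultimately show ?thesis by (simp add: left_invariant_1forms_def)
qed

lemma commutator_bilinear: "bilinear_map K M \<Omega> \<Omega> commutator"
  unfolding bilinear_map_def commutator_def
  by (intro conjI ballI hom_minus_maps[OF vsO] \<Omega>.mult_hom_left \<Omega>.mult_hom_right jx_closed
      hom_comp[OF hom_comp[OF \<iota>_hom algebra_homD(1)[OF j_hom]] \<Omega>.mult_hom_left]
      hom_comp[OF hom_comp[OF \<iota>_hom algebra_homD(1)[OF j_hom]] \<Omega>.mult_hom_right])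

lemma jx_br: "x \<in> carrier M \<Longrightarrow> y \<in> carrier M \<Longrightarrow> jx (br x y) = jx x \<otimes>\<^bsub>\<Omega>\<^esub> jx y \<ominus>\<^bsub>\<Omega>\<^esub> jx y \<otimes>\<^bsub>\<Omega>\<^esub> jx x"
  using hom_minus[OF algebra_homD(1)[OF j_hom] U.vectorspace_axioms vsO, of "\<iota> x \<otimes>\<^bsub>U\<^esub> \<iota> y" "\<iota> y \<otimes>\<^bsub>U\<^esub> \<iota> x"]
  by (simp add: \<iota>_bracket[symmetric] \<iota>_closed algebra_homD(3)[OF j_hom])

text \<open>Commutators form a representation of the Lie algebra on forms. Transported along
  \<open>D\<close>, this becomes the pre-Lie identity.\<close>

lemma commutator_br:
  assumes "x \<in> carrier M" "y \<in> carrier M" "\<eta> \<in> carrier \<Omega>"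
  shows "commutator x (commutator y \<eta>) \<ominus>\<^bsub>\<Omega>\<^esub> commutator y (commutator x \<eta>) = commutator (br x y) \<eta>"
  unfolding commutator_def jx_br[OF assms(1,2)]
  by (rule \<Omega>.A.commutator_commutator[OF jx_closed[OF assms(1)] jx_closed[OF assms(2)] assms(3)])

text \<open>This is the Leibniz rule applied to \<open>x y - y x\<close>. Transported along
  \<open>D\<close>, it says that the product induces the bracket.\<close>

lemma commutator_D:
  assumes x: "x \<in> carrier M" and y: "y \<in> carrier M"
  shows "commutator x (D y) \<ominus>\<^bsub>\<Omega>\<^esub> commutator y (D x) = D (br x y)"
proof -
  note c = jx_closed[OF x] jx_closed[OF y] D_closed[OF x] D_closed[OF y]
  have jm: "jx a \<otimes>\<^bsub>\<Omega>\<^esub> jx b = j (\<iota> a \<otimes>\<^bsub>U\<^esub> \<iota> b)" if "a \<in> carrier M" "b \<in> carrier M" for a b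
    using that by (simp add: algebra_homD(3)[OF j_hom] \<iota>_closed)
  have "D (br x y) = d (jx x \<otimes>\<^bsub>\<Omega>\<^esub> jx y) \<ominus>\<^bsub>\<Omega>\<^esub> d (jx y \<otimes>\<^bsub>\<Omega>\<^esub> jx x)"
    unfolding jx_br[OF x y] using c by (intro hom_minus[OF d_linear vsO vsO]) simp_all
  also have "\<dots> = (D x \<otimes>\<^bsub>\<Omega>\<^esub> jx y \<oplus>\<^bsub>\<Omega>\<^esub> jx x \<otimes>\<^bsub>\<Omega>\<^esub> D y) \<ominus>\<^bsub>\<Omega>\<^esub> (D y \<otimes>\<^bsub>\<Omega>\<^esub> jx x \<oplus>\<^bsub>\<Omega>\<^esub> jx y \<otimes>\<^bsub>\<Omega>\<^esub> D x)"
    unfolding jm[OF x y] jm[OF y x] d_j_mult[OF \<iota>_closed[OF x] \<iota>_closed[OF y]] d_j_mult[OF \<iota>_closed[OF y] \<iota>_closed[OF x]] ..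
  also have "\<dots> = commutator x (D y) \<ominus>\<^bsub>\<Omega>\<^esub> commutator y (D x)"
    unfolding commutator_def by (rule \<Omega>.A.commutator_leibniz[OF c])
  finally show ?thesis by simp
qed

lemma D_inj:
  assumes conn: "connected_calculus K U \<Omega> j d" and fd: fin_dim
  shows "inj_on (\<lambda>x. D x) (carrier M)"
proof -
  obtain e co where co: "coords K M dim e co" using coords_exist[OF vectorspace_axioms fd] by blast
  interpret pbw K M br dim e co by (intro pbw.intro lie_algebra_axioms co)
  have ker: "x = \<zero>\<^bsub>M\<^esub>" if x: "x \<in> carrier M" "D x = \<zero>\<^bsub>\<Omega>\<^esub>" for x
  proof -
    have "\<iota> x \<in> {a \<in> carrier U. d (j a) = \<zero>\<^bsub>\<Omega>\<^esub>}" using x \<iota>_closed by blast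
    \<comment> \<open>Connectedness makes \<open>\<iota> x\<close> a scalar multiple of the unit;
      the counit, which vanishes on \<open>\<iota> x\<close>, forces that scalar to be zero.\<close>
    then obtain c where c: "c \<in> carrier K" "\<iota> x = c \<odot>\<^bsub>U\<^esub> \<one>\<^bsub>U\<^esub>"
      unfolding conn[unfolded connected_calculus_def] by blast
    have "\<zero>\<^bsub>K\<^esub> = env_counit K (c \<odot>\<^bsub>U\<^esub> \<one>\<^bsub>U\<^esub>)" using counit(2)[OF x(1)] c(2) by simp
    also have "\<dots> = c"
      using algebra_homD(6)[OF counit(1) c(1) U.A.one_closed] algebra_homD(4)[OF counit(1)] c(1)
      by (simp add: ground_algebra_def)
    finally have "\<iota> x = \<zero>\<^bsub>U\<^esub>" using c(2) U.lmult_0[OF U.A.one_closed] by (metis)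
    then have "\<iota> x = \<iota> \<zero>\<^bsub>M\<^esub>" using hom_zero[OF \<iota>_hom vectorspace_axioms U.vectorspace_axioms] by simp
    then show ?thesis by (rule inj_onD[OF \<iota>_inj _ x(1) M.zero_closed])
  qed
  show ?thesis
  proof (rule inj_onI)
    fix x y assume xy: "x \<in> carrier M" "y \<in> carrier M" "D x = D y"
    have "D (x \<ominus>\<^bsub>M\<^esub> y) = D x \<ominus>\<^bsub>\<Omega>\<^esub> D y" by (rule hom_minus[OF D_hom vectorspace_axioms vsO xy(1,2)])
    also have "\<dots> = \<zero>\<^bsub>\<Omega>\<^esub>" by (rule minus_eq_zero_iff[THEN iffD2, OF vsO D_closed[OF xy(1)] D_closed[OF xy(2)] xy(3)])
    finally show "x = y" using ker[OF M.minus_closed[OF xy(1,2)]] minus_eq_zero_iff[OF vectorspace_axioms xy(1,2)] by blast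
  qed
qed

text \<open>Injectivity and equality of dimensions make \<open>D\<close> a bijection onto the
  invariant forms, so the adjoint action can be pulled back to the Lie algebra. Identities for
  \<open>pl\<close> are verified after applying \<open>D\<close>.\<close>

theorem pre_lie:
  assumes conn: "connected_calculus K U \<Omega> j d" and fd: fin_dim
    and \<Lambda>fd: "vectorspace.fin_dim K \<Lambda>V" and \<Lambda>dim: "vectorspace.dim K \<Lambda>V = dim"
  shows "\<exists>pl. pre_lie_structure K M br pl"
proof -
  note inj = D_inj[OF conn fd]
  have surj: "(\<lambda>x. D x) ` carrier M = \<Lambda>"
    using inj_hom_surj[OF vectorspace_axioms \<Lambda>_vectorspace D_hom_\<Lambda> inj fd \<Lambda>fd \<Lambda>dim] by simp
  define pl where "pl x y = the_inv_into (carrier M) (\<lambda>x. D x) (commutator x (D y))" for x y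
  have plc: "pl x y \<in> carrier M" and D_pl: "D (pl x y) = commutator x (D y)" if "x \<in> carrier M" "y \<in> carrier M" for x y
  proof -
    have "commutator x (D y) \<in> (\<lambda>x. D x) ` carrier M"
      unfolding surj by (rule commutator_invariant[OF that(1) D_invariant[OF that(2)]])
    then show "pl x y \<in> carrier M" "D (pl x y) = commutator x (D y)"
      unfolding pl_def using the_inv_into_into[OF inj _ order_refl] f_the_inv_into_f[OF inj] by blast+
  qed
  note eqI = inj_onD[OF inj]
  note cb = bilinearD[OF commutator_bilinear]
  note Dm = hom_minus[OF D_hom vectorspace_axioms vsO]
  have bil: "bilinear_map K M M M pl"
    by (rule bilinearI; (rule plc, assumption+)?; rule eqI)
      (simp_all add: plc D_pl hom_add[OF D_hom] hom_smult[OF D_hom] cb D_closed)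
  have br_pl: "pl x y \<ominus>\<^bsub>M\<^esub> pl y x = br x y" if "x \<in> carrier M" "y \<in> carrier M" for x y
    by (rule eqI) (use that in \<open>simp_all add: Dm D_pl plc br_closed commutator_D\<close>)
  have "pl (pl x y) z \<ominus>\<^bsub>M\<^esub> pl (pl y x) z = pl x (pl y z) \<ominus>\<^bsub>M\<^esub> pl y (pl x z)"
    if xyz: "x \<in> carrier M" "y \<in> carrier M" "z \<in> carrier M" for x y z
  proof -
    \<comment> \<open>By bilinearity and \<open>br_pl\<close> the left side is the product by a
      bracket, so that the representation property applies.\<close>
    have "pl (pl x y) z \<ominus>\<^bsub>M\<^esub> pl (pl y x) z = pl (br x y) z"
      unfolding br_pl[OF xyz(1,2), symmetric]
      by (rule hom_minus[OF bilinearD(2)[OF bil xyz(3)] vectorspace_axioms vectorspace_axioms, symmetric])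
        (use plc xyz in simp_all)
    also have "\<dots> = pl x (pl y z) \<ominus>\<^bsub>M\<^esub> pl y (pl x z)"
      by (rule eqI) (use xyz in \<open>simp_all add: Dm D_pl plc br_closed commutator_br D_closed\<close>)
    finally show ?thesis .
  qed
  then have "pre_lie_structure K M br pl" unfolding pre_lie_structure_def using bil br_pl by blast
  then show ?thesis by blast
qed

end

section \<open>Matrix algebras\<close>

text \<open>Matrices are functions on all pairs of indices, forced to vanish outside the block of
  size \<open>N\<close>, so that equality of matrices is equality of functions.\<close>

definition matrix_algebra :: "('k, 'a, 'e) module_scheme \<Rightarrow> nat \<Rightarrow> ('k, nat \<Rightarrow> nat \<Rightarrow> 'a) module" where
  "matrix_algebra A N = \<lparr>
     carrier = {f. \<forall>i j. f i j \<in> carrier A \<and> (N \<le> i \<or> N \<le> j \<longrightarrow> f i j = \<zero>\<^bsub>A\<^esub>)},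
     mult = (\<lambda>f g i j. \<Oplus>\<^bsub>A\<^esub>k\<in>{..<N}. f i k \<otimes>\<^bsub>A\<^esub> g k j),
     one = (\<lambda>i j. if i = j \<and> i < N then \<one>\<^bsub>A\<^esub> else \<zero>\<^bsub>A\<^esub>),
     zero = (\<lambda>i j. \<zero>\<^bsub>A\<^esub>),
     add = (\<lambda>f g i j. f i j \<oplus>\<^bsub>A\<^esub> g i j),
     smult = (\<lambda>c f i j. c \<odot>\<^bsub>A\<^esub> f i j)\<rparr>"

context assoc_alg begin

context fixes N :: nat begin

abbreviation "Mat \<equiv> matrix_algebra A N"

lemma mem_Mat: "f \<in> carrier Mat \<longleftrightarrow> (\<forall>i j. f i j \<in> carrier A \<and> (N \<le> i \<or> N \<le> j \<longrightarrow> f i j = \<zero>\<^bsub>A\<^esub>))"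
  by (simp add: matrix_algebra_def)

lemma Mat_ops: "(f \<oplus>\<^bsub>Mat\<^esub> g) i j = f i j \<oplus>\<^bsub>A\<^esub> g i j" "(c \<odot>\<^bsub>Mat\<^esub> f) i j = c \<odot>\<^bsub>A\<^esub> f i j" "\<zero>\<^bsub>Mat\<^esub> i j = \<zero>\<^bsub>A\<^esub>"
  "(f \<otimes>\<^bsub>Mat\<^esub> g) i j = (\<Oplus>\<^bsub>A\<^esub>k\<in>{..<N}. f i k \<otimes>\<^bsub>A\<^esub> g k j)"
  "\<one>\<^bsub>Mat\<^esub> i j = (if i = j \<and> i < N then \<one>\<^bsub>A\<^esub> else \<zero>\<^bsub>A\<^esub>)"
  by (simp_all add: matrix_algebra_def)

lemma Mat_vectorspace: "vectorspace K Mat"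
proof (rule vs_criteria)
  show "\<forall>v\<in>carrier Mat. \<exists>neg_v\<in>carrier Mat. v \<oplus>\<^bsub>Mat\<^esub> neg_v = \<zero>\<^bsub>Mat\<^esub>"
  proof
    fix v assume "v \<in> carrier Mat"
    then show "\<exists>neg_v\<in>carrier Mat. v \<oplus>\<^bsub>Mat\<^esub> neg_v = \<zero>\<^bsub>Mat\<^esub>"
      by (intro bexI[of _ "\<lambda>i j. \<ominus>\<^bsub>A\<^esub> v i j"]) (auto simp: mem_Mat Mat_ops M.r_neg fun_eq_iff)
  qed
qed (auto simp: mem_Mat Mat_ops field_axioms M.add.m_ac smult_assoc1 smult_l_distr smult_r_distr fun_eq_iff)

lemma Mat_eval_hom: "(\<lambda>f. f i j) \<in> module_hom K Mat A"
  by (rule module_homI) (simp_all add: mem_Mat Mat_ops)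

lemma Mat_homI:
  assumes "\<And>i j. (\<lambda>v. F v i j) \<in> module_hom K V A"
    and "\<And>v i j. v \<in> carrier V \<Longrightarrow> N \<le> i \<or> N \<le> j \<Longrightarrow> F v i j = \<zero>\<^bsub>A\<^esub>"
  shows "F \<in> module_hom K V Mat"
  by (rule module_homI) (use hom_closed[OF assms(1)] hom_add[OF assms(1)] hom_smult[OF assms(1)] assms(2) in
      \<open>auto simp: mem_Mat Mat_ops fun_eq_iff\<close>)

lemma Mat_assoc_alg: "assoc_alg K Mat"
proof (rule assoc_algI[OF Mat_vectorspace])
  have c: "f i j \<in> carrier A" if "f \<in> carrier Mat" for f i j using that by (simp add: mem_Mat)
  have z: "(\<Oplus>\<^bsub>A\<^esub>k\<in>{..<N}. g k) = \<zero>\<^bsub>A\<^esub>" if "\<And>k. g k = \<zero>\<^bsub>A\<^esub>" for g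
    using that by simp
  have out: "(f \<otimes>\<^bsub>Mat\<^esub> g) i j = \<zero>\<^bsub>A\<^esub>" if fg: "f \<in> carrier Mat" "g \<in> carrier Mat" and "N \<le> i \<or> N \<le> j" for f g i j
    unfolding Mat_ops by (rule z) (use fg that(3) c[OF fg(1)] c[OF fg(2)] in \<open>auto simp: mem_Mat\<close>)
  show r: "(\<lambda>g. f \<otimes>\<^bsub>Mat\<^esub> g) \<in> module_hom K Mat Mat" if f: "f \<in> carrier Mat" for f
  proof (rule Mat_homI)
    show "(\<lambda>g. (f \<otimes>\<^bsub>Mat\<^esub> g) i j) \<in> module_hom K Mat A" for i j
      unfolding Mat_ops
      by (rule hom_finsum_maps[OF vectorspace_axioms]) (simp, rule hom_comp[OF Mat_eval_hom mult_hom_right[OF c[OF f]]])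
  qed (rule out[OF f])
  show "(\<lambda>f. f \<otimes>\<^bsub>Mat\<^esub> g) \<in> module_hom K Mat Mat" if g: "g \<in> carrier Mat" for g
  proof (rule Mat_homI)
    show "(\<lambda>f. (f \<otimes>\<^bsub>Mat\<^esub> g) i j) \<in> module_hom K Mat A" for i j
      unfolding Mat_ops
      by (rule hom_finsum_maps[OF vectorspace_axioms]) (simp, rule hom_comp[OF Mat_eval_hom mult_hom_left[OF c[OF g]]])
  qed (rule out[OF _ g])
  show "\<one>\<^bsub>Mat\<^esub> \<in> carrier Mat" by (simp add: mem_Mat Mat_ops)
  show "\<one>\<^bsub>Mat\<^esub> \<otimes>\<^bsub>Mat\<^esub> f = f" if f: "f \<in> carrier Mat" for f
  proof (intro ext)
    fix i j
    show "(\<one>\<^bsub>Mat\<^esub> \<otimes>\<^bsub>Mat\<^esub> f) i j = f i j"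
    proof (cases "i < N")
      case True
      have "(\<Oplus>\<^bsub>A\<^esub>k\<in>{..<N}. \<one>\<^bsub>Mat\<^esub> i k \<otimes>\<^bsub>A\<^esub> f k j) = (\<Oplus>\<^bsub>A\<^esub>k\<in>{..<N}. if i = k then f k j else \<zero>\<^bsub>A\<^esub>)"
        by (rule M.finsum_cong'[OF refl]) (use True c[OF f] in \<open>simp_all add: Mat_ops\<close>)
      also have "\<dots> = f i j" by (rule M.finsum_singleton) (use True c[OF f] in simp_all)
      finally show ?thesis by (simp only: Mat_ops(4))
    next
      case False then show ?thesis using out[OF \<open>\<one>\<^bsub>Mat\<^esub> \<in> carrier Mat\<close> f, of i j] f by (simp add: mem_Mat)
    qed
  qed
  show "f \<otimes>\<^bsub>Mat\<^esub> \<one>\<^bsub>Mat\<^esub> = f" if f: "f \<in> carrier Mat" for f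
  proof (intro ext)
    fix i j
    show "(f \<otimes>\<^bsub>Mat\<^esub> \<one>\<^bsub>Mat\<^esub>) i j = f i j"
    proof (cases "j < N")
      case True
      have "(\<Oplus>\<^bsub>A\<^esub>k\<in>{..<N}. f i k \<otimes>\<^bsub>A\<^esub> \<one>\<^bsub>Mat\<^esub> k j) = (\<Oplus>\<^bsub>A\<^esub>k\<in>{..<N}. if j = k then f i k else \<zero>\<^bsub>A\<^esub>)"
        by (rule M.finsum_cong'[OF refl]) (use True c[OF f] in \<open>simp_all add: Mat_ops\<close>)
      also have "\<dots> = f i j" by (rule M.finsum_singleton) (use True c[OF f] in simp_all)
      finally show ?thesis by (simp only: Mat_ops(4))
    next
      case False then show ?thesis using out[OF f \<open>\<one>\<^bsub>Mat\<^esub> \<in> carrier Mat\<close>, of i j] f by (simp add: mem_Mat)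
    qed
  qed
  show "f \<otimes>\<^bsub>Mat\<^esub> g \<otimes>\<^bsub>Mat\<^esub> h = f \<otimes>\<^bsub>Mat\<^esub> (g \<otimes>\<^bsub>Mat\<^esub> h)"
    if f: "f \<in> carrier Mat" and g: "g \<in> carrier Mat" and h: "h \<in> carrier Mat" for f g h
  proof (intro ext)
    fix i j
    note cc = c[OF f] c[OF g] c[OF h]
    have "(f \<otimes>\<^bsub>Mat\<^esub> g \<otimes>\<^bsub>Mat\<^esub> h) i j = (\<Oplus>\<^bsub>A\<^esub>k\<in>{..<N}. \<Oplus>\<^bsub>A\<^esub>l\<in>{..<N}. f i l \<otimes>\<^bsub>A\<^esub> g l k \<otimes>\<^bsub>A\<^esub> h k j)"
      unfolding Mat_ops
      by (rule M.finsum_cong'[OF refl]) (use cc in \<open>auto intro!: M.finsum_closed A.finsum_ldistr\<close>)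
    also have "\<dots> = (\<Oplus>\<^bsub>A\<^esub>l\<in>{..<N}. \<Oplus>\<^bsub>A\<^esub>k\<in>{..<N}. f i l \<otimes>\<^bsub>A\<^esub> g l k \<otimes>\<^bsub>A\<^esub> h k j)"
      by (rule A.finsum_finsum_swap) (use cc in auto)
    also have "\<dots> = (\<Oplus>\<^bsub>A\<^esub>l\<in>{..<N}. \<Oplus>\<^bsub>A\<^esub>k\<in>{..<N}. f i l \<otimes>\<^bsub>A\<^esub> (g l k \<otimes>\<^bsub>A\<^esub> h k j))"
      using cc by (simp only: A.m_assoc)
    also have "\<dots> = (f \<otimes>\<^bsub>Mat\<^esub> (g \<otimes>\<^bsub>Mat\<^esub> h)) i j"
      unfolding Mat_ops
      by (rule M.finsum_cong'[OF refl]) (use cc in \<open>auto intro!: M.finsum_closed A.finsum_rdistr[symmetric]\<close>)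
    finally show "(f \<otimes>\<^bsub>Mat\<^esub> g \<otimes>\<^bsub>Mat\<^esub> h) i j = (f \<otimes>\<^bsub>Mat\<^esub> (g \<otimes>\<^bsub>Mat\<^esub> h)) i j" .
  qed
qed

end

end

text \<open>An injective map compatible with all operations reflects the equational axioms;
  negatives arise as multiples by \<open>-1\<close>. It gives the product of forms its
  associativity.\<close>

lemma assoc_alg_pullback:
  assumes B: "assoc_alg K B" and inj: "inj_on h (carrier A)"
    and hc: "\<And>x. x \<in> carrier A \<Longrightarrow> h x \<in> carrier B"
    and cl: "\<And>x y. x \<in> carrier A \<Longrightarrow> y \<in> carrier A \<Longrightarrow> x \<oplus>\<^bsub>A\<^esub> y \<in> carrier A"
      "\<And>x y. x \<in> carrier A \<Longrightarrow> y \<in> carrier A \<Longrightarrow> x \<otimes>\<^bsub>A\<^esub> y \<in> carrier A"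
      "\<And>c x. c \<in> carrier K \<Longrightarrow> x \<in> carrier A \<Longrightarrow> c \<odot>\<^bsub>A\<^esub> x \<in> carrier A"
      "\<zero>\<^bsub>A\<^esub> \<in> carrier A" "\<one>\<^bsub>A\<^esub> \<in> carrier A"
    and h: "\<And>x y. x \<in> carrier A \<Longrightarrow> y \<in> carrier A \<Longrightarrow> h (x \<oplus>\<^bsub>A\<^esub> y) = h x \<oplus>\<^bsub>B\<^esub> h y"
      "\<And>x y. x \<in> carrier A \<Longrightarrow> y \<in> carrier A \<Longrightarrow> h (x \<otimes>\<^bsub>A\<^esub> y) = h x \<otimes>\<^bsub>B\<^esub> h y"
      "\<And>c x. c \<in> carrier K \<Longrightarrow> x \<in> carrier A \<Longrightarrow> h (c \<odot>\<^bsub>A\<^esub> x) = c \<odot>\<^bsub>B\<^esub> h x"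
      "h \<zero>\<^bsub>A\<^esub> = \<zero>\<^bsub>B\<^esub>" "h \<one>\<^bsub>A\<^esub> = \<one>\<^bsub>B\<^esub>"
  shows "assoc_alg K A"
proof -
  interpret B: assoc_alg K B by fact
  note eq = inj_onD[OF inj]
  have es: "\<And>v w. v \<in> carrier A \<Longrightarrow> w \<in> carrier A \<Longrightarrow> v \<oplus>\<^bsub>A\<^esub> w = w \<oplus>\<^bsub>A\<^esub> v"
    "\<And>u v w. u \<in> carrier A \<Longrightarrow> v \<in> carrier A \<Longrightarrow> w \<in> carrier A \<Longrightarrow> u \<oplus>\<^bsub>A\<^esub> v \<oplus>\<^bsub>A\<^esub> w = u \<oplus>\<^bsub>A\<^esub> (v \<oplus>\<^bsub>A\<^esub> w)"
    "\<And>v. v \<in> carrier A \<Longrightarrow> v \<oplus>\<^bsub>A\<^esub> \<zero>\<^bsub>A\<^esub> = v"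
    "\<And>v. v \<in> carrier A \<Longrightarrow> \<one>\<^bsub>K\<^esub> \<odot>\<^bsub>A\<^esub> v = v"
    "\<And>a b v. a \<in> carrier K \<Longrightarrow> b \<in> carrier K \<Longrightarrow> v \<in> carrier A \<Longrightarrow> a \<otimes>\<^bsub>K\<^esub> b \<odot>\<^bsub>A\<^esub> v = a \<odot>\<^bsub>A\<^esub> (b \<odot>\<^bsub>A\<^esub> v)"
    "\<And>a b v. a \<in> carrier K \<Longrightarrow> b \<in> carrier K \<Longrightarrow> v \<in> carrier A \<Longrightarrow> (a \<oplus>\<^bsub>K\<^esub> b) \<odot>\<^bsub>A\<^esub> v = a \<odot>\<^bsub>A\<^esub> v \<oplus>\<^bsub>A\<^esub> b \<odot>\<^bsub>A\<^esub> v"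
    "\<And>a v w. a \<in> carrier K \<Longrightarrow> v \<in> carrier A \<Longrightarrow> w \<in> carrier A \<Longrightarrow> a \<odot>\<^bsub>A\<^esub> (v \<oplus>\<^bsub>A\<^esub> w) = a \<odot>\<^bsub>A\<^esub> v \<oplus>\<^bsub>A\<^esub> a \<odot>\<^bsub>A\<^esub> w"
    by (rule eq; simp add: cl h hc B.M.add.m_ac B.smult_assoc1 B.smult_l_distr B.smult_r_distr)+
  have vs: "vectorspace K A"
  proof (rule vs_criteria)
    show "\<forall>v\<in>carrier A. \<exists>neg_v\<in>carrier A. v \<oplus>\<^bsub>A\<^esub> neg_v = \<zero>\<^bsub>A\<^esub>"
    proof
      fix v assume v: "v \<in> carrier A"
      have "v \<oplus>\<^bsub>A\<^esub> (\<ominus>\<^bsub>K\<^esub> \<one>\<^bsub>K\<^esub>) \<odot>\<^bsub>A\<^esub> v = \<zero>\<^bsub>A\<^esub>"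
        by (rule eq) (use v hc[OF v] in \<open>simp_all add: cl h hc B.smult_minus_1 B.M.r_neg\<close>)
      then show "\<exists>neg_v\<in>carrier A. v \<oplus>\<^bsub>A\<^esub> neg_v = \<zero>\<^bsub>A\<^esub>" using v cl(3) by (metis B.R.add.inv_closed B.R.one_closed)
    qed
  qed (((intro allI ballI impI)?; (elim conjE)?; (rule B.field_axioms cl es; assumption?))+)
  show ?thesis
  proof (rule assoc_algI[OF vs])
    show "(\<lambda>y. x \<otimes>\<^bsub>A\<^esub> y) \<in> module_hom K A A" if "x \<in> carrier A" for x
      by (rule module_homI; (rule eq)?) (simp_all add: that cl h hc B.A.r_distr B.smult_mult_right)
    show "(\<lambda>x. x \<otimes>\<^bsub>A\<^esub> y) \<in> module_hom K A A" if "y \<in> carrier A" for y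
      by (rule module_homI; (rule eq)?) (simp_all add: that cl h hc B.A.l_distr B.smult_mult_left)
  qed (simp add: cl, (rule eq; simp add: cl h hc B.A.m_assoc)+)
qed

section \<open>Bialgebra identities\<close>

text \<open>Makes both sides of a bialgebra identity algebra maps on \<open>U\<close>, so that
  \<open>U_algebra_hom_eq\<close> reduces the identity to generators.\<close>

lemma tensor_map_algebra_hom:
  assumes A: "assoc_alg K A" "assoc_alg K B" "assoc_alg K A'" "assoc_alg K B'"
    and f: "f \<in> algebra_hom K A A'" and g: "g \<in> algebra_hom K B B'"
  shows "tensor_map K A' B' f g \<in> algebra_hom K (tensor K A B) (tensor K A' B')"
proof -
  interpret A: assoc_alg K A by fact
  interpret B: assoc_alg K B by fact
  interpret A': assoc_alg K A' by fact
  interpret B': assoc_alg K B' by fact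
  note vs = A.vectorspace_axioms B.vectorspace_axioms A'.vectorspace_axioms B'.vectorspace_axioms
  note fh = algebra_homD(1)[OF f] and gh = algebra_homD(1)[OF g]
  note h = tensor_map_hom[OF vs fh gh]
  note t = tensor_map_tens[OF vs fh gh]
  show ?thesis
  proof (rule algebra_homI[OF h])
    show "tensor_map K A' B' f g \<one>\<^bsub>tensor K A B\<^esub> = \<one>\<^bsub>tensor K A' B'\<^esub>"
      unfolding tens_one[OF A(1,2)] tens_one[OF A(3,4)] t[OF A.A.one_closed B.A.one_closed]
        algebra_homD(4)[OF f] algebra_homD(4)[OF g] ..
    show "tensor_map K A' B' f g (x \<otimes>\<^bsub>tensor K A B\<^esub> y) = tensor_map K A' B' f g x \<otimes>\<^bsub>tensor K A' B'\<^esub> tensor_map K A' B' f g y"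
      if "x \<in> carrier (tensor K A B)" "y \<in> carrier (tensor K A B)" for x y
      by (rule tensor_mult_hom[OF A(1,2) tensor_assoc_alg[OF A(3,4)] h _ that])
        (simp add: t algebra_homD(2,3)[OF f] algebra_homD(2,3)[OF g] tens_mult[OF A(3,4)])
  qed
qed

lemma tensor_assoc_algebra_hom:
  assumes A: "assoc_alg K A" "assoc_alg K B" "assoc_alg K C"
  shows "tensor_assoc K A B C \<in> algebra_hom K (tensor K (tensor K A B) C) (tensor K A (tensor K B C))"
proof -
  interpret A: assoc_alg K A by fact
  interpret B: assoc_alg K B by fact
  interpret C: assoc_alg K C by fact
  note AB' = tensor_assoc_alg[OF A(1,2)] and BC' = tensor_assoc_alg[OF A(2,3)]
  interpret AB: assoc_alg K "tensor K A B" by (rule AB')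
  interpret BC: assoc_alg K "tensor K B C" by (rule BC')
  interpret T: assoc_alg K "tensor K A (tensor K B C)" by (rule tensor_assoc_alg[OF A(1) BC'])
  note vs = A.vectorspace_axioms B.vectorspace_axioms C.vectorspace_axioms
  let ?T = "tensor K A (tensor K B C)" and ?f = "tensor_assoc K A B C" and ?t = "tens K (tensor K A B) C"
  note h = tensor_assoc_hom[OF vs]
  note tt = tensor_assoc_tens[OF vs]
  note cAB = bilinearD(3)[OF tens_bilinear[OF vs(1,2)]] and cBC = bilinearD(3)[OF tens_bilinear[OF vs(2,3)]]
    and cABC = bilinearD(3)[OF tens_bilinear[OF vs(1) BC.vectorspace_axioms]]
  note bt = tens_bilinear[OF AB.vectorspace_axioms vs(3)]
  have g: "(\<lambda>s. ?f (?t s c)) \<in> module_hom K (tensor K A B) ?T" if "c \<in> carrier C" for c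
    by (rule hom_comp[OF bilinearD(2)[OF bt that] h])
  \<comment> \<open>Tensors in \<open>A \<otimes> B\<close> are reduced to elementary ones
    separately: \<open>s'\<close> here, \<open>s\<close> in \<open>m2\<close>.\<close>
  have m1: "?f (?t (tens K A B a b \<otimes>\<^bsub>tensor K A B\<^esub> s') (c \<otimes>\<^bsub>C\<^esub> c')) = ?f (?t (tens K A B a b) c) \<otimes>\<^bsub>?T\<^esub> ?f (?t s' c')"
    if "a \<in> carrier A" "b \<in> carrier B" "c \<in> carrier C" "c' \<in> carrier C" "s' \<in> carrier (tensor K A B)" for a b c c' s'
    by (rule tensor_hom_eq[OF vs(1,2) T.vectorspace_axioms hom_comp[OF AB.mult_hom_right g]
          hom_comp[OF g T.mult_hom_right] _ that(5)])
      (simp_all add: that tt cAB cBC cABC tens_mult[OF A(1,2)] tens_mult[OF A(1) BC'] tens_mult[OF A(2,3)]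
        hom_closed[OF g])
  have m2: "?f (?t (s \<otimes>\<^bsub>tensor K A B\<^esub> s') (c \<otimes>\<^bsub>C\<^esub> c')) = ?f (?t s c) \<otimes>\<^bsub>?T\<^esub> ?f (?t s' c')"
    if "s \<in> carrier (tensor K A B)" "s' \<in> carrier (tensor K A B)" "c \<in> carrier C" "c' \<in> carrier C" for s s' c c'
    by (rule tensor_hom_eq[OF vs(1,2) T.vectorspace_axioms hom_comp[OF AB.mult_hom_left g]
          hom_comp[OF g T.mult_hom_left] _ that(1)])
      (simp_all add: that m1 hom_closed[OF g])
  show ?thesis
  proof (rule algebra_homI[OF h])
    show "?f \<one>\<^bsub>tensor K (tensor K A B) C\<^esub> = \<one>\<^bsub>?T\<^esub>"
      unfolding tens_one[OF AB' A(3)] tens_one[OF A(1,2)] tens_one[OF A(1) BC'] tens_one[OF A(2,3)]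
      by (rule tt) simp_all
    show "?f (x \<otimes>\<^bsub>tensor K (tensor K A B) C\<^esub> y) = ?f x \<otimes>\<^bsub>?T\<^esub> ?f y"
      if "x \<in> carrier (tensor K (tensor K A B) C)" "y \<in> carrier (tensor K (tensor K A B) C)" for x y
      by (rule tensor_mult_hom[OF AB' A(3) T.assoc_alg_axioms h _ that]) (rule m2)
  qed
qed

lemma algebra_hom_comp:
  "f \<in> algebra_hom K A B \<Longrightarrow> g \<in> algebra_hom K B C \<Longrightarrow> (\<lambda>x. g (f x)) \<in> algebra_hom K A C"
  by (rule algebra_homI[OF hom_comp[OF algebra_homD(1) algebra_homD(1)]]) (simp_all add: algebra_homD)

lemma algebra_hom_id: "id \<in> algebra_hom K A A" "(\<lambda>x. x) \<in> algebra_hom K A A"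
  by (rule algebra_homI; simp add: hom_id)+

definition flip where
  "flip K V W = induced_map K (tensor K W V) (\<lambda>(v, w). tens K W V w v)"

lemma flip_bilinear:
  assumes "vectorspace K V" "vectorspace K W"
  shows "bilinear_map K V W (tensor K W V) (\<lambda>v w. tens K W V w v)"
  using tens_bilinear[OF assms(2,1)] by (simp add: bilinear_map_def)

lemma flip_hom:
  assumes "vectorspace K V" "vectorspace K W"
  shows "flip K V W \<in> module_hom K (tensor K V W) (tensor K W V)"
  unfolding flip_def by (rule induced_map_hom[OF assms tensor_vectorspace[OF assms(2,1)] flip_bilinear[OF assms]])

lemma flip_tens:
  assumes "vectorspace K V" "vectorspace K W" "v \<in> carrier V" "w \<in> carrier W"
  shows "flip K V W (tens K V W v w) = tens K W V w v"
  unfolding flip_def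
  by (rule induced_map_tens[OF assms(1,2) tensor_vectorspace[OF assms(2,1)] flip_bilinear[OF assms(1,2)] assms(3,4)])

lemma flip_algebra_hom:
  assumes A: "assoc_alg K A" "assoc_alg K B"
  shows "flip K A B \<in> algebra_hom K (tensor K A B) (tensor K B A)"
proof -
  interpret A: assoc_alg K A by fact
  interpret B: assoc_alg K B by fact
  note vs = A.vectorspace_axioms B.vectorspace_axioms
  show ?thesis
  proof (rule algebra_homI[OF flip_hom[OF vs]])
    show "flip K A B \<one>\<^bsub>tensor K A B\<^esub> = \<one>\<^bsub>tensor K B A\<^esub>"
      unfolding tens_one[OF A] tens_one[OF A(2,1)] by (rule flip_tens[OF vs A.A.one_closed B.A.one_closed])
    show "flip K A B (x \<otimes>\<^bsub>tensor K A B\<^esub> y) = flip K A B x \<otimes>\<^bsub>tensor K B A\<^esub> flip K A B y"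
      if "x \<in> carrier (tensor K A B)" "y \<in> carrier (tensor K A B)" for x y
      by (rule tensor_mult_hom[OF A tensor_assoc_alg[OF A(2,1)] flip_hom[OF vs] _ that])
        (simp add: flip_tens[OF vs] tens_mult[OF A(2,1)])
  qed
qed

context lie_algebra begin

abbreviation "\<epsilon> \<equiv> env_counit K"

lemmas vsU = U.vectorspace_axioms
lemmas UU_hom_eq = tensor_hom_eq[OF vsU vsU]

lemma counit_closed: "u \<in> carrier U \<Longrightarrow> \<epsilon> u \<in> carrier K"
  using algebra_homD(2)[OF counit(1)] by (simp add: ground_algebra_def)

lemma counit_simps:
  "u \<in> carrier U \<Longrightarrow> v \<in> carrier U \<Longrightarrow> \<epsilon> (u \<oplus>\<^bsub>U\<^esub> v) = \<epsilon> u \<oplus>\<^bsub>K\<^esub> \<epsilon> v"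
  "u \<in> carrier U \<Longrightarrow> v \<in> carrier U \<Longrightarrow> \<epsilon> (u \<otimes>\<^bsub>U\<^esub> v) = \<epsilon> u \<otimes>\<^bsub>K\<^esub> \<epsilon> v"
  "c \<in> carrier K \<Longrightarrow> u \<in> carrier U \<Longrightarrow> \<epsilon> (c \<odot>\<^bsub>U\<^esub> u) = c \<otimes>\<^bsub>K\<^esub> \<epsilon> u"
  "\<epsilon> \<one>\<^bsub>U\<^esub> = \<one>\<^bsub>K\<^esub>"
  using algebra_homD[OF counit(1)] by (simp_all add: ground_algebra_def)

lemma counit_bilinear_left:
  assumes "vectorspace K Z" shows "bilinear_map K U Z Z (\<lambda>a b. \<epsilon> a \<odot>\<^bsub>Z\<^esub> b)"
proof -
  interpret Z: vectorspace K Z by fact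
  show ?thesis
    by (rule bilinearI) (simp_all add: counit_closed counit_simps Z.smult_l_distr Z.smult_r_distr Z.smult_assoc1[symmetric] R.m_comm)
qed

lemma counit_bilinear_right:
  assumes "vectorspace K Z" shows "bilinear_map K Z U Z (\<lambda>b a. \<epsilon> a \<odot>\<^bsub>Z\<^esub> b)"
  using counit_bilinear_left[OF assms] by (simp add: bilinear_map_def)

lemmas counit_left_hom = induced_map_hom[OF vsU vsU vsU counit_bilinear_left[OF vsU]]
lemmas counit_left_tens = induced_map_tens[OF vsU vsU vsU counit_bilinear_left[OF vsU]]
lemmas counit_right_hom = induced_map_hom[OF vsU vsU vsU counit_bilinear_right[OF vsU]]
lemmas counit_right_tens = induced_map_tens[OF vsU vsU vsU counit_bilinear_right[OF vsU]]

lemma smult_mult_smult: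
  "c \<in> carrier K \<Longrightarrow> c' \<in> carrier K \<Longrightarrow> u \<in> carrier U \<Longrightarrow> v \<in> carrier U \<Longrightarrow>
    (c \<odot>\<^bsub>U\<^esub> u) \<otimes>\<^bsub>U\<^esub> (c' \<odot>\<^bsub>U\<^esub> v) = (c \<otimes>\<^bsub>K\<^esub> c') \<odot>\<^bsub>U\<^esub> (u \<otimes>\<^bsub>U\<^esub> v)"
  by (simp add: U.smult_mult_left U.smult_mult_right U.smult_assoc1[symmetric] R.m_comm)

text \<open>The composite is an algebra map; on a generator it gives
  \<open>\<epsilon>(x) 1 + \<epsilon>(1) x = x\<close>.\<close>

lemma coproduct_counit_left:
  assumes u: "u \<in> carrier U"
  shows "induced_map K U (\<lambda>(a, b). \<epsilon> a \<odot>\<^bsub>U\<^esub> b) (\<Delta> u) = u"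
proof -
  let ?f = "induced_map K U (\<lambda>(a, b). \<epsilon> a \<odot>\<^bsub>U\<^esub> b)"
  have "?f \<in> algebra_hom K UU U"
  proof (rule algebra_homI[OF counit_left_hom])
    show "?f \<one>\<^bsub>UU\<^esub> = \<one>\<^bsub>U\<^esub>"
      unfolding tens_one[OF U_assoc_alg U_assoc_alg] by (simp add: counit_left_tens counit_simps)
    show "?f (x \<otimes>\<^bsub>UU\<^esub> y) = ?f x \<otimes>\<^bsub>U\<^esub> ?f y" if "x \<in> carrier UU" "y \<in> carrier UU" for x y
      by (rule tensor_mult_hom[OF U_assoc_alg U_assoc_alg U_assoc_alg counit_left_hom _ that])
        (simp add: counit_left_tens counit_simps counit_closed smult_mult_smult)
  qed
  from algebra_hom_comp[OF coproduct_hom this] show ?thesis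
    by (rule U_algebra_hom_eq[OF U_assoc_alg _ algebra_hom_id(2) _ u])
      (simp add: coproduct_\<iota> primitive_def hom_add[OF counit_left_hom] UU_closed \<iota>_closed counit_left_tens counit counit_simps)
qed

text \<open>Both sides are algebra maps, and primitive elements are symmetric. This yields the right
  counit law and, later, the right coaction from the left one.\<close>

lemma coproduct_cocommutative:
  assumes u: "u \<in> carrier U" shows "flip K U U (\<Delta> u) = \<Delta> u"
  by (rule U_algebra_hom_eq[OF UU_assoc_alg algebra_hom_comp[OF coproduct_hom flip_algebra_hom[OF U_assoc_alg U_assoc_alg]] coproduct_hom _ u])
    (simp add: coproduct_\<iota> primitive_def hom_add[OF flip_hom[OF vsU vsU]] UU_closed \<iota>_closed flip_tens[OF vsU vsU] UU.M.add.m_comm)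

lemma coproduct_counit_right:
  assumes u: "u \<in> carrier U"
  shows "induced_map K U (\<lambda>(a, b). \<epsilon> b \<odot>\<^bsub>U\<^esub> a) (\<Delta> u) = u"
proof -
  have "induced_map K U (\<lambda>(a, b). \<epsilon> b \<odot>\<^bsub>U\<^esub> a) X = induced_map K U (\<lambda>(a, b). \<epsilon> a \<odot>\<^bsub>U\<^esub> b) (flip K U U X)" if "X \<in> carrier UU" for X
    by (rule UU_hom_eq[OF vsU counit_right_hom hom_comp[OF flip_hom[OF vsU vsU] counit_left_hom] _ that])
      (simp add: counit_left_tens counit_right_tens flip_tens[OF vsU vsU])
  then show ?thesis
    using algebra_homD(2)[OF coproduct_hom u] coproduct_cocommutative[OF u] coproduct_counit_left[OF u] by simp
qed

text \<open>Both sides are algebra maps in \<open>u\<close>. On a generator each is the sum of the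
  three ways of placing \<open>x\<close> in one tensor factor and the unit in the others.\<close>

lemma coproduct_coassoc:
  assumes u: "u \<in> carrier U"
  shows "tensor_assoc K U U U (tensor_map K UU U \<Delta> id (\<Delta> u)) = tensor_map K U UU id \<Delta> (\<Delta> u)"
proof -
  note a = U_assoc_alg and aa = UU_assoc_alg
  note L = tensor_map_algebra_hom[OF a a aa a coproduct_hom algebra_hom_id(1)]
  note R = tensor_map_algebra_hom[OF a a a aa algebra_hom_id(1) coproduct_hom]
  note \<Delta>h = algebra_homD(1)[OF coproduct_hom]
  note vUU = UU.vectorspace_axioms
  note tl = tensor_map_tens[OF vsU vsU vUU vsU \<Delta>h hom_id(2)]
  note tr = tensor_map_tens[OF vsU vsU vsU vUU hom_id(2) \<Delta>h]
  note ta = tensor_assoc_tens[OF vsU vsU vsU]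
  note bl = bilinearD(4)[OF tens_bilinear[OF vUU vsU]] and br = bilinearD(5)[OF tens_bilinear[OF vsU vUU]]
  note cl = bilinearD(3)[OF tens_bilinear[OF vUU vsU]] bilinearD(3)[OF tens_bilinear[OF vsU vUU]]
  interpret T: assoc_alg K "tensor K U UU" by (rule tensor_assoc_alg[OF a aa])
  interpret T': assoc_alg K "tensor K UU U" by (rule tensor_assoc_alg[OF aa a])
  have one: "\<one>\<^bsub>UU\<^esub> = tens K U U \<one>\<^bsub>U\<^esub> \<one>\<^bsub>U\<^esub>" by (rule tens_one[OF a a])
  show ?thesis
  proof (rule U_algebra_hom_eq[OF tensor_assoc_alg[OF a aa]
        algebra_hom_comp[OF coproduct_hom algebra_hom_comp[OF L tensor_assoc_algebra_hom[OF a a a]]]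
        algebra_hom_comp[OF coproduct_hom R] _ u])
    fix x assume x: "x \<in> carrier M"
    note c = \<iota>_closed[OF x] U.A.one_closed
    have "tensor_map K UU U \<Delta> id (\<Delta> (\<iota> x)) = tens K UU U (tens K U U (\<iota> x) \<one>\<^bsub>U\<^esub>) \<one>\<^bsub>U\<^esub> \<oplus>\<^bsub>tensor K UU U\<^esub> tens K UU U (tens K U U \<one>\<^bsub>U\<^esub> (\<iota> x)) \<one>\<^bsub>U\<^esub>
        \<oplus>\<^bsub>tensor K UU U\<^esub> tens K UU U (tens K U U \<one>\<^bsub>U\<^esub> \<one>\<^bsub>U\<^esub>) (\<iota> x)"
      using x c by (simp add: coproduct_\<iota> primitive_def algebra_homD(5)[OF L] UU_closed tl bl algebra_homD(4)[OF coproduct_hom] one)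
    then have "tensor_assoc K U U U (tensor_map K UU U \<Delta> id (\<Delta> (\<iota> x)))
        = tens K U UU (\<iota> x) (tens K U U \<one>\<^bsub>U\<^esub> \<one>\<^bsub>U\<^esub>) \<oplus>\<^bsub>tensor K U UU\<^esub> tens K U UU \<one>\<^bsub>U\<^esub> (tens K U U (\<iota> x) \<one>\<^bsub>U\<^esub>)
          \<oplus>\<^bsub>tensor K U UU\<^esub> tens K U UU \<one>\<^bsub>U\<^esub> (tens K U U \<one>\<^bsub>U\<^esub> (\<iota> x))"
      using c by (simp add: hom_add[OF tensor_assoc_hom[OF vsU vsU vsU]] UU_closed cl ta)
    also have "\<dots> = tensor_map K U UU id \<Delta> (\<Delta> (\<iota> x))"
      using x c by (simp add: coproduct_\<iota> primitive_def algebra_homD(5)[OF R] UU_closed tr br cl algebra_homD(4)[OF coproduct_hom] one T.M.add.m_assoc)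
    finally show "tensor_assoc K U U U (tensor_map K UU U \<Delta> id (\<Delta> (\<iota> x))) = tensor_map K U UU id \<Delta> (\<Delta> (\<iota> x))" .
  qed
qed

end

section \<open>The bimodule of a pre-Lie structure\<close>

lemma (in abelian_monoid) finsum_lessThan_Suc_shift:
  assumes "\<And>i. i < Suc n \<Longrightarrow> f i \<in> carrier G"
  shows "(\<Oplus>i\<in>{..<Suc n}. f i) = f 0 \<oplus> (\<Oplus>i\<in>{..<n}. f (Suc i))"
proof -
  have "(\<Oplus>i\<in>{..<Suc n}. f i) = (\<Oplus>i\<in>insert 0 (Suc ` {..<n}). f i)" by (simp only: lessThan_Suc_eq_insert_0)
  also have "\<dots> = f 0 \<oplus> (\<Oplus>i\<in>Suc ` {..<n}. f i)"
    by (rule finsum_insert) (use assms in auto)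
  also have "(\<Oplus>i\<in>Suc ` {..<n}. f i) = (\<Oplus>i\<in>{..<n}. f (Suc i))"
    by (rule finsum_reindex) (use assms in auto)
  finally show ?thesis .
qed

locale pre_lie_coords = lie_algebra K M br + coords K M n e co for K M br n e co +
  fixes pl :: "'c \<Rightarrow> 'c \<Rightarrow> 'c"
  assumes pre_lie: "pre_lie_structure K M br pl"
begin

lemma pl_bilinear: "bilinear_map K M M M pl"
  and pl_assoc: "x \<in> carrier M \<Longrightarrow> y \<in> carrier M \<Longrightarrow> z \<in> carrier M \<Longrightarrow>
    pl (pl x y) z \<ominus>\<^bsub>M\<^esub> pl (pl y x) z = pl x (pl y z) \<ominus>\<^bsub>M\<^esub> pl y (pl x z)"
  and pl_br: "x \<in> carrier M \<Longrightarrow> y \<in> carrier M \<Longrightarrow> pl x y \<ominus>\<^bsub>M\<^esub> pl y x = br x y"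
  using pre_lie by (auto simp: pre_lie_structure_def)

lemmas pl_closed = bilinearD(3)[OF pl_bilinear]

lemma pl_neg_right: "x \<in> carrier M \<Longrightarrow> y \<in> carrier M \<Longrightarrow> pl x (\<ominus>\<^bsub>M\<^esub> y) = \<ominus>\<^bsub>M\<^esub> pl x y"
  by (rule hom_neg[OF bilinearD(1)[OF pl_bilinear] vectorspace_axioms vectorspace_axioms])

text \<open>The pre-Lie axiom restated: left multiplication by \<open>\<circ>\<close> is a
  representation of the Lie algebra on itself.\<close>

lemma pl_rep: "x \<in> carrier M \<Longrightarrow> y \<in> carrier M \<Longrightarrow> z \<in> carrier M \<Longrightarrow>
    pl x (pl y z) \<ominus>\<^bsub>M\<^esub> pl y (pl x z) = pl (br x y) z"
  using hom_minus[OF bilinearD(2)[OF pl_bilinear] vectorspace_axioms vectorspace_axioms, of z "pl x y" "pl y x"]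
  by (simp add: pl_br pl_assoc pl_closed)

lemma neg_hom: "(\<lambda>v. \<ominus>\<^bsub>M\<^esub> v) \<in> module_hom K M M"
  by (rule module_homI) (simp_all add: M.minus_add smult_r_minus)

abbreviation "N \<equiv> Suc n"

text \<open>The right module \<open>K \<oplus> \<mm>\<close> of row vectors on which \<open>x\<close> acts by \<open>1 \<mapsto> x\<close> and \<open>y \<mapsto> - x \<circ> y\<close>:
  \<open>row x i\<close> is the image of the \<open>i\<close>-th basis vector, all images lying in \<open>\<mm>\<close>.\<close>

definition row :: "'c \<Rightarrow> nat \<Rightarrow> 'c" where
  "row x i = (case i of 0 \<Rightarrow> x | Suc l \<Rightarrow> \<ominus>\<^bsub>M\<^esub> pl x (e l))"

text \<open>The matrix of the action of \<open>x\<close> in coordinates: index \<open>0\<close>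
  belongs to the unit and \<open>Suc k\<close> to the basis vector \<open>e k\<close>. Column
  \<open>0\<close> vanishes because all images lie in the Lie algebra.\<close>

definition entry :: "'c \<Rightarrow> nat \<Rightarrow> nat \<Rightarrow> 'a" where
  "entry x i j = (case j of 0 \<Rightarrow> \<zero>\<^bsub>K\<^esub> | Suc k \<Rightarrow> co k (row x i))"

lemma row_hom: "(\<lambda>x. row x i) \<in> module_hom K M M"
proof (cases i)
  case 0 then show ?thesis by (simp add: row_def hom_id)
next
  case (Suc l) then show ?thesis
    using hom_comp[OF bilinearD(2)[OF pl_bilinear e_closed] neg_hom] by (simp add: row_def)
qed

lemmas row_closed = hom_closed[OF row_hom]

lemma entry_closed: "x \<in> carrier M \<Longrightarrow> entry x i j \<in> carrier K"
  by (cases j) (simp_all add: entry_def co_closed row_closed)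

lemma entry_add: "x \<in> carrier M \<Longrightarrow> y \<in> carrier M \<Longrightarrow> entry (x \<oplus>\<^bsub>M\<^esub> y) i j = entry x i j \<oplus>\<^bsub>K\<^esub> entry y i j"
  by (cases j) (simp_all add: entry_def co_add row_closed hom_add[OF row_hom])

lemma entry_smult: "c \<in> carrier K \<Longrightarrow> x \<in> carrier M \<Longrightarrow> entry (c \<odot>\<^bsub>M\<^esub> x) i j = c \<otimes>\<^bsub>K\<^esub> entry x i j"
  by (cases j) (simp_all add: entry_def co_smult row_closed hom_smult[OF row_hom])

lemma entry_hom: "(\<lambda>x. entry x i j \<odot>\<^bsub>U\<^esub> u) \<in> module_hom K M U" if "u \<in> carrier U"
  by (rule module_homI) (simp_all add: that entry_closed entry_add entry_smult U.smult_l_distr U.smult_assoc1)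

text \<open>The right module law: acting by \<open>x\<close> and then \<open>y\<close>, minus the
  other order, is acting by the bracket. At \<open>i = 0\<close> it is \<open>pl_br\<close>,
  elsewhere it is \<open>pl_rep\<close>, whose order the minus sign in \<open>row\<close>
  reverses.\<close>

lemma row_br:
  assumes x: "x \<in> carrier M" and y: "y \<in> carrier M"
  shows "\<ominus>\<^bsub>M\<^esub> pl y (row x i) \<ominus>\<^bsub>M\<^esub> \<ominus>\<^bsub>M\<^esub> pl x (row y i) = row (br x y) i"
proof (cases i)
  case 0
  then show ?thesis
    using x y pl_br[OF x y] by (simp add: row_def a_minus_def pl_closed M.add.m_comm)
next
  case (Suc l)
  have "\<ominus>\<^bsub>M\<^esub> pl (br x y) (e l) = pl y (pl x (e l)) \<ominus>\<^bsub>M\<^esub> pl x (pl y (e l))"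
    using x y e_closed[of l] unfolding pl_rep[OF x y e_closed, symmetric]
    by (simp add: a_minus_def pl_closed M.minus_add M.add.m_comm)
  then show ?thesis
    using Suc x y e_closed[of l] by (simp add: row_def pl_neg_right pl_closed)
qed

text \<open>The term \<open>k = 0\<close> of the matrix product drops out, and the rest is the
  coordinate expansion of the action of \<open>y\<close> on \<open>row x i\<close>.\<close>

lemma entry_product:
  assumes x: "x \<in> carrier M" and y: "y \<in> carrier M"
  shows "(\<Oplus>\<^bsub>K\<^esub>k\<in>{..<N}. entry x i k \<otimes>\<^bsub>K\<^esub> entry y k (Suc m)) = co m (\<ominus>\<^bsub>M\<^esub> pl y (row x i))"
proof -
  have cl: "entry x i k \<otimes>\<^bsub>K\<^esub> entry y k (Suc m) \<in> carrier K" for k by (simp add: entry_closed x y)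
  have "(\<Oplus>\<^bsub>K\<^esub>k\<in>{..<N}. entry x i k \<otimes>\<^bsub>K\<^esub> entry y k (Suc m))
      = entry x i 0 \<otimes>\<^bsub>K\<^esub> entry y 0 (Suc m) \<oplus>\<^bsub>K\<^esub> (\<Oplus>\<^bsub>K\<^esub>l\<in>{..<n}. entry x i (Suc l) \<otimes>\<^bsub>K\<^esub> entry y (Suc l) (Suc m))"
    by (rule R.finsum_lessThan_Suc_shift[OF cl])
  also have "\<dots> = (\<Oplus>\<^bsub>K\<^esub>l\<in>{..<n}. co l (row x i) \<otimes>\<^bsub>K\<^esub> co m (\<ominus>\<^bsub>M\<^esub> pl y (e l)))"
    using entry_closed[OF y, of 0 "Suc m"] R.finsum_closed[of "\<lambda>l. co l (row x i) \<otimes>\<^bsub>K\<^esub> co m (\<ominus>\<^bsub>M\<^esub> pl y (e l))" "{..<n}"]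
    by (simp add: entry_def row_def[of y] co_closed row_closed x y pl_closed e_closed)
  also have "\<dots> = co m (\<ominus>\<^bsub>M\<^esub> pl y (row x i))"
    using hom_expand[OF field_vectorspace[OF field_axioms] hom_comp[OF hom_comp[OF bilinearD(1)[OF pl_bilinear y] neg_hom] co_hom] row_closed[OF x]]
    unfolding finsum_ground by (simp add: ground_algebra_def)
  finally show ?thesis .
qed

lemma entry_br:
  assumes x: "x \<in> carrier M" and y: "y \<in> carrier M"
  shows "(\<Oplus>\<^bsub>K\<^esub>k\<in>{..<N}. entry x i k \<otimes>\<^bsub>K\<^esub> entry y k j) \<ominus>\<^bsub>K\<^esub> (\<Oplus>\<^bsub>K\<^esub>k\<in>{..<N}. entry y i k \<otimes>\<^bsub>K\<^esub> entry x k j) = entry (br x y) i j"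
proof (cases j)
  case 0
  have "(\<Oplus>\<^bsub>K\<^esub>k\<in>{..<N}. entry a i k \<otimes>\<^bsub>K\<^esub> entry b k 0) = \<zero>\<^bsub>K\<^esub>" if "a \<in> carrier M" for a b
    using entry_closed[OF that] by (simp add: entry_def[of b])
  then show ?thesis using x y 0 by (simp add: entry_def[of "br x y"] a_minus_def)
next
  case (Suc m)
  have g: "vectorspace K (ground_algebra K)" by (rule field_vectorspace[OF field_axioms])
  have "co m (\<ominus>\<^bsub>M\<^esub> pl y (row x i)) \<ominus>\<^bsub>ground_algebra K\<^esub> co m (\<ominus>\<^bsub>M\<^esub> pl x (row y i)) = co m (row (br x y) i)"
    unfolding row_br[OF x y, symmetric]
    by (rule hom_minus[OF co_hom vectorspace_axioms g, symmetric]) (simp_all add: x y pl_closed row_closed)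
  moreover have "a \<ominus>\<^bsub>ground_algebra K\<^esub> b = a \<ominus>\<^bsub>K\<^esub> b" for a b
    by (simp add: ground_algebra_def a_minus_def a_inv_def m_inv_def)
  ultimately show ?thesis using Suc x y by (simp add: entry_product entry_def[of "br x y"])
qed

section \<open>The matrix representation of the enveloping algebra\<close>

abbreviation "Mat \<equiv> matrix_algebra U N"

lemmas Mat_assoc = U.Mat_assoc_alg[of N]

sublocale Mat: assoc_alg K Mat by (rule Mat_assoc)

text \<open>Left multiplication by \<open>x\<close> sits on the diagonal and the scalar action is
  added to it: row \<open>Suc l\<close> reads \<open>d e_l x = x d e_l - d (x \<circ> e_l)\<close>,
  and row \<open>0\<close> holds \<open>x\<close> and the coordinates of \<open>dx\<close>.\<close>

definition gen :: "'c \<Rightarrow> nat \<Rightarrow> nat \<Rightarrow> ('a, 'c) env" where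
  "gen x i j = (if i < N \<and> j < N then (if i = j then \<iota> x else \<zero>\<^bsub>U\<^esub>) \<oplus>\<^bsub>U\<^esub> entry x i j \<odot>\<^bsub>U\<^esub> \<one>\<^bsub>U\<^esub> else \<zero>\<^bsub>U\<^esub>)"

lemma gen_hom: "gen \<in> module_hom K M Mat"
proof (rule U.Mat_homI)
  show "(\<lambda>x. gen x i j) \<in> module_hom K M U" for i j
    by (cases "i < N"; cases "j < N"; cases "i = j")
      (simp_all add: gen_def hom_zero_map[OF vsU] hom_add_maps[OF vsU \<iota>_hom entry_hom[OF U.A.one_closed]]
        hom_add_maps[OF vsU hom_zero_map[OF vsU] entry_hom[OF U.A.one_closed]])
qed (auto simp: gen_def)

lemma gen_closed: "x \<in> carrier M \<Longrightarrow> gen x \<in> carrier Mat"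
  by (rule hom_closed[OF gen_hom])

lemma mult_gen:
  assumes f: "f \<in> carrier Mat" and x: "x \<in> carrier M" and j: "j < N"
  shows "(f \<otimes>\<^bsub>Mat\<^esub> gen x) i j = f i j \<otimes>\<^bsub>U\<^esub> \<iota> x \<oplus>\<^bsub>U\<^esub> (\<Oplus>\<^bsub>U\<^esub>k\<in>{..<N}. entry x k j \<odot>\<^bsub>U\<^esub> f i k)"
proof -
  have c: "f i k \<in> carrier U" for k using f by (simp add: U.mem_Mat)
  have "(f \<otimes>\<^bsub>Mat\<^esub> gen x) i j = (\<Oplus>\<^bsub>U\<^esub>k\<in>{..<N}. (if j = k then f i k \<otimes>\<^bsub>U\<^esub> \<iota> x else \<zero>\<^bsub>U\<^esub>) \<oplus>\<^bsub>U\<^esub> entry x k j \<odot>\<^bsub>U\<^esub> f i k)"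
    unfolding U.Mat_ops
    by (rule U.M.finsum_cong'[OF refl])
      (use c j x in \<open>auto simp: gen_def \<iota>_closed entry_closed U.A.r_distr U.smult_mult_right\<close>)
  also have "\<dots> = (\<Oplus>\<^bsub>U\<^esub>k\<in>{..<N}. if j = k then f i k \<otimes>\<^bsub>U\<^esub> \<iota> x else \<zero>\<^bsub>U\<^esub>) \<oplus>\<^bsub>U\<^esub> (\<Oplus>\<^bsub>U\<^esub>k\<in>{..<N}. entry x k j \<odot>\<^bsub>U\<^esub> f i k)"
    by (rule U.M.finsum_addf) (use c x in \<open>auto simp: \<iota>_closed entry_closed\<close>)
  also have "(\<Oplus>\<^bsub>U\<^esub>k\<in>{..<N}. if j = k then f i k \<otimes>\<^bsub>U\<^esub> \<iota> x else \<zero>\<^bsub>U\<^esub>) = f i j \<otimes>\<^bsub>U\<^esub> \<iota> x"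
    by (rule U.M.finsum_singleton) (use c x j in \<open>auto simp: \<iota>_closed\<close>)
  finally show ?thesis .
qed

lemma gen_mult:
  assumes x: "x \<in> carrier M" and y: "y \<in> carrier M" and i: "i < N" and j: "j < N"
  shows "(gen x \<otimes>\<^bsub>Mat\<^esub> gen y) i j =
    ((if i = j then \<iota> x \<otimes>\<^bsub>U\<^esub> \<iota> y else \<zero>\<^bsub>U\<^esub>) \<oplus>\<^bsub>U\<^esub> entry x i j \<odot>\<^bsub>U\<^esub> \<iota> y) \<oplus>\<^bsub>U\<^esub>
    (entry y i j \<odot>\<^bsub>U\<^esub> \<iota> x \<oplus>\<^bsub>U\<^esub> (\<Oplus>\<^bsub>K\<^esub>k\<in>{..<N}. entry x i k \<otimes>\<^bsub>K\<^esub> entry y k j) \<odot>\<^bsub>U\<^esub> \<one>\<^bsub>U\<^esub>)"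
proof -
  note c = \<iota>_closed[OF x] \<iota>_closed[OF y] entry_closed[OF x] entry_closed[OF y]
  have s1: "(\<lambda>c. c \<odot>\<^bsub>U\<^esub> \<one>\<^bsub>U\<^esub>) \<in> module_hom K (ground_algebra K) U"
    by (rule module_homI) (simp_all add: ground_algebra_def U.smult_l_distr U.smult_assoc1)
  have "(\<Oplus>\<^bsub>U\<^esub>k\<in>{..<N}. entry y k j \<odot>\<^bsub>U\<^esub> gen x i k)
      = (\<Oplus>\<^bsub>U\<^esub>k\<in>{..<N}. (if i = k then entry y k j \<odot>\<^bsub>U\<^esub> \<iota> x else \<zero>\<^bsub>U\<^esub>) \<oplus>\<^bsub>U\<^esub> (entry x i k \<otimes>\<^bsub>K\<^esub> entry y k j) \<odot>\<^bsub>U\<^esub> \<one>\<^bsub>U\<^esub>)"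
    by (rule U.M.finsum_cong'[OF refl])
      (use c i in \<open>auto simp: gen_def U.smult_r_distr U.smult_assoc1[symmetric] R.m_comm\<close>)
  also have "\<dots> = (\<Oplus>\<^bsub>U\<^esub>k\<in>{..<N}. if i = k then entry y k j \<odot>\<^bsub>U\<^esub> \<iota> x else \<zero>\<^bsub>U\<^esub>) \<oplus>\<^bsub>U\<^esub> (\<Oplus>\<^bsub>U\<^esub>k\<in>{..<N}. (entry x i k \<otimes>\<^bsub>K\<^esub> entry y k j) \<odot>\<^bsub>U\<^esub> \<one>\<^bsub>U\<^esub>)"
    by (rule U.M.finsum_addf) (use c in auto)
  also have "(\<Oplus>\<^bsub>U\<^esub>k\<in>{..<N}. if i = k then entry y k j \<odot>\<^bsub>U\<^esub> \<iota> x else \<zero>\<^bsub>U\<^esub>) = entry y i j \<odot>\<^bsub>U\<^esub> \<iota> x"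
    by (rule U.M.finsum_singleton) (use c i in auto)
  also have "(\<Oplus>\<^bsub>U\<^esub>k\<in>{..<N}. (entry x i k \<otimes>\<^bsub>K\<^esub> entry y k j) \<odot>\<^bsub>U\<^esub> \<one>\<^bsub>U\<^esub>) = (\<Oplus>\<^bsub>K\<^esub>k\<in>{..<N}. entry x i k \<otimes>\<^bsub>K\<^esub> entry y k j) \<odot>\<^bsub>U\<^esub> \<one>\<^bsub>U\<^esub>"
    by (rule hom_finsum[OF s1 field_vectorspace[OF field_axioms] vsU, unfolded finsum_ground, symmetric])
      (use c in \<open>auto simp: ground_algebra_def\<close>)
  finally show ?thesis
    unfolding mult_gen[OF gen_closed[OF x] y j]
    using c i j by (simp add: gen_def U.A.l_distr U.smult_mult_left)
qed

text \<open>Scalars are central, so the mixed terms of the two products agree and cancel. The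
  diagonal parts give \<open>\<iota> (br x y)\<close>, the scalar parts
  \<open>entry_br\<close>.\<close>

lemma gen_bracket:
  assumes x: "x \<in> carrier M" and y: "y \<in> carrier M"
  shows "gen x \<otimes>\<^bsub>Mat\<^esub> gen y \<ominus>\<^bsub>Mat\<^esub> gen y \<otimes>\<^bsub>Mat\<^esub> gen x = gen (br x y)"
proof (intro ext)
  fix i j
  note g = gen_closed[OF x] gen_closed[OF y]
  have m: "(gen x \<otimes>\<^bsub>Mat\<^esub> gen y \<ominus>\<^bsub>Mat\<^esub> gen y \<otimes>\<^bsub>Mat\<^esub> gen x) i j = (gen x \<otimes>\<^bsub>Mat\<^esub> gen y) i j \<ominus>\<^bsub>U\<^esub> (gen y \<otimes>\<^bsub>Mat\<^esub> gen x) i j"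
    by (rule hom_minus[OF U.Mat_eval_hom Mat.vectorspace_axioms vsU]) (use g in simp_all)
  show "(gen x \<otimes>\<^bsub>Mat\<^esub> gen y \<ominus>\<^bsub>Mat\<^esub> gen y \<otimes>\<^bsub>Mat\<^esub> gen x) i j = gen (br x y) i j"
  proof (cases "i < N \<and> j < N")
    case True
    let ?s = "\<lambda>x y. \<Oplus>\<^bsub>K\<^esub>k\<in>{..<N}. entry x i k \<otimes>\<^bsub>K\<^esub> entry y k j"
    have sc: "?s x y \<in> carrier K" "?s y x \<in> carrier K"
      by (rule R.finsum_closed; simp add: entry_closed x y)+
    note c = \<iota>_closed[OF x] \<iota>_closed[OF y] entry_closed[OF x] entry_closed[OF y] sc
    have s1: "(\<lambda>c. c \<odot>\<^bsub>U\<^esub> \<one>\<^bsub>U\<^esub>) \<in> module_hom K (ground_algebra K) U"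
      by (rule module_homI) (simp_all add: ground_algebra_def U.smult_l_distr U.smult_assoc1)
    have "a \<ominus>\<^bsub>ground_algebra K\<^esub> b = a \<ominus>\<^bsub>K\<^esub> b" for a b
      by (simp add: ground_algebra_def a_minus_def a_inv_def m_inv_def)
    then have "?s x y \<odot>\<^bsub>U\<^esub> \<one>\<^bsub>U\<^esub> \<ominus>\<^bsub>U\<^esub> ?s y x \<odot>\<^bsub>U\<^esub> \<one>\<^bsub>U\<^esub> = entry (br x y) i j \<odot>\<^bsub>U\<^esub> \<one>\<^bsub>U\<^esub>"
      using hom_minus[OF s1 field_vectorspace[OF field_axioms] vsU, of "?s x y" "?s y x"] sc entry_br[OF x y, of i j]
      by (simp add: ground_algebra_def)
    moreover have "(if i = j then \<iota> x \<otimes>\<^bsub>U\<^esub> \<iota> y else \<zero>\<^bsub>U\<^esub>) \<ominus>\<^bsub>U\<^esub> (if i = j then \<iota> y \<otimes>\<^bsub>U\<^esub> \<iota> x else \<zero>\<^bsub>U\<^esub>) = (if i = j then \<iota> (br x y) else \<zero>\<^bsub>U\<^esub>)"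
      by (simp add: \<iota>_bracket x y)
    ultimately show ?thesis
      unfolding m using True by (simp only: gen_mult[OF x y] gen_mult[OF y x])
        (subst U.A.minus_four, (use c in \<open>simp_all add: gen_def\<close>))
  next
    case False
    then show ?thesis
      unfolding m using Mat.A.m_closed[OF g] Mat.A.m_closed[OF g(2,1)] gen_closed[OF br_closed[OF x y]]
      by (auto simp: U.mem_Mat a_minus_def)
  qed
qed

text \<open>Row \<open>0\<close> of \<open>\<Phi> u\<close> lists \<open>u\<close> followed by the
  coefficients of \<open>du\<close>; row \<open>Suc k\<close> lists those of \<open>d e_k u\<close>.
  Hence multiplicativity of \<open>\<Phi>\<close> contains both the Leibniz rule, in row
  \<open>0\<close>, and the right module law.\<close>

definition \<Phi> :: "('a, 'c) env \<Rightarrow> nat \<Rightarrow> nat \<Rightarrow> ('a, 'c) env" where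
  "\<Phi> = env_extend K Mat gen"

lemma \<Phi>_hom: "\<Phi> \<in> algebra_hom K U Mat"
  unfolding \<Phi>_def by (rule env_extend(1)[OF Mat_assoc gen_hom]) (rule gen_bracket)

lemma \<Phi>_\<iota>: "x \<in> carrier M \<Longrightarrow> \<Phi> (\<iota> x) = gen x"
  unfolding \<Phi>_def by (rule env_extend(2)[OF Mat_assoc gen_hom]) (rule gen_bracket)

lemma \<Phi>_entry_hom: "(\<lambda>u. \<Phi> u i j) \<in> module_hom K U U"
  by (rule hom_comp[OF algebra_homD(1)[OF \<Phi>_hom] U.Mat_eval_hom])

lemmas \<Phi>_closed = hom_closed[OF \<Phi>_entry_hom]

lemma \<Phi>_out: "u \<in> carrier U \<Longrightarrow> N \<le> i \<or> N \<le> j \<Longrightarrow> \<Phi> u i j = \<zero>\<^bsub>U\<^esub>"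
  using algebra_homD(2)[OF \<Phi>_hom, of u] by (auto simp: U.mem_Mat)

lemma \<Phi>_one: "\<Phi> \<one>\<^bsub>U\<^esub> i j = (if i = j \<and> i < N then \<one>\<^bsub>U\<^esub> else \<zero>\<^bsub>U\<^esub>)"
  by (simp only: algebra_homD(4)[OF \<Phi>_hom] U.Mat_ops)

lemma \<Phi>_mult: "u \<in> carrier U \<Longrightarrow> v \<in> carrier U \<Longrightarrow> \<Phi> (u \<otimes>\<^bsub>U\<^esub> v) i j = (\<Oplus>\<^bsub>U\<^esub>k\<in>{..<N}. \<Phi> u i k \<otimes>\<^bsub>U\<^esub> \<Phi> v k j)"
  by (simp only: algebra_homD(3)[OF \<Phi>_hom] U.Mat_ops)

lemma \<Phi>_step: "u \<in> carrier U \<Longrightarrow> x \<in> carrier M \<Longrightarrow> j < N \<Longrightarrow>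
    \<Phi> (u \<otimes>\<^bsub>U\<^esub> \<iota> x) i j = \<Phi> u i j \<otimes>\<^bsub>U\<^esub> \<iota> x \<oplus>\<^bsub>U\<^esub> (\<Oplus>\<^bsub>U\<^esub>k\<in>{..<N}. entry x k j \<odot>\<^bsub>U\<^esub> \<Phi> u i k)"
  by (simp only: algebra_homD(3)[OF \<Phi>_hom] \<iota>_closed \<Phi>_\<iota> mult_gen algebra_homD(2)[OF \<Phi>_hom])

text \<open>Column \<open>0\<close> of \<open>entry\<close> vanishes, so a generator acts on this
  column by plain right multiplication and it stays \<open>u\<close> above zeros.\<close>

lemma \<Phi>_column_0: "u \<in> carrier U \<Longrightarrow> i < N \<Longrightarrow> \<Phi> u i 0 = (if i = 0 then u else \<zero>\<^bsub>U\<^esub>)"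
proof (induct u rule: U_induct_right)
  case one then show ?case by (simp add: \<Phi>_one)
next
  case (mult u x)
  have "(\<Oplus>\<^bsub>U\<^esub>k\<in>{..<N}. entry x k 0 \<odot>\<^bsub>U\<^esub> \<Phi> u i k) = \<zero>\<^bsub>U\<^esub>" using mult(1) by (simp add: entry_def \<Phi>_closed)
  then show ?case using mult \<iota>_closed[OF mult(2)] by (simp add: \<Phi>_step)
qed (simp_all add: hom_add[OF \<Phi>_entry_hom] hom_smult[OF \<Phi>_entry_hom])

lemma \<Phi>_\<iota>_row_0: "x \<in> carrier M \<Longrightarrow> k < n \<Longrightarrow> \<Phi> (\<iota> x) 0 (Suc k) = co k x \<odot>\<^bsub>U\<^esub> \<one>\<^bsub>U\<^esub>"
  by (simp add: \<Phi>_\<iota> gen_def entry_def row_def co_closed)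

section \<open>Compatibility of the matrix representation with the coproduct\<close>

definition id_\<Phi> where
  "id_\<Phi> i j = tensor_map K U U id (\<lambda>u. \<Phi> u i j)"

lemma id_\<Phi>_hom: "id_\<Phi> i j \<in> module_hom K UU UU"
  unfolding id_\<Phi>_def by (rule tensor_map_hom[OF vsU vsU vsU vsU hom_id(2) \<Phi>_entry_hom])

lemma id_\<Phi>_tens: "a \<in> carrier U \<Longrightarrow> b \<in> carrier U \<Longrightarrow> id_\<Phi> i j (tens K U U a b) = tens K U U a (\<Phi> b i j)"
  unfolding id_\<Phi>_def using tensor_map_tens[OF vsU vsU vsU vsU hom_id(2) \<Phi>_entry_hom] by (simp only: id_apply)

text \<open>The analogue of \<open>\<Phi>_step\<close> in \<open>U \<otimes> U\<close>. In
  \<open>x \<otimes> 1 + 1 \<otimes> x\<close> the first term does not touch the factor on which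
  \<open>\<Phi>\<close> acts, and the second obeys \<open>\<Phi>_step\<close>.\<close>

lemma id_\<Phi>_step:
  assumes X: "X \<in> carrier UU" and x: "x \<in> carrier M" and j: "j < N"
  shows "id_\<Phi> i j (X \<otimes>\<^bsub>UU\<^esub> primitive x) =
    id_\<Phi> i j X \<otimes>\<^bsub>UU\<^esub> primitive x \<oplus>\<^bsub>UU\<^esub>
    (\<Oplus>\<^bsub>UU\<^esub>k\<in>{..<N}. entry x k j \<odot>\<^bsub>UU\<^esub> id_\<Phi> i k X)" (is "?l X = ?r X")
proof (rule UU_hom_eq[OF UU.vectorspace_axioms _ _ _ X])
  note p = hom_closed[OF primitive_hom x]
  note vUU = UU.vectorspace_axioms
  show "?l \<in> module_hom K UU UU" by (rule hom_comp[OF UU.mult_hom_left[OF p] id_\<Phi>_hom])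
  show "?r \<in> module_hom K UU UU"
    by (intro hom_add_maps[OF vUU] hom_comp[OF id_\<Phi>_hom UU.mult_hom_left[OF p]] hom_finsum_maps[OF vUU] hom_smult_map[OF vUU]
        id_\<Phi>_hom entry_closed[OF x]) simp
  fix a b assume ab: "a \<in> carrier U" "b \<in> carrier U"
  note c = ab \<iota>_closed[OF x] U.A.one_closed \<Phi>_closed[OF ab(2)] entry_closed[OF x]
  have s: "tens K U U a (\<Oplus>\<^bsub>U\<^esub>k\<in>{..<N}. entry x k j \<odot>\<^bsub>U\<^esub> \<Phi> b i k) = (\<Oplus>\<^bsub>UU\<^esub>k\<in>{..<N}. entry x k j \<odot>\<^bsub>UU\<^esub> tens K U U a (\<Phi> b i k))"
    using c by (subst hom_finsum[OF bilinearD(1)[OF UU_bilinear ab(1)] vsU vUU]) (simp_all add: bilinearD(7)[OF UU_bilinear])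
  have sc: "(\<Oplus>\<^bsub>U\<^esub>k\<in>{..<N}. entry x k j \<odot>\<^bsub>U\<^esub> \<Phi> b i k) \<in> carrier U" by (rule U.M.finsum_closed) (use c in simp)
  have "?l (tens K U U a b) = tens K U U (a \<otimes>\<^bsub>U\<^esub> \<iota> x) (\<Phi> b i j) \<oplus>\<^bsub>UU\<^esub> tens K U U a (\<Phi> (b \<otimes>\<^bsub>U\<^esub> \<iota> x) i j)"
    using c by (simp add: primitive_def UU.A.r_distr UU_closed UU_mult hom_add[OF id_\<Phi>_hom] id_\<Phi>_tens)
  also have "\<dots> = tens K U U (a \<otimes>\<^bsub>U\<^esub> \<iota> x) (\<Phi> b i j) \<oplus>\<^bsub>UU\<^esub> (tens K U U a (\<Phi> b i j \<otimes>\<^bsub>U\<^esub> \<iota> x) \<oplus>\<^bsub>UU\<^esub> (\<Oplus>\<^bsub>UU\<^esub>k\<in>{..<N}. entry x k j \<odot>\<^bsub>UU\<^esub> tens K U U a (\<Phi> b i k)))"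
    unfolding \<Phi>_step[OF ab(2) x j] s[symmetric] using c sc by (simp add: bilinearD(5)[OF UU_bilinear])
  also have "\<dots> = tens K U U a (\<Phi> b i j) \<otimes>\<^bsub>UU\<^esub> primitive x \<oplus>\<^bsub>UU\<^esub> (\<Oplus>\<^bsub>UU\<^esub>k\<in>{..<N}. entry x k j \<odot>\<^bsub>UU\<^esub> tens K U U a (\<Phi> b i k))"
    unfolding s[symmetric] using c sc by (simp add: primitive_def UU.A.r_distr UU_closed UU_mult UU.M.add.m_assoc)
  also have "\<dots> = ?r (tens K U U a b)"
    using c by (simp only: id_\<Phi>_tens)
  finally show "?l (tens K U U a b) = ?r (tens K U U a b)" .
qed

text \<open>Both sides satisfy the same recursion under right multiplication by a generator. All
  columns \<open>j\<close> are treated at once because the recursion mixes them. Covariance of the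
  differential (\<open>i = 0\<close>) and of the right action (\<open>i > 0\<close>) both rest on
  this.\<close>

lemma coproduct_\<Phi>:
  assumes "u \<in> carrier U"
  shows "\<forall>j<N. \<Delta> (\<Phi> u i j) = id_\<Phi> i j (\<Delta> u)"
  using assms
proof (induct u rule: U_induct_right)
  case one
  have o: "\<one>\<^bsub>UU\<^esub> = tens K U U \<one>\<^bsub>U\<^esub> \<one>\<^bsub>U\<^esub>" by (rule tens_one[OF U_assoc_alg U_assoc_alg])
  have z: "tens K U U \<one>\<^bsub>U\<^esub> \<zero>\<^bsub>U\<^esub> = \<zero>\<^bsub>UU\<^esub>"
    by (rule hom_zero[OF bilinearD(1)[OF UU_bilinear U.A.one_closed] vsU UU.vectorspace_axioms])
  have z': "\<Delta> \<zero>\<^bsub>U\<^esub> = \<zero>\<^bsub>UU\<^esub>" by (rule hom_zero[OF algebra_homD(1)[OF coproduct_hom] vsU UU.vectorspace_axioms])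
  show ?case by (simp add: \<Phi>_one algebra_homD(4)[OF coproduct_hom] o id_\<Phi>_tens z z')
next
  case (mult u x)
  note \<Delta>h = algebra_homD(1)[OF coproduct_hom]
  note c = mult(1) \<iota>_closed[OF mult(2)] \<Phi>_closed[OF mult(1)] entry_closed[OF mult(2)]
  show ?case
  proof (intro allI impI)
    fix j assume j: "j < N"
    have s: "\<Delta> (\<Oplus>\<^bsub>U\<^esub>k\<in>{..<N}. entry x k j \<odot>\<^bsub>U\<^esub> \<Phi> u i k) = (\<Oplus>\<^bsub>UU\<^esub>k\<in>{..<N}. entry x k j \<odot>\<^bsub>UU\<^esub> \<Delta> (\<Phi> u i k))"
      using c by (subst hom_finsum[OF \<Delta>h vsU UU.vectorspace_axioms]) (simp_all add: hom_smult[OF \<Delta>h])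
    also have "\<dots> = (\<Oplus>\<^bsub>UU\<^esub>k\<in>{..<N}. entry x k j \<odot>\<^bsub>UU\<^esub> id_\<Phi> i k (\<Delta> u))"
      by (rule UU.M.finsum_cong'[OF refl])
        (use c mult(3) hom_closed[OF id_\<Phi>_hom hom_closed[OF \<Delta>h mult(1)]] in auto)
    finally have s': "\<Delta> (\<Oplus>\<^bsub>U\<^esub>k\<in>{..<N}. entry x k j \<odot>\<^bsub>U\<^esub> \<Phi> u i k) = (\<Oplus>\<^bsub>UU\<^esub>k\<in>{..<N}. entry x k j \<odot>\<^bsub>UU\<^esub> id_\<Phi> i k (\<Delta> u))" .
    have sc: "(\<Oplus>\<^bsub>U\<^esub>k\<in>{..<N}. entry x k j \<odot>\<^bsub>U\<^esub> \<Phi> u i k) \<in> carrier U" by (rule U.M.finsum_closed) (use c in simp)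
    have "\<Delta> (\<Phi> (u \<otimes>\<^bsub>U\<^esub> \<iota> x) i j) = \<Delta> (\<Phi> u i j) \<otimes>\<^bsub>UU\<^esub> primitive x \<oplus>\<^bsub>UU\<^esub> \<Delta> (\<Oplus>\<^bsub>U\<^esub>k\<in>{..<N}. entry x k j \<odot>\<^bsub>U\<^esub> \<Phi> u i k)"
      unfolding \<Phi>_step[OF mult(1,2) j] using c sc mult(2) by (simp add: algebra_homD(3,5)[OF coproduct_hom] coproduct_\<iota>)
    also have "\<dots> = id_\<Phi> i j (\<Delta> u \<otimes>\<^bsub>UU\<^esub> primitive x)"
      unfolding s' id_\<Phi>_step[OF hom_closed[OF \<Delta>h mult(1)] mult(2) j] using mult(3) j by simp
    also have "\<dots> = id_\<Phi> i j (\<Delta> (u \<otimes>\<^bsub>U\<^esub> \<iota> x))"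
      using c mult(2) by (simp add: algebra_homD(3)[OF coproduct_hom] coproduct_\<iota>)
    finally show "\<Delta> (\<Phi> (u \<otimes>\<^bsub>U\<^esub> \<iota> x) i j) = id_\<Phi> i j (\<Delta> (u \<otimes>\<^bsub>U\<^esub> \<iota> x))" .
  qed
next
  case (add u v)
  then show ?case
    by (simp add: hom_add[OF \<Phi>_entry_hom] algebra_homD(2,5)[OF coproduct_hom] \<Phi>_closed hom_add[OF id_\<Phi>_hom])
next
  case (smult c u)
  then show ?case
    by (simp add: hom_smult[OF \<Phi>_entry_hom] algebra_homD(2,6)[OF coproduct_hom] \<Phi>_closed hom_smult[OF id_\<Phi>_hom])
qed

end

section \<open>The first order calculus of a pre-Lie structure\<close>

context pre_lie_coords begin

definition crd :: "('a, 'c) form \<Rightarrow> nat \<Rightarrow> ('a, 'c) env" where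
  "crd w i = (if i < N then hd w ! i else \<zero>\<^bsub>U\<^esub>)"

definition mk :: "(nat \<Rightarrow> ('a, 'c) env) \<Rightarrow> ('a, 'c) form" where
  "mk f = [map f [0..<N]]"

lemma crd_mk: "crd (mk f) i = (if i < N then f i else \<zero>\<^bsub>U\<^esub>)"
  by (simp add: crd_def mk_def del: upt_Suc)

text \<open>A form \<open>u + \<Sum> u\<^sub>k d e\<^sub>k\<close> is encoded as the singleton \<open>[[u, u\<^sub>0, \<dots>, u\<^sub>n\<^sub>-\<^sub>1]]\<close>. Sending it to the matrix with
  this top row and the remaining rows of \<open>\<Phi> u\<close> embeds the forms into the matrices over \<open>U\<close>, which
  gives the product and its associativity.\<close>

definition \<Psi> :: "('a, 'c) form \<Rightarrow> nat \<Rightarrow> nat \<Rightarrow> ('a, 'c) env" where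
  "\<Psi> w i j = (if i = 0 then crd w j else \<Phi> (crd w 0) i j)"

definition Om :: "('a, ('a, 'c) form) module" where
  "Om = \<lparr>carrier = {mk f | f. \<forall>i. f i \<in> carrier U},
     mult = (\<lambda>v w. mk (\<lambda>j. (\<Psi> v \<otimes>\<^bsub>Mat\<^esub> \<Psi> w) 0 j)),
     one = mk (\<lambda>i. if i = 0 then \<one>\<^bsub>U\<^esub> else \<zero>\<^bsub>U\<^esub>), zero = mk (\<lambda>_. \<zero>\<^bsub>U\<^esub>),
     add = (\<lambda>v w. mk (\<lambda>i. crd v i \<oplus>\<^bsub>U\<^esub> crd w i)),
     smult = (\<lambda>c v. mk (\<lambda>i. c \<odot>\<^bsub>U\<^esub> crd v i))\<rparr>"

lemma mk_closed: "(\<And>i. f i \<in> carrier U) \<Longrightarrow> mk f \<in> carrier Om"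
  by (auto simp: Om_def)

lemma crd_closed: "w \<in> carrier Om \<Longrightarrow> crd w i \<in> carrier U"
  by (auto simp: Om_def crd_mk)

lemma crd_out: "N \<le> i \<Longrightarrow> crd w i = \<zero>\<^bsub>U\<^esub>" by (simp add: crd_def)

lemma mk_cong: "(\<And>i. i < N \<Longrightarrow> f i = g i) \<Longrightarrow> mk f = mk g"
  unfolding mk_def by (simp del: upt_Suc)

lemma mk_crd: "w \<in> carrier Om \<Longrightarrow> mk (crd w) = w"
  by (auto simp: Om_def crd_mk intro!: mk_cong)

lemma Om_eqI:
  assumes "v \<in> carrier Om" "w \<in> carrier Om" "\<And>i. i < N \<Longrightarrow> crd v i = crd w i"
  shows "v = w"
  using mk_cong[of "crd v" "crd w"] assms by (simp add: mk_crd)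

lemma crd_add: "crd (v \<oplus>\<^bsub>Om\<^esub> w) i = crd v i \<oplus>\<^bsub>U\<^esub> crd w i"
  by (simp add: Om_def crd_mk crd_out)

lemma crd_smult: "c \<in> carrier K \<Longrightarrow> crd (c \<odot>\<^bsub>Om\<^esub> w) i = c \<odot>\<^bsub>U\<^esub> crd w i"
  by (simp add: Om_def crd_mk crd_out)

lemma crd_zero: "crd \<zero>\<^bsub>Om\<^esub> i = \<zero>\<^bsub>U\<^esub>"
  by (simp add: Om_def crd_mk)

lemma crd_one: "crd \<one>\<^bsub>Om\<^esub> i = (if i = 0 then \<one>\<^bsub>U\<^esub> else \<zero>\<^bsub>U\<^esub>)"
  by (simp add: Om_def crd_mk)

lemma Om_closed:
  "v \<in> carrier Om \<Longrightarrow> w \<in> carrier Om \<Longrightarrow> v \<oplus>\<^bsub>Om\<^esub> w \<in> carrier Om"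
  "c \<in> carrier K \<Longrightarrow> v \<in> carrier Om \<Longrightarrow> c \<odot>\<^bsub>Om\<^esub> v \<in> carrier Om"
  "\<zero>\<^bsub>Om\<^esub> \<in> carrier Om" "\<one>\<^bsub>Om\<^esub> \<in> carrier Om"
proof -
  show "v \<in> carrier Om \<Longrightarrow> w \<in> carrier Om \<Longrightarrow> v \<oplus>\<^bsub>Om\<^esub> w \<in> carrier Om"
    using mk_closed[of "\<lambda>i. crd v i \<oplus>\<^bsub>U\<^esub> crd w i"] crd_closed by (simp add: Om_def)
  show "c \<in> carrier K \<Longrightarrow> v \<in> carrier Om \<Longrightarrow> c \<odot>\<^bsub>Om\<^esub> v \<in> carrier Om"
    using mk_closed[of "\<lambda>i. c \<odot>\<^bsub>U\<^esub> crd v i"] crd_closed by (simp add: Om_def)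
  show "\<zero>\<^bsub>Om\<^esub> \<in> carrier Om" using mk_closed[of "\<lambda>_. \<zero>\<^bsub>U\<^esub>"] by (simp add: Om_def)
  show "\<one>\<^bsub>Om\<^esub> \<in> carrier Om" using mk_closed[of "\<lambda>i. if i = 0 then \<one>\<^bsub>U\<^esub> else \<zero>\<^bsub>U\<^esub>"] by (simp add: Om_def)
qed

lemma \<Psi>_closed: "w \<in> carrier Om \<Longrightarrow> \<Psi> w \<in> carrier Mat"
  by (auto simp: U.mem_Mat \<Psi>_def crd_closed \<Phi>_closed crd_out \<Phi>_out)

lemma \<Psi>_mult_closed: "v \<in> carrier Om \<Longrightarrow> w \<in> carrier Om \<Longrightarrow> (\<Psi> v \<otimes>\<^bsub>Mat\<^esub> \<Psi> w) i j \<in> carrier U"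
  using Mat.A.m_closed[OF \<Psi>_closed \<Psi>_closed] by (simp add: U.mem_Mat)

lemma crd_mult_\<Psi>: "v \<in> carrier Om \<Longrightarrow> w \<in> carrier Om \<Longrightarrow> crd (v \<otimes>\<^bsub>Om\<^esub> w) i = (\<Psi> v \<otimes>\<^bsub>Mat\<^esub> \<Psi> w) 0 i"
  using Mat.A.m_closed[OF \<Psi>_closed \<Psi>_closed, of v w] by (auto simp: Om_def crd_mk U.mem_Mat)

lemma Om_mult_closed: "v \<in> carrier Om \<Longrightarrow> w \<in> carrier Om \<Longrightarrow> v \<otimes>\<^bsub>Om\<^esub> w \<in> carrier Om"
  using mk_closed[of "\<lambda>j. (\<Psi> v \<otimes>\<^bsub>Mat\<^esub> \<Psi> w) 0 j"] \<Psi>_mult_closed by (simp add: Om_def)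

text \<open>The product is the left action on coordinates plus the right action through
  \<open>\<Phi>\<close>. The form part of \<open>w\<close> is never paired with that of
  \<open>v\<close>, so products of 1-forms vanish.\<close>

lemma crd_mult:
  assumes v: "v \<in> carrier Om" and w: "w \<in> carrier Om"
  shows "crd (v \<otimes>\<^bsub>Om\<^esub> w) i = crd v 0 \<otimes>\<^bsub>U\<^esub> crd w i \<oplus>\<^bsub>U\<^esub> (\<Oplus>\<^bsub>U\<^esub>k\<in>{..<n}. crd v (Suc k) \<otimes>\<^bsub>U\<^esub> \<Phi> (crd w 0) (Suc k) i)"
proof -
  have "\<Psi> v 0 k \<otimes>\<^bsub>U\<^esub> \<Psi> w k i \<in> carrier U" for k using v w by (simp add: \<Psi>_def crd_closed \<Phi>_closed)
  then show ?thesis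
    unfolding crd_mult_\<Psi>[OF v w] U.Mat_ops by (subst U.M.finsum_lessThan_Suc_shift) (simp_all add: \<Psi>_def)
qed

lemma crd_mult_0:
  assumes v: "v \<in> carrier Om" and w: "w \<in> carrier Om"
  shows "crd (v \<otimes>\<^bsub>Om\<^esub> w) 0 = crd v 0 \<otimes>\<^bsub>U\<^esub> crd w 0"
proof -
  have "(\<Oplus>\<^bsub>U\<^esub>k\<in>{..<n}. crd v (Suc k) \<otimes>\<^bsub>U\<^esub> \<Phi> (crd w 0) (Suc k) 0) = (\<Oplus>\<^bsub>U\<^esub>k\<in>{..<n}. \<zero>\<^bsub>U\<^esub>)"
    by (rule U.M.finsum_cong'[OF refl]) (use v w in \<open>simp_all add: crd_closed \<Phi>_column_0\<close>)
  then show ?thesis unfolding crd_mult[OF v w] using v w by (simp add: crd_closed)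
qed

text \<open>Row \<open>0\<close> defines the product. The other rows depend only on the degree-zero
  parts, which multiply as in \<open>U\<close>, so they follow from multiplicativity of
  \<open>\<Phi>\<close>.\<close>

lemma \<Psi>_mult:
  assumes v: "v \<in> carrier Om" and w: "w \<in> carrier Om"
  shows "\<Psi> (v \<otimes>\<^bsub>Om\<^esub> w) = \<Psi> v \<otimes>\<^bsub>Mat\<^esub> \<Psi> w"
proof (intro ext)
  fix i j
  show "\<Psi> (v \<otimes>\<^bsub>Om\<^esub> w) i j = (\<Psi> v \<otimes>\<^bsub>Mat\<^esub> \<Psi> w) i j"
  proof (cases "i = 0")
    case True then show ?thesis using v w by (simp add: \<Psi>_def[of "v \<otimes>\<^bsub>Om\<^esub> w"] crd_mult_\<Psi>)
  next
    case False
    have "\<Psi> (v \<otimes>\<^bsub>Om\<^esub> w) i j = (\<Oplus>\<^bsub>U\<^esub>k\<in>{..<N}. \<Phi> (crd v 0) i k \<otimes>\<^bsub>U\<^esub> \<Phi> (crd w 0) k j)"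
      using False v w by (simp add: \<Psi>_def crd_mult_0 \<Phi>_mult crd_closed)
    also have "\<dots> = (\<Oplus>\<^bsub>U\<^esub>k\<in>{..<N}. \<Psi> v i k \<otimes>\<^bsub>U\<^esub> \<Psi> w k j)"
    proof (rule U.M.finsum_cong'[OF refl])
      fix k
      \<comment> \<open>\<open>\<Psi> w\<close> and \<open>\<Phi> (crd w 0)\<close> differ only in
        row \<open>0\<close>, which is multiplied by this zero entry.\<close>
      have "\<Phi> (crd v 0) i 0 = \<zero>\<^bsub>U\<^esub>"
        using False \<Phi>_column_0[OF crd_closed[OF v], of i] \<Phi>_out[OF crd_closed[OF v], of i] by (cases "i < N") auto
      then show "\<Phi> (crd v 0) i k \<otimes>\<^bsub>U\<^esub> \<Phi> (crd w 0) k j = \<Psi> v i k \<otimes>\<^bsub>U\<^esub> \<Psi> w k j"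
        using False v w by (simp add: \<Psi>_def \<Phi>_closed crd_closed)
    qed (use False v w in \<open>auto simp: \<Psi>_def \<Phi>_closed crd_closed\<close>)
    finally show ?thesis by (simp only: U.Mat_ops)
  qed
qed

lemma Om_assoc_alg: "assoc_alg K Om"
proof (rule assoc_alg_pullback[OF Mat_assoc])
  show "inj_on \<Psi> (carrier Om)"
  proof (rule inj_onI)
    fix v w assume vw: "v \<in> carrier Om" "w \<in> carrier Om" "\<Psi> v = \<Psi> w"
    then have "\<Psi> v 0 i = \<Psi> w 0 i" for i by simp
    then show "v = w" by (intro Om_eqI vw) (simp add: \<Psi>_def)
  qed
  fix v w assume vw: "v \<in> carrier Om" "w \<in> carrier Om"
  show "\<Psi> (v \<oplus>\<^bsub>Om\<^esub> w) = \<Psi> v \<oplus>\<^bsub>Mat\<^esub> \<Psi> w"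
    by (intro ext) (use vw in \<open>simp add: \<Psi>_def U.Mat_ops crd_add hom_add[OF \<Phi>_entry_hom] crd_closed\<close>)
next
  fix c v assume "c \<in> carrier K" "v \<in> carrier Om"
  then show "\<Psi> (c \<odot>\<^bsub>Om\<^esub> v) = c \<odot>\<^bsub>Mat\<^esub> \<Psi> v"
    by (intro ext) (simp add: \<Psi>_def U.Mat_ops crd_smult hom_smult[OF \<Phi>_entry_hom] crd_closed)
next
  show "\<Psi> \<zero>\<^bsub>Om\<^esub> = \<zero>\<^bsub>Mat\<^esub>"
    by (intro ext) (simp add: \<Psi>_def U.Mat_ops crd_zero hom_zero[OF \<Phi>_entry_hom vsU vsU])
  show "\<Psi> \<one>\<^bsub>Om\<^esub> = \<one>\<^bsub>Mat\<^esub>"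
    by (intro ext) (simp add: \<Psi>_def U.Mat_ops crd_one \<Phi>_one)
qed (auto intro: Om_closed Om_mult_closed \<Psi>_closed \<Psi>_mult)

sublocale Om: assoc_alg K Om by (rule Om_assoc_alg)

lemmas vsOm = Om.vectorspace_axioms

lemma crd_hom: "(\<lambda>w. crd w i) \<in> module_hom K Om U"
  by (rule module_homI) (simp_all add: crd_closed crd_add crd_smult)

text \<open>\<open>slot 0 u\<close> is the function \<open>u\<close>, and
  \<open>slot (Suc k) u\<close> is the form \<open>u d e_k\<close>. Beyond the last coordinate
  \<open>mk\<close> discards the entry and the slot is zero.\<close>

definition slot :: "nat \<Rightarrow> ('a, 'c) env \<Rightarrow> ('a, 'c) form" where
  "slot i u = mk (\<lambda>k. if k = i then u else \<zero>\<^bsub>U\<^esub>)"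

lemma crd_slot: "i < N \<Longrightarrow> crd (slot i u) k = (if k = i then u else \<zero>\<^bsub>U\<^esub>)"
  by (auto simp: slot_def crd_mk)

lemma slot_closed: "u \<in> carrier U \<Longrightarrow> slot i u \<in> carrier Om"
  unfolding slot_def by (rule mk_closed) simp

lemma slot_hom: "slot i \<in> module_hom K U Om"
proof (rule module_homI)
  fix u v assume "u \<in> carrier U" "v \<in> carrier U"
  then show "slot i (u \<oplus>\<^bsub>U\<^esub> v) = slot i u \<oplus>\<^bsub>Om\<^esub> slot i v"
    by (intro Om_eqI slot_closed Om_closed) (auto simp: crd_add slot_def crd_mk)
next
  fix c u assume "c \<in> carrier K" "u \<in> carrier U"
  then show "slot i (c \<odot>\<^bsub>U\<^esub> u) = c \<odot>\<^bsub>Om\<^esub> slot i u"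
    by (intro Om_eqI slot_closed Om_closed) (auto simp: crd_smult slot_def crd_mk)
qed (rule slot_closed)

lemma Om_decomp:
  assumes w: "w \<in> carrier Om"
  shows "w = (\<Oplus>\<^bsub>Om\<^esub>i\<in>{..<N}. slot i (crd w i))"
proof (rule Om_eqI[OF w])
  note c = crd_closed[OF w]
  show "(\<Oplus>\<^bsub>Om\<^esub>i\<in>{..<N}. slot i (crd w i)) \<in> carrier Om"
    by (rule Om.M.finsum_closed) (simp add: slot_closed c)
  fix k assume k: "k < N"
  have "crd (\<Oplus>\<^bsub>Om\<^esub>i\<in>{..<N}. slot i (crd w i)) k = (\<Oplus>\<^bsub>U\<^esub>i\<in>{..<N}. crd (slot i (crd w i)) k)"
    by (rule hom_finsum[OF crd_hom vsOm vsU]) (simp_all add: slot_closed c)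
  also have "\<dots> = (\<Oplus>\<^bsub>U\<^esub>i\<in>{..<N}. if k = i then crd w i else \<zero>\<^bsub>U\<^esub>)"
    by (rule U.M.finsum_cong'[OF refl]) (use c in \<open>simp_all add: crd_slot\<close>)
  also have "\<dots> = crd w k" by (rule U.M.finsum_singleton) (use k c in auto)
  finally show "crd w k = crd (\<Oplus>\<^bsub>Om\<^esub>i\<in>{..<N}. slot i (crd w i)) k" by simp
qed

lemma Om_hom_eq:
  assumes "vectorspace K Z" "f \<in> module_hom K Om Z" "g \<in> module_hom K Om Z"
    "\<And>i u. i < N \<Longrightarrow> u \<in> carrier U \<Longrightarrow> f (slot i u) = g (slot i u)" "w \<in> carrier Om"
  shows "f w = g w"
proof -
  interpret Z: vectorspace K Z by fact
  note c = slot_closed[OF crd_closed[OF assms(5)]]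
  have "f w = (\<Oplus>\<^bsub>Z\<^esub>i\<in>{..<N}. f (slot i (crd w i)))"
    by (subst Om_decomp[OF assms(5)], rule hom_finsum[OF assms(2) vsOm assms(1)]) (simp_all add: c)
  also have "\<dots> = (\<Oplus>\<^bsub>Z\<^esub>i\<in>{..<N}. g (slot i (crd w i)))"
    by (rule Z.M.finsum_cong'[OF refl]) (use hom_closed[OF assms(3) c] assms(4) crd_closed[OF assms(5)] in auto)
  also have "\<dots> = g w"
    by (subst (2) Om_decomp[OF assms(5)], rule hom_finsum[OF assms(3) vsOm assms(1), symmetric]) (simp_all add: c)
  finally show ?thesis .
qed

text \<open>Left multiplication by a function acts on each coordinate; only the opposite order, in
  \<open>slot_Suc_mult_0\<close>, involves \<open>\<Phi>\<close>.\<close>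

lemma slot_0_mult:
  assumes u: "u \<in> carrier U" and v: "v \<in> carrier U" and k: "k < N"
  shows "slot 0 u \<otimes>\<^bsub>Om\<^esub> slot k v = slot k (u \<otimes>\<^bsub>U\<^esub> v)"
proof (rule Om_eqI)
  fix i
  have "(\<Oplus>\<^bsub>U\<^esub>l\<in>{..<n}. crd (slot 0 u) (Suc l) \<otimes>\<^bsub>U\<^esub> \<Phi> (crd (slot k v) 0) (Suc l) i) = (\<Oplus>\<^bsub>U\<^esub>l\<in>{..<n}. \<zero>\<^bsub>U\<^esub>)"
    by (rule U.M.finsum_cong'[OF refl]) (use u v k in \<open>simp_all add: crd_slot \<Phi>_closed\<close>)
  then show "crd (slot 0 u \<otimes>\<^bsub>Om\<^esub> slot k v) i = crd (slot k (u \<otimes>\<^bsub>U\<^esub> v)) i"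
    using u v k by (simp add: crd_mult slot_closed crd_slot)
qed (use u v in \<open>simp_all add: slot_closed Om_mult_closed\<close>)

lemma slot_Suc_mult_Suc:
  assumes u: "u \<in> carrier U" and v: "v \<in> carrier U" and i: "i < n" and k: "k < n"
  shows "slot (Suc i) u \<otimes>\<^bsub>Om\<^esub> slot (Suc k) v = \<zero>\<^bsub>Om\<^esub>"
proof (rule Om_eqI)
  fix j
  have "(\<Oplus>\<^bsub>U\<^esub>l\<in>{..<n}. crd (slot (Suc i) u) (Suc l) \<otimes>\<^bsub>U\<^esub> \<Phi> (crd (slot (Suc k) v) 0) (Suc l) j) = (\<Oplus>\<^bsub>U\<^esub>l\<in>{..<n}. \<zero>\<^bsub>U\<^esub>)"
    by (rule U.M.finsum_cong'[OF refl]) (use u v i k in \<open>simp_all add: crd_slot hom_zero[OF \<Phi>_entry_hom vsU vsU]\<close>)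
  then show "crd (slot (Suc i) u \<otimes>\<^bsub>Om\<^esub> slot (Suc k) v) j = crd \<zero>\<^bsub>Om\<^esub> j"
    using u v i k by (simp add: crd_mult slot_closed crd_slot crd_zero)
qed (use u v in \<open>simp_all add: slot_closed Om_mult_closed\<close>)

lemma crd_slot_Suc_mult_0:
  assumes u: "u \<in> carrier U" and v: "v \<in> carrier U" and i: "i < n"
  shows "crd (slot (Suc i) u \<otimes>\<^bsub>Om\<^esub> slot 0 v) k = u \<otimes>\<^bsub>U\<^esub> \<Phi> v (Suc i) k"
proof -
  have "(\<Oplus>\<^bsub>U\<^esub>l\<in>{..<n}. crd (slot (Suc i) u) (Suc l) \<otimes>\<^bsub>U\<^esub> \<Phi> (crd (slot 0 v) 0) (Suc l) k)
      = (\<Oplus>\<^bsub>U\<^esub>l\<in>{..<n}. if i = l then u \<otimes>\<^bsub>U\<^esub> \<Phi> v (Suc l) k else \<zero>\<^bsub>U\<^esub>)"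
    by (rule U.M.finsum_cong'[OF refl]) (use u v i in \<open>auto simp: crd_slot \<Phi>_closed\<close>)
  also have "\<dots> = u \<otimes>\<^bsub>U\<^esub> \<Phi> v (Suc i) k"
    by (rule U.M.finsum_singleton) (use u v i in \<open>auto simp: \<Phi>_closed\<close>)
  finally show ?thesis using u v i by (simp add: crd_mult slot_closed crd_slot \<Phi>_closed)
qed

lemma slot_Suc_mult_0:
  assumes u: "u \<in> carrier U" and v: "v \<in> carrier U" and i: "i < n"
  shows "slot (Suc i) u \<otimes>\<^bsub>Om\<^esub> slot 0 v = (\<Oplus>\<^bsub>Om\<^esub>k\<in>{..<N}. slot k (u \<otimes>\<^bsub>U\<^esub> \<Phi> v (Suc i) k))"
  using Om_decomp[OF Om_mult_closed[OF slot_closed[OF u] slot_closed[OF v]], of "Suc i" 0] u v i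
  by (simp only: crd_slot_Suc_mult_0)

section \<open>Differential, grading and Leibniz rule\<close>

definition dOm :: "('a, 'c) form \<Rightarrow> ('a, 'c) form" where
  "dOm w = mk (\<lambda>i. if i = 0 then \<zero>\<^bsub>U\<^esub> else \<Phi> (crd w 0) 0 i)"

text \<open>One formula for all degrees: degree \<open>0\<close> has no form part, degree
  \<open>1\<close> no function part, and from degree \<open>2\<close> on both conditions apply and
  leave only zero.\<close>

definition grOm :: "nat \<Rightarrow> ('a, 'c) form set" where
  "grOm m = {w \<in> carrier Om. (m \<noteq> 0 \<longrightarrow> crd w 0 = \<zero>\<^bsub>U\<^esub>) \<and> (m \<noteq> 1 \<longrightarrow> (\<forall>i. crd w (Suc i) = \<zero>\<^bsub>U\<^esub>))}"

lemma dOm_closed: "w \<in> carrier Om \<Longrightarrow> dOm w \<in> carrier Om"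
  unfolding dOm_def by (rule mk_closed) (simp add: \<Phi>_closed crd_closed)

lemma crd_dOm: "w \<in> carrier Om \<Longrightarrow> crd (dOm w) i = (if i = 0 then \<zero>\<^bsub>U\<^esub> else \<Phi> (crd w 0) 0 i)"
  by (auto simp: dOm_def crd_mk \<Phi>_out crd_closed)

lemma dOm_hom: "dOm \<in> module_hom K Om Om"
proof (rule module_homI)
  fix v w assume vw: "v \<in> carrier Om" "w \<in> carrier Om"
  show "dOm (v \<oplus>\<^bsub>Om\<^esub> w) = dOm v \<oplus>\<^bsub>Om\<^esub> dOm w"
    by (intro Om_eqI) (use vw in \<open>simp_all add: dOm_closed Om_closed crd_dOm crd_add crd_closed hom_add[OF \<Phi>_entry_hom]\<close>)
next
  fix c w assume "c \<in> carrier K" "w \<in> carrier Om"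
  then show "dOm (c \<odot>\<^bsub>Om\<^esub> w) = c \<odot>\<^bsub>Om\<^esub> dOm w"
    by (intro Om_eqI) (simp_all add: dOm_closed Om_closed crd_dOm crd_smult crd_closed hom_smult[OF \<Phi>_entry_hom])
qed (rule dOm_closed)

lemma grOm_sub: "LinearCombinations.submodule K (grOm m) Om"
  by (rule LinearCombinations.submodule.intro[OF Om.module_axioms])
    (auto simp: grOm_def Om_closed crd_add crd_smult crd_zero)

lemma grOm_0_slot: "w \<in> grOm 0 \<Longrightarrow> w = slot 0 (crd w 0)"
proof -
  assume w: "w \<in> grOm 0"
  show "w = slot 0 (crd w 0)"
  proof (rule Om_eqI)
    show wc: "w \<in> carrier Om" using w by (simp add: grOm_def)
    show "slot 0 (crd w 0) \<in> carrier Om" by (rule slot_closed[OF crd_closed[OF wc]])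
    show "crd w i = crd (slot 0 (crd w 0)) i" for i
      using w by (cases i) (simp_all add: grOm_def crd_slot)
  qed
qed

lemma slot_0_grOm: "u \<in> carrier U \<Longrightarrow> slot 0 u \<in> grOm 0"
  by (simp add: grOm_def slot_closed crd_slot)

lemma grOm_high: "w \<in> grOm m \<Longrightarrow> m \<noteq> 0 \<Longrightarrow> m \<noteq> 1 \<Longrightarrow> w = \<zero>\<^bsub>Om\<^esub>"
proof -
  assume w: "w \<in> grOm m" and m: "m \<noteq> 0" "m \<noteq> 1"
  have "crd w i = \<zero>\<^bsub>U\<^esub>" for i using w m by (cases i) (simp_all add: grOm_def)
  then show ?thesis using w by (intro Om_eqI) (simp_all add: grOm_def Om_closed crd_zero)
qed

lemma grOm_sum:
  assumes c: "\<And>m. c m \<in> grOm m"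
  shows "(\<Oplus>\<^bsub>Om\<^esub>m\<in>{m. c m \<noteq> \<zero>\<^bsub>Om\<^esub>}. c m) = c 0 \<oplus>\<^bsub>Om\<^esub> c 1"
proof -
  have cc: "c m \<in> carrier Om" for m using c[of m] by (simp add: grOm_def)
  have s: "{m. c m \<noteq> \<zero>\<^bsub>Om\<^esub>} \<subseteq> {0, 1}" using grOm_high[OF c] by blast
  have "(\<Oplus>\<^bsub>Om\<^esub>m\<in>{m. c m \<noteq> \<zero>\<^bsub>Om\<^esub>}. c m) = (\<Oplus>\<^bsub>Om\<^esub>m\<in>{0, 1}. c m)"
    by (rule finsum_superset[OF vsOm _ s]) (use cc in auto)
  then show ?thesis using cc by simp
qed

lemma grOm_direct_sum:
  assumes w: "w \<in> carrier Om"
  shows "\<exists>!c. (\<forall>m. c m \<in> grOm m) \<and> finite {m. c m \<noteq> \<zero>\<^bsub>Om\<^esub>} \<and> w = (\<Oplus>\<^bsub>Om\<^esub>m\<in>{m. c m \<noteq> \<zero>\<^bsub>Om\<^esub>}. c m)"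
proof -
  define c where "c m = (if m = 0 then slot 0 (crd w 0) else if m = 1 then mk (\<lambda>i. if i = 0 then \<zero>\<^bsub>U\<^esub> else crd w i) else \<zero>\<^bsub>Om\<^esub>)" for m :: nat
  have c1: "mk (\<lambda>i. if i = 0 then \<zero>\<^bsub>U\<^esub> else crd w i) \<in> carrier Om" by (rule mk_closed) (simp add: crd_closed w)
  have c: "c m \<in> grOm m" for m
    using w c1 by (auto simp: c_def grOm_def slot_closed crd_closed crd_slot crd_mk crd_zero Om_closed)
  have fin: "finite {m. c m \<noteq> \<zero>\<^bsub>Om\<^esub>}" if "\<And>m. c m \<in> grOm m" for c
  proof -
    have "{m. c m \<noteq> \<zero>\<^bsub>Om\<^esub>} \<subseteq> {0, 1}" using grOm_high[OF that] by blast
    then show ?thesis by (rule finite_subset) simp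
  qed
  have wc: "w = c 0 \<oplus>\<^bsub>Om\<^esub> c 1"
  proof (rule Om_eqI[OF w])
    show "c 0 \<oplus>\<^bsub>Om\<^esub> c 1 \<in> carrier Om" using c[of 0] c[of 1] by (simp add: grOm_def Om_closed)
    show "crd w i = crd (c 0 \<oplus>\<^bsub>Om\<^esub> c 1) i" if "i < N" for i
      using that crd_closed[OF w] by (simp add: crd_add c_def crd_slot crd_mk)
  qed
  show ?thesis
  proof (rule ex1I[of _ c])
    show "(\<forall>m. c m \<in> grOm m) \<and> finite {m. c m \<noteq> \<zero>\<^bsub>Om\<^esub>} \<and> w = (\<Oplus>\<^bsub>Om\<^esub>m\<in>{m. c m \<noteq> \<zero>\<^bsub>Om\<^esub>}. c m)"
      by (intro conjI allI c fin trans[OF wc grOm_sum[symmetric]])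
    fix b assume b: "(\<forall>m. b m \<in> grOm m) \<and> finite {m. b m \<noteq> \<zero>\<^bsub>Om\<^esub>} \<and> w = (\<Oplus>\<^bsub>Om\<^esub>m\<in>{m. b m \<noteq> \<zero>\<^bsub>Om\<^esub>}. b m)"
    then have bm: "\<And>m. b m \<in> grOm m" and wb: "w = b 0 \<oplus>\<^bsub>Om\<^esub> b 1" using grOm_sum[of b] by auto
    \<comment> \<open>The two components occupy disjoint coordinates, so those of the sum determine
      both; this gives uniqueness of the decomposition.\<close>
    have crd_eq: "crd (a m) i = (if (i = 0) = (m = 0) then crd w i else \<zero>\<^bsub>U\<^esub>)"
      if am: "\<And>m. a m \<in> grOm m" and wa: "w = a 0 \<oplus>\<^bsub>Om\<^esub> a 1" and m: "m = 0 \<or> m = 1" for a i m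
    proof -
      have "crd w i = crd (a 0) i \<oplus>\<^bsub>U\<^esub> crd (a 1) i" using wa by (simp add: crd_add)
      then show ?thesis using am[of 0] am[of 1] m crd_closed[of "a 0" i] crd_closed[of "a 1" i]
        by (cases i) (auto simp: grOm_def)
    qed
    show "b = c"
    proof
      fix m
      show "b m = c m"
      proof (cases "m = 0 \<or> m = 1")
        case True
        then show ?thesis
          using bm[of m] c[of m] crd_eq[OF bm wb True] crd_eq[OF c wc True] by (intro Om_eqI) (simp_all add: grOm_def)
      next
        case False
        then show ?thesis using grOm_high[OF bm[of m]] grOm_high[OF c[of m]] by auto
      qed
    qed
  qed
qed

lemma grOm_mult:
  assumes v: "v \<in> grOm k" and w: "w \<in> grOm m"
  shows "v \<otimes>\<^bsub>Om\<^esub> w \<in> grOm (k + m)"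
proof -
  have c: "v \<in> carrier Om" "w \<in> carrier Om" using v w by (simp_all add: grOm_def)
  note cc = crd_closed[OF c(1)] crd_closed[OF c(2)]
  have 0: "crd (v \<otimes>\<^bsub>Om\<^esub> w) 0 = \<zero>\<^bsub>U\<^esub>" if "k + m \<noteq> 0"
    using that v w cc by (auto simp: crd_mult_0[OF c] grOm_def)
  have 1: "crd (v \<otimes>\<^bsub>Om\<^esub> w) (Suc i) = \<zero>\<^bsub>U\<^esub>" if km: "k + m \<noteq> 1" for i
  proof -
    have a: "crd v 0 \<otimes>\<^bsub>U\<^esub> crd w (Suc i) = \<zero>\<^bsub>U\<^esub>"
      using km v w cc by (cases "m = 1") (auto simp: grOm_def)
    have b: "crd v (Suc l) \<otimes>\<^bsub>U\<^esub> \<Phi> (crd w 0) (Suc l) (Suc i) = \<zero>\<^bsub>U\<^esub>" for l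
      using km v w cc \<Phi>_closed[OF cc(2)] by (cases "k = 1") (auto simp: grOm_def hom_zero[OF \<Phi>_entry_hom vsU vsU])
    show ?thesis unfolding crd_mult[OF c] a b by simp
  qed
  show ?thesis using 0 1 Om_mult_closed[OF c] by (auto simp: grOm_def)
qed

lemma dOm_grOm: "w \<in> grOm k \<Longrightarrow> dOm w \<in> grOm (Suc k)"
  by (auto simp: grOm_def dOm_closed crd_dOm hom_zero[OF \<Phi>_entry_hom vsU vsU])

lemma dOm_slot_Suc: "u \<in> carrier U \<Longrightarrow> i < n \<Longrightarrow> dOm (slot (Suc i) u) = \<zero>\<^bsub>Om\<^esub>"
  by (rule Om_eqI) (simp_all add: dOm_closed slot_closed Om_closed crd_dOm crd_slot crd_zero hom_zero[OF \<Phi>_entry_hom vsU vsU])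

lemma dOm_eq_0: "w \<in> carrier Om \<Longrightarrow> crd w 0 = \<zero>\<^bsub>U\<^esub> \<Longrightarrow> dOm w = \<zero>\<^bsub>Om\<^esub>"
  by (rule Om_eqI) (simp_all add: dOm_closed Om_closed crd_dOm crd_zero hom_zero[OF \<Phi>_entry_hom vsU vsU])

text \<open>Row \<open>0\<close> of \<open>\<Phi>_mult\<close> with the summand \<open>k = 0\<close>
  split off: that summand is \<open>u dv\<close> and the remaining ones form \<open>(du) v\<close>,
  where \<open>v\<close> is the function part of \<open>w\<close>.\<close>

lemma dOm_leibniz_0:
  assumes u: "u \<in> carrier U" and w: "w \<in> carrier Om"
  shows "dOm (slot 0 u \<otimes>\<^bsub>Om\<^esub> w) = dOm (slot 0 u) \<otimes>\<^bsub>Om\<^esub> w \<oplus>\<^bsub>Om\<^esub> slot 0 u \<otimes>\<^bsub>Om\<^esub> dOm w"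
proof (rule Om_eqI)
  note c = slot_closed[OF u, of 0] w
  note cc = crd_closed[OF w] u \<Phi>_closed[OF u] \<Phi>_closed[OF crd_closed[OF w]]
  fix i assume "i < N"
  show "crd (dOm (slot 0 u \<otimes>\<^bsub>Om\<^esub> w)) i = crd (dOm (slot 0 u) \<otimes>\<^bsub>Om\<^esub> w \<oplus>\<^bsub>Om\<^esub> slot 0 u \<otimes>\<^bsub>Om\<^esub> dOm w) i"
  proof (cases i)
    case 0
    then show ?thesis
      using c cc by (simp add: crd_dOm crd_add Om_mult_closed dOm_closed crd_mult_0 crd_slot)
  next
    case (Suc k)
    let ?v = "crd w 0"
    have "crd (dOm (slot 0 u \<otimes>\<^bsub>Om\<^esub> w)) i = (\<Oplus>\<^bsub>U\<^esub>k\<in>{..<N}. \<Phi> u 0 k \<otimes>\<^bsub>U\<^esub> \<Phi> ?v k i)"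
      using c Suc cc by (simp add: crd_dOm Om_mult_closed crd_mult_0 crd_slot \<Phi>_mult)
    also have "\<dots> = \<Phi> u 0 0 \<otimes>\<^bsub>U\<^esub> \<Phi> ?v 0 i \<oplus>\<^bsub>U\<^esub> (\<Oplus>\<^bsub>U\<^esub>k\<in>{..<n}. \<Phi> u 0 (Suc k) \<otimes>\<^bsub>U\<^esub> \<Phi> ?v (Suc k) i)"
      by (rule U.M.finsum_lessThan_Suc_shift) (use cc in simp)
    finally have l: "crd (dOm (slot 0 u \<otimes>\<^bsub>Om\<^esub> w)) i = u \<otimes>\<^bsub>U\<^esub> \<Phi> ?v 0 i \<oplus>\<^bsub>U\<^esub> (\<Oplus>\<^bsub>U\<^esub>k\<in>{..<n}. \<Phi> u 0 (Suc k) \<otimes>\<^bsub>U\<^esub> \<Phi> ?v (Suc k) i)"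
      using \<Phi>_column_0[OF u, of 0] by simp
    have s: "(\<Oplus>\<^bsub>U\<^esub>k\<in>{..<n}. \<Phi> u 0 (Suc k) \<otimes>\<^bsub>U\<^esub> \<Phi> ?v (Suc k) i) \<in> carrier U"
      by (rule U.M.finsum_closed) (use cc in simp)
    have r1: "crd (dOm (slot 0 u) \<otimes>\<^bsub>Om\<^esub> w) i = (\<Oplus>\<^bsub>U\<^esub>k\<in>{..<n}. \<Phi> u 0 (Suc k) \<otimes>\<^bsub>U\<^esub> \<Phi> ?v (Suc k) i)"
      using c cc s by (simp add: crd_mult dOm_closed crd_dOm crd_slot)
    have "(\<Oplus>\<^bsub>U\<^esub>k\<in>{..<n}. crd (slot 0 u) (Suc k) \<otimes>\<^bsub>U\<^esub> \<Phi> (crd (dOm w) 0) (Suc k) i) = (\<Oplus>\<^bsub>U\<^esub>k\<in>{..<n}. \<zero>\<^bsub>U\<^esub>)"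
      by (rule U.M.finsum_cong'[OF refl]) (use c cc in \<open>simp_all add: crd_slot \<Phi>_closed crd_closed dOm_closed\<close>)
    then have r2: "crd (slot 0 u \<otimes>\<^bsub>Om\<^esub> dOm w) i = u \<otimes>\<^bsub>U\<^esub> \<Phi> ?v 0 i"
      using c cc Suc by (simp add: crd_mult dOm_closed crd_dOm crd_slot)
    show ?thesis unfolding l crd_add r1 r2 using cc s by (simp add: U.M.add.m_comm)
  qed
qed (use u w in \<open>simp_all add: slot_closed Om_mult_closed Om_closed dOm_closed\<close>)

text \<open>In positive degree every term is zero: \<open>v\<close> and \<open>v w\<close> have no
  function part, so \<open>d\<close> kills them, and \<open>v dw\<close> has degree at least
  two.\<close>

lemma dOm_leibniz:
  assumes v: "v \<in> grOm m" and w: "w \<in> carrier Om"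
  shows "dOm (v \<otimes>\<^bsub>Om\<^esub> w) = dOm v \<otimes>\<^bsub>Om\<^esub> w \<oplus>\<^bsub>Om\<^esub> (\<ominus>\<^bsub>Om\<^esub> \<one>\<^bsub>Om\<^esub>) [^]\<^bsub>Om\<^esub> m \<otimes>\<^bsub>Om\<^esub> (v \<otimes>\<^bsub>Om\<^esub> dOm w)"
proof (cases "m = 0")
  case True
  define u where "u = crd v 0"
  have v0: "v = slot 0 u" "u \<in> carrier U" using grOm_0_slot[of v] v True by (simp_all add: u_def grOm_def crd_closed)
  show ?thesis using dOm_leibniz_0[OF v0(2) w] True v0 w by (simp add: Om_mult_closed slot_closed dOm_closed)
next
  case False
  have vc: "v \<in> carrier Om" and v0: "crd v 0 = \<zero>\<^bsub>U\<^esub>" using v False by (simp_all add: grOm_def)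
  have "dOm w \<in> grOm 1" using w by (auto simp: grOm_def dOm_closed crd_dOm)
  from grOm_high[OF grOm_mult[OF v this]] False have z: "v \<otimes>\<^bsub>Om\<^esub> dOm w = \<zero>\<^bsub>Om\<^esub>" by simp
  have "crd (v \<otimes>\<^bsub>Om\<^esub> w) 0 = \<zero>\<^bsub>U\<^esub>" using v0 w vc by (simp add: crd_mult_0 crd_closed)
  then have "dOm (v \<otimes>\<^bsub>Om\<^esub> w) = \<zero>\<^bsub>Om\<^esub>" using vc w by (simp add: dOm_eq_0 Om_mult_closed)
  then show ?thesis using dOm_eq_0[OF vc v0] z w by simp
qed

abbreviation "theta i \<equiv> slot (Suc i) \<one>\<^bsub>U\<^esub>"

lemma dOm_\<iota>:
  assumes x: "x \<in> carrier M"
  shows "dOm (slot 0 (\<iota> x)) = (\<Oplus>\<^bsub>Om\<^esub>i\<in>{..<n}. co i x \<odot>\<^bsub>Om\<^esub> theta i)"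
proof (rule Om_eqI)
  note c = \<iota>_closed[OF x] co_closed[OF x]
  have tc: "co i x \<odot>\<^bsub>Om\<^esub> theta i \<in> carrier Om" for i using c by (simp add: Om_closed slot_closed)
  show "dOm (slot 0 (\<iota> x)) \<in> carrier Om" using c by (simp add: dOm_closed slot_closed)
  show "(\<Oplus>\<^bsub>Om\<^esub>i\<in>{..<n}. co i x \<odot>\<^bsub>Om\<^esub> theta i) \<in> carrier Om" by (rule Om.M.finsum_closed) (use tc in simp)
  fix k assume k: "k < N"
  have "crd (\<Oplus>\<^bsub>Om\<^esub>i\<in>{..<n}. co i x \<odot>\<^bsub>Om\<^esub> theta i) k = (\<Oplus>\<^bsub>U\<^esub>i\<in>{..<n}. crd (co i x \<odot>\<^bsub>Om\<^esub> theta i) k)"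
    by (rule hom_finsum[OF crd_hom vsOm vsU]) (use tc in simp_all)
  also have "\<dots> = (if k = 0 then \<zero>\<^bsub>U\<^esub> else co (k - 1) x \<odot>\<^bsub>U\<^esub> \<one>\<^bsub>U\<^esub>)"
  proof (cases k)
    case 0
    have "(\<Oplus>\<^bsub>U\<^esub>i\<in>{..<n}. crd (co i x \<odot>\<^bsub>Om\<^esub> theta i) k) = (\<Oplus>\<^bsub>U\<^esub>i\<in>{..<n}. \<zero>\<^bsub>U\<^esub>)"
      by (rule U.M.finsum_cong'[OF refl]) (use c 0 in \<open>simp_all add: crd_smult crd_slot\<close>)
    then show ?thesis using 0 by simp
  next
    case (Suc l)
    have "(\<Oplus>\<^bsub>U\<^esub>i\<in>{..<n}. crd (co i x \<odot>\<^bsub>Om\<^esub> theta i) k) = (\<Oplus>\<^bsub>U\<^esub>i\<in>{..<n}. if l = i then co i x \<odot>\<^bsub>U\<^esub> \<one>\<^bsub>U\<^esub> else \<zero>\<^bsub>U\<^esub>)"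
      by (rule U.M.finsum_cong'[OF refl]) (use c Suc in \<open>auto simp: crd_smult crd_slot\<close>)
    also have "\<dots> = co l x \<odot>\<^bsub>U\<^esub> \<one>\<^bsub>U\<^esub>" by (rule U.M.finsum_singleton) (use c Suc k in auto)
    finally show ?thesis using Suc by simp
  qed
  finally show "crd (dOm (slot 0 (\<iota> x))) k = crd (\<Oplus>\<^bsub>Om\<^esub>i\<in>{..<n}. co i x \<odot>\<^bsub>Om\<^esub> theta i) k"
    using c k by (cases k) (simp_all add: crd_dOm slot_closed crd_slot \<Phi>_\<iota>_row_0 x)
qed

lemma dOm_e: "i < n \<Longrightarrow> dOm (slot 0 (\<iota> (e i))) = theta i"
  using dOm_\<iota>[OF e_closed[of i]] finsum_delta[OF vsOm, of "\<lambda>l. theta l" i] by (simp add: slot_closed)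

lemma slot_0_hom: "slot 0 \<in> algebra_hom K U Om"
proof (rule algebra_homI[OF slot_hom])
  show "slot 0 \<one>\<^bsub>U\<^esub> = \<one>\<^bsub>Om\<^esub>" by (rule Om_eqI) (simp_all add: slot_closed Om_closed crd_slot crd_one)
qed (simp add: slot_0_mult)

text \<open>The basic forms are the differentials of the \<open>\<iota> (e k)\<close>. Left
  multiples of them, together with the functions, already fill all slots.\<close>

lemma generated_Om: "generate_ring Om (slot 0 ` carrier U \<union> dOm ` slot 0 ` carrier U) = carrier Om"
proof
  let ?H = "slot 0 ` carrier U \<union> dOm ` slot 0 ` carrier U"
  let ?R = "generate_ring Om ?H"
  have H: "?H \<subseteq> carrier Om" by (auto simp: slot_closed dOm_closed)
  show "?R \<subseteq> carrier Om" using Om.A.generate_ring_in_carrier[OF H] by blast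
  show "carrier Om \<subseteq> ?R"
  proof
    fix w assume w: "w \<in> carrier Om"
    have j: "slot 0 u \<in> ?R" if "u \<in> carrier U" for u using that by (intro generate_ring.incl) blast
    have t: "slot i u \<in> ?R" if i: "i < N" and u: "u \<in> carrier U" for i u
    proof (cases i)
      case 0 then show ?thesis using j u by simp
    next
      case (Suc k)
      have "dOm (slot 0 (\<iota> (e k))) \<in> ?R" using \<iota>_closed[OF e_closed] by (intro generate_ring.incl) blast
      moreover have "k < n" using Suc i by simp
      ultimately have "theta k \<in> ?R" by (simp only: dOm_e)
      from generate_ring.eng_mult[OF j[OF u] this] show ?thesis using Suc i u by (simp add: slot_0_mult)
    qed
    have z: "\<zero>\<^bsub>Om\<^esub> \<in> ?R"
    proof -
      have "\<one>\<^bsub>Om\<^esub> \<oplus>\<^bsub>Om\<^esub> \<ominus>\<^bsub>Om\<^esub> \<one>\<^bsub>Om\<^esub> \<in> ?R" by (intro generate_ring.eng_add generate_ring.a_inv generate_ring.one)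
      then show ?thesis by (simp add: Om.M.r_neg Om_closed)
    qed
    have "(\<Oplus>\<^bsub>Om\<^esub>i\<in>A. slot i (crd w i)) \<in> ?R" if "finite A" "A \<subseteq> {..<N}" for A
      using that
    proof (induct A rule: finite_induct)
      case empty then show ?case using z by simp
    next
      case (insert i A)
      have "(\<lambda>i. slot i (crd w i)) \<in> A \<rightarrow> carrier Om" "slot i (crd w i) \<in> carrier Om" using w by (simp_all add: slot_closed crd_closed)
      then have "(\<Oplus>\<^bsub>Om\<^esub>i\<in>insert i A. slot i (crd w i)) = slot i (crd w i) \<oplus>\<^bsub>Om\<^esub> (\<Oplus>\<^bsub>Om\<^esub>i\<in>A. slot i (crd w i))"
        by (rule Om.M.finsum_insert[OF insert(1,2)])
      then show ?case using insert t[of i "crd w i"] crd_closed[OF w] by (simp add: generate_ring.eng_add)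
    qed
    from this[OF finite_lessThan order_refl] show "w \<in> ?R"
      by (rule ssubst[OF Om_decomp[OF w], of "\<lambda>x. x \<in> ?R"])
  qed
qed

lemma dga_Om: "dga_over K Om grOm U (slot 0) dOm"
proof (intro dga_over.intro graded_algebra.intro dga_over_axioms.intro)
  show "assoc_algebra K Om" by (simp add: assoc_algebra_iff Om_assoc_alg)
  show "VectorSpace.subspace K (grOm m) Om" for m by (simp add: VectorSpace.subspace_def grOm_sub vsOm)
  show "\<one>\<^bsub>Om\<^esub> \<in> grOm 0" by (simp add: grOm_def Om_closed crd_one)
  show "inj_on (slot 0) (carrier U)"
  proof (rule inj_onI)
    fix u v assume "slot 0 u = slot 0 v"
    then have "crd (slot 0 u) 0 = crd (slot 0 v) 0" by simp
    then show "u = v" by (simp add: crd_slot)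
  qed
  show "slot 0 ` carrier U = grOm 0"
  proof
    show "slot 0 ` carrier U \<subseteq> grOm 0" using slot_0_grOm by blast
    show "grOm 0 \<subseteq> slot 0 ` carrier U"
    proof
      fix w assume w: "w \<in> grOm 0"
      then have "w \<in> carrier Om" by (simp add: grOm_def)
      then show "w \<in> slot 0 ` carrier U" using grOm_0_slot[OF w] crd_closed[of w 0] by blast
    qed
  qed
  show "dOm (dOm w) = \<zero>\<^bsub>Om\<^esub>" if "w \<in> carrier Om" for w
    using that by (intro dOm_eq_0) (simp_all add: dOm_closed crd_dOm)
qed (fact grOm_direct_sum grOm_mult slot_0_hom dOm_hom dOm_grOm dOm_leibniz generated_Om)+

end

section \<open>Covariance\<close>

context pre_lie_coords begin

abbreviation "UO \<equiv> tensor K U Om"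
abbreviation "OU \<equiv> tensor K Om U"

lemma UO_assoc_alg: "assoc_alg K UO" by (rule tensor_assoc_alg[OF U_assoc_alg Om_assoc_alg])

sublocale UO: assoc_alg K UO by (rule UO_assoc_alg)

lemma OU_assoc_alg: "assoc_alg K OU" by (rule tensor_assoc_alg[OF Om_assoc_alg U_assoc_alg])

sublocale OU: assoc_alg K OU by (rule OU_assoc_alg)

lemmas vsUO = UO.vectorspace_axioms and vsOU = OU.vectorspace_axioms and vsUU = UU.vectorspace_axioms
lemmas \<Delta>_hom = algebra_homD(1)[OF coproduct_hom]
lemmas \<Delta>_closed = hom_closed[OF \<Delta>_hom]
lemmas UO_bilinear = tens_bilinear[OF vsU vsOm]
lemmas UO_mult = tens_mult[OF U_assoc_alg Om_assoc_alg]

definition id_slot where "id_slot i = tensor_map K U Om id (slot i)"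

lemma id_slot_hom: "id_slot i \<in> module_hom K UU UO"
  unfolding id_slot_def by (rule tensor_map_hom[OF vsU vsU vsU vsOm hom_id(2) slot_hom])

lemma id_slot_tens: "a \<in> carrier U \<Longrightarrow> b \<in> carrier U \<Longrightarrow> id_slot i (tens K U U a b) = tens K U Om a (slot i b)"
  unfolding id_slot_def using tensor_map_tens[OF vsU vsU vsU vsOm hom_id(2) slot_hom] by (simp only: id_apply)

lemmas id_slot_closed = hom_closed[OF id_slot_hom]

text \<open>The coproduct in every slot, that is
  \<open>\<Delta>L (u d e_k) = \<Delta>(u) (1 \<otimes> d e_k)\<close>, with the basic forms
  invariant.\<close>

definition coactL where
  "coactL w = (\<Oplus>\<^bsub>UO\<^esub>i\<in>{..<N}. id_slot i (\<Delta> (crd w i)))"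

lemma coactL_hom: "coactL \<in> module_hom K Om UO"
  unfolding coactL_def
  by (intro hom_finsum_maps[OF vsUO] hom_comp[OF hom_comp[OF crd_hom \<Delta>_hom] id_slot_hom]) simp

lemma coactL_slot:
  assumes i: "i < N" and u: "u \<in> carrier U"
  shows "coactL (slot i u) = id_slot i (\<Delta> u)"
proof -
  have z: "id_slot k (\<Delta> \<zero>\<^bsub>U\<^esub>) = \<zero>\<^bsub>UO\<^esub>" for k
    by (rule hom_zero[OF hom_comp[OF \<Delta>_hom id_slot_hom] vsU vsUO])
  have "coactL (slot i u) = (\<Oplus>\<^bsub>UO\<^esub>k\<in>{..<N}. if i = k then id_slot k (\<Delta> u) else \<zero>\<^bsub>UO\<^esub>)"
    unfolding coactL_def
    by (rule UO.M.finsum_cong'[OF refl]) (use i u z in \<open>auto simp: crd_slot id_slot_closed \<Delta>_closed\<close>)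
  also have "\<dots> = id_slot i (\<Delta> u)"
    by (rule UO.M.finsum_singleton) (use i u in \<open>auto simp: id_slot_closed \<Delta>_closed\<close>)
  finally show ?thesis .
qed

lemma tens_one_UU: "\<one>\<^bsub>UU\<^esub> = tens K U U \<one>\<^bsub>U\<^esub> \<one>\<^bsub>U\<^esub>" by (rule tens_one[OF U_assoc_alg U_assoc_alg])
lemma tens_one_UO: "\<one>\<^bsub>UO\<^esub> = tens K U Om \<one>\<^bsub>U\<^esub> \<one>\<^bsub>Om\<^esub>" by (rule tens_one[OF U_assoc_alg Om_assoc_alg])

text \<open>Checks an identity bilinear in two elements of \<open>U \<otimes> U\<close> on pairs of
  elementary tensors.\<close>

lemma UU_bilinear_eq:
  assumes "vectorspace K Z"
    "\<And>Y. Y \<in> carrier UU \<Longrightarrow> (\<lambda>X. f X Y) \<in> module_hom K UU Z" "\<And>X. X \<in> carrier UU \<Longrightarrow> (\<lambda>Y. f X Y) \<in> module_hom K UU Z"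
    "\<And>Y. Y \<in> carrier UU \<Longrightarrow> (\<lambda>X. g X Y) \<in> module_hom K UU Z" "\<And>X. X \<in> carrier UU \<Longrightarrow> (\<lambda>Y. g X Y) \<in> module_hom K UU Z"
    "\<And>a b c d. a \<in> carrier U \<Longrightarrow> b \<in> carrier U \<Longrightarrow> c \<in> carrier U \<Longrightarrow> d \<in> carrier U \<Longrightarrow>
      f (tens K U U a b) (tens K U U c d) = g (tens K U U a b) (tens K U U c d)"
    "X \<in> carrier UU" "Y \<in> carrier UU"
  shows "f X Y = g X Y"
proof (rule UU_hom_eq[OF assms(1,2,4) _ assms(7)])
  fix a b assume ab: "a \<in> carrier U" "b \<in> carrier U"
  show "f (tens K U U a b) Y = g (tens K U U a b) Y"
    by (rule UU_hom_eq[OF assms(1) assms(3)[OF UU_closed[OF ab]] assms(5)[OF UU_closed[OF ab]] _ assms(8)])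
      (rule assms(6)[OF ab])
qed (rule assms(8))+

lemma id_slot_mult_0:
  assumes X: "X \<in> carrier UU" and Y: "Y \<in> carrier UU" and k: "k < N"
  shows "id_slot 0 X \<otimes>\<^bsub>UO\<^esub> id_slot k Y = id_slot k (X \<otimes>\<^bsub>UU\<^esub> Y)"
  by (rule UU_bilinear_eq[where f="\<lambda>X Y. id_slot 0 X \<otimes>\<^bsub>UO\<^esub> id_slot k Y" and g="\<lambda>X Y. id_slot k (X \<otimes>\<^bsub>UU\<^esub> Y)",
        OF vsUO hom_comp[OF id_slot_hom UO.mult_hom_left[OF id_slot_closed]] hom_comp[OF id_slot_hom UO.mult_hom_right[OF id_slot_closed]]
        hom_comp[OF UU.mult_hom_left id_slot_hom] hom_comp[OF UU.mult_hom_right id_slot_hom] _ X Y])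
    (use k in \<open>simp_all add: id_slot_tens UO_mult slot_closed slot_0_mult UU_mult\<close>)

lemma id_slot_mult_Suc:
  assumes X: "X \<in> carrier UU" and Y: "Y \<in> carrier UU" and i: "i < n" and k: "k < n"
  shows "id_slot (Suc i) X \<otimes>\<^bsub>UO\<^esub> id_slot (Suc k) Y = \<zero>\<^bsub>UO\<^esub>"
proof -
  have z: "tens K U Om a \<zero>\<^bsub>Om\<^esub> = \<zero>\<^bsub>UO\<^esub>" if "a \<in> carrier U" for a
    by (rule hom_zero[OF bilinearD(1)[OF UO_bilinear that] vsOm vsUO])
  show ?thesis
    by (rule UU_bilinear_eq[where f="\<lambda>X Y. id_slot (Suc i) X \<otimes>\<^bsub>UO\<^esub> id_slot (Suc k) Y" and g="\<lambda>X Y. \<zero>\<^bsub>UO\<^esub>",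
        OF vsUO hom_comp[OF id_slot_hom UO.mult_hom_left[OF id_slot_closed]] hom_comp[OF id_slot_hom UO.mult_hom_right[OF id_slot_closed]]
        hom_zero_map[OF vsUO] hom_zero_map[OF vsUO] _ X Y])
      (use i k z in \<open>simp_all add: id_slot_tens UO_mult slot_closed slot_Suc_mult_Suc\<close>)
qed

text \<open>Lifts the right action \<open>slot_Suc_mult_0\<close> to the second tensor factor, in
  the shape in which \<open>coproduct_\<Phi>\<close> can be used.\<close>

lemma id_slot_mult_Suc_0:
  assumes X: "X \<in> carrier UU" and Y: "Y \<in> carrier UU" and i: "i < n"
  shows "id_slot (Suc i) X \<otimes>\<^bsub>UO\<^esub> id_slot 0 Y = (\<Oplus>\<^bsub>UO\<^esub>k\<in>{..<N}. id_slot k (X \<otimes>\<^bsub>UU\<^esub> id_\<Phi> (Suc i) k Y))"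
proof (rule UU_bilinear_eq[where f="\<lambda>X Y. id_slot (Suc i) X \<otimes>\<^bsub>UO\<^esub> id_slot 0 Y" and g="\<lambda>X Y. \<Oplus>\<^bsub>UO\<^esub>k\<in>{..<N}. id_slot k (X \<otimes>\<^bsub>UU\<^esub> id_\<Phi> (Suc i) k Y)",
      OF vsUO hom_comp[OF id_slot_hom UO.mult_hom_left[OF id_slot_closed]] hom_comp[OF id_slot_hom UO.mult_hom_right[OF id_slot_closed]]
      _ _ _ X Y])
  show "(\<lambda>X. \<Oplus>\<^bsub>UO\<^esub>k\<in>{..<N}. id_slot k (X \<otimes>\<^bsub>UU\<^esub> id_\<Phi> (Suc i) k Y)) \<in> module_hom K UU UO" if "Y \<in> carrier UU" for Y
    by (intro hom_finsum_maps[OF vsUO] hom_comp[OF UU.mult_hom_left[OF hom_closed[OF id_\<Phi>_hom that]] id_slot_hom]) simp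
  show "(\<lambda>Y. \<Oplus>\<^bsub>UO\<^esub>k\<in>{..<N}. id_slot k (X \<otimes>\<^bsub>UU\<^esub> id_\<Phi> (Suc i) k Y)) \<in> module_hom K UU UO" if "X \<in> carrier UU" for X
    by (intro hom_finsum_maps[OF vsUO] hom_comp[OF hom_comp[OF id_\<Phi>_hom UU.mult_hom_right[OF that]] id_slot_hom]) simp
  fix a b c d assume ab: "a \<in> carrier U" "b \<in> carrier U" and cd: "c \<in> carrier U" "d \<in> carrier U"
  note cl = ab cd \<Phi>_closed[OF cd(2)]
  have "tens K U Om (a \<otimes>\<^bsub>U\<^esub> c) (\<Oplus>\<^bsub>Om\<^esub>k\<in>{..<N}. slot k (b \<otimes>\<^bsub>U\<^esub> \<Phi> d (Suc i) k))
      = (\<Oplus>\<^bsub>UO\<^esub>k\<in>{..<N}. tens K U Om (a \<otimes>\<^bsub>U\<^esub> c) (slot k (b \<otimes>\<^bsub>U\<^esub> \<Phi> d (Suc i) k)))"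
    by (rule hom_finsum[OF bilinearD(1)[OF UO_bilinear] vsOm vsUO]) (use cl in \<open>simp_all add: slot_closed\<close>)
  then show "id_slot (Suc i) (tens K U U a b) \<otimes>\<^bsub>UO\<^esub> id_slot 0 (tens K U U c d)
      = (\<Oplus>\<^bsub>UO\<^esub>k\<in>{..<N}. id_slot k (tens K U U a b \<otimes>\<^bsub>UU\<^esub> id_\<Phi> (Suc i) k (tens K U U c d)))"
    using cl i by (simp add: id_slot_tens id_\<Phi>_tens UO_mult UU_mult slot_closed slot_Suc_mult_0)
qed

text \<open>A function times a slot uses multiplicativity of \<open>\<Delta>\<close>, and two
  1-forms give zero on both sides. For a 1-form times a function, the coproduct must also commute
  with the entries of \<open>\<Phi>\<close>.\<close>

lemma coactL_mult_slots:
  assumes i: "i < N" and k: "k < N" and u: "u \<in> carrier U" and v: "v \<in> carrier U"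
  shows "coactL (slot i u \<otimes>\<^bsub>Om\<^esub> slot k v) = coactL (slot i u) \<otimes>\<^bsub>UO\<^esub> coactL (slot k v)"
proof (cases i)
  case 0
  then show ?thesis
    using k u v by (simp add: slot_0_mult coactL_slot algebra_homD(3)[OF coproduct_hom] id_slot_mult_0 \<Delta>_closed)
next
  case (Suc i')
  then have i': "i' < n" using i by simp
  show ?thesis
  proof (cases k)
    case 0
    have "coactL (slot i u \<otimes>\<^bsub>Om\<^esub> slot k v) = (\<Oplus>\<^bsub>UO\<^esub>m\<in>{..<N}. coactL (slot m (u \<otimes>\<^bsub>U\<^esub> \<Phi> v (Suc i') m)))"
      unfolding 0 Suc slot_Suc_mult_0[OF u v i']
      by (rule hom_finsum[OF coactL_hom vsOm vsUO]) (use u \<Phi>_closed[OF v] in \<open>simp_all add: slot_closed\<close>)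
    also have "\<dots> = (\<Oplus>\<^bsub>UO\<^esub>m\<in>{..<N}. id_slot m (\<Delta> u \<otimes>\<^bsub>UU\<^esub> id_\<Phi> (Suc i') m (\<Delta> v)))"
    proof (rule UO.M.finsum_cong'[OF refl])
      fix m assume m: "m \<in> {..<N}"
      have "\<Delta> (\<Phi> v (Suc i') m) = id_\<Phi> (Suc i') m (\<Delta> v)" using coproduct_\<Phi>[OF v, of "Suc i'"] m by simp
      then show "coactL (slot m (u \<otimes>\<^bsub>U\<^esub> \<Phi> v (Suc i') m)) = id_slot m (\<Delta> u \<otimes>\<^bsub>UU\<^esub> id_\<Phi> (Suc i') m (\<Delta> v))"
        using m u \<Phi>_closed[OF v] by (simp add: coactL_slot algebra_homD(3)[OF coproduct_hom])
    qed (use u v in \<open>auto simp: id_slot_closed \<Delta>_closed hom_closed[OF id_\<Phi>_hom]\<close>)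
    also have "\<dots> = coactL (slot i u) \<otimes>\<^bsub>UO\<^esub> coactL (slot k v)"
      using i k u v unfolding Suc 0 by (simp add: coactL_slot id_slot_mult_Suc_0 i' \<Delta>_closed)
    finally show ?thesis .
  next
    case (Suc k')
    then show ?thesis
      using i i' k u v \<open>i = Suc i'\<close> hom_zero[OF coactL_hom vsOm vsUO]
      by (simp add: slot_Suc_mult_Suc coactL_slot id_slot_mult_Suc \<Delta>_closed)
  qed
qed

lemma coactL_algebra_hom: "coactL \<in> algebra_hom K Om UO"
proof (rule algebra_homI[OF coactL_hom])
  have "\<one>\<^bsub>Om\<^esub> = slot 0 \<one>\<^bsub>U\<^esub>" using algebra_homD(4)[OF slot_0_hom] by simp
  then show "coactL \<one>\<^bsub>Om\<^esub> = \<one>\<^bsub>UO\<^esub>"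
    by (simp add: coactL_slot algebra_homD(4)[OF coproduct_hom] tens_one_UU id_slot_tens tens_one_UO)
  note cc = hom_closed[OF coactL_hom]
  have 1: "coactL (slot i u \<otimes>\<^bsub>Om\<^esub> w) = coactL (slot i u) \<otimes>\<^bsub>UO\<^esub> coactL w"
    if "i < N" "u \<in> carrier U" "w \<in> carrier Om" for i u w
    by (rule Om_hom_eq[OF vsUO hom_comp[OF Om.mult_hom_right coactL_hom] hom_comp[OF coactL_hom UO.mult_hom_right] _ that(3)])
      (use that in \<open>simp_all add: slot_closed cc coactL_mult_slots\<close>)
  show "coactL (v \<otimes>\<^bsub>Om\<^esub> w) = coactL v \<otimes>\<^bsub>UO\<^esub> coactL w" if "v \<in> carrier Om" "w \<in> carrier Om" for v w
    by (rule Om_hom_eq[OF vsUO hom_comp[OF Om.mult_hom_left[OF that(2)] coactL_hom] hom_comp[OF coactL_hom UO.mult_hom_left[OF cc[OF that(2)]]] _ that(1)])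
      (rule 1[OF _ _ that(2)])
qed

text \<open>On 1-forms both sides vanish. On functions \<open>d\<close> is row \<open>0\<close> of
  \<open>\<Phi>\<close>, and the claim is \<open>coproduct_\<Phi>\<close> for that row.\<close>

lemma coactL_d:
  assumes w: "w \<in> carrier Om"
  shows "coactL (dOm w) = tensor_map K U Om id dOm (coactL w)"
proof -
  note th = tensor_map_hom[OF vsU vsOm vsU vsOm hom_id(2) dOm_hom]
  have tt: "tensor_map K U Om id dOm (tens K U Om a v) = tens K U Om a (dOm v)" if "a \<in> carrier U" "v \<in> carrier Om" for a v
    using tensor_map_tens[OF vsU vsOm vsU vsOm hom_id(2) dOm_hom that] by (simp only: id_apply)
  have z: "tens K U Om a \<zero>\<^bsub>Om\<^esub> = \<zero>\<^bsub>UO\<^esub>" if "a \<in> carrier U" for a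
    by (rule hom_zero[OF bilinearD(1)[OF UO_bilinear that] vsOm vsUO])
  show ?thesis
  proof (rule Om_hom_eq[OF vsUO hom_comp[OF dOm_hom coactL_hom] hom_comp[OF coactL_hom th] _ w])
    fix i u assume i: "i < N" and u: "u \<in> carrier U"
    show "coactL (dOm (slot i u)) = tensor_map K U Om id dOm (coactL (slot i u))"
    proof (cases i)
      case (Suc k)
      have "tensor_map K U Om id dOm (id_slot i X) = \<zero>\<^bsub>UO\<^esub>" if "X \<in> carrier UU" for X
        by (rule UU_hom_eq[OF vsUO hom_comp[OF id_slot_hom th] hom_zero_map[OF vsUO] _ that])
          (use Suc i in \<open>simp only: id_slot_tens tt slot_closed dOm_slot_Suc Suc_less_eq z\<close>)
      moreover have "dOm (slot i u) = \<zero>\<^bsub>Om\<^esub>" using Suc i u by (simp add: dOm_slot_Suc)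
      ultimately show ?thesis
        using coactL_slot[OF i u] hom_zero[OF coactL_hom vsOm vsUO] \<Delta>_closed[OF u] by simp
    next
      case 0
      have d0: "dOm (slot 0 v) = (\<Oplus>\<^bsub>Om\<^esub>k\<in>{..<n}. slot (Suc k) (\<Phi> v 0 (Suc k)))" if v: "v \<in> carrier U" for v
      proof -
        have c: "slot k (crd (dOm (slot 0 v)) k) \<in> carrier Om" for k
          using v by (simp add: slot_closed dOm_closed crd_closed)
        have "dOm (slot 0 v) = slot 0 (crd (dOm (slot 0 v)) 0) \<oplus>\<^bsub>Om\<^esub> (\<Oplus>\<^bsub>Om\<^esub>k\<in>{..<n}. slot (Suc k) (crd (dOm (slot 0 v)) (Suc k)))"
          by (rule trans[OF Om_decomp[OF dOm_closed[OF slot_closed[OF v]]] Om.M.finsum_lessThan_Suc_shift[OF c]])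
        moreover have "crd (dOm (slot 0 v)) (Suc k) = \<Phi> v 0 (Suc k)" "crd (dOm (slot 0 v)) 0 = \<zero>\<^bsub>U\<^esub>" for k
          using v by (simp_all add: crd_dOm slot_closed crd_slot)
        moreover have "slot 0 \<zero>\<^bsub>U\<^esub> = \<zero>\<^bsub>Om\<^esub>" by (rule hom_zero[OF slot_hom vsU vsOm])
        moreover have "(\<Oplus>\<^bsub>Om\<^esub>k\<in>{..<n}. slot (Suc k) (\<Phi> v 0 (Suc k))) \<in> carrier Om"
          by (rule Om.M.finsum_closed) (use \<Phi>_closed[OF v] in \<open>simp add: slot_closed\<close>)
        ultimately show ?thesis by (simp only: Om.M.l_zero)
      qed
      have d1: "tensor_map K U Om id dOm (id_slot 0 X) = (\<Oplus>\<^bsub>UO\<^esub>k\<in>{..<n}. id_slot (Suc k) (id_\<Phi> 0 (Suc k) X))" if X: "X \<in> carrier UU" for X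
      proof (rule UU_hom_eq[OF vsUO hom_comp[OF id_slot_hom th] hom_finsum_maps[OF vsUO _ hom_comp[OF id_\<Phi>_hom id_slot_hom]] _ X])
        fix a b assume ab: "a \<in> carrier U" "b \<in> carrier U"
        have "tens K U Om a (\<Oplus>\<^bsub>Om\<^esub>k\<in>{..<n}. slot (Suc k) (\<Phi> b 0 (Suc k))) = (\<Oplus>\<^bsub>UO\<^esub>k\<in>{..<n}. tens K U Om a (slot (Suc k) (\<Phi> b 0 (Suc k))))"
          by (rule hom_finsum[OF bilinearD(1)[OF UO_bilinear ab(1)] vsOm vsUO]) (use \<Phi>_closed[OF ab(2)] in \<open>simp_all add: slot_closed\<close>)
        then show "tensor_map K U Om id dOm (id_slot 0 (tens K U U a b)) = (\<Oplus>\<^bsub>UO\<^esub>k\<in>{..<n}. id_slot (Suc k) (id_\<Phi> 0 (Suc k) (tens K U U a b)))"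
          using ab \<Phi>_closed[OF ab(2)] by (simp only: id_slot_tens id_\<Phi>_tens tt slot_closed d0)
      qed simp
      have "coactL (dOm (slot 0 u)) = (\<Oplus>\<^bsub>UO\<^esub>k\<in>{..<n}. coactL (slot (Suc k) (\<Phi> u 0 (Suc k))))"
        unfolding d0[OF u] by (rule hom_finsum[OF coactL_hom vsOm vsUO]) (use \<Phi>_closed[OF u] in \<open>simp_all add: slot_closed\<close>)
      also have "\<dots> = (\<Oplus>\<^bsub>UO\<^esub>k\<in>{..<n}. id_slot (Suc k) (id_\<Phi> 0 (Suc k) (\<Delta> u)))"
      proof (rule UO.M.finsum_cong'[OF refl])
        fix k assume k: "k \<in> {..<n}"
        have "\<Delta> (\<Phi> u 0 (Suc k)) = id_\<Phi> 0 (Suc k) (\<Delta> u)" using coproduct_\<Phi>[OF u, of 0] k by simp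
        then show "coactL (slot (Suc k) (\<Phi> u 0 (Suc k))) = id_slot (Suc k) (id_\<Phi> 0 (Suc k) (\<Delta> u))"
          using k \<Phi>_closed[OF u] by (simp add: coactL_slot)
      qed (use u in \<open>auto simp: id_slot_closed \<Delta>_closed hom_closed[OF id_\<Phi>_hom]\<close>)
      also have "\<dots> = tensor_map K U Om id dOm (id_slot 0 (\<Delta> u))" by (rule d1[OF \<Delta>_closed[OF u], symmetric])
      finally show ?thesis unfolding 0 using u by (simp only: coactL_slot zero_less_Suc)
    qed
  qed
qed

lemma coactL_counit:
  assumes w: "w \<in> carrier Om"
  shows "induced_map K Om (\<lambda>(a, \<eta>). \<epsilon> a \<odot>\<^bsub>Om\<^esub> \<eta>) (coactL w) = w"
proof -
  note ih = induced_map_hom[OF vsU vsOm vsOm counit_bilinear_left[OF vsOm]]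
  note it = induced_map_tens[OF vsU vsOm vsOm counit_bilinear_left[OF vsOm]]
  have s: "induced_map K Om (\<lambda>(a, \<eta>). \<epsilon> a \<odot>\<^bsub>Om\<^esub> \<eta>) (id_slot i X) = slot i (induced_map K U (\<lambda>(a, b). \<epsilon> a \<odot>\<^bsub>U\<^esub> b) X)"
    if "X \<in> carrier UU" for i X
    by (rule UU_hom_eq[OF vsOm hom_comp[OF id_slot_hom ih] hom_comp[OF counit_left_hom slot_hom] _ that])
      (simp add: id_slot_tens it slot_closed counit_left_tens hom_smult[OF slot_hom] counit_closed)
  show ?thesis
    by (rule Om_hom_eq[OF vsOm hom_comp[OF coactL_hom ih] hom_id(1) _ w])
      (simp add: coactL_slot s \<Delta>_closed coproduct_counit_left)
qed

text \<open>The slot maps commute with every arrow of the diagram (\<open>Lt\<close>,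
  \<open>At\<close>, \<open>Rt\<close>), which reduces the claim to coassociativity of
  \<open>\<Delta>\<close>.\<close>

lemma coactL_coassoc:
  assumes w: "w \<in> carrier Om"
  shows "tensor_assoc K U U Om (tensor_map K UU Om \<Delta> id (coactL w)) = tensor_map K U UO id coactL (coactL w)"
proof -
  note L = tensor_map_hom[OF vsU vsOm vsUU vsOm \<Delta>_hom hom_id(2)]
  note L' = tensor_map_hom[OF vsU vsU vsUU vsU \<Delta>_hom hom_id(2)]
  note R = tensor_map_hom[OF vsU vsOm vsU vsUO hom_id(2) coactL_hom]
  note A = tensor_assoc_hom[OF vsU vsU vsOm]
  note A' = tensor_assoc_hom[OF vsU vsU vsU]
  note I = tensor_map_hom[OF vsU vsUU vsU vsUO hom_id(2) id_slot_hom]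
  note J = tensor_map_hom[OF vsUU vsU vsUU vsOm hom_id(2) slot_hom]
  note R' = tensor_map_hom[OF vsU vsU vsU vsUU hom_id(2) \<Delta>_hom]
  have V: "vectorspace K (tensor K U UO)" "vectorspace K (tensor K UU Om)" by (rule tensor_vectorspace[OF vsU vsUO] tensor_vectorspace[OF vsUU vsOm])+
  have Lt: "tensor_map K UU Om \<Delta> id (id_slot i X) = tensor_map K UU Om id (slot i) (tensor_map K UU U \<Delta> id X)"
    if "X \<in> carrier UU" for i X
    by (rule UU_hom_eq[OF V(2) hom_comp[OF id_slot_hom L] hom_comp[OF L' J] _ that])
      (simp only: id_slot_tens tensor_map_tens[OF vsU vsOm vsUU vsOm \<Delta>_hom hom_id(2)] slot_closed
        tensor_map_tens[OF vsU vsU vsUU vsU \<Delta>_hom hom_id(2)] tensor_map_tens[OF vsUU vsU vsUU vsOm hom_id(2) slot_hom] \<Delta>_closed id_apply)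
  have At: "tensor_assoc K U U Om (tensor_map K UU Om id (slot i) Z) = tensor_map K U UO id (id_slot i) (tensor_assoc K U U U Z)"
    if Z: "Z \<in> carrier (tensor K UU U)" for i Z
  proof (rule tensor_hom_eq[OF vsUU vsU V(1) hom_comp[OF J A] hom_comp[OF A' I] _ Z])
    fix X c assume X: "X \<in> carrier UU" and c: "c \<in> carrier U"
    note bl = tens_bilinear[OF vsUU vsOm] and bl' = tens_bilinear[OF vsUU vsU]
    have "tensor_assoc K U U Om (tens K UU Om X (slot i c)) = tensor_map K U UO id (id_slot i) (tensor_assoc K U U U (tens K UU U X c))"
      by (rule UU_hom_eq[OF V(1) hom_comp[OF bilinearD(2)[OF bl slot_closed[OF c]] A] hom_comp[OF hom_comp[OF bilinearD(2)[OF bl' c] A'] I] _ X])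
        (simp only: tensor_assoc_tens[OF vsU vsU vsOm] tensor_assoc_tens[OF vsU vsU vsU] slot_closed c
          tensor_map_tens[OF vsU vsUU vsU vsUO hom_id(2) id_slot_hom] UU_closed id_slot_tens id_apply)
    then show "tensor_assoc K U U Om (tensor_map K UU Om id (slot i) (tens K UU U X c))
        = tensor_map K U UO id (id_slot i) (tensor_assoc K U U U (tens K UU U X c))"
      by (simp only: tensor_map_tens[OF vsUU vsU vsUU vsOm hom_id(2) slot_hom X c] id_apply)
  qed
  have Rt: "tensor_map K U UO id coactL (id_slot i X) = tensor_map K U UO id (id_slot i) (tensor_map K U UU id \<Delta> X)"
    if i: "i < N" and X: "X \<in> carrier UU" for i X
    by (rule UU_hom_eq[OF V(1) hom_comp[OF id_slot_hom R] hom_comp[OF R' I] _ X])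
      (simp only: id_slot_tens tensor_map_tens[OF vsU vsOm vsU vsUO hom_id(2) coactL_hom] slot_closed coactL_slot[OF i]
        tensor_map_tens[OF vsU vsU vsU vsUU hom_id(2) \<Delta>_hom] tensor_map_tens[OF vsU vsUU vsU vsUO hom_id(2) id_slot_hom] \<Delta>_closed id_apply)
  show ?thesis
  proof (rule Om_hom_eq[OF V(1) hom_comp[OF hom_comp[OF coactL_hom L] A] hom_comp[OF coactL_hom R] _ w])
    fix i u assume i: "i < N" and u: "u \<in> carrier U"
    note c = \<Delta>_closed[OF u]
    show "tensor_assoc K U U Om (tensor_map K UU Om \<Delta> id (coactL (slot i u))) = tensor_map K U UO id coactL (coactL (slot i u))"
      unfolding coactL_slot[OF i u] Lt[OF c] At[OF hom_closed[OF L' c]] coproduct_coassoc[OF u] Rt[OF i c] ..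
  qed
qed

lemma left_covariance_Om: "left_covariance K U \<Delta> \<epsilon> Om (slot 0) dOm coactL"
proof
  show "coactL (slot 0 a) = tensor_map K U Om id (slot 0) (\<Delta> a)" if "a \<in> carrier U" for a
    using coactL_slot[OF _ that, of 0] by (simp add: id_slot_def)
qed (fact coactL_algebra_hom coactL_coassoc coactL_counit coactL_d)+

subsection \<open>The right coaction\<close>

definition slot_id where "slot_id i = tensor_map K Om U (slot i) id"

lemma slot_id_hom: "slot_id i \<in> module_hom K UU OU"
  unfolding slot_id_def by (rule tensor_map_hom[OF vsU vsU vsOm vsU slot_hom hom_id(2)])

lemma slot_id_tens: "a \<in> carrier U \<Longrightarrow> b \<in> carrier U \<Longrightarrow> slot_id i (tens K U U a b) = tens K Om U (slot i a) b"
  unfolding slot_id_def using tensor_map_tens[OF vsU vsU vsOm vsU slot_hom hom_id(2)] by (simp only: id_apply)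

text \<open>Flipping a left coaction gives a right coaction extending \<open>\<Delta>\<close>
  because \<open>\<Delta>\<close> is cocommutative. The basic forms are then invariant on both
  sides.\<close>

definition coactR where "coactR w = flip K U Om (coactL w)"

lemma coactR_hom: "coactR \<in> module_hom K Om OU"
  unfolding coactR_def by (rule hom_comp[OF coactL_hom flip_hom[OF vsU vsOm]])

lemma flip_id_slot: "X \<in> carrier UU \<Longrightarrow> flip K U Om (id_slot i X) = slot_id i (flip K U U X)"
  by (rule UU_hom_eq[OF vsOU hom_comp[OF id_slot_hom flip_hom[OF vsU vsOm]] hom_comp[OF flip_hom[OF vsU vsU] slot_id_hom]])
    (simp_all add: id_slot_tens flip_tens[OF vsU vsOm] flip_tens[OF vsU vsU] slot_closed slot_id_tens)

lemma coactR_slot: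
  assumes i: "i < N" and u: "u \<in> carrier U"
  shows "coactR (slot i u) = slot_id i (\<Delta> u)"
  unfolding coactR_def coactL_slot[OF i u] flip_id_slot[OF \<Delta>_closed[OF u]] coproduct_cocommutative[OF u] ..

lemma coactR_d:
  assumes w: "w \<in> carrier Om"
  shows "coactR (dOm w) = tensor_map K Om U dOm id (coactR w)"
proof -
  note tl = tensor_map_hom[OF vsU vsOm vsU vsOm hom_id(2) dOm_hom] and tr = tensor_map_hom[OF vsOm vsU vsOm vsU dOm_hom hom_id(2)]
  have "flip K U Om (tensor_map K U Om id dOm X) = tensor_map K Om U dOm id (flip K U Om X)" if "X \<in> carrier UO" for X
    by (rule tensor_hom_eq[OF vsU vsOm vsOU hom_comp[OF tl flip_hom[OF vsU vsOm]] hom_comp[OF flip_hom[OF vsU vsOm] tr] _ that])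
      (simp only: tensor_map_tens[OF vsU vsOm vsU vsOm hom_id(2) dOm_hom] tensor_map_tens[OF vsOm vsU vsOm vsU dOm_hom hom_id(2)]
        flip_tens[OF vsU vsOm] id_apply dOm_closed)
  then show ?thesis unfolding coactR_def coactL_d[OF w] using hom_closed[OF coactL_hom w] by blast
qed

lemma coactR_counit:
  assumes w: "w \<in> carrier Om"
  shows "induced_map K Om (\<lambda>(\<eta>, a). \<epsilon> a \<odot>\<^bsub>Om\<^esub> \<eta>) (coactR w) = w"
proof -
  note ih = induced_map_hom[OF vsOm vsU vsOm counit_bilinear_right[OF vsOm]]
  note it = induced_map_tens[OF vsOm vsU vsOm counit_bilinear_right[OF vsOm]]
  have s: "induced_map K Om (\<lambda>(\<eta>, a). \<epsilon> a \<odot>\<^bsub>Om\<^esub> \<eta>) (slot_id i X) = slot i (induced_map K U (\<lambda>(a, b). \<epsilon> b \<odot>\<^bsub>U\<^esub> a) X)"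
    if "X \<in> carrier UU" for i X
    by (rule UU_hom_eq[OF vsOm hom_comp[OF slot_id_hom ih] hom_comp[OF counit_right_hom slot_hom] _ that])
      (simp add: slot_id_tens it slot_closed counit_right_tens hom_smult[OF slot_hom] counit_closed)
  show ?thesis
    by (rule Om_hom_eq[OF vsOm hom_comp[OF coactR_hom ih] hom_id(1) _ w])
      (simp add: coactR_slot s \<Delta>_closed coproduct_counit_right)
qed

lemma coactR_coassoc:
  assumes w: "w \<in> carrier Om"
  shows "tensor_assoc K Om U U (tensor_map K OU U coactR id (coactR w)) = tensor_map K Om UU id \<Delta> (coactR w)"
proof -
  note L = tensor_map_hom[OF vsOm vsU vsOU vsU coactR_hom hom_id(2)]
  note L' = tensor_map_hom[OF vsU vsU vsUU vsU \<Delta>_hom hom_id(2)]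
  note R = tensor_map_hom[OF vsOm vsU vsOm vsUU hom_id(2) \<Delta>_hom]
  note R' = tensor_map_hom[OF vsU vsU vsU vsUU hom_id(2) \<Delta>_hom]
  note A = tensor_assoc_hom[OF vsOm vsU vsU]
  note A' = tensor_assoc_hom[OF vsU vsU vsU]
  note I = tensor_map_hom[OF vsUU vsU vsOU vsU slot_id_hom hom_id(2)]
  note J = tensor_map_hom[OF vsU vsUU vsOm vsUU slot_hom hom_id(2)]
  have V: "vectorspace K (tensor K OU U)" "vectorspace K (tensor K Om UU)"
    by (rule tensor_vectorspace[OF vsOU vsU] tensor_vectorspace[OF vsOm vsUU])+
  have Lt: "tensor_map K OU U coactR id (slot_id i X) = tensor_map K OU U (slot_id i) id (tensor_map K UU U \<Delta> id X)"
    if i: "i < N" and X: "X \<in> carrier UU" for i X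
    by (rule UU_hom_eq[OF V(1) hom_comp[OF slot_id_hom L] hom_comp[OF L' I] _ X])
      (simp only: slot_id_tens tensor_map_tens[OF vsOm vsU vsOU vsU coactR_hom hom_id(2)] slot_closed coactR_slot[OF i]
        tensor_map_tens[OF vsU vsU vsUU vsU \<Delta>_hom hom_id(2)] tensor_map_tens[OF vsUU vsU vsOU vsU slot_id_hom hom_id(2)] \<Delta>_closed id_apply)
  have At: "tensor_assoc K Om U U (tensor_map K OU U (slot_id i) id Z) = tensor_map K Om UU (slot i) id (tensor_assoc K U U U Z)"
    if Z: "Z \<in> carrier (tensor K UU U)" for i Z
  proof (rule tensor_hom_eq[OF vsUU vsU V(2) hom_comp[OF I A] hom_comp[OF A' J] _ Z])
    fix X c assume X: "X \<in> carrier UU" and c: "c \<in> carrier U"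
    note bl = tens_bilinear[OF vsOU vsU] and bl' = tens_bilinear[OF vsUU vsU]
    have "tensor_assoc K Om U U (tens K OU U (slot_id i X) c) = tensor_map K Om UU (slot i) id (tensor_assoc K U U U (tens K UU U X c))"
      by (rule UU_hom_eq[OF V(2) hom_comp[OF hom_comp[OF slot_id_hom bilinearD(2)[OF bl c]] A] hom_comp[OF hom_comp[OF bilinearD(2)[OF bl' c] A'] J] _ X])
        (simp only: tensor_assoc_tens[OF vsOm vsU vsU] tensor_assoc_tens[OF vsU vsU vsU] slot_closed c
          tensor_map_tens[OF vsU vsUU vsOm vsUU slot_hom hom_id(2)] UU_closed slot_id_tens id_apply)
    then show "tensor_assoc K Om U U (tensor_map K OU U (slot_id i) id (tens K UU U X c))
        = tensor_map K Om UU (slot i) id (tensor_assoc K U U U (tens K UU U X c))"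
      by (simp only: tensor_map_tens[OF vsUU vsU vsOU vsU slot_id_hom hom_id(2) X c] id_apply)
  qed
  have Rt: "tensor_map K Om UU id \<Delta> (slot_id i X) = tensor_map K Om UU (slot i) id (tensor_map K U UU id \<Delta> X)"
    if X: "X \<in> carrier UU" for i X
    by (rule UU_hom_eq[OF V(2) hom_comp[OF slot_id_hom R] hom_comp[OF R' J] _ X])
      (simp only: slot_id_tens tensor_map_tens[OF vsOm vsU vsOm vsUU hom_id(2) \<Delta>_hom] slot_closed
        tensor_map_tens[OF vsU vsU vsU vsUU hom_id(2) \<Delta>_hom] tensor_map_tens[OF vsU vsUU vsOm vsUU slot_hom hom_id(2)] \<Delta>_closed id_apply)
  show ?thesis
  proof (rule Om_hom_eq[OF V(2) hom_comp[OF hom_comp[OF coactR_hom L] A] hom_comp[OF coactR_hom R] _ w])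
    fix i u assume i: "i < N" and u: "u \<in> carrier U"
    note c = \<Delta>_closed[OF u]
    show "tensor_assoc K Om U U (tensor_map K OU U coactR id (coactR (slot i u))) = tensor_map K Om UU id \<Delta> (coactR (slot i u))"
      unfolding coactR_slot[OF i u] Lt[OF i c] At[OF hom_closed[OF L' c]] coproduct_coassoc[OF u] Rt[OF c] ..
  qed
qed

lemma right_covariance_Om: "right_covariance K U \<Delta> \<epsilon> Om (slot 0) dOm coactR"
proof
  show "coactR \<in> algebra_hom K Om OU"
    unfolding coactR_def by (rule algebra_hom_comp[OF coactL_algebra_hom flip_algebra_hom[OF U_assoc_alg Om_assoc_alg]])
  show "coactR (slot 0 a) = tensor_map K Om U (slot 0) id (\<Delta> a)" if "a \<in> carrier U" for a
    using coactR_slot[OF _ that, of 0] by (simp add: slot_id_def)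
qed (fact coactR_coassoc coactR_counit coactR_d)+

end

section \<open>Connectedness\<close>

context pre_lie_coords begin

text \<open>The span of words of length strictly below \<open>m\<close>. With the strict bound,
  \<open>fil 0\<close> contains only zero and \<open>fil 1\<close> only scalars.\<close>

inductive fil :: "nat \<Rightarrow> ('a, 'c) env \<Rightarrow> bool" for m where
  word: "w \<in> lists (carrier M) \<Longrightarrow> length w < m \<Longrightarrow> fil m (UQ.pr (single K w))"
| zero: "fil m \<zero>\<^bsub>U\<^esub>"
| add: "fil m u \<Longrightarrow> fil m v \<Longrightarrow> fil m (u \<oplus>\<^bsub>U\<^esub> v)"
| smult: "c \<in> carrier K \<Longrightarrow> fil m u \<Longrightarrow> fil m (c \<odot>\<^bsub>U\<^esub> u)"

lemma fil_closed: "fil m u \<Longrightarrow> u \<in> carrier U"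
  by (induct rule: fil.induct) (simp_all add: word_closed)

lemma fil_mono: "fil m u \<Longrightarrow> m \<le> m' \<Longrightarrow> fil m' u"
  by (induct rule: fil.induct) (simp_all add: fil.intros)

lemma fil_mult:
  assumes x: "x \<in> carrier M" shows "fil m u \<Longrightarrow> fil (Suc m) (u \<otimes>\<^bsub>U\<^esub> \<iota> x)"
proof (induct rule: fil.induct)
  case (word w)
  then show ?case using fil.word[of "w @ [x]" "Suc m"] x by (simp add: pr_snoc)
next
  case zero then show ?case using fil.zero x by (simp add: \<iota>_closed)
next
  case (add u v) then show ?case using x by (simp add: U.A.l_distr fil_closed \<iota>_closed fil.add)
next
  case (smult c u) then show ?case using x by (simp add: U.smult_mult_left fil_closed \<iota>_closed fil.smult)
qed

lemma fil_finsum: "finite A \<Longrightarrow> (\<And>a. a \<in> A \<Longrightarrow> fil m (f a)) \<Longrightarrow> fil m (\<Oplus>\<^bsub>U\<^esub>a\<in>A. f a)"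
proof (induct A rule: finite_induct)
  case empty then show ?case using fil.zero by simp
next
  case (insert a A)
  have "(\<Oplus>\<^bsub>U\<^esub>a\<in>insert a A. f a) = f a \<oplus>\<^bsub>U\<^esub> (\<Oplus>\<^bsub>U\<^esub>a\<in>A. f a)"
    by (rule U.M.finsum_insert) (use insert fil_closed in auto)
  then show ?case using insert fil.add by simp
qed

lemma fil_1: "fil (Suc 0) u \<Longrightarrow> \<exists>c\<in>carrier K. u = c \<odot>\<^bsub>U\<^esub> \<one>\<^bsub>U\<^esub>"
proof (induct rule: fil.induct)
  case (word w) then show ?case by (intro bexI[of _ "\<one>\<^bsub>K\<^esub>"]) (simp_all add: pr_Nil)
next
  case zero then show ?case by (intro bexI[of _ "\<zero>\<^bsub>K\<^esub>"]) simp_all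
next
  case (add u v) then show ?case using U.smult_l_distr[OF _ _ U.A.one_closed, symmetric] R.a_closed by blast
next
  case (smult c u) then show ?case using U.smult_assoc1[OF _ _ U.A.one_closed, symmetric] R.m_closed by blast
qed

lemma fil_exhaust: "u \<in> carrier U \<Longrightarrow> \<exists>m. fil m u"
proof (induct rule: U_word_induct)
  case (word w) then show ?case using fil.word[of w "Suc (length w)"] by auto
next
  case (add u v)
  then obtain k m where "fil k u" "fil m v" by blast
  then have "fil (max k m) u" "fil (max k m) v" using fil_mono by simp_all
  then show ?case using fil.add by blast
qed (use fil.smult in blast)

text \<open>Differentiation trades one letter for a basic form. In the induction the new letter
  \<open>x\<close> contributes at most \<open>w\<close> itself, which is one letter shorter than
  \<open>w @ [x]\<close>.\<close>

lemma fil_\<Phi>: "w \<in> lists (carrier M) \<Longrightarrow> k < n \<Longrightarrow> fil (length w) (\<Phi> (UQ.pr (single K w)) 0 (Suc k))"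
proof (induct w arbitrary: k rule: rev_induct)
  case Nil then show ?case using fil.zero by (simp add: pr_Nil \<Phi>_one)
next
  case (snoc x w)
  let ?u = "UQ.pr (single K w)"
  have w: "w \<in> lists (carrier M)" and x: "x \<in> carrier M" using snoc(2) by simp_all
  note u = word_closed[OF w]
  have "fil (Suc (length w)) (\<Phi> ?u 0 i)" if "i < N" for i
  proof (cases i)
    case 0 then show ?thesis using w u by (simp add: \<Phi>_column_0 fil.word)
  next
    case (Suc l) then show ?thesis using fil_mono[OF snoc(1)[OF w, of l]] that by simp
  qed
  then have "fil (Suc (length w)) (\<Oplus>\<^bsub>U\<^esub>i\<in>{..<N}. entry x i (Suc k) \<odot>\<^bsub>U\<^esub> \<Phi> ?u 0 i)"
    by (intro fil_finsum fil.smult) (simp_all add: entry_closed x)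
  then show ?case
    using fil.add[OF fil_mult[OF x snoc(1)[OF w snoc(3)]]] by (simp add: pr_snoc w x \<Phi>_step[OF u x] snoc(3))
qed

text \<open>The map obtained from \<open>d\<close> on \<open>U\<close> by replacing each basic form \<open>d e\<^sub>k\<close> with \<open>e\<^sub>k\<close>. It is
  multiplication by the degree up to terms of lower filtration.\<close>

definition euler :: "('a, 'c) env \<Rightarrow> ('a, 'c) env" where
  "euler u = (\<Oplus>\<^bsub>U\<^esub>k\<in>{..<n}. \<Phi> u 0 (Suc k) \<otimes>\<^bsub>U\<^esub> \<iota> (e k))"

lemma euler_hom: "euler \<in> module_hom K U U"
  unfolding euler_def
  by (intro hom_finsum_maps[OF vsU] hom_comp[OF \<Phi>_entry_hom U.mult_hom_left] \<iota>_closed e_closed) simp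

lemma mult_expand:
  assumes u: "u \<in> carrier U" and x: "x \<in> carrier M"
  shows "(\<Oplus>\<^bsub>U\<^esub>k\<in>{..<n}. co k x \<odot>\<^bsub>U\<^esub> (u \<otimes>\<^bsub>U\<^esub> \<iota> (e k))) = u \<otimes>\<^bsub>U\<^esub> \<iota> x"
  by (rule hom_expand[OF vsU hom_comp[OF \<iota>_hom U.mult_hom_right[OF u]] x, symmetric])

lemma \<iota>_commute:
  assumes "x \<in> carrier M" "y \<in> carrier M"
  shows "\<iota> x \<otimes>\<^bsub>U\<^esub> \<iota> y = \<iota> y \<otimes>\<^bsub>U\<^esub> \<iota> x \<oplus>\<^bsub>U\<^esub> \<iota> (br x y)"
  using assms unfolding \<iota>_bracket[OF assms, symmetric]
  by (simp add: a_minus_def \<iota>_closed U.M.add.m_lcomm U.M.r_neg)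

text \<open>In \<open>d(u x) = (du) x + u dx\<close> the last term becomes \<open>u x\<close> once
  forms are replaced by letters. In \<open>(du) x\<close> the letter \<open>x\<close> has to be
  moved past \<open>e_k\<close>, at the cost of shorter terms.\<close>

lemma euler_step:
  assumes w: "w \<in> lists (carrier M)" and x: "x \<in> carrier M"
  shows "\<exists>f. fil (Suc (length w)) f \<and>
    euler (UQ.pr (single K w) \<otimes>\<^bsub>U\<^esub> \<iota> x) = euler (UQ.pr (single K w)) \<otimes>\<^bsub>U\<^esub> \<iota> x \<oplus>\<^bsub>U\<^esub> (UQ.pr (single K w) \<otimes>\<^bsub>U\<^esub> \<iota> x \<oplus>\<^bsub>U\<^esub> f)"
proof -
  let ?u = "UQ.pr (single K w)" and ?r = "length w"
  let ?a = "\<lambda>k. \<Phi> ?u 0 (Suc k)"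
  note u = word_closed[OF w]
  define s where "s k = (\<Oplus>\<^bsub>U\<^esub>l\<in>{..<n}. entry x (Suc l) (Suc k) \<odot>\<^bsub>U\<^esub> ?a l)" for k
  \<comment> \<open>The shorter terms: the bracket from moving \<open>x\<close> past
    \<open>e k\<close>, and the correction \<open>s k\<close> from the right action on
    forms.\<close>
  define t where "t k = ?a k \<otimes>\<^bsub>U\<^esub> \<iota> (br x (e k)) \<oplus>\<^bsub>U\<^esub> s k \<otimes>\<^bsub>U\<^esub> \<iota> (e k)" for k
  have fs: "fil ?r (s k)" for k unfolding s_def
    by (intro fil_finsum fil.smult fil_\<Phi>[OF w]) (simp_all add: entry_closed x)
  note sc = fil_closed[OF fs]
  have ft: "fil (Suc ?r) (t k)" if "k < n" for k
    unfolding t_def by (intro fil.add fil_mult fil_\<Phi>[OF w] that fs e_closed br_closed x)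
  note c = u \<Phi>_closed[OF u] \<iota>_closed[OF x] \<iota>_closed[OF e_closed] \<iota>_closed[OF br_closed[OF x e_closed]] sc co_closed[OF x]
  have tc: "t k \<in> carrier U" for k unfolding t_def using c by simp
  have term_k: "\<Phi> (?u \<otimes>\<^bsub>U\<^esub> \<iota> x) 0 (Suc k) \<otimes>\<^bsub>U\<^esub> \<iota> (e k)
      = ?a k \<otimes>\<^bsub>U\<^esub> \<iota> (e k) \<otimes>\<^bsub>U\<^esub> \<iota> x \<oplus>\<^bsub>U\<^esub> (co k x \<odot>\<^bsub>U\<^esub> (?u \<otimes>\<^bsub>U\<^esub> \<iota> (e k)) \<oplus>\<^bsub>U\<^esub> t k)" if k: "k < n" for k
  proof -
    have "(\<Oplus>\<^bsub>U\<^esub>i\<in>{..<N}. entry x i (Suc k) \<odot>\<^bsub>U\<^esub> \<Phi> ?u 0 i) = entry x 0 (Suc k) \<odot>\<^bsub>U\<^esub> \<Phi> ?u 0 0 \<oplus>\<^bsub>U\<^esub> s k"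
      unfolding s_def by (rule U.M.finsum_lessThan_Suc_shift) (simp add: entry_closed x c)
    also have "entry x 0 (Suc k) = co k x" by (simp add: entry_def row_def)
    also have "\<Phi> ?u 0 0 = ?u" by (simp add: \<Phi>_column_0 u)
    finally have "\<Phi> (?u \<otimes>\<^bsub>U\<^esub> \<iota> x) 0 (Suc k) = ?a k \<otimes>\<^bsub>U\<^esub> \<iota> x \<oplus>\<^bsub>U\<^esub> (co k x \<odot>\<^bsub>U\<^esub> ?u \<oplus>\<^bsub>U\<^esub> s k)"
      using \<Phi>_step[OF u x, of "Suc k" 0] k by simp
    then have "\<Phi> (?u \<otimes>\<^bsub>U\<^esub> \<iota> x) 0 (Suc k) \<otimes>\<^bsub>U\<^esub> \<iota> (e k)
        = ?a k \<otimes>\<^bsub>U\<^esub> (\<iota> x \<otimes>\<^bsub>U\<^esub> \<iota> (e k)) \<oplus>\<^bsub>U\<^esub> (co k x \<odot>\<^bsub>U\<^esub> (?u \<otimes>\<^bsub>U\<^esub> \<iota> (e k)) \<oplus>\<^bsub>U\<^esub> s k \<otimes>\<^bsub>U\<^esub> \<iota> (e k))"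
      using c by (simp add: U.A.l_distr U.A.m_assoc U.smult_mult_left)
    also have "?a k \<otimes>\<^bsub>U\<^esub> (\<iota> x \<otimes>\<^bsub>U\<^esub> \<iota> (e k)) = ?a k \<otimes>\<^bsub>U\<^esub> \<iota> (e k) \<otimes>\<^bsub>U\<^esub> \<iota> x \<oplus>\<^bsub>U\<^esub> ?a k \<otimes>\<^bsub>U\<^esub> \<iota> (br x (e k))"
      unfolding \<iota>_commute[OF x e_closed] using c by (simp add: U.A.r_distr U.A.m_assoc)
    finally show ?thesis unfolding t_def using c by (simp add: U.M.add.m_assoc U.M.add.m_lcomm)
  qed
  have ct: "?a k \<otimes>\<^bsub>U\<^esub> \<iota> (e k) \<otimes>\<^bsub>U\<^esub> \<iota> x \<in> carrier U" "co k x \<odot>\<^bsub>U\<^esub> (?u \<otimes>\<^bsub>U\<^esub> \<iota> (e k)) \<in> carrier U" for k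
    using c by simp_all
  have "euler (?u \<otimes>\<^bsub>U\<^esub> \<iota> x) = (\<Oplus>\<^bsub>U\<^esub>k\<in>{..<n}. ?a k \<otimes>\<^bsub>U\<^esub> \<iota> (e k) \<otimes>\<^bsub>U\<^esub> \<iota> x \<oplus>\<^bsub>U\<^esub> (co k x \<odot>\<^bsub>U\<^esub> (?u \<otimes>\<^bsub>U\<^esub> \<iota> (e k)) \<oplus>\<^bsub>U\<^esub> t k))"
    unfolding euler_def by (rule U.M.finsum_cong'[OF refl]) (use ct tc term_k in auto)
  also have "\<dots> = (\<Oplus>\<^bsub>U\<^esub>k\<in>{..<n}. ?a k \<otimes>\<^bsub>U\<^esub> \<iota> (e k) \<otimes>\<^bsub>U\<^esub> \<iota> x) \<oplus>\<^bsub>U\<^esub> ((\<Oplus>\<^bsub>U\<^esub>k\<in>{..<n}. co k x \<odot>\<^bsub>U\<^esub> (?u \<otimes>\<^bsub>U\<^esub> \<iota> (e k))) \<oplus>\<^bsub>U\<^esub> (\<Oplus>\<^bsub>U\<^esub>k\<in>{..<n}. t k))"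
    using ct tc by (simp only: U.M.finsum_addf Pi_def mem_Collect_eq U.M.a_closed simp_thms)
  also have "(\<Oplus>\<^bsub>U\<^esub>k\<in>{..<n}. ?a k \<otimes>\<^bsub>U\<^esub> \<iota> (e k) \<otimes>\<^bsub>U\<^esub> \<iota> x) = euler ?u \<otimes>\<^bsub>U\<^esub> \<iota> x"
    unfolding euler_def by (rule hom_finsum[OF U.mult_hom_left[OF \<iota>_closed[OF x]] vsU vsU, symmetric]) (use c in simp_all)
  also have "(\<Oplus>\<^bsub>U\<^esub>k\<in>{..<n}. co k x \<odot>\<^bsub>U\<^esub> (?u \<otimes>\<^bsub>U\<^esub> \<iota> (e k))) = ?u \<otimes>\<^bsub>U\<^esub> \<iota> x" by (rule mult_expand[OF u x])
  finally show ?thesis using fil_finsum[of "{..<n}" "Suc ?r" t] ft by auto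
qed

text \<open>Each letter contributes one copy of the word through \<open>euler_step\<close>, hence
  the factor \<open>length w\<close>.\<close>

lemma euler_word:
  "w \<in> lists (carrier M) \<Longrightarrow> \<exists>f. fil (length w) f \<and>
    euler (UQ.pr (single K w)) = ([length w] \<cdot>\<^bsub>K\<^esub> \<one>\<^bsub>K\<^esub>) \<odot>\<^bsub>U\<^esub> UQ.pr (single K w) \<oplus>\<^bsub>U\<^esub> f"
proof (induct w rule: rev_induct)
  case Nil
  have "euler \<one>\<^bsub>U\<^esub> = \<zero>\<^bsub>U\<^esub>" unfolding euler_def by (simp add: \<Phi>_one \<iota>_closed e_closed)
  then show ?case using fil.zero by (intro exI[of _ "\<zero>\<^bsub>U\<^esub>"]) (simp add: pr_Nil)
next
  case (snoc x w)
  let ?u = "UQ.pr (single K w)" and ?r = "[length w] \<cdot>\<^bsub>K\<^esub> \<one>\<^bsub>K\<^esub>"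
  have w: "w \<in> lists (carrier M)" and x: "x \<in> carrier M" using snoc(2) by simp_all
  obtain f where f: "fil (length w) f" "euler ?u = ?r \<odot>\<^bsub>U\<^esub> ?u \<oplus>\<^bsub>U\<^esub> f" using snoc(1)[OF w] by blast
  obtain g where g: "fil (Suc (length w)) g"
    "euler (?u \<otimes>\<^bsub>U\<^esub> \<iota> x) = euler ?u \<otimes>\<^bsub>U\<^esub> \<iota> x \<oplus>\<^bsub>U\<^esub> (?u \<otimes>\<^bsub>U\<^esub> \<iota> x \<oplus>\<^bsub>U\<^esub> g)"
    using euler_step[OF w x] by blast
  have r: "?r \<in> carrier K" by simp
  note c = word_closed[OF w] \<iota>_closed[OF x] fil_closed[OF f(1)] fil_closed[OF g(1)] r
  have "euler (?u \<otimes>\<^bsub>U\<^esub> \<iota> x) = (?r \<odot>\<^bsub>U\<^esub> (?u \<otimes>\<^bsub>U\<^esub> \<iota> x) \<oplus>\<^bsub>U\<^esub> ?u \<otimes>\<^bsub>U\<^esub> \<iota> x) \<oplus>\<^bsub>U\<^esub> (f \<otimes>\<^bsub>U\<^esub> \<iota> x \<oplus>\<^bsub>U\<^esub> g)"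
    unfolding g(2) f(2) using c by (simp add: U.A.l_distr U.smult_mult_left U.M.add.m_assoc U.M.add.m_lcomm)
  also have "?r \<odot>\<^bsub>U\<^esub> (?u \<otimes>\<^bsub>U\<^esub> \<iota> x) \<oplus>\<^bsub>U\<^esub> ?u \<otimes>\<^bsub>U\<^esub> \<iota> x = ([Suc (length w)] \<cdot>\<^bsub>K\<^esub> \<one>\<^bsub>K\<^esub>) \<odot>\<^bsub>U\<^esub> (?u \<otimes>\<^bsub>U\<^esub> \<iota> x)"
    using c by (simp add: R.add.nat_pow_Suc U.smult_l_distr)
  finally show ?case
    using fil.add[OF fil_mult[OF x f(1)] g(1)] by (intro exI[of _ "f \<otimes>\<^bsub>U\<^esub> \<iota> x \<oplus>\<^bsub>U\<^esub> g"]) (simp add: pr_snoc w x)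
qed

text \<open>Words in \<open>fil (Suc m)\<close> have length at most \<open>m\<close>. For length
  exactly \<open>m\<close> the multiples of the word cancel, and shorter words lie in
  \<open>fil m\<close> anyway.\<close>

lemma euler_fil:
  assumes "fil (Suc m) u"
  shows "fil m (euler u \<ominus>\<^bsub>U\<^esub> ([m] \<cdot>\<^bsub>K\<^esub> \<one>\<^bsub>K\<^esub>) \<odot>\<^bsub>U\<^esub> u)" (is "fil m (?g u)")
proof -
  have mc: "[k] \<cdot>\<^bsub>K\<^esub> \<one>\<^bsub>K\<^esub> \<in> carrier K" for k :: nat by simp
  note h = hom_minus_maps[OF vsU euler_hom hom_smult_map[OF vsU hom_id(1) mc]]
  have neg: "fil m (\<ominus>\<^bsub>U\<^esub> v)" if "fil m v" for v
    using fil.smult[OF R.a_inv_closed[OF R.one_closed] that] fil_closed[OF that]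
    by (simp add: U.smult_l_minus)
  show ?thesis using assms
  proof (induct rule: fil.induct)
    case (word w)
    let ?u = "UQ.pr (single K w)" and ?r = "[length w] \<cdot>\<^bsub>K\<^esub> \<one>\<^bsub>K\<^esub>"
    obtain f where f: "fil (length w) f" "euler ?u = ?r \<odot>\<^bsub>U\<^esub> ?u \<oplus>\<^bsub>U\<^esub> f" using euler_word[OF word(1)] by blast
    note c = word_closed[OF word(1)] fil_closed[OF f(1)] mc
    show ?case
    proof (cases "length w = m")
      case True
      then have "?g ?u = f" unfolding f(2) using c by (simp add: a_minus_def U.M.add.m_ac U.M.r_neg)
      then show ?thesis using f(1) True by simp
    next
      case False
      then have lw: "length w < m" using word(2) by simp
      note fu = fil.word[OF word(1) lw] and ff = fil_mono[OF f(1) less_imp_le[OF lw]]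
      show ?thesis unfolding f(2) a_minus_def by (intro fil.add neg fil.smult mc fu ff)
    qed
  next
    case zero show ?case unfolding hom_zero[OF h vsU vsU] by (rule fil.zero)
  next
    case (add u v) then show ?case
      unfolding hom_add[OF h fil_closed[OF add(1)] fil_closed[OF add(3)]] by (intro fil.add)
  next
    case (smult c u) then show ?case
      unfolding hom_smult[OF h smult(1) fil_closed[OF smult(2)]] by (intro fil.smult)
  qed
qed

text \<open>On the kernel of \<open>euler\<close>, the previous lemma puts a nonzero multiple of
  \<open>u\<close> one filtration step lower. Dividing by that multiple, possible in characteristic
  zero, and repeating this descends to the scalars.\<close>

lemma euler_kernel:
  assumes K0: "char_zero K" and eu: "euler u = \<zero>\<^bsub>U\<^esub>" and u: "u \<in> carrier U"
  shows "\<exists>c\<in>carrier K. u = c \<odot>\<^bsub>U\<^esub> \<one>\<^bsub>U\<^esub>"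
proof -
  have "fil (Suc m) u \<Longrightarrow> fil (Suc 0) u" for m
  proof (induct m)
    case (Suc m)
    define c where "c = [Suc m] \<cdot>\<^bsub>K\<^esub> \<one>\<^bsub>K\<^esub>"
    have "c \<noteq> \<zero>\<^bsub>K\<^esub>" using K0 unfolding char_zero_def c_def by blast
    moreover have c: "c \<in> carrier K" by (simp add: c_def)
    ultimately have inv: "inv\<^bsub>K\<^esub> c \<in> carrier K" "inv\<^bsub>K\<^esub> c \<otimes>\<^bsub>K\<^esub> c = \<one>\<^bsub>K\<^esub>"
      using field_Units by (auto intro: R.Units_l_inv)
    have "euler u \<ominus>\<^bsub>U\<^esub> c \<odot>\<^bsub>U\<^esub> u = (\<ominus>\<^bsub>K\<^esub> c) \<odot>\<^bsub>U\<^esub> u"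
      unfolding eu a_minus_def using u c by (simp add: U.smult_l_minus)
    then have "fil (Suc m) ((\<ominus>\<^bsub>K\<^esub> c) \<odot>\<^bsub>U\<^esub> u)" using euler_fil[OF Suc(2)] by (simp only: c_def)
    \<comment> \<open>Division by \<open>c\<close>; the minus sign matches the one left over from
      \<open>0 - c u\<close>.\<close>
    then have "fil (Suc m) ((\<ominus>\<^bsub>K\<^esub> (inv\<^bsub>K\<^esub> c)) \<odot>\<^bsub>U\<^esub> ((\<ominus>\<^bsub>K\<^esub> c) \<odot>\<^bsub>U\<^esub> u))"
      by (rule fil.smult[OF R.a_inv_closed[OF inv(1)]])
    moreover have "(\<ominus>\<^bsub>K\<^esub> (inv\<^bsub>K\<^esub> c)) \<odot>\<^bsub>U\<^esub> ((\<ominus>\<^bsub>K\<^esub> c) \<odot>\<^bsub>U\<^esub> u) = u"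
      using c inv u by (simp add: U.smult_assoc1[symmetric] R.l_minus R.r_minus)
    ultimately show ?case using Suc(1) by simp
  qed
  moreover obtain m where "fil m u" using fil_exhaust[OF u] by blast
  then have "fil (Suc m) u" by (rule fil_mono) simp
  ultimately show ?thesis using fil_1 by blast
qed

text \<open>If \<open>du = 0\<close>, all coefficients in row \<open>0\<close> after the first
  vanish, hence so does \<open>euler u\<close>. Conversely \<open>\<Phi>\<close> sends scalars to
  scalar matrices, whose row \<open>0\<close> has no form part.\<close>

lemma connected_Om:
  assumes "char_zero K" shows "connected_calculus K U Om (slot 0) dOm"
proof -
  have "\<exists>c\<in>carrier K. u = c \<odot>\<^bsub>U\<^esub> \<one>\<^bsub>U\<^esub>" if u: "u \<in> carrier U" and d: "dOm (slot 0 u) = \<zero>\<^bsub>Om\<^esub>" for u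
  proof (rule euler_kernel[OF assms _ u])
    have "\<Phi> u 0 (Suc k) = \<zero>\<^bsub>U\<^esub>" if "k < n" for k
    proof -
      have "crd (dOm (slot 0 u)) (Suc k) = \<zero>\<^bsub>U\<^esub>" by (simp only: d crd_zero)
      then show ?thesis using that u by (simp add: crd_dOm slot_closed crd_slot)
    qed
    then have "euler u = (\<Oplus>\<^bsub>U\<^esub>k\<in>{..<n}. \<zero>\<^bsub>U\<^esub>)"
      unfolding euler_def by (intro U.M.finsum_cong') (simp_all add: \<iota>_closed e_closed)
    then show "euler u = \<zero>\<^bsub>U\<^esub>" by simp
  qed
  moreover have "dOm (slot 0 (c \<odot>\<^bsub>U\<^esub> \<one>\<^bsub>U\<^esub>)) = \<zero>\<^bsub>Om\<^esub>" if c: "c \<in> carrier K" for c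
  proof (rule Om_eqI)
    show "crd (dOm (slot 0 (c \<odot>\<^bsub>U\<^esub> \<one>\<^bsub>U\<^esub>))) i = crd \<zero>\<^bsub>Om\<^esub> i" if "i < N" for i
      using c that by (simp add: crd_dOm slot_closed crd_slot hom_smult[OF \<Phi>_entry_hom] \<Phi>_one crd_zero)
  qed (use c in \<open>simp_all add: dOm_closed slot_closed Om_closed\<close>)
  ultimately show ?thesis unfolding connected_calculus_def by auto
qed

section \<open>Left-invariant forms\<close>

sublocale Om_calculus: left_covariant_calculus K M br Om grOm "slot 0" dOm coactL
  by (intro left_covariant_calculus.intro lie_algebra_axioms dga_Om left_covariance_Om)

abbreviation "D x \<equiv> dOm (slot 0 (\<iota> x))"

lemma crd_D: "x \<in> carrier M \<Longrightarrow> k < n \<Longrightarrow> crd (D x) (Suc k) = co k x \<odot>\<^bsub>U\<^esub> \<one>\<^bsub>U\<^esub>"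
  by (simp add: crd_dOm slot_closed crd_slot \<iota>_closed \<Phi>_\<iota>_row_0)

lemma counit_smult_one: "c \<in> carrier K \<Longrightarrow> \<epsilon> (c \<odot>\<^bsub>U\<^esub> \<one>\<^bsub>U\<^esub>) = c"
  by (simp add: counit_simps)

text \<open>The form coordinates of \<open>D x\<close> are the coordinates of \<open>x\<close> times
  the unit, and the counit recovers the scalars.\<close>

lemma D_inj_Om: "inj_on (\<lambda>x. D x) (carrier M)"
proof (rule inj_onI)
  fix x y assume x: "x \<in> carrier M" and y: "y \<in> carrier M" and eq: "D x = D y"
  have "co k x = co k y" if "k < n" for k
  proof -
    have "\<epsilon> (crd (D x) (Suc k)) = \<epsilon> (crd (D y) (Suc k))" by (simp only: eq)
    then show ?thesis using that x y by (simp only: crd_D counit_smult_one co_closed)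
  qed
  then have "(\<Oplus>\<^bsub>M\<^esub>l\<in>{..<n}. co l x \<odot>\<^bsub>M\<^esub> e l) = (\<Oplus>\<^bsub>M\<^esub>l\<in>{..<n}. co l y \<odot>\<^bsub>M\<^esub> e l)"
    by (intro M.finsum_cong') (simp_all add: co_closed y e_closed)
  then show "x = y" by (simp only: expand[OF x] expand[OF y])
qed

text \<open>The coaction is the coproduct in each coordinate; this turns invariance of a form into a
  condition on its coordinates.\<close>

lemma crd_coactL:
  assumes w: "w \<in> carrier Om" and k: "k < N"
  shows "tensor_map K U U id (\<lambda>v. crd v k) (coactL w) = \<Delta> (crd w k)"
proof -
  note h = tensor_map_hom[OF vsU vsOm vsU vsU hom_id(2) crd_hom]
  have t: "tensor_map K U U id (\<lambda>v. crd v k) (tens K U Om a v) = tens K U U a (crd v k)" if "a \<in> carrier U" "v \<in> carrier Om" for a v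
    using tensor_map_tens[OF vsU vsOm vsU vsU hom_id(2) crd_hom that] by (simp only: id_apply)
  have z: "tens K U U a \<zero>\<^bsub>U\<^esub> = \<zero>\<^bsub>UU\<^esub>" if "a \<in> carrier U" for a
    by (rule hom_zero[OF bilinearD(1)[OF UU_bilinear that] vsU vsUU])
  have s: "tensor_map K U U id (\<lambda>v. crd v k) (id_slot i X) = (if i = k then X else \<zero>\<^bsub>UU\<^esub>)" if "X \<in> carrier UU" "i < N" for i X
  proof -
    have "(\<lambda>X. if i = k then X else \<zero>\<^bsub>UU\<^esub>) \<in> module_hom K UU UU"
      by (cases "i = k") (simp_all add: hom_id(1) hom_zero_map[OF vsUU])
    then show ?thesis
      by (rule UU_hom_eq[OF vsUU hom_comp[OF id_slot_hom h] _ _ that(1)])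
        (use that(2) z in \<open>simp add: id_slot_tens t slot_closed crd_slot\<close>)
  qed
  have z': "\<Delta> \<zero>\<^bsub>U\<^esub> = \<zero>\<^bsub>UU\<^esub>" by (rule hom_zero[OF \<Delta>_hom vsU vsUU])
  show ?thesis
    by (rule Om_hom_eq[OF vsUU hom_comp[OF coactL_hom h] hom_comp[OF crd_hom \<Delta>_hom] _ w])
      (use k z' in \<open>simp add: coactL_slot s \<Delta>_closed crd_slot\<close>)
qed

text \<open>A coordinate \<open>u\<close> of an invariant form satisfies
  \<open>\<Delta> u = 1 \<otimes> u\<close>. Applying the counit to the second factor gives
  \<open>u = \<epsilon>(u) 1\<close>.\<close>

lemma invariant_crd:
  assumes w: "w \<in> Om_calculus.\<Lambda>" and k: "k < N"
  shows "crd w k = \<epsilon> (crd w k) \<odot>\<^bsub>U\<^esub> \<one>\<^bsub>U\<^esub>"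
proof -
  have c: "w \<in> carrier Om" and L: "coactL w = tens K U Om \<one>\<^bsub>U\<^esub> w"
    using w by (simp_all add: left_invariant_1forms_def grOm_def)
  have "\<Delta> (crd w k) = tens K U U \<one>\<^bsub>U\<^esub> (crd w k)"
    using tensor_map_tens[OF vsU vsOm vsU vsU hom_id(2) crd_hom U.A.one_closed c, of k]
    unfolding crd_coactL[OF c k, symmetric] L by (simp only: id_apply)
  then show ?thesis
    using coproduct_counit_right[OF crd_closed[OF c], of k] counit_right_tens[OF U.A.one_closed crd_closed[OF c], of k] by simp
qed

lemma D_surj: "(\<lambda>x. D x) ` carrier M = Om_calculus.\<Lambda>"
proof
  show "(\<lambda>x. D x) ` carrier M \<subseteq> Om_calculus.\<Lambda>" using Om_calculus.D_invariant by blast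
  show "Om_calculus.\<Lambda> \<subseteq> (\<lambda>x. D x) ` carrier M"
  proof
    fix w assume w: "w \<in> Om_calculus.\<Lambda>"
    have wc: "w \<in> carrier Om" and w0: "crd w 0 = \<zero>\<^bsub>U\<^esub>" using w by (simp_all add: left_invariant_1forms_def grOm_def)
    define a where "a l = \<epsilon> (crd w (Suc l))" for l
    have ac: "a l \<in> carrier K" for l by (simp add: a_def counit_closed crd_closed wc)
    \<comment> \<open>The form coordinates of \<open>w\<close> are scalars \<open>a l\<close>, so
      \<open>w\<close> is the differential of the vector with these coordinates.\<close>
    define x where "x = (\<Oplus>\<^bsub>M\<^esub>l\<in>{..<n}. a l \<odot>\<^bsub>M\<^esub> e l)"
    have xc: "x \<in> carrier M" unfolding x_def by (rule M.finsum_closed) (simp add: ac e_closed)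
    have cx: "co k x = a k" if k: "k < n" for k
    proof -
      note g = field_vectorspace[OF field_axioms]
      have "co k x = (\<Oplus>\<^bsub>ground_algebra K\<^esub>l\<in>{..<n}. co k (a l \<odot>\<^bsub>M\<^esub> e l))"
        unfolding x_def by (rule hom_finsum[OF co_hom vectorspace_axioms g]) (simp_all add: ac e_closed)
      also have "\<dots> = (\<Oplus>\<^bsub>K\<^esub>l\<in>{..<n}. if k = l then a l else \<zero>\<^bsub>K\<^esub>)"
        unfolding finsum_ground by (rule R.finsum_cong'[OF refl]) (use k in \<open>simp_all add: ac co_smult e_closed dual\<close>)
      also have "\<dots> = a k" by (rule R.finsum_singleton) (use k ac in simp_all)
      finally show ?thesis .
    qed
    have "w = D x"
    proof (rule Om_eqI[OF wc])
      show "D x \<in> carrier Om" using xc by (simp add: dOm_closed slot_closed \<iota>_closed)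
      show "crd w i = crd (D x) i" if i: "i < N" for i
      proof (cases i)
        case 0 then show ?thesis using w0 xc by (simp add: crd_dOm slot_closed \<iota>_closed)
      next
        case (Suc k)
        then show ?thesis using i invariant_crd[OF w i] by (simp add: crd_D xc cx a_def)
      qed
    qed
    then show "w \<in> (\<lambda>x. D x) ` carrier M" using xc by blast
  qed
qed

text \<open>\<open>D\<close> is an isomorphism from the Lie algebra onto the invariant
  1-forms.\<close>

lemma \<Lambda>_dim:
  assumes "fin_dim"
  shows "vectorspace.fin_dim K Om_calculus.\<Lambda>V" "vectorspace.dim K Om_calculus.\<Lambda>V = dim"
proof -
  interpret D: linear_map K M Om_calculus.\<Lambda>V "\<lambda>x. D x"
    by (rule vectorspace_linear_map[OF vectorspace_axioms Om_calculus.\<Lambda>_vectorspace Om_calculus.D_hom_\<Lambda>])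
  have s: "(\<lambda>x. D x) ` carrier M = carrier Om_calculus.\<Lambda>V" using D_surj by simp
  show "vectorspace.fin_dim K Om_calculus.\<Lambda>V" by (rule D.surj_fin_dim[OF assms s])
  show "vectorspace.dim K Om_calculus.\<Lambda>V = dim" by (rule D.dim_eq[OF assms D_inj_Om s, symmetric])
qed

end

lemma classical_calculus_imp_pre_lie:
  fixes K :: "('k, 'f) ring_scheme" and M :: "('k, 'm, 'e) module_scheme"
  assumes M: "lie_algebra K M br" "vectorspace.fin_dim K M"
    and "admits_classical_calculus TYPE('w) K M br"
  shows "\<exists>pl. pre_lie_structure K M br pl"
proof -
  obtain \<Omega> :: "('k, 'w) module" and gr j d \<Delta>L where c:
    "dga_over K \<Omega> gr (enveloping_algebra K M br) j d"
    "left_covariance K (enveloping_algebra K M br) (env_coproduct K M br) (env_counit K) \<Omega> j d \<Delta>L"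
    "connected_calculus K (enveloping_algebra K M br) \<Omega> j d"
    "vectorspace.fin_dim K (\<Omega>\<lparr>carrier := left_invariant_1forms K (enveloping_algebra K M br) \<Omega> gr \<Delta>L\<rparr>)"
    "vectorspace.dim K (\<Omega>\<lparr>carrier := left_invariant_1forms K (enveloping_algebra K M br) \<Omega> gr \<Delta>L\<rparr>) = vectorspace.dim K M"
    using assms(3) unfolding admits_classical_calculus_def Let_def by blast
  interpret left_covariant_calculus K M br \<Omega> gr j d \<Delta>L
    by (intro left_covariant_calculus.intro M(1) c(1,2))
  show ?thesis by (rule pre_lie[OF c(3) M(2) c(4,5)])
qed

text \<open>The second conjunct, at an arbitrary type \<open>'w\<close>, extends the passage from a
  calculus to a pre-Lie structure to carriers in any type; the first provides a carrier type for the
  converse.\<close>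

theorem proposition4p4:
  fixes K :: "('k, 'f) ring_scheme" and M :: "('k, 'm, 'e) module_scheme"
    and br :: "'m \<Rightarrow> 'm \<Rightarrow> 'm"
  assumes "char_zero K"
    and "lie_algebra K M br"
    and "vectorspace.fin_dim K M"
  shows "(admits_classical_calculus TYPE(('k, 'm) form) K M br \<longleftrightarrow>
            (\<exists>pl. pre_lie_structure K M br pl)) \<and>
         (admits_classical_calculus TYPE('w) K M br \<longrightarrow>
            (\<exists>pl. pre_lie_structure K M br pl))"
proof -
  have "admits_classical_calculus TYPE(('k, 'm) form) K M br" if pl: "pre_lie_structure K M br pl" for pl
  proof -
    interpret L: lie_algebra K M br by fact
    obtain e co where "coords K M L.dim e co"
      using coords_exist[OF L.vectorspace_axioms assms(3)] by blast
    then interpret P: pre_lie_coords K M br L.dim e co pl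
      by (intro pre_lie_coords.intro pre_lie_coords_axioms.intro assms(2) pl)
    show ?thesis
      unfolding admits_classical_calculus_def Let_def
      by (rule exI[of _ P.Om], rule exI[of _ P.grOm], rule exI[of _ "P.slot 0"], rule exI[of _ P.dOm],
          rule exI[of _ P.coactL], rule exI[of _ P.coactR])
        (intro conjI P.dga_Om P.left_covariance_Om P.right_covariance_Om P.connected_Om[OF assms(1)] P.\<Lambda>_dim[OF assms(3)])
  qed
  then show ?thesis
    using classical_calculus_imp_pre_lie[OF assms(2,3), where 'w="('k, 'm) form"]
      classical_calculus_imp_pre_lie[OF assms(2,3), where 'w='w] by blast
qed

end
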